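(* Let $A$ be a PBW-reduction-algebra over a field $\mathbb{K}$, $E$ a finite set, $(A^E,\prec^E)=(\mathbb{K}\langle\underline x\rangle,S_e,I_e,\prec_e)_{e\in E}$ and $G\subseteq A^E$ a finite subset. Then (reduced) Gröbner bases with respect to $\prec^E$ of the left $A$-submodule of $A^E$ generated by $G$, and of the two-sided $A$-submodule of $A^E$ generated by $G$ (regarded as a left $A$-module), are computable.
   Context: **Orderings.** $\mathbb{K}\langle\underline x\rangle=\mathbb{K}\langle x_1,\dots,x_n\rangle$ is the free algebra, $\mathbb{K}[\underline x]$ its $\mathbb{K}$-subspace spanned by standard monomials $\underline x^\alpha=x_1^{\alpha_1}\cdots x_n^{\alpha_n}$. For finite $E$, $R^E=\bigoplus_{e\in E}R(e)$. A monomial ordering on $\{\underline x^\alpha(e)\}$ is a total order with $\underline x^\alpha(e)\prec\underline x^{\alpha'}(e')\Rightarrow\underline x^{\alpha+\gamma}(e)\prec\underline x^{\alpha'+\gamma}(e')$; well-ordering if $(e)\preceq\underline x^\alpha(e)$ always. $\prec^E_e$ is the induced ordering $\underline x^\alpha\prec^E_e\underline x^\beta$ iff $\underline x^\alpha(e)\prec^E\underline x^\beta(e)$. For $0\ne t\in\mathbb{K}[\underline x]^E$ with largest monomial $\underline x^\alpha(e)$: $\operatorname{le}(t)=\alpha$, $\operatorname{lcomp}(t)=e$, $\operatorname{lec}(t)=(\alpha,e)$, $\operatorname{lc}(t)$ its coefficient; $\beta+(\alpha,e)=(\alpha+\beta,e)$; leading exponents of $0$ are smaller than all others and absorb addition.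 **PBW-reduction-algebras.** A commutation system $(S,\prec)$ is a monomial ordering $\prec$ on $\{\underline x^\alpha\}$ and $S=\{x_jx_i-c_{ij}x_ix_j-d_{ij}\mid i<j\}$, $c_{ij}\in\mathbb{K}^*$, $d_{ij}\in\mathbb{K}[\underline x]$, $d_{ij}=0$ or $\operatorname{lm}(d_{ij})\prec x_ix_j$, such that every element of $\mathbb{K}\langle\underline x\rangle$ is transformed into one of $\mathbb{K}[\underline x]$ by finitely many $\mathbb{K}$-linear replacements of a monomial $m\,x_jx_i\,m'$ by $m(c_{ij}x_ix_j+d_{ij})m'$. With $\operatorname{l}_\prec(G)$ the set of leading exponents of nonzero elements of $G$ and $\operatorname{L}_\prec(G)=\operatorname{l}_\prec(G)+\mathbb{N}^n$, a PBW-reduction datum $(\mathbb{K}\langle\underline x\rangle,S,I,\prec)$ is a commutation system with $\prec$ a well-ordering and a finite $I\subseteq\mathbb{K}[\underline x]$ with $\operatorname{L}_\prec(I)=\operatorname{l}_\prec(\langle I\cup S\rangle\cap\mathbb{K}[\underline x])$; it defines the PBW-reduction-algebra $\mathbb{K}\langle\underline x\rangle/\langle I\cup S\rangle$. **Modules.** $(A^E,\prec^E)=(\mathbb{K}\langle\underline x\rangle,S_e,I_e,\prec_e)_{e\in E}$ means that each $(\mathbb{K}\langle\underline x\rangle,S_e,I_e,\prec_e)$ is a PBW-reduction datum with $A=\mathbb{K}\langle\underline x\rangle/\langle I_e\cup S_e\rangle$, and $\prec^E$ is a monomial ordering on $\{\underline x^\alpha(e)\}$ with $\prec^E_e=\prec_e$.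 Each $a\in A^E$ has a unique representative $\tau(a)\in\mathbb{K}[\underline x]^E$ whose monomials $\underline x^\alpha(e)$ all satisfy $\alpha\notin\operatorname{L}_{\prec_e}(I_e)$; leading data of $a$ are those of $\tau(a)$; similarly for $a\in A$ with respect to the $e$-th datum, giving $\operatorname{le}_{\prec^E_e}(a)$. **Gröbner basis.** A finite subset $G$ of a left submodule $M\subseteq A^E$ is a Gröbner basis of $M$ if every $m\in M$ can be written $m=\sum_{g\in G}a_gg$ with $a_g\in A$, $\operatorname{le}_{\prec^E_{\operatorname{lcomp}(g)}}(a_g)+\operatorname{lec}(g)\preceq^E\operatorname{lec}(m)$ for all $g$. It is reduced if $0\notin G$, $\operatorname{lc}(g)=1$ for all $g\in G$, and whenever $\underline x^\alpha(e)$ occurs in $\tau(g)$ with nonzero coefficient, $(\alpha,e)\ne\operatorname{lec}(g')+\gamma$ for all $g'\in G\setminus\{g\}$, $\gamma\in\mathbb{N}^n$. "Computable" means: obtainable by an algorithm from the given PBW-reduction data and $G$ (with effective arithmetic in $\mathbb{K}$). *)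

theory Defs
  imports "HOL.Hull" "HOL-Algebra.QuotRing" "HOL-Library.Poly_Mapping"
begin

section \<open>The free algebra\<close>

text \<open>
  Words form a monoid under concatenation, so that \<^typ>\<open>nat list \<Rightarrow>\<^sub>0 'k\<close> with the multiplication
  of \<^theory>\<open>HOL-Library.Poly_Mapping\<close> (convolution) is the free associative algebra over \<open>'k\<close> in
  countably many variables \<open>x\<^sub>0, x\<^sub>1, \<dots>\<close>. The free algebra in \<open>n\<close> variables consists of
  those elements that only involve the letters below \<open>n\<close>.
\<close>

instantiation list :: (type) monoid_add
begin

definition zero_list :: "'a list" where "zero_list = []"
definition plus_list :: "'a list \<Rightarrow> 'a list \<Rightarrow> 'a list" where "plus_list = (@)"

instance by standard (simp_all add: zero_list_def plus_list_def)

end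

abbreviation keys :: "('a \<Rightarrow>\<^sub>0 'b::zero) \<Rightarrow> 'a set" where "keys \<equiv> Poly_Mapping.keys"
abbreviation lookup :: "('a \<Rightarrow>\<^sub>0 'b::zero) \<Rightarrow> 'a \<Rightarrow> 'b" where "lookup \<equiv> Poly_Mapping.lookup"

type_synonym 'k falg = "nat list \<Rightarrow>\<^sub>0 'k"
type_synonym expo = "nat \<Rightarrow>\<^sub>0 nat"

definition free_algebra :: "nat \<Rightarrow> ('k::field) falg ring" where
  "free_algebra n =
     \<lparr>carrier = {f. \<forall>w\<in>keys f. set w \<subseteq> {..<n}}, mult = (*), one = 1, zero = 0, add = (+)\<rparr>"

definition gen :: "nat \<Rightarrow> ('k::field) falg" where
  "gen i = Poly_Mapping.single [i] 1"

definition scalar :: "'k::field \<Rightarrow> 'k falg" where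
  "scalar a = Poly_Mapping.single [] a"

definition word :: "nat list \<Rightarrow> ('k::field) falg" where
  "word w = Poly_Mapping.single w 1"

definition expos :: "nat \<Rightarrow> expo set" where
  "expos n = {\<alpha>. keys \<alpha> \<subseteq> {..<n}}"

definition std_word :: "nat \<Rightarrow> expo \<Rightarrow> nat list" where
  "std_word n \<alpha> = concat (map (\<lambda>i. replicate (lookup \<alpha> i) i) [0..<n])"

text \<open>The subspace spanned by the standard monomials, and the exponents occurring in an element.\<close>

definition std_polys :: "nat \<Rightarrow> ('k::field) falg set" where
  "std_polys n = {t. keys t \<subseteq> std_word n ` expos n}"

definition supp :: "nat \<Rightarrow> ('k::field) falg \<Rightarrow> expo set" where
  "supp n t = {\<alpha> \<in> expos n. std_word n \<alpha> \<in> keys t}"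

definition vsupp :: "nat \<Rightarrow> 'e set \<Rightarrow> ('e \<Rightarrow> ('k::field) falg) \<Rightarrow> (expo \<times> 'e) set" where
  "vsupp n E t = {(\<alpha>, e). e \<in> E \<and> \<alpha> \<in> supp n (t e)}"


section \<open>Monomial orderings and leading exponents\<close>

text \<open>Orderings are given by their strict part \<open>\<prec>\<close>; only its values on \<open>\<nat>\<^sup>n\<close>, respectively
  on \<open>\<nat>\<^sup>n \<times> E\<close>, matter.\<close>

definition monomial_ordering :: "nat \<Rightarrow> (expo \<Rightarrow> expo \<Rightarrow> bool) \<Rightarrow> bool" where
  "monomial_ordering n prec \<longleftrightarrow>
     irreflp_on (expos n) prec \<and> transp_on (expos n) prec \<and> totalp_on (expos n) prec \<and>
     (\<forall>\<alpha>\<in>expos n. \<forall>\<beta>\<in>expos n. \<forall>\<gamma>\<in>expos n. prec \<alpha> \<beta> \<longrightarrow> prec (\<alpha> + \<gamma>) (\<beta> + \<gamma>))"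

definition well_ordering :: "nat \<Rightarrow> (expo \<Rightarrow> expo \<Rightarrow> bool) \<Rightarrow> bool" where
  "well_ordering n prec \<longleftrightarrow> (\<forall>\<alpha>\<in>expos n. 0 = \<alpha> \<or> prec 0 \<alpha>)"

definition module_monomial_ordering ::
  "nat \<Rightarrow> 'e set \<Rightarrow> (expo \<times> 'e \<Rightarrow> expo \<times> 'e \<Rightarrow> bool) \<Rightarrow> bool" where
  "module_monomial_ordering n E prec \<longleftrightarrow>
     irreflp_on (expos n \<times> E) prec \<and> transp_on (expos n \<times> E) prec \<and>
     totalp_on (expos n \<times> E) prec \<and>
     (\<forall>\<alpha>\<in>expos n. \<forall>\<beta>\<in>expos n. \<forall>\<gamma>\<in>expos n. \<forall>e\<in>E. \<forall>e'\<in>E.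
        prec (\<alpha>, e) (\<beta>, e') \<longrightarrow> prec (\<alpha> + \<gamma>, e) (\<beta> + \<gamma>, e'))"

definition induced :: "(expo \<times> 'e \<Rightarrow> expo \<times> 'e \<Rightarrow> bool) \<Rightarrow> 'e \<Rightarrow> expo \<Rightarrow> expo \<Rightarrow> bool" where
  "induced prec e \<alpha> \<beta> \<longleftrightarrow> prec (\<alpha>, e) (\<beta>, e)"

text \<open>\<open>None\<close> is the leading exponent of zero: smaller than all others, absorbing addition.\<close>

definition lead :: "('b \<Rightarrow> 'b \<Rightarrow> bool) \<Rightarrow> 'b set \<Rightarrow> 'b option" where
  "lead prec Y = (if Y = {} then None else Some (THE y. y \<in> Y \<and> (\<forall>z\<in>Y. z = y \<or> prec z y)))"

fun preceq :: "('b \<Rightarrow> 'b \<Rightarrow> bool) \<Rightarrow> 'b option \<Rightarrow> 'b option \<Rightarrow> bool" where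
  "preceq prec None _ = True"
| "preceq prec (Some _) None = False"
| "preceq prec (Some y) (Some z) = (y = z \<or> prec y z)"

fun add_lec :: "expo option \<Rightarrow> (expo \<times> 'e) option \<Rightarrow> (expo \<times> 'e) option" where
  "add_lec (Some \<beta>) (Some (\<alpha>, e)) = Some (\<alpha> + \<beta>, e)"
| "add_lec _ _ = None"

definition le :: "nat \<Rightarrow> (expo \<Rightarrow> expo \<Rightarrow> bool) \<Rightarrow> ('k::field) falg \<Rightarrow> expo option" where
  "le n prec t = lead prec (supp n t)"

definition lexps :: "nat \<Rightarrow> (expo \<Rightarrow> expo \<Rightarrow> bool) \<Rightarrow> ('k::field) falg set \<Rightarrow> expo set" where
  "lexps n prec F = {\<alpha>. \<exists>f\<in>F. f \<noteq> 0 \<and> le n prec f = Some \<alpha>}"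

definition Lexps :: "nat \<Rightarrow> (expo \<Rightarrow> expo \<Rightarrow> bool) \<Rightarrow> ('k::field) falg set \<Rightarrow> expo set" where
  "Lexps n prec F = {\<alpha> + \<gamma> | \<alpha> \<gamma>. \<alpha> \<in> lexps n prec F \<and> \<gamma> \<in> expos n}"


section \<open>PBW-reduction-algebras\<close>

text \<open>
  A set \<open>S\<close> of commutation relations is given by the families \<open>c\<close> and \<open>d\<close>; only the values
  \<open>c i j\<close>, \<open>d i j\<close> for \<open>i < j < n\<close> matter.
\<close>

definition comm_rel ::
  "(nat \<Rightarrow> nat \<Rightarrow> 'k) \<Rightarrow> (nat \<Rightarrow> nat \<Rightarrow> 'k falg) \<Rightarrow> nat \<Rightarrow> nat \<Rightarrow> ('k::field) falg" where
  "comm_rel c d i j = gen j * gen i - scalar (c i j) * gen i * gen j - d i j"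

definition comm_rels ::
  "nat \<Rightarrow> (nat \<Rightarrow> nat \<Rightarrow> 'k) \<Rightarrow> (nat \<Rightarrow> nat \<Rightarrow> 'k falg) \<Rightarrow> ('k::field) falg set" where
  "comm_rels n c d = {comm_rel c d i j | i j. i < j \<and> j < n}"

text \<open>One replacement of an occurring monomial \<open>m x\<^sub>j x\<^sub>i m'\<close> by \<open>m (c\<^sub>i\<^sub>j x\<^sub>i x\<^sub>j + d\<^sub>i\<^sub>j) m'\<close>.\<close>

definition replacement ::
  "nat \<Rightarrow> (nat \<Rightarrow> nat \<Rightarrow> 'k) \<Rightarrow> (nat \<Rightarrow> nat \<Rightarrow> 'k falg) \<Rightarrow>
   ('k::field) falg \<Rightarrow> 'k falg \<Rightarrow> bool" where
  "replacement n c d f f' \<longleftrightarrow>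
     (\<exists>m m' i j. i < j \<and> j < n \<and> m @ [j, i] @ m' \<in> keys f \<and>
        f' = f - scalar (lookup f (m @ [j, i] @ m')) * word (m @ [j, i] @ m')
               + scalar (lookup f (m @ [j, i] @ m')) *
                   (word m * (scalar (c i j) * gen i * gen j + d i j) * word m'))"

definition commutation_system ::
  "nat \<Rightarrow> (nat \<Rightarrow> nat \<Rightarrow> 'k) \<Rightarrow> (nat \<Rightarrow> nat \<Rightarrow> ('k::field) falg) \<Rightarrow>
   (expo \<Rightarrow> expo \<Rightarrow> bool) \<Rightarrow> bool" where
  "commutation_system n c d prec \<longleftrightarrow>
     monomial_ordering n prec \<and>
     (\<forall>i j. i < j \<and> j < n \<longrightarrow>
        c i j \<noteq> 0 \<and> d i j \<in> std_polys n \<and>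
        (d i j = 0 \<or>
         (\<exists>\<alpha>. le n prec (d i j) = Some \<alpha> \<and>
              prec \<alpha> (Poly_Mapping.single i 1 + Poly_Mapping.single j 1)))) \<and>
     (\<forall>f\<in>carrier (free_algebra n). \<exists>f'\<in>std_polys n. (replacement n c d)\<^sup>*\<^sup>* f f')"

definition defining_ideal ::
  "nat \<Rightarrow> (nat \<Rightarrow> nat \<Rightarrow> 'k) \<Rightarrow> (nat \<Rightarrow> nat \<Rightarrow> 'k falg) \<Rightarrow>
   'k falg set \<Rightarrow> ('k::field) falg set" where
  "defining_ideal n c d I = Idl\<^bsub>free_algebra n\<^esub> (I \<union> comm_rels n c d)"

definition pbw_datum ::
  "nat \<Rightarrow> (nat \<Rightarrow> nat \<Rightarrow> 'k) \<Rightarrow> (nat \<Rightarrow> nat \<Rightarrow> 'k falg) \<Rightarrow>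
   ('k::field) falg set \<Rightarrow> (expo \<Rightarrow> expo \<Rightarrow> bool) \<Rightarrow> bool" where
  "pbw_datum n c d I prec \<longleftrightarrow>
     commutation_system n c d prec \<and> well_ordering n prec \<and>
     finite I \<and> I \<subseteq> std_polys n \<and>
     Lexps n prec I = lexps n prec (defining_ideal n c d I \<inter> std_polys n)"

definition pbw_quotient ::
  "nat \<Rightarrow> (nat \<Rightarrow> nat \<Rightarrow> 'k) \<Rightarrow> (nat \<Rightarrow> nat \<Rightarrow> 'k falg) \<Rightarrow>
   'k falg set \<Rightarrow> ('k::field) falg set ring" where
  "pbw_quotient n c d I = free_algebra n Quot defining_ideal n c d I"

definition pbw_reduction_algebra :: "nat \<Rightarrow> ('k::field) falg set ring \<Rightarrow> bool" where
  "pbw_reduction_algebra n A \<longleftrightarrow>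
     (\<exists>c d I prec. pbw_datum n c d I prec \<and> A = pbw_quotient n c d I)"


section \<open>Free modules over PBW-reduction-algebras\<close>

text \<open>The \<open>e\<close>-th datum has relations given by \<open>c e\<close>, \<open>d e\<close>, ideal part \<open>I e\<close>, and the ordering
  induced by \<open>prec\<close>. All the data define the same algebra \<open>A\<close>.\<close>

definition pbw_module ::
  "nat \<Rightarrow> ('k::field) falg set ring \<Rightarrow> 'e set \<Rightarrow> ('e \<Rightarrow> nat \<Rightarrow> nat \<Rightarrow> 'k) \<Rightarrow>
   ('e \<Rightarrow> nat \<Rightarrow> nat \<Rightarrow> 'k falg) \<Rightarrow> ('e \<Rightarrow> 'k falg set) \<Rightarrow>
   (expo \<times> 'e \<Rightarrow> expo \<times> 'e \<Rightarrow> bool) \<Rightarrow> bool" where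
  "pbw_module n A E c d I prec \<longleftrightarrow>
     finite E \<and> module_monomial_ordering n E prec \<and>
     (\<forall>e\<in>E. pbw_datum n (c e) (d e) (I e) (induced prec e) \<and>
            A = pbw_quotient n (c e) (d e) (I e))"

definition free_module :: "('a, 'm) ring_scheme \<Rightarrow> 'e set \<Rightarrow> ('e \<Rightarrow> 'a) set" where
  "free_module A E = E \<rightarrow>\<^sub>E carrier A"

definition vzero :: "('a, 'm) ring_scheme \<Rightarrow> 'e set \<Rightarrow> ('e \<Rightarrow> 'a)" where
  "vzero A E = (\<lambda>e\<in>E. \<zero>\<^bsub>A\<^esub>)"

definition left_submodule ::
  "('a, 'm) ring_scheme \<Rightarrow> 'e set \<Rightarrow> ('e \<Rightarrow> 'a) set \<Rightarrow> bool" where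
  "left_submodule A E M \<longleftrightarrow>
     M \<subseteq> free_module A E \<and> vzero A E \<in> M \<and>
     (\<forall>u\<in>M. \<forall>v\<in>M. (\<lambda>e\<in>E. u e \<oplus>\<^bsub>A\<^esub> v e) \<in> M) \<and>
     (\<forall>a\<in>carrier A. \<forall>u\<in>M. (\<lambda>e\<in>E. a \<otimes>\<^bsub>A\<^esub> u e) \<in> M)"

definition two_sided_submodule ::
  "('a, 'm) ring_scheme \<Rightarrow> 'e set \<Rightarrow> ('e \<Rightarrow> 'a) set \<Rightarrow> bool" where
  "two_sided_submodule A E M \<longleftrightarrow>
     left_submodule A E M \<and>
     (\<forall>a\<in>carrier A. \<forall>u\<in>M. (\<lambda>e\<in>E. u e \<otimes>\<^bsub>A\<^esub> a) \<in> M)"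

text \<open>Elements of \<open>A\<close> are cosets, so the representatives of \<open>a\<close> in the free algebra are the
  members of \<open>a\<close>.\<close>

definition tau ::
  "nat \<Rightarrow> (expo \<Rightarrow> expo \<Rightarrow> bool) \<Rightarrow> ('k::field) falg set \<Rightarrow> 'k falg set \<Rightarrow> 'k falg" where
  "tau n prec I a = (THE t. t \<in> a \<and> t \<in> std_polys n \<and> supp n t \<inter> Lexps n prec I = {})"

definition le_comp ::
  "nat \<Rightarrow> ('e \<Rightarrow> ('k::field) falg set) \<Rightarrow> (expo \<times> 'e \<Rightarrow> expo \<times> 'e \<Rightarrow> bool) \<Rightarrow>
   'e \<Rightarrow> 'k falg set \<Rightarrow> expo option" where
  "le_comp n I prec e a = le n (induced prec e) (tau n (induced prec e) (I e) a)"

definition vtau ::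
  "nat \<Rightarrow> 'e set \<Rightarrow> ('e \<Rightarrow> ('k::field) falg set) \<Rightarrow> (expo \<times> 'e \<Rightarrow> expo \<times> 'e \<Rightarrow> bool) \<Rightarrow>
   ('e \<Rightarrow> 'k falg set) \<Rightarrow> 'e \<Rightarrow> 'k falg" where
  "vtau n E I prec g = (\<lambda>e\<in>E. tau n (induced prec e) (I e) (g e))"

definition lec ::
  "nat \<Rightarrow> 'e set \<Rightarrow> ('e \<Rightarrow> ('k::field) falg set) \<Rightarrow> (expo \<times> 'e \<Rightarrow> expo \<times> 'e \<Rightarrow> bool) \<Rightarrow>
   ('e \<Rightarrow> 'k falg set) \<Rightarrow> (expo \<times> 'e) option" where
  "lec n E I prec g = lead prec (vsupp n E (vtau n E I prec g))"

definition lc ::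
  "nat \<Rightarrow> 'e set \<Rightarrow> ('e \<Rightarrow> ('k::field) falg set) \<Rightarrow> (expo \<times> 'e \<Rightarrow> expo \<times> 'e \<Rightarrow> bool) \<Rightarrow>
   ('e \<Rightarrow> 'k falg set) \<Rightarrow> 'k" where
  "lc n E I prec g = (case lec n E I prec g of None \<Rightarrow> 0
     | Some (\<alpha>, e) \<Rightarrow> lookup (vtau n E I prec g e) (std_word n \<alpha>))"

text \<open>\<open>le (a g) + lec g\<close>, where the leading exponent of the coefficient is taken with respect to
  the datum at the leading component of \<open>g\<close>.\<close>

definition term_lec ::
  "nat \<Rightarrow> 'e set \<Rightarrow> ('e \<Rightarrow> ('k::field) falg set) \<Rightarrow> (expo \<times> 'e \<Rightarrow> expo \<times> 'e \<Rightarrow> bool) \<Rightarrow>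
   'k falg set \<Rightarrow> ('e \<Rightarrow> 'k falg set) \<Rightarrow> (expo \<times> 'e) option" where
  "term_lec n E I prec a g = (case lec n E I prec g of None \<Rightarrow> None
     | Some (\<alpha>, e) \<Rightarrow> add_lec (le_comp n I prec e a) (Some (\<alpha>, e)))"

definition groebner_basis ::
  "nat \<Rightarrow> ('k::field) falg set ring \<Rightarrow> 'e set \<Rightarrow> ('e \<Rightarrow> 'k falg set) \<Rightarrow>
   (expo \<times> 'e \<Rightarrow> expo \<times> 'e \<Rightarrow> bool) \<Rightarrow> ('e \<Rightarrow> 'k falg set) set \<Rightarrow>
   ('e \<Rightarrow> 'k falg set) set \<Rightarrow> bool" where
  "groebner_basis n A E I prec M G \<longleftrightarrow>
     left_submodule A E M \<and> finite G \<and> G \<subseteq> M \<and>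
     (\<forall>m\<in>M. \<exists>a\<in>G \<rightarrow> carrier A.
        m = (\<lambda>e\<in>E. \<Oplus>\<^bsub>A\<^esub>g\<in>G. a g \<otimes>\<^bsub>A\<^esub> g e) \<and>
        (\<forall>g\<in>G. preceq prec (term_lec n E I prec (a g) g) (lec n E I prec m)))"

definition reduced_groebner_basis ::
  "nat \<Rightarrow> ('k::field) falg set ring \<Rightarrow> 'e set \<Rightarrow> ('e \<Rightarrow> 'k falg set) \<Rightarrow>
   (expo \<times> 'e \<Rightarrow> expo \<times> 'e \<Rightarrow> bool) \<Rightarrow> ('e \<Rightarrow> 'k falg set) set \<Rightarrow>
   ('e \<Rightarrow> 'k falg set) set \<Rightarrow> bool" where
  "reduced_groebner_basis n A E I prec M G \<longleftrightarrow>
     groebner_basis n A E I prec M G \<and>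
     vzero A E \<notin> G \<and> (\<forall>g\<in>G. lc n E I prec g = 1) \<and>
     (\<forall>g\<in>G. \<forall>(\<alpha>, e)\<in>vsupp n E (vtau n E I prec g). \<forall>g'\<in>G - {g}. \<forall>\<gamma>\<in>expos n.
        Some (\<alpha>, e) \<noteq> add_lec (Some \<gamma>) (lec n E I prec g'))"


section \<open>Algorithms with effective field arithmetic\<close>

text \<open>
  Algorithms are programs of a deeply embedded while language that operates on finite trees with
  natural numbers and field elements at the leaves. The arithmetic of the field, the test for equality
  and the comparison of monomials are elementary steps; apart from that a program has no
  access to the field, and it contains no field constants besides 0 and 1.
  The type of programs depends neither on the field nor on the index set.
\<close>

datatype 'k val = Num nat | Scal 'k | Pair "'k val" "'k val"

datatype prog =
    Ident
  | Seq prog prog         \<comment> \<open>first the left program, then the right one\<close>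
  | Fork prog prog        \<comment> \<open>pair of both results on the same input\<close>
  | Cond prog prog prog
  | While prog prog
  | Fst | Snd
  | Zero | Succ | Pred    \<comment> \<open>natural numbers\<close>
  | SZero | SOne | SAdd | SNeg | SMul | SInv    \<comment> \<open>field elements\<close>
  | Equal
  | Less                  \<comment> \<open>comparison of monomials\<close>

definition bit :: "bool \<Rightarrow> 'k val" where
  "bit b = Num (if b then 1 else 0)"

text \<open>\<open>run Q p v w\<close>: on input \<open>v\<close> the program \<open>p\<close> halts with result \<open>w\<close>; the predicate \<open>Q\<close> answers
  the comparisons. A program applied to a value of the wrong shape has no result.\<close>

inductive run :: "(('k::field) val \<Rightarrow> bool) \<Rightarrow> prog \<Rightarrow> 'k val \<Rightarrow> 'k val \<Rightarrow> bool" for Q where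
  "run Q Ident v v"
| "run Q p u v \<Longrightarrow> run Q q v w \<Longrightarrow> run Q (Seq p q) u w"
| "run Q p u v \<Longrightarrow> run Q q u w \<Longrightarrow> run Q (Fork p q) u (Pair v w)"
| "run Q b u (Num (Suc k)) \<Longrightarrow> run Q p u v \<Longrightarrow> run Q (Cond b p q) u v"
| "run Q b u (Num 0) \<Longrightarrow> run Q q u v \<Longrightarrow> run Q (Cond b p q) u v"
| "run Q b u (Num 0) \<Longrightarrow> run Q (While b p) u u"
| "run Q b u (Num (Suc k)) \<Longrightarrow> run Q p u v \<Longrightarrow> run Q (While b p) v w \<Longrightarrow> run Q (While b p) u w"
| "run Q Fst (Pair u v) u"
| "run Q Snd (Pair u v) v"
| "run Q Zero u (Num 0)"
| "run Q Succ (Num k) (Num (Suc k))"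
| "run Q Pred (Num k) (Num (k - 1))"
| "run Q SZero u (Scal 0)"
| "run Q SOne u (Scal 1)"
| "run Q SAdd (Pair (Scal a) (Scal b)) (Scal (a + b))"
| "run Q SNeg (Scal a) (Scal (- a))"
| "run Q SMul (Pair (Scal a) (Scal b)) (Scal (a * b))"
| "a \<noteq> 0 \<Longrightarrow> run Q SInv (Scal a) (Scal (inverse a))"
| "run Q Equal (Pair u v) (bit (u = v))"
| "run Q Less u (bit (Q u))"

inductive_cases run_elims:
  "run Q Ident u v" "run Q (Seq p q) u v" "run Q (Fork p q) u v" "run Q (Cond b p q) u v"
  "run Q Fst u v" "run Q Snd u v" "run Q Zero u v" "run Q Succ u v" "run Q Pred u v"
  "run Q SZero u v" "run Q SOne u v" "run Q SAdd u v" "run Q SNeg u v" "run Q SMul u v"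
  "run Q SInv u v" "run Q Equal u v" "run Q Less u v"

inductive_cases run_While: "run Q (While b p) u v"

lemma run_deterministic:
  assumes "run Q p u v" "run Q p u v'"
  shows "v = v'"
  using assms
proof (induction arbitrary: v' rule: run.induct)
  case (2 p u v q w)
  from 2(5) show ?case by (rule run_elims) (use 2(3,4) in blast)
next
  case (3 p u v q w)
  from 3(5) show ?case by (rule run_elims) (use 3(3,4) in blast)
next
  case (4 b u k p v q)
  from 4(5) show ?case by (rule run_elims) (use 4(3,4) in blast)+
next
  case (5 b u q v p)
  from 5(5) show ?case by (rule run_elims) (use 5(3,4) in blast)+
next
  case (6 b u p)
  from 6(3) show ?case by (rule run_While) (use 6(2) in blast)+
next
  case (7 b u k p v w)
  from 7(7) show ?case by (rule run_While) (use 7(4,5,6) in blast)+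
qed (erule run_elims; simp)+


section \<open>Coding of input and output\<close>

definition list_val :: "'k val list \<Rightarrow> 'k val" where
  "list_val vs = foldr Pair vs (Num 0)"

text \<open>A finite set is coded by listing its elements in any order, possibly with repetitions.\<close>

definition set_code :: "('x \<Rightarrow> 'k val \<Rightarrow> bool) \<Rightarrow> 'x set \<Rightarrow> 'k val \<Rightarrow> bool" where
  "set_code R Y v \<longleftrightarrow> (\<exists>ys vs. set ys = Y \<and> list_all2 R ys vs \<and> v = list_val vs)"

text \<open>Each word with nonzero coefficient is listed exactly once, with its coefficient.\<close>

definition poly_code :: "('k::field) falg \<Rightarrow> 'k val \<Rightarrow> bool" where
  "poly_code f v \<longleftrightarrow> (\<exists>ws. distinct ws \<and> set ws = keys f \<and>
     v = list_val (map (\<lambda>w. Pair (Scal (lookup f w)) (list_val (map Num w))) ws))"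

definition comm_code ::
  "nat \<Rightarrow> (nat \<Rightarrow> nat \<Rightarrow> 'k) \<Rightarrow> (nat \<Rightarrow> nat \<Rightarrow> 'k falg) \<Rightarrow> ('k::field) val \<Rightarrow> bool" where
  "comm_code n c d = set_code
     (\<lambda>(i, j) v. \<exists>u. poly_code (d i j) u \<and> v = Pair (Num i) (Pair (Num j) (Pair (Scal (c i j)) u)))
     {(i, j). i < j \<and> j < n}"

definition datum_code ::
  "nat \<Rightarrow> (nat \<Rightarrow> nat \<Rightarrow> 'k) \<Rightarrow> (nat \<Rightarrow> nat \<Rightarrow> 'k falg) \<Rightarrow> 'k falg set \<Rightarrow>
   ('k::field) val \<Rightarrow> bool" where
  "datum_code n c d I v \<longleftrightarrow>
     (\<exists>u w. comm_code n c d u \<and> set_code poly_code I w \<and> v = Pair u w)"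

text \<open>The elements of the index set are referred to by their positions in a list \<open>es\<close>. An element
  of the free module is coded by listing one representative in the free algebra per component.\<close>

definition vec_code :: "'e list \<Rightarrow> ('e \<Rightarrow> ('k::field) falg set) \<Rightarrow> 'k val \<Rightarrow> bool" where
  "vec_code es g v \<longleftrightarrow>
     (\<exists>vs. list_all2 (\<lambda>e u. \<exists>t\<in>g e. poly_code t u) es vs \<and> v = list_val vs)"

definition input_code ::
  "nat \<Rightarrow> 'e list \<Rightarrow> ('e \<Rightarrow> nat \<Rightarrow> nat \<Rightarrow> 'k) \<Rightarrow> ('e \<Rightarrow> nat \<Rightarrow> nat \<Rightarrow> 'k falg) \<Rightarrow>
   ('e \<Rightarrow> 'k falg set) \<Rightarrow> ('e \<Rightarrow> 'k falg set) set \<Rightarrow> ('k::field) val \<Rightarrow> bool" where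
  "input_code n es c d I G v \<longleftrightarrow>
     (\<exists>vs w. list_all2 (\<lambda>e. datum_code n (c e) (d e) (I e)) es vs \<and>
             set_code (vec_code es) G w \<and>
             v = Pair (Num n) (Pair (list_val vs) w))"

definition mono_val :: "nat \<Rightarrow> expo \<Rightarrow> nat \<Rightarrow> 'k val" where
  "mono_val n \<alpha> p = Pair (list_val (map (\<lambda>i. Num (lookup \<alpha> i)) [0..<n])) (Num p)"

definition compare ::
  "nat \<Rightarrow> 'e list \<Rightarrow> (expo \<times> 'e \<Rightarrow> expo \<times> 'e \<Rightarrow> bool) \<Rightarrow> 'k val \<Rightarrow> bool" where
  "compare n es prec v \<longleftrightarrow>
     (\<exists>\<alpha>\<in>expos n. \<exists>\<beta>\<in>expos n. \<exists>p<length es. \<exists>q<length es.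
        v = Pair (mono_val n \<alpha> p) (mono_val n \<beta> q) \<and> prec (\<alpha>, es ! p) (\<beta>, es ! q))"

text \<open>
  An algorithm solves a problem \<open>P n A E I prec G\<close>, a property of finite subsets of the free
  module, if for all data, all enumerations of \<open>E\<close> and all codings of the input it halts with
  a code of a solution.
\<close>

definition solves ::
  "prog \<Rightarrow>
   (nat \<Rightarrow> ('k::field) falg set ring \<Rightarrow> 'e set \<Rightarrow> ('e \<Rightarrow> 'k falg set) \<Rightarrow>
     (expo \<times> 'e \<Rightarrow> expo \<times> 'e \<Rightarrow> bool) \<Rightarrow> ('e \<Rightarrow> 'k falg set) set \<Rightarrow>
     ('e \<Rightarrow> 'k falg set) set \<Rightarrow> bool) \<Rightarrow> bool" where
  "solves p P \<longleftrightarrow>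
     (\<forall>n A E c d I prec G es v.
        pbw_reduction_algebra n A \<longrightarrow> pbw_module n A E c d I prec \<longrightarrow>
        finite G \<longrightarrow> G \<subseteq> free_module A E \<longrightarrow>
        distinct es \<longrightarrow> set es = E \<longrightarrow> input_code n es c d I G v \<longrightarrow>
        (\<exists>w H. run (compare n es prec) p v w \<and> set_code (vec_code es) H w \<and>
               P n A E I prec G H))"

end

theory Submission
  imports Defs "HOL.Topological_Spaces" "HOL.Vector_Spaces" "HOL-Library.Function_Algebras"
    "HOL-Library.Multiset" "HOL-Library.Infinite_Set"
begin

text \<open>
  Elements of \<open>A\<^sup>E\<close> are cosets; the proof works with their representatives, families of elements of the
  free algebra, modulo the subspace \<open>JE\<close> of families over the ideal \<open>J\<close> of relations.

  \<^emph>\<open>Leading monomials.\<close> Exchanging two letters of a word by a commutation relation multiplies it by a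
  nonzero constant and adds smaller terms. By induction on the ordering, every word is, modulo \<open>J\<close>, a nonzero
  multiple of its sorted rearrangement plus smaller standard monomials (\<open>word_has_lead\<close>). Hence
  multiplication by a word shifts leading monomials (\<open>has_lead_lmul\<close>), and the subspaces \<open>V P\<close> spanned
  modulo \<open>J\<close> by the standard monomials in \<open>P\<close> behave like spaces of commutative polynomials. The
  condition on \<open>L(I)\<close> says that a monomial is congruent to a combination of smaller ones exactly if
  it is divisible by a leading monomial of \<open>I\<close> (\<open>Ld_iff\<close>); this identifies the leading data of \<open>A\<^sup>E\<close>
  with those of representatives.

  \<^emph>\<open>Buchberger's criterion\<close> (\<open>buchberger\<close>). Finitely many vectors \<open>h\<close> with distinct leading monomials outside
  \<open>L(I)\<close> form a Groebner basis of the left submodule they generate as soon as finitely many vectors are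
  combinations of multiples of the \<open>h\<close> with smaller leading monomials, modulo \<open>JE\<close>: the S-vectors of two
  of them, and the products that move a leading monomial of some \<open>h\<close> to its least common multiple with a
  leading monomial of \<open>I\<close>.

  \<^emph>\<open>The algorithm\<close> is an unbounded search for \<open>N\<close>. For given \<open>N\<close> it forms all products of the generators
  of \<open>J\<close>, and of the elements of \<open>G\<close>, by words of length at most \<open>N\<close> and computes the reduced row
  echelon form of this finite list of vectors, where words that are not standard are eliminated first and
  standard monomials come in decreasing order. The rows whose pivots are minimal standard monomials outside
  \<open>L(I)\<close> are the candidates. A test then looks for certificates, by membership in spans of explicit
  finite lists: that tails are reduced, that the critical pairs reduce, and that \<open>G\<close>, in the two-sided case also
  the product of each candidate with each variable on the right, lies in the span of multiples of the
  candidates. If the test succeeds, the criterion shows that the candidates are the reduced Groebner basis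
  (\<open>accept_sound\<close>). It succeeds for some \<open>N\<close> (\<open>accept_complete\<close>): by Dickson's lemma the reduced Groebner
  basis is finite, its elements and the certificates involve finitely many products, and once these are
  available the echelon form contains the reduced basis.

  All functions used for fixed \<open>N\<close> are composed of folds over lists, so that there are programs for them by the
  closure properties of \<open>computable\<close>; the search itself is \<open>computable_search\<close>. A program for reduced
  Groebner bases also solves the problem of finding Groebner bases.
\<close>

section \<open>Computable functions on coded data\<close>

fun enc_pair :: "('a \<Rightarrow> 'k val) \<Rightarrow> ('b \<Rightarrow> 'k val) \<Rightarrow> 'a \<times> 'b \<Rightarrow> 'k val" where
  "enc_pair a b (x, y) = Pair (a x) (b y)"

definition enc_list :: "('a \<Rightarrow> 'k val) \<Rightarrow> 'a list \<Rightarrow> 'k val" where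
  "enc_list a xs = list_val (map a xs)"

text \<open>One program has to serve all answers \<open>Q\<close> to the comparisons, because the monomial ordering is part
  of the input; \<open>a\<close> and \<open>b\<close> are the codings of arguments and results.\<close>

definition computable ::
  "('a \<Rightarrow> 'k val) \<Rightarrow> ('b \<Rightarrow> 'k val) \<Rightarrow> ((('k::field) val \<Rightarrow> bool) \<Rightarrow> 'a \<Rightarrow> 'b) \<Rightarrow> bool" where
  "computable a b f \<longleftrightarrow> (\<exists>p. \<forall>Q x. run Q p (a x) (b (f Q x)))"

lemma enc_list_simps [simp]:
  "enc_list a [] = Num 0"
  "enc_list a (x # xs) = Pair (a x) (enc_list a xs)"
  by (simp_all add: enc_list_def list_val_def)

lemma enc_list_eq_Num [simp]: "enc_list a xs = Num 0 \<longleftrightarrow> xs = []"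
  by (cases xs) auto

lemma inj_enc_pair [simp, intro]: "inj a \<Longrightarrow> inj b \<Longrightarrow> inj (enc_pair a b)"
  by (rule injI) (auto dest: injD)

lemma inj_enc_list [simp, intro]:
  assumes "inj a" shows "inj (enc_list a)"
proof (rule injI)
  fix xs ys assume "enc_list a xs = enc_list a ys"
  then show "xs = ys"
  proof (induction xs arbitrary: ys)
    case Nil then show ?case by (cases ys) auto
  next
    case (Cons x xs) then show ?case using assms by (cases ys) (auto dest: injD)
  qed
qed

lemma inj_Num [simp, intro]: "inj Num" by (rule injI) simp
lemma inj_Scal [simp, intro]: "inj Scal" by (rule injI) simp

lemma enc_pair_conv: "enc_pair a b z = Pair (a (fst z)) (b (snd z))"
  by (cases z) simp

lemma bit_simps: "bit True = Num (Suc 0)" "bit False = Num 0"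
  by (simp_all add: bit_def)

lemma computable_id: "computable a a (\<lambda>Q x. x)"
  unfolding computable_def by (blast intro: run.intros)

lemma computable_comp:
  "computable a b f \<Longrightarrow> computable b c g \<Longrightarrow> computable a c (\<lambda>Q x. g Q (f Q x))"
  unfolding computable_def by (blast intro: run.intros)

lemma computable_Pair:
  "computable a b f \<Longrightarrow> computable a c g \<Longrightarrow> computable a (enc_pair b c) (\<lambda>Q x. (f Q x, g Q x))"
  unfolding computable_def enc_pair.simps by (blast intro: run.intros)

lemma computable_fst: "computable a (enc_pair b c) f \<Longrightarrow> computable a b (\<lambda>Q x. fst (f Q x))"
  unfolding computable_def enc_pair_conv by (blast intro: run.intros)

lemma computable_snd: "computable a (enc_pair b c) f \<Longrightarrow> computable a c (\<lambda>Q x. snd (f Q x))"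
  unfolding computable_def enc_pair_conv by (blast intro: run.intros)

lemma computable_if:
  assumes "computable a bit c" "computable a b f" "computable a b g"
  shows "computable a b (\<lambda>Q x. if c Q x then f Q x else g Q x)"
proof -
  obtain pc pf pg where p: "\<And>Q x. run Q pc (a x) (bit (c Q x))"
    "\<And>Q x. run Q pf (a x) (b (f Q x))" "\<And>Q x. run Q pg (a x) (b (g Q x))"
    using assms unfolding computable_def by blast
  have "run Q (Cond pc pf pg) (a x) (b (if c Q x then f Q x else g Q x))" for Q x
    using p(1)[of Q x] p(2,3)[of Q x]
    by (cases "c Q x") (auto simp: bit_simps intro: run.intros)
  then show ?thesis unfolding computable_def by blast
qed

lemma computable_0: "computable a Num (\<lambda>Q x. 0)"
  and computable_Nil: "computable a (enc_list b) (\<lambda>Q x. [])"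
  and computable_Scal0: "computable a Scal (\<lambda>Q x. 0)"
  and computable_Scal1: "computable a Scal (\<lambda>Q x. 1)"
  and computable_False: "computable a bit (\<lambda>Q x. False)"
  unfolding computable_def by (auto simp: bit_simps intro: run.intros)

lemma computable_Suc: "computable a Num f \<Longrightarrow> computable a Num (\<lambda>Q x. Suc (f Q x))"
  unfolding computable_def by (blast intro: run.intros)

lemma computable_True: "computable a bit (\<lambda>Q x. True)"
  using computable_Suc[OF computable_0] by (simp add: computable_def bit_simps)

lemma computable_op:
  assumes "computable a b f" "\<And>Q x. run Q p (b x) (c (g Q x))"
  shows "computable a c (\<lambda>Q x. g Q (f Q x))"
  using assms(2) by (intro computable_comp[OF assms(1)]) (auto simp: computable_def)

lemma computable_plus:
  assumes "computable a Scal f" "computable a Scal g"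
  shows "computable a Scal (\<lambda>Q x. f Q x + g Q x)"
  using computable_op[OF computable_Pair[OF assms], where p = SAdd and g = "\<lambda>Q z. fst z + snd z"]
  by (simp add: enc_pair_conv run.intros(15))

lemma computable_times:
  assumes "computable a Scal f" "computable a Scal g"
  shows "computable a Scal (\<lambda>Q x. f Q x * g Q x)"
  using computable_op[OF computable_Pair[OF assms], where p = SMul and g = "\<lambda>Q z. fst z * snd z"]
  by (simp add: enc_pair_conv run.intros(17))

lemma computable_uminus: "computable a Scal f \<Longrightarrow> computable a Scal (\<lambda>Q x. - f Q x)"
  by (erule computable_op) (rule run.intros(16))

text \<open>The elementary test compares codes, so the coding has to be injective.\<close>

lemma computable_eq:
  assumes "computable a b f" "computable a b g" "inj b"
  shows "computable a bit (\<lambda>Q x. f Q x = g Q x)"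
proof -
  obtain pf pg where p:
    "\<And>Q x. run Q pf (a x) (b (f Q x))" "\<And>Q x. run Q pg (a x) (b (g Q x))"
    using assms unfolding computable_def by blast
  have "run Q (Seq (Fork pf pg) Equal) (a x) (bit (f Q x = g Q x))" for Q x
    using run.intros(2)[OF run.intros(3)[OF p] run.intros(19), of Q x] assms(3)
    by (simp add: inj_eq)
  then show ?thesis unfolding computable_def by blast
qed

lemma computable_Less:
  "computable a b f \<Longrightarrow> computable a bit (\<lambda>Q x. Q (b (f Q x)))"
  unfolding computable_def by (blast intro: run.intros)

lemma computable_inverse:
  assumes "computable a Scal f"
  shows "computable a Scal (\<lambda>Q x. inverse (f Q x))"
proof -
  obtain pf where p: "\<And>Q x. run Q pf (a x) (Scal (f Q x))"
    using assms unfolding computable_def by blast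
  have e: "run Q (Seq (Fork pf SZero) Equal) (a x) (bit (f Q x = 0))" for Q x
    using run.intros(2)[OF run.intros(3)[OF p run.intros(13)] run.intros(19), of Q x] by simp
  \<comment> \<open>the elementary inversion has no result at \<open>0\<close>, whereas \<open>inverse 0 = 0\<close>\<close>
  have "run Q (Cond (Seq (Fork pf SZero) Equal) SZero (Seq pf SInv)) (a x) (Scal (inverse (f Q x)))"
    for Q x
    using e[of Q x] p[of Q x] by (cases "f Q x = 0") (auto simp: bit_simps intro: run.intros)
  then show ?thesis unfolding computable_def by blast
qed

lemma computable_cong: "computable a b f \<Longrightarrow> (\<And>Q x. f Q x = g Q x) \<Longrightarrow> computable a b g"
  by (simp add: computable_def)

lemma computable_not: "computable a bit f \<Longrightarrow> computable a bit (\<lambda>Q x. \<not> f Q x)"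
  by (rule computable_cong[OF computable_if[OF _ computable_False computable_True]]) auto

lemma computable_and:
  "computable a bit f \<Longrightarrow> computable a bit g \<Longrightarrow> computable a bit (\<lambda>Q x. f Q x \<and> g Q x)"
  by (rule computable_cong[OF computable_if[OF _ _ computable_False], of _ f g]) auto

lemma computable_or:
  "computable a bit f \<Longrightarrow> computable a bit g \<Longrightarrow> computable a bit (\<lambda>Q x. f Q x \<or> g Q x)"
  by (rule computable_cong[OF computable_if[OF _ computable_True], of _ f g]) auto

lemma computable_Cons:
  assumes "computable a b f" "computable a (enc_list b) g"
  shows "computable a (enc_list b) (\<lambda>Q x. f Q x # g Q x)"
  using assms unfolding computable_def enc_list_simps by (blast intro: run.intros)

lemma computable_null:
  assumes "computable a (enc_list b) f"
  shows "computable a bit (\<lambda>Q x. f Q x = [])"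
proof -
  obtain pf where p: "\<And>Q x. run Q pf (a x) (enc_list b (f Q x))"
    using assms unfolding computable_def by blast
  have "run Q (Seq (Fork pf Zero) Equal) (a x) (bit (f Q x = []))" for Q x
    using run.intros(2)[OF run.intros(3)[OF p run.intros(10)] run.intros(19), of Q x] by simp
  then show ?thesis unfolding computable_def by blast
qed

text \<open>Premises about functions of several arguments pack these into nested pairs, together with the input
  \<open>x\<close> on which the functions may depend.\<close>

lemma computable_case_list:
  assumes "computable a (enc_list c) l" "computable a b f"
    and "computable (enc_pair a (enc_pair c (enc_list c))) b
           (\<lambda>Q z. g Q (fst z) (fst (snd z)) (snd (snd z)))"
  shows "computable a b (\<lambda>Q x. case l Q x of [] \<Rightarrow> f Q x | y # ys \<Rightarrow> g Q x y ys)"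
proof -
  obtain pl pn pf pg where p: "\<And>Q x. run Q pl (a x) (enc_list c (l Q x))"
    "\<And>Q x. run Q pn (a x) (bit (l Q x = []))"
    "\<And>Q x. run Q pf (a x) (b (f Q x))"
    "\<And>Q z. run Q pg (enc_pair a (enc_pair c (enc_list c)) z) (b (g Q (fst z) (fst (snd z)) (snd (snd z))))"
    using assms computable_null[OF assms(1)] unfolding computable_def by blast
  have "run Q (Cond pn pf (Seq (Fork Ident pl) pg)) (a x)
      (b (case l Q x of [] \<Rightarrow> f Q x | y # ys \<Rightarrow> g Q x y ys))" for Q x
  proof (cases "l Q x")
    case Nil
    then show ?thesis using p(2,3)[of Q x] by (auto simp: bit_simps intro: run.intros)
  next
    case (Cons y ys)
    then show ?thesis using p(1,2)[of Q x] p(4)[of Q "(x, y, ys)"]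
      by (auto simp: bit_simps intro!: run.intros(5) intro: run.intros(1-3))
  qed
  then show ?thesis unfolding computable_def by blast
qed

text \<open>The only loops that the algorithm needs, besides one final unbounded search, run over a
  given list or up to a given number.\<close>

lemma computable_fold:
  assumes "computable a (enc_list c) l" "computable a b s"
    and "computable (enc_pair a (enc_pair c b)) b (\<lambda>Q z. f Q (fst z) (fst (snd z)) (snd (snd z)))"
  shows "computable a b (\<lambda>Q x. fold (f Q x) (l Q x) (s Q x))"
proof -
  obtain pl ps pf where p: "\<And>Q x. run Q pl (a x) (enc_list c (l Q x))"
    "\<And>Q x. run Q ps (a x) (b (s Q x))"
    "\<And>Q x y s. run Q pf (Pair (a x) (Pair (c y) (b s))) (b (f Q x y s))"
    using assms unfolding computable_def enc_pair_conv by (metis fst_conv snd_conv)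
  \<comment> \<open>the state is a triple of the input, the remaining list and the accumulator\<close>
  define cond where "cond = Cond (Seq (Fork (Seq Snd Fst) Zero) Equal) Zero (Seq Zero Succ)"
  define body where "body = Fork Fst (Fork (Seq Snd (Seq Fst Snd))
     (Seq (Fork Fst (Fork (Seq Snd (Seq Fst Fst)) (Seq Snd Snd))) pf))"
  have cond: "run Q cond (Pair u (Pair (enc_list c ys) w)) (bit (ys \<noteq> []))" for Q u ys w
  proof -
    have "run Q (Seq (Fork (Seq Snd Fst) Zero) Equal) (Pair u (Pair (enc_list c ys) w))
        (bit (enc_list c ys = Num 0))" for Q u ys w
      by (rule run.intros(2)[OF run.intros(3)[OF run.intros(2)[OF run.intros(9,8)] run.intros(10)] run.intros(19)])
    from this[of Q u ys w] show ?thesis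
      by (cases ys) (auto simp: cond_def bit_simps intro: run.intros)
  qed
  have body: "run Q body (Pair (a x) (Pair (enc_list c (y # ys)) (b t)))
      (Pair (a x) (Pair (enc_list c ys) (b (f Q x y t))))" for Q x y ys t
    unfolding body_def by (auto intro!: run.intros p(3))
  have loop: "run Q (While cond body) (Pair (a x) (Pair (enc_list c ys) (b t)))
      (Pair (a x) (Pair (Num 0) (b (fold (f Q x) ys t))))" for Q x ys t
  proof (induction ys arbitrary: t)
    case Nil
    have "run Q cond (Pair (a x) (Pair (Num 0) (b t))) (Num 0)"
      using cond[of Q "a x" "[]" "b t"] by (simp add: bit_simps)
    then show ?case by (simp add: run.intros(6))
  next
    case (Cons y ys)
    have "run Q cond (Pair (a x) (Pair (enc_list c (y # ys)) (b t))) (Num (Suc 0))"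
      using cond[of Q "a x" "y # ys" "b t"] by (simp add: bit_simps)
    from run.intros(7)[OF this body Cons.IH] show ?case by simp
  qed
  have "run Q (Seq (Fork Ident (Fork pl ps)) (Seq (While cond body) (Seq Snd Snd))) (a x)
      (b (fold (f Q x) (l Q x) (s Q x)))" for Q x
    by (auto intro!: run.intros(1-3,9) p(1,2) loop)
  then show ?thesis unfolding computable_def by blast
qed

lemma computable_rec_nat:
  assumes "computable a Num m" "computable a b s"
    and "computable (enc_pair a (enc_pair Num b)) b (\<lambda>Q z. f Q (fst z) (fst (snd z)) (snd (snd z)))"
  shows "computable a b (\<lambda>Q x. rec_nat (s Q x) (f Q x) (m Q x))"
proof -
  obtain pm ps pf where p: "\<And>Q x. run Q pm (a x) (Num (m Q x))"
    "\<And>Q x. run Q ps (a x) (b (s Q x))"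
    "\<And>Q x i s. run Q pf (Pair (a x) (Pair (Num i) (b s))) (b (f Q x i s))"
    using assms unfolding computable_def enc_pair_conv by (metis fst_conv snd_conv)
  \<comment> \<open>the state consists of the input, the remaining number of rounds, the round and the accumulator\<close>
  define body where "body = Fork Fst (Fork (Seq Snd (Seq Fst Pred))
     (Fork (Seq Snd (Seq Snd (Seq Fst Succ)))
     (Seq (Fork Fst (Fork (Seq Snd (Seq Snd Fst)) (Seq Snd (Seq Snd Snd)))) pf)))"
  have body: "run Q body (Pair (a x) (Pair (Num (Suc j)) (Pair (Num i) (b t))))
      (Pair (a x) (Pair (Num j) (Pair (Num (Suc i)) (b (f Q x i t)))))" for Q x j i t
  proof -
    have "run Q Pred (Num (Suc j)) (Num j)" using run.intros(12)[of Q "Suc j"] by simp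
    then show ?thesis unfolding body_def by (auto intro!: run.intros(1-3,8,9,11) p(3))
  qed
  have loop: "run Q (While (Seq Snd Fst) body)
      (Pair (a x) (Pair (Num j) (Pair (Num i) (b (rec_nat (s Q x) (f Q x) i)))))
      (Pair (a x) (Pair (Num 0) (Pair (Num (i + j)) (b (rec_nat (s Q x) (f Q x) (i + j))))))"
    for Q x j i
  proof (induction j arbitrary: i)
    case 0
    show ?case by (auto intro!: run.intros(6) run.intros(2,8,9))
  next
    case (Suc j)
    show ?case
      by (rule run.intros(7)[OF _ body]) (use Suc.IH[of "Suc i"] in \<open>auto intro: run.intros\<close>)
  qed
  have "run Q (Seq (Fork Ident (Fork pm (Fork Zero ps))) (Seq (While (Seq Snd Fst) body)
      (Seq Snd (Seq Snd Snd)))) (a x) (b (rec_nat (s Q x) (f Q x) (m Q x)))" for Q x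
  proof -
    have "run Q (Fork Ident (Fork pm (Fork Zero ps))) (a x)
        (Pair (a x) (Pair (Num (m Q x)) (Pair (Num 0) (b (rec_nat (s Q x) (f Q x) 0)))))"
      by (auto intro!: run.intros(1-3,10) p(1,2))
    then show ?thesis using loop[of Q x "m Q x" 0] 
      by (auto intro!: run.intros(2)[of Q "Fork _ _"] run.intros(2)[of Q "While _ _"] run.intros(2)[OF run.intros(9)] run.intros(9))
  qed
  then show ?thesis unfolding computable_def by blast
qed

text \<open>The program tests \<open>N = 0, 1, \<dots>\<close> in turn and evaluates \<open>r\<close> at the first success. It diverges where no
  \<open>N\<close> passes the test.\<close>

lemma computable_search:
  assumes "computable (enc_pair Num a) bit t" "computable (enc_pair Num a) b r"
  shows "\<exists>p. \<forall>Q x. (\<exists>N. t Q (N, x)) \<longrightarrow> (\<exists>N. t Q (N, x) \<and> run Q p (a x) (b (r Q (N, x))))"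
proof -
  obtain pt pr where p: "\<And>Q N x. run Q pt (Pair (Num N) (a x)) (bit (\<not> t Q (N, x)))"
    "\<And>Q N x. run Q pr (Pair (Num N) (a x)) (b (r Q (N, x)))"
    using assms(2) computable_not[OF assms(1)] unfolding computable_def
    by (metis enc_pair.simps)
  let ?body = "Fork (Seq Fst Succ) Snd"
  have loop: "run Q (While pt ?body) (Pair (Num M) (a x)) (Pair (Num N) (a x))"
    if "t Q (N, x)" "\<forall>K\<in>{M..<N}. \<not> t Q (K, x)" "M \<le> N" for Q N x M
    using that(3,2)
  proof (induction M rule: inc_induct)
    case base
    show ?case using p(1)[of Q N x] that(1) by (auto simp: bit_simps intro: run.intros(6))
  next
    case (step M)
    then have "run Q (While pt ?body) (Pair (Num (Suc M)) (a x)) (Pair (Num N) (a x))" by auto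
    moreover have "run Q pt (Pair (Num M) (a x)) (Num (Suc 0))"
      using p(1)[of Q M x] step by (auto simp: bit_simps)
    ultimately show ?case by (rule run.intros(7)[rotated 2]) (auto intro: run.intros)
  qed
  have "\<exists>N. t Q (N, x) \<and> run Q (Seq (Fork Zero Ident) (Seq (While pt ?body) pr)) (a x) (b (r Q (N, x)))"
    if "\<exists>N. t Q (N, x)" for Q x
  proof -
    let ?N = "LEAST N. t Q (N, x)"
    have N: "t Q (?N, x)" by (rule LeastI_ex[OF that])
    have "\<not> t Q (K, x)" if "K < ?N" for K by (rule not_less_Least[OF that])
    then have K: "\<forall>K\<in>{0..<?N}. \<not> t Q (K, x)" by (blast dest: atLeastLessThan_iff[THEN iffD1])
    have w: "run Q (While pt ?body) (Pair (Num 0) (a x)) (Pair (Num ?N) (a x))"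
      by (rule loop[OF N K le0])
    have f: "run Q (Fork Zero Ident) (a x) (Pair (Num 0) (a x))"
      by (rule run.intros(3)[OF run.intros(10) run.intros(1)])
    have "run Q (Seq (Fork Zero Ident) (Seq (While pt ?body) pr)) (a x) (b (r Q (?N, x)))"
      by (rule run.intros(2)[OF f run.intros(2)[OF w p(2)]])
    with N show ?thesis by blast
  qed
  then show ?thesis by blast
qed

lemmas computable_basic =
  computable_Pair computable_fst computable_snd computable_if
  computable_0 computable_Suc computable_Scal0 computable_Scal1 computable_plus computable_times
  computable_uminus computable_inverse computable_True computable_False computable_not
  computable_and computable_or computable_Nil computable_Cons computable_case_list
  computable_fold computable_rec_nat computable_id

lemma computable_rev:
  assumes "computable a (enc_list b) f"
  shows "computable a (enc_list b) (\<lambda>Q x. rev (f Q x))"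
proof -
  have "computable a (enc_list b) (\<lambda>Q x. fold (\<lambda>y s. y # s) (f Q x) [])"
    by (rule assms computable_basic)+
  then show ?thesis by (rule computable_cong) (simp add: fold_Cons_rev)
qed

lemma computable_append:
  assumes "computable a (enc_list b) f" "computable a (enc_list b) g"
  shows "computable a (enc_list b) (\<lambda>Q x. f Q x @ g Q x)"
proof -
  have "computable a (enc_list b) (\<lambda>Q x. fold (\<lambda>y s. y # s) (rev (f Q x)) (g Q x))"
    by (rule assms computable_basic computable_rev)+
  then show ?thesis by (rule computable_cong) (simp add: fold_Cons_rev)
qed

lemma computable_map:
  assumes "computable (enc_pair a c) b (\<lambda>Q z. f Q (fst z) (snd z))" "computable a (enc_list c) l"
  shows "computable a (enc_list b) (\<lambda>Q x. map (f Q x) (l Q x))"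
proof -
  have "computable (enc_pair a (enc_pair c (enc_list b))) b (\<lambda>Q z. f Q (fst z) (fst (snd z)))"
  proof -
    have "computable (enc_pair a (enc_pair c (enc_list b))) (enc_pair a c) (\<lambda>Q z. (fst z, fst (snd z)))"
      by (rule computable_basic)+
    from computable_comp[OF this assms(1)] show ?thesis by simp
  qed
  then have "computable a (enc_list b) (\<lambda>Q x. rev (fold (\<lambda>y s. f Q x y # s) (l Q x) []))"
    by - (rule assms computable_rev computable_basic | assumption)+
  moreover have "fold (\<lambda>y s. f Q x y # s) l s = rev (map (f Q x) l) @ s" for Q x l s
    by (induction l arbitrary: s) auto
  ultimately show ?thesis by simp
qed

lemma computable_filter:
  assumes "computable (enc_pair a c) bit (\<lambda>Q z. f Q (fst z) (snd z))" "computable a (enc_list c) l"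
  shows "computable a (enc_list c) (\<lambda>Q x. filter (f Q x) (l Q x))"
proof -
  have "computable (enc_pair a (enc_pair c (enc_list c))) bit (\<lambda>Q z. f Q (fst z) (fst (snd z)))"
  proof -
    have "computable (enc_pair a (enc_pair c (enc_list c))) (enc_pair a c) (\<lambda>Q z. (fst z, fst (snd z)))"
      by (rule computable_basic)+
    from computable_comp[OF this assms(1)] show ?thesis by simp
  qed
  then have "computable a (enc_list c)
      (\<lambda>Q x. rev (fold (\<lambda>y s. if f Q x y then y # s else s) (l Q x) []))"
    by - (rule assms computable_rev computable_basic | assumption)+
  moreover have "fold (\<lambda>y s. if f Q x y then y # s else s) l s = rev (filter (f Q x) l) @ s"
    for Q x l s
    by (induction l arbitrary: s) auto
  ultimately show ?thesis by simp
qed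

lemma computable_concat:
  assumes "computable a (enc_list (enc_list b)) f"
  shows "computable a (enc_list b) (\<lambda>Q x. concat (f Q x))"
proof -
  have "computable a (enc_list b) (\<lambda>Q x. fold (\<lambda>y s. s @ y) (f Q x) [])"
    by (rule assms computable_basic computable_append)+
  moreover have "fold (\<lambda>y s. s @ y) l s = s @ concat l" for l and s :: "'c list"
    by (induction l arbitrary: s) auto
  ultimately show ?thesis by - (erule computable_cong, simp)
qed

lemma computable_list_all:
  assumes "computable (enc_pair a c) bit (\<lambda>Q z. f Q (fst z) (snd z))" "computable a (enc_list c) l"
  shows "computable a bit (\<lambda>Q x. list_all (f Q x) (l Q x))"
proof -
  have "computable a bit (\<lambda>Q x. filter (\<lambda>y. \<not> f Q x y) (l Q x) = [])"
    by (rule computable_null computable_filter computable_not assms)+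
  then show ?thesis by (rule computable_cong) (simp add: filter_empty_conv list_all_iff)
qed

lemma computable_upt:
  assumes "computable a Num f"
  shows "computable a (enc_list Num) (\<lambda>Q x. [0..<f Q x])"
proof -
  have "computable a (enc_list Num) (\<lambda>Q x. rec_nat [] (\<lambda>i l. l @ [i]) (f Q x))"
    by (rule assms computable_basic computable_append)+
  moreover have "rec_nat [] (\<lambda>i l. l @ [i]) n = [0..<n]" for n by (induction n) auto
  ultimately show ?thesis by simp
qed

lemma computable_sum_list:
  assumes "computable a (enc_list Scal) f"
  shows "computable a Scal (\<lambda>Q x. sum_list (f Q x))"
proof -
  have "computable a Scal (\<lambda>Q x. fold (\<lambda>y s. s + y) (f Q x) 0)"
    by (rule assms computable_basic)+
  moreover have "fold (\<lambda>y s. s + y) l s = s + sum_list l" for l and s :: 'b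
    by (induction l arbitrary: s) (auto simp: add.assoc)
  ultimately show ?thesis by simp
qed

lemma computable_enumerate:
  assumes "computable a (enc_list b) f"
  shows "computable a (enc_list (enc_pair Num b)) (\<lambda>Q x. List.enumerate 0 (f Q x))"
proof -
  have "computable a (enc_list (enc_pair Num b))
      (\<lambda>Q x. snd (fold (\<lambda>y s. (Suc (fst s), snd s @ [(fst s, y)])) (f Q x) (0, [])))"
    by (rule assms computable_basic computable_append)+
  moreover have "fold (\<lambda>y s. (Suc (fst s), snd s @ [(fst s, y)])) l (i, s)
      = (i + length l, s @ List.enumerate i l)" for l i and s :: "(nat \<times> 'c) list"
    by (induction l arbitrary: i s) auto
  ultimately show ?thesis by - (erule computable_cong, simp)
qed

lemma computable_tl:
  assumes "computable a (enc_list b) f"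
  shows "computable a (enc_list b) (\<lambda>Q x. tl (f Q x))"
proof -
  have "computable a (enc_list b) (\<lambda>Q x. case f Q x of [] \<Rightarrow> [] | y # ys \<Rightarrow> ys)"
    by (rule assms computable_basic)+
  then show ?thesis by (simp add: tl_def)
qed

lemmas computable_intros = computable_basic computable_append computable_map computable_filter
  computable_concat computable_list_all computable_upt computable_sum_list computable_enumerate
  computable_tl computable_eq inj_enc_pair inj_enc_list inj_Num inj_Scal computable_null

section \<open>Gaussian elimination on sparse vectors\<close>

text \<open>A vector is a list of coefficients with keys. A key may occur repeatedly; its coefficients add up.
  Thus addition is concatenation, and terms never have to be collected.\<close>

definition coef :: "('k::field \<times> 'a) list \<Rightarrow> 'a \<Rightarrow> 'k" where
  "coef v k = sum_list (map fst (filter (\<lambda>t. snd t = k) v))"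

definition smul :: "'k::field \<Rightarrow> ('k \<times> 'a) list \<Rightarrow> ('k \<times> 'a) list" where
  "smul c v = map (\<lambda>t. (c * fst t, snd t)) v"

text \<open>If \<open>r\<close> has coefficient \<open>1\<close> at \<open>k\<close>, this clears the coefficient of \<open>v\<close> at \<open>k\<close>.\<close>

definition elim :: "'a \<Rightarrow> ('k::field \<times> 'a) list \<Rightarrow> ('k \<times> 'a) list \<Rightarrow> ('k \<times> 'a) list" where
  "elim k r v = v @ smul (- coef v k) r"

definition vkeys :: "('k \<times> 'a) list list \<Rightarrow> 'a list" where
  "vkeys rows = concat (map (map snd) rows)"

text \<open>The state consists of the finished pivot rows, with their pivots, and of the remaining rows. The
  row chosen as pivot row also stays among the remaining ones, where it is reduced to zero.\<close>

definition rref_step :: "'a \<Rightarrow> ('a \<times> ('k::field \<times> 'a) list) list \<times> ('k \<times> 'a) list list \<Rightarrow>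
    ('a \<times> ('k \<times> 'a) list) list \<times> ('k \<times> 'a) list list" where
  "rref_step k s = (case filter (\<lambda>r. coef r k \<noteq> 0) (snd s) of
       [] \<Rightarrow> s
     | r # rs \<Rightarrow> ((k, smul (inverse (coef r k)) r) #
           map (\<lambda>t. (fst t, elim k (smul (inverse (coef r k)) r) (snd t))) (fst s),
         map (elim k (smul (inverse (coef r k)) r)) (snd s)))"

definition rref :: "'a list \<Rightarrow> ('k::field \<times> 'a) list list \<Rightarrow> ('a \<times> ('k \<times> 'a) list) list" where
  "rref ks rows = fst (fold rref_step ks ([], rows))"

definition in_span :: "('k::field \<times> 'a) list list \<Rightarrow> ('k \<times> 'a) list \<Rightarrow> bool" where
  "in_span rows v \<longleftrightarrow>
     list_all (\<lambda>k. coef (fold (\<lambda>t. elim (fst t) (snd t)) (rref (vkeys (v # rows)) rows) v) k = 0)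
       (vkeys (v # rows))"

lemma coef_append [simp]: "coef (v @ w) k = coef v k + coef w k"
  by (simp add: coef_def)

lemma coef_Nil [simp]: "coef [] k = 0"
  by (simp add: coef_def)

lemma coef_Cons: "coef (t # v) k = (if snd t = k then fst t else 0) + coef v k"
  by (simp add: coef_def)

lemma coef_smul [simp]: "coef (smul c v) k = c * coef v k"
  by (induction v) (simp_all add: smul_def coef_Cons algebra_simps)

lemma coef_elim [simp]: "coef (elim k r v) l = coef v l - coef v k * coef r l"
  by (simp add: elim_def)

lemma coef_nonzero_key: "coef v k \<noteq> 0 \<Longrightarrow> k \<in> snd ` set v"
  by (induction v) (auto simp: coef_Cons split: if_splits)

lemma keys_smul [simp]: "snd ` set (smul c v) = snd ` set v"
  by (auto simp: smul_def image_image)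

lemma keys_elim: "snd ` set (elim k r v) \<subseteq> snd ` set v \<union> snd ` set r"
  by (simp add: elim_def image_Un)

lemma set_vkeys: "set (vkeys rows) = (\<Union>r\<in>set rows. snd ` set r)"
  by (simp add: vkeys_def)

text \<open>\<open>\<phi>\<close> interprets sparse vectors in a vector space with coordinate functionals \<open>X k\<close>. Only for keys in \<open>V\<close>
  do the coordinates have to agree with the coefficients.\<close>

locale sparse_rep = vector_space scale
  for scale :: "'k::field \<Rightarrow> 'v::ab_group_add \<Rightarrow> 'v" +
  fixes \<phi> :: "('k \<times> 'a) list \<Rightarrow> 'v" and X :: "'a \<Rightarrow> 'v \<Rightarrow> 'k" and V :: "'a set"
  assumes \<phi>_append: "\<phi> (v @ w) = \<phi> v + \<phi> w"
    and \<phi>_smul: "\<phi> (smul c v) = scale c (\<phi> v)"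
    and X_add: "X k (x + y) = X k x + X k y"
    and X_scale: "X k (scale c x) = c * X k x"
    and X_\<phi>: "k \<in> V \<Longrightarrow> X k (\<phi> v) = coef v k"
    and \<phi>_zero: "(\<And>k. k \<in> V \<Longrightarrow> coef v k = 0) \<Longrightarrow> \<phi> v = 0"
begin

lemma X_zero [simp]: "X k 0 = 0"
  using X_scale[of k 0 0] by simp

lemma \<phi>_elim: "\<phi> (elim k r v) = \<phi> v - scale (coef v k) (\<phi> r)"
  by (simp add: elim_def \<phi>_append \<phi>_smul)

text \<open>\<open>K\<close> is the set of the columns that have been processed; \<open>R\<close> relates earlier columns to later ones. A
  pivot row vanishes in the processed columns before its pivot, since the remaining rows did so when it was chosen.\<close>

definition rref_inv where
  "rref_inv R K rows s \<longleftrightarrow>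
     span (\<phi> ` (snd ` set (fst s) \<union> set (snd s))) = span (\<phi> ` set rows) \<and>
     distinct (map fst (fst s)) \<and>
     (\<forall>(k, r)\<in>set (fst s). k \<in> K \<and> coef r k = 1 \<and> (\<forall>(k', r')\<in>set (fst s). k \<noteq> k' \<longrightarrow> coef r k' = 0)) \<and>
     (\<forall>r\<in>set (snd s). \<forall>k\<in>K. coef r k = 0) \<and>
     (\<forall>(k, r)\<in>set (fst s). \<forall>k'. coef r k' \<noteq> 0 \<longrightarrow> k' = k \<or> R k k' \<or> k' \<notin> K) \<and>
     (\<forall>r\<in>snd ` set (fst s) \<union> set (snd s). snd ` set r \<subseteq> set (vkeys rows))"

lemma rref_invD:
  assumes "rref_inv R K rows s"
  shows "span (\<phi> ` (snd ` set (fst s) \<union> set (snd s))) = span (\<phi> ` set rows)"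
    and "distinct (map fst (fst s))"
    and "(k, r) \<in> set (fst s) \<Longrightarrow> k \<in> K"
    and "(k, r) \<in> set (fst s) \<Longrightarrow> coef r k = 1"
    and "(k, r) \<in> set (fst s) \<Longrightarrow> (k', r') \<in> set (fst s) \<Longrightarrow> k \<noteq> k' \<Longrightarrow> coef r k' = 0"
    and "v \<in> set (snd s) \<Longrightarrow> l \<in> K \<Longrightarrow> coef v l = 0"
    and "(k, r) \<in> set (fst s) \<Longrightarrow> coef r l \<noteq> 0 \<Longrightarrow> l = k \<or> R k l \<or> l \<notin> K"
    and "v \<in> snd ` set (fst s) \<union> set (snd s) \<Longrightarrow> snd ` set v \<subseteq> set (vkeys rows)"
proof -
  note a = assms[unfolded rref_inv_def]
  note c1 = a[THEN conjunct1] note a = a[THEN conjunct2]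
  note c2 = a[THEN conjunct1] note a = a[THEN conjunct2]
  note c3 = a[THEN conjunct1] note a = a[THEN conjunct2]
  note c4 = a[THEN conjunct1] note a = a[THEN conjunct2]
  note c5 = a[THEN conjunct1] note c6 = a[THEN conjunct2]
  show "span (\<phi> ` (snd ` set (fst s) \<union> set (snd s))) = span (\<phi> ` set rows)" by (rule c1)
  show "distinct (map fst (fst s))" by (rule c2)
  show "(k, r) \<in> set (fst s) \<Longrightarrow> k \<in> K" "(k, r) \<in> set (fst s) \<Longrightarrow> coef r k = 1"
    using c3 by auto
  show "(k, r) \<in> set (fst s) \<Longrightarrow> (k', r') \<in> set (fst s) \<Longrightarrow> k \<noteq> k' \<Longrightarrow> coef r k' = 0"
    using c3 by fastforce
  show "v \<in> set (snd s) \<Longrightarrow> l \<in> K \<Longrightarrow> coef v l = 0" using c4 by blast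
  show "(k, r) \<in> set (fst s) \<Longrightarrow> coef r l \<noteq> 0 \<Longrightarrow> l = k \<or> R k l \<or> l \<notin> K" using c5 by blast
  show "v \<in> snd ` set (fst s) \<union> set (snd s) \<Longrightarrow> snd ` set v \<subseteq> set (vkeys rows)" using c6 by blast
qed

lemma rref_invI:
  assumes "span (\<phi> ` (snd ` set (fst s) \<union> set (snd s))) = span (\<phi> ` set rows)"
    and "distinct (map fst (fst s))"
    and "\<And>k r. (k, r) \<in> set (fst s) \<Longrightarrow> k \<in> K"
    and "\<And>k r. (k, r) \<in> set (fst s) \<Longrightarrow> coef r k = 1"
    and "\<And>k r k' r'. (k, r) \<in> set (fst s) \<Longrightarrow> (k', r') \<in> set (fst s) \<Longrightarrow> k \<noteq> k' \<Longrightarrow> coef r k' = 0"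
    and "\<And>v l. v \<in> set (snd s) \<Longrightarrow> l \<in> K \<Longrightarrow> coef v l = 0"
    and "\<And>k r l. (k, r) \<in> set (fst s) \<Longrightarrow> coef r l \<noteq> 0 \<Longrightarrow> l = k \<or> R k l \<or> l \<notin> K"
    and "\<And>v. v \<in> snd ` set (fst s) \<union> set (snd s) \<Longrightarrow> snd ` set v \<subseteq> set (vkeys rows)"
  shows "rref_inv R K rows s"
  unfolding rref_inv_def
proof (intro conjI)
  show "\<forall>(k, r)\<in>set (fst s). k \<in> K \<and> coef r k = 1 \<and>
      (\<forall>(k', r')\<in>set (fst s). k \<noteq> k' \<longrightarrow> coef r k' = 0)"
    using assms(3-5) by auto
  show "\<forall>(k, r)\<in>set (fst s). \<forall>k'. coef r k' \<noteq> 0 \<longrightarrow> k' = k \<or> R k k' \<or> k' \<notin> K"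
    using assms(7) by blast
qed (use assms(1,2,6,8) in auto)

lemma rref_inv_step:
  assumes inv: "rref_inv R K rows s" and R: "\<forall>k'\<in>K. R k' k"
  shows "rref_inv R (insert k K) rows (rref_step k s)"
proof (cases "filter (\<lambda>r. coef r k \<noteq> 0) (snd s)")
  case Nil
  then have z: "\<forall>r\<in>set (snd s). coef r k = 0" by (simp add: filter_empty_conv)
  have "rref_inv R (insert k K) rows s"
  proof (rule rref_invI)
    fix v l assume "v \<in> set (snd s)" "l \<in> insert k K"
    then show "coef v l = 0" using z rref_invD(6)[OF inv] by blast
  next
    fix k' r l assume "(k', r) \<in> set (fst s)" "coef r l \<noteq> 0"
    then show "l = k' \<or> R k' l \<or> l \<notin> insert k K"
      using rref_invD(7)[OF inv] rref_invD(3)[OF inv] R by blast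
  qed (use rref_invD[OF inv] in blast)+
  then show ?thesis by (simp add: rref_step_def Nil)
next
  case (Cons r0 rs)
  then have r0: "r0 \<in> set (snd s)" "coef r0 k \<noteq> 0"
    by (metis (mono_tags, lifting) list.set_intros(1) mem_Collect_eq set_filter)+
  define r where "r = smul (inverse (coef r0 k)) r0"
  have step: "rref_step k s =
      ((k, r) # map (\<lambda>t. (fst t, elim k r (snd t))) (fst s), map (elim k r) (snd s))"
    by (simp add: rref_step_def Cons r_def)
  have kK: "k \<notin> K" using r0 rref_invD(6)[OF inv] by blast
  have rk: "coef r k = 1" using r0 by (simp add: r_def)
  have rz: "coef r k' = 0" if "k' \<in> K" for k'
    using rref_invD(6)[OF inv r0(1) that] by (simp add: r_def)
  let ?old = "\<phi> ` (snd ` set (fst s) \<union> set (snd s))"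
  let ?new = "insert (\<phi> r) (\<phi> ` elim k r ` (snd ` set (fst s) \<union> set (snd s)))"
  have "span ?new = span ?old"
  proof (rule span_eq[THEN iffD2], intro conjI subsetI)
    have "\<phi> r0 \<in> span ?old" using r0 by (intro span_base) auto
    then have old: "\<phi> r \<in> span ?old" by (simp add: r_def \<phi>_smul span_scale)
    fix x assume "x \<in> ?new"
    then consider "x = \<phi> r" | v where "v \<in> snd ` set (fst s) \<union> set (snd s)" "x = \<phi> (elim k r v)"
      by blast
    then show "x \<in> span ?old"
    proof cases
      case 2
      have "\<phi> v \<in> span ?old" using 2(1) by (intro span_base) auto
      then show ?thesis using old 2(2) by (simp add: \<phi>_elim span_diff span_scale)
    qed (use old in simp)
  next
    fix x assume "x \<in> ?old"
    then obtain v where v: "v \<in> snd ` set (fst s) \<union> set (snd s)" "x = \<phi> v" by blast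
    have "\<phi> v = \<phi> (elim k r v) + scale (coef v k) (\<phi> r)" by (simp add: \<phi>_elim)
    moreover have "\<phi> (elim k r v) \<in> span ?new" "\<phi> r \<in> span ?new"
      using v(1) by (auto intro!: span_base)
    ultimately show "x \<in> span ?new" using v(2) by (simp add: span_add span_scale)
  qed
  moreover have "\<phi> ` (snd ` set (fst (rref_step k s)) \<union> set (snd (rref_step k s))) = ?new"
    unfolding step by (auto simp: image_image)
  ultimately have sp: "span (\<phi> ` (snd ` set (fst (rref_step k s)) \<union> set (snd (rref_step k s))))
      = span (\<phi> ` set rows)"
    using rref_invD(1)[OF inv] by simp
  have keys_r: "snd ` set r \<subseteq> set (vkeys rows)"
    using rref_invD(8)[OF inv, of r0] r0 by (simp add: r_def)
  have keys_e: "snd ` set (elim k r v) \<subseteq> set (vkeys rows)"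
    if "v \<in> snd ` set (fst s) \<union> set (snd s)" for v
    using keys_elim[of k r v] keys_r rref_invD(8)[OF inv that] by blast
  have piv: "(k1 = k \<and> r1 = r) \<or> (\<exists>r2. (k1, r2) \<in> set (fst s) \<and> r1 = elim k r r2)"
    if "(k1, r1) \<in> set (fst (rref_step k s))" for k1 r1
    using that unfolding step by auto
  show ?thesis
  proof (rule rref_invI)
    show "distinct (map fst (fst (rref_step k s)))"
      using rref_invD(2)[OF inv] rref_invD(3)[OF inv] kK unfolding step by (auto simp: comp_def)
    show "k1 \<in> insert k K" if "(k1, r1) \<in> set (fst (rref_step k s))" for k1 r1
      using piv[OF that] rref_invD(3)[OF inv] by auto
    show "coef r1 k1 = 1" if "(k1, r1) \<in> set (fst (rref_step k s))" for k1 r1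
      using piv[OF that] rk rz rref_invD(3,4)[OF inv] by auto
    show "coef r1 k2 = 0" if a: "(k1, r1) \<in> set (fst (rref_step k s))"
      "(k2, r2) \<in> set (fst (rref_step k s))" "k1 \<noteq> k2" for k1 r1 k2 r2
    proof (cases "k2 = k")
      case True
      then obtain r1' where "r1 = elim k r r1'" using piv[OF a(1)] a(3) by blast
      then show ?thesis using rk True by simp
    next
      case False
      then obtain r2' where r2': "(k2, r2') \<in> set (fst s)" using piv[OF a(2)] by blast
      then have "k2 \<in> K" by (rule rref_invD(3)[OF inv])
      then show ?thesis using piv[OF a(1)] rz rref_invD(5)[OF inv _ r2' a(3)] by auto
    qed
    show "coef v l = 0" if "v \<in> set (snd (rref_step k s))" "l \<in> insert k K" for v l
      using that rk rz rref_invD(6)[OF inv] unfolding step by auto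
    show "l = k1 \<or> R k1 l \<or> l \<notin> insert k K"
      if a: "(k1, r1) \<in> set (fst (rref_step k s))" "coef r1 l \<noteq> 0" for k1 r1 l
      using piv[OF a(1)]
    proof
      assume "k1 = k \<and> r1 = r"
      then show ?thesis using a(2) rz by blast
    next
      assume "\<exists>r2. (k1, r2) \<in> set (fst s) \<and> r1 = elim k r r2"
      then obtain r2 where r2: "(k1, r2) \<in> set (fst s)" "r1 = elim k r r2" by blast
      show ?thesis
      proof (cases "l \<in> K")
        case True
        then have "coef r2 l \<noteq> 0" using a(2) rz r2(2) by simp
        then show ?thesis using rref_invD(7)[OF inv r2(1)] True by blast
      next
        case False
        then show ?thesis using R rref_invD(3)[OF inv r2(1)] by blast
      qed
    qed
    show "snd ` set v \<subseteq> set (vkeys rows)"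
      if "v \<in> snd ` set (fst (rref_step k s)) \<union> set (snd (rref_step k s))" for v
    proof -
      have "v = r \<or> v \<in> elim k r ` (snd ` set (fst s) \<union> set (snd s))"
        using that unfolding step by (auto simp: image_iff)
      then show ?thesis using keys_r keys_e by blast
    qed
  qed (rule sp)
qed

lemma rref_inv_fold:
  "sorted_wrt R ks \<Longrightarrow> rref_inv R (set ks) rows (fold rref_step ks ([], rows))"
proof (induction ks rule: rev_induct)
  case Nil
  show ?case by (rule rref_invI) (auto simp: set_vkeys)
next
  case (snoc k ks)
  then show ?case using rref_inv_step[of R "set ks" rows "fold rref_step ks ([], rows)" k]
    by (simp add: sorted_wrt_append)
qed

context
  fixes ks :: "'a list" and rows :: "('k \<times> 'a) list list" and R :: "'a \<Rightarrow> 'a \<Rightarrow> bool"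
  assumes ks: "set (vkeys rows) \<subseteq> set ks" and sorted: "sorted_wrt R ks"
    and V: "set (vkeys rows) \<subseteq> V"
begin

private lemma inv: "rref_inv R (set ks) rows (fold rref_step ks ([], rows))"
  by (rule rref_inv_fold[OF sorted])

lemma rref_span: "span (\<phi> ` snd ` set (rref ks rows)) = span (\<phi> ` set rows)"
proof -
  let ?s = "fold rref_step ks ([], rows)"
  have "\<phi> r = 0" if "r \<in> set (snd ?s)" for r
  proof (rule \<phi>_zero)
    fix k
    have "snd ` set r \<subseteq> set ks" "\<forall>k\<in>set ks. coef r k = 0"
      using rref_invD(8)[OF inv, of r] rref_invD(6)[OF inv that] that ks by blast+
    then show "coef r k = 0" using coef_nonzero_key[of r k] by blast
  qed
  then have "\<phi> ` (snd ` set (fst ?s) \<union> set (snd ?s)) \<subseteq> insert 0 (\<phi> ` snd ` set (fst ?s))"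
    by auto
  then have "span (\<phi> ` (snd ` set (fst ?s) \<union> set (snd ?s))) \<subseteq> span (\<phi> ` snd ` set (fst ?s))"
    using span_mono span_insert_0 by metis
  moreover have "span (\<phi> ` snd ` set (fst ?s)) \<subseteq> span (\<phi> ` (snd ` set (fst ?s) \<union> set (snd ?s)))"
    by (rule span_mono) auto
  moreover have "span (\<phi> ` (snd ` set (fst ?s) \<union> set (snd ?s))) = span (\<phi> ` set rows)"
    by (rule rref_invD(1)[OF inv])
  ultimately show ?thesis unfolding rref_def by simp
qed

lemma rref_keys:
  assumes "(k, r) \<in> set (rref ks rows)"
  shows "snd ` set r \<subseteq> set (vkeys rows)" "k \<in> snd ` set r" "coef r k = 1"
proof -
  show "snd ` set r \<subseteq> set (vkeys rows)" "coef r k = 1"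
    using rref_invD(8)[OF inv, of r] rref_invD(4)[OF inv] assms unfolding rref_def by force+
  then show "k \<in> snd ` set r" using coef_nonzero_key[of r k] by simp
qed

lemma rref_distinct: "distinct (map fst (rref ks rows))"
  using rref_invD(2)[OF inv] unfolding rref_def .

lemma rref_reduced:
  "(k, r) \<in> set (rref ks rows) \<Longrightarrow> (k', r') \<in> set (rref ks rows) \<Longrightarrow> k \<noteq> k' \<Longrightarrow> coef r k' = 0"
  using rref_invD(5)[OF inv] unfolding rref_def .

text \<open>When all columns have been processed, the pivot of a row is its first nonzero entry.\<close>

lemma rref_order:
  "(k, r) \<in> set (rref ks rows) \<Longrightarrow> coef r k' \<noteq> 0 \<Longrightarrow> k' \<noteq> k \<Longrightarrow> R k k'"
  using rref_invD(7)[OF inv, of k r k'] coef_nonzero_key[of r k'] rref_keys(1)[of k r] ks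
  unfolding rref_def by blast

text \<open>A vector of the row space is the combination of the pivot rows whose coefficients are its coordinates at
  the pivots, as each pivot column has a single nonzero entry.\<close>

lemma rref_unique:
  assumes "x \<in> span (\<phi> ` set rows)"
    and zero: "\<And>k r. (k, r) \<in> set (rref ks rows) \<Longrightarrow> X k x = 0"
  shows "x = 0"
proof -
  let ?P = "set (rref ks rows)"
  have "x = (\<Sum>t\<in>?P. scale (X (fst t) x) (\<phi> (snd t)))" if "x \<in> span (\<phi> ` snd ` ?P)" for x
    using that
  proof (induction rule: span_induct_alt)
    case base show ?case by simp
  next
    case (step c y z)
    from step(1) obtain k r where kr: "(k, r) \<in> ?P" "y = \<phi> r" by auto
    have "X (fst t) y = (if t = (k, r) then 1 else 0)" if "t \<in> ?P" for t
    proof -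
      obtain k' r' where t: "t = (k', r')" by (cases t)
      have "k' \<in> V" using rref_keys[of k' r'] that V t by blast
      then have "X (fst t) y = coef r k'" using t kr by (simp add: X_\<phi>)
      moreover have "k' = k \<Longrightarrow> r' = r"
        using rref_distinct that t kr by (metis eq_key_imp_eq_value)
      ultimately show ?thesis using rref_keys(3)[OF kr(1)] rref_reduced[OF kr(1)] that t by auto
    qed
    then have "(\<Sum>t\<in>?P. scale (X (fst t) y) (\<phi> (snd t))) = (\<Sum>t\<in>?P. if t = (k, r) then y else 0)"
      using kr by (intro sum.cong) auto
    also have "\<dots> = y" using kr(1) by (simp add: sum.delta)
    finally have y: "(\<Sum>t\<in>?P. scale (X (fst t) y) (\<phi> (snd t))) = y" .
    have "(\<Sum>t\<in>?P. scale (X (fst t) (scale c y + z)) (\<phi> (snd t)))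
        = scale c (\<Sum>t\<in>?P. scale (X (fst t) y) (\<phi> (snd t)))
          + (\<Sum>t\<in>?P. scale (X (fst t) z) (\<phi> (snd t)))"
      by (simp add: X_add X_scale scale_left_distrib scale_sum_right sum.distrib)
    then show ?case using y step(2) by simp
  qed
  from this[of x] have "x = (\<Sum>t\<in>?P. scale (X (fst t) x) (\<phi> (snd t)))"
    using assms(1) rref_span by simp
  also have "\<dots> = 0" by (rule sum.neutral) (use zero in auto)
  finally show ?thesis .
qed

end

text \<open>Reducing \<open>v\<close> by the pivot rows changes it by an element of the row space and makes its coordinates at the pivots
  vanish, so that the result is zero exactly if \<open>v\<close> lies in the row space.\<close>

theorem in_span_iff:
  assumes V: "set (vkeys (v # rows)) \<subseteq> V"
  shows "in_span rows v \<longleftrightarrow> \<phi> v \<in> span (\<phi> ` set rows)"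
proof -
  let ?ks = "vkeys (v # rows)"
  let ?P = "rref ?ks rows"
  let ?S = "span (\<phi> ` set rows)"
  define v' where "v' = fold (\<lambda>t. elim (fst t) (snd t)) ?P v"
  have ks: "set (vkeys rows) \<subseteq> set ?ks" by (auto simp: vkeys_def)
  have sorted: "sorted_wrt (\<lambda>_ _. True) ?ks" by (simp add: sorted_wrt_iff_nth_less)
  have VV: "set (vkeys rows) \<subseteq> V" using V by (auto simp: vkeys_def)
  note rref = rref_span[OF ks sorted VV] rref_keys[OF ks sorted VV]
    rref_distinct[OF ks sorted VV] rref_reduced[OF ks sorted VV] rref_unique[OF ks sorted VV]
  have PS: "\<phi> r \<in> ?S" if "(k, r) \<in> set ?P" for k r
    using that rref(1) span_base[of "\<phi> r" "\<phi> ` snd ` set ?P"] by force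
  have gen: "\<phi> v - \<phi> (fold (\<lambda>t. elim (fst t) (snd t)) P u) \<in> ?S \<and>
      snd ` set (fold (\<lambda>t. elim (fst t) (snd t)) P u) \<subseteq> set ?ks \<and>
      (\<forall>k\<in>fst ` (D \<union> set P). coef (fold (\<lambda>t. elim (fst t) (snd t)) P u) k = 0)"
    if "D \<union> set P \<subseteq> set ?P" "\<phi> v - \<phi> u \<in> ?S" "snd ` set u \<subseteq> set ?ks"
      "\<forall>k\<in>fst ` D. coef u k = 0" for P u D
    using that
  proof (induction P arbitrary: u D)
    case Nil then show ?case by simp
  next
    case (Cons t P)
    obtain k r where t: "t = (k, r)" "(k, r) \<in> set ?P" using Cons.prems(1) by (cases t) auto
    have "\<phi> v - \<phi> (elim k r u) = (\<phi> v - \<phi> u) + scale (coef u k) (\<phi> r)"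
      by (simp add: \<phi>_elim)
    also have "\<dots> \<in> ?S" using Cons.prems(2) PS[OF t(2)] by (simp add: span_add span_scale)
    finally have a: "\<phi> v - \<phi> (elim k r u) \<in> ?S" .
    have b: "snd ` set (elim k r u) \<subseteq> set ?ks"
      using keys_elim[of k r u] Cons.prems(3) rref(2)[OF t(2)] ks by blast
    have c: "\<forall>l\<in>fst ` insert t D. coef (elim k r u) l = 0"
    proof
      fix l assume l: "l \<in> fst ` insert t D"
      then obtain r' where "(l, r') \<in> set ?P" using Cons.prems(1) by force
      then show "coef (elim k r u) l = 0"
        using rref(6)[OF t(2), of l r'] rref(4)[OF t(2)] l Cons.prems(4) t by (cases "l = k") auto
    qed
    have "insert t D \<union> set P \<subseteq> set ?P" using Cons.prems(1) by auto
    from Cons.IH[OF this a b c] show ?case using t by simp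
  qed
  have v': "\<phi> v - \<phi> v' \<in> ?S" "snd ` set v' \<subseteq> set ?ks" "\<And>k r. (k, r) \<in> set ?P \<Longrightarrow> coef v' k = 0"
    using gen[of "{}" ?P v] unfolding v'_def
    by (auto simp: span_zero vkeys_def)
  show ?thesis
  proof
    assume "in_span rows v"
    then have "\<forall>k\<in>set ?ks. coef v' k = 0"
      by (simp add: in_span_def v'_def list_all_iff)
    then have "\<phi> v' = 0" using v'(2) coef_nonzero_key[of v'] by (intro \<phi>_zero) blast
    then show "\<phi> v \<in> ?S" using v'(1) by simp
  next
    assume "\<phi> v \<in> ?S"
    then have "\<phi> v' \<in> ?S" using v'(1) span_diff[of "\<phi> v" _ "\<phi> v - \<phi> v'"] by simp
    then have "\<phi> v' = 0"
    proof (rule rref(7))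
      fix k r assume kr: "(k, r) \<in> set ?P"
      then have "k \<in> V" using rref(2,3)[OF kr] VV by blast
      then show "X k (\<phi> v') = 0" using v'(3)[OF kr] by (simp add: X_\<phi>)
    qed
    then have "coef v' k = 0" if "k \<in> V" for k using X_\<phi>[OF that, of v'] by simp
    then show "in_span rows v" using V by (auto simp: in_span_def v'_def list_all_iff)
  qed
qed

end

section \<open>Words and exponents\<close>

text \<open>The exponent of a word, which forgets the order of its letters.\<close>

definition exw :: "nat list \<Rightarrow> expo" where
  "exw w = sum_list (map (\<lambda>i. Poly_Mapping.single i 1) w)"

lemma exw_simps [simp]: "exw [] = 0" "exw (i # w) = Poly_Mapping.single i 1 + exw w"
  "exw (v @ w) = exw v + exw w"
  by (simp_all add: exw_def)

lemma lookup_exw: "lookup (exw w) i = count_list w i"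
  by (induction w) (auto simp: lookup_add lookup_single when_def)

lemma exw_in_expos [simp]: "exw w \<in> expos n \<longleftrightarrow> set w \<subseteq> {..<n}"
proof -
  have "keys (exw w) = set w"
    by (auto simp: in_keys_iff lookup_exw count_list_0_iff)
  then show ?thesis by (simp add: expos_def)
qed

lemma zero_in_expos [simp]: "0 \<in> expos n" by (simp add: expos_def)

lemma plus_in_expos [simp]: "\<alpha> + \<beta> \<in> expos n \<longleftrightarrow> \<alpha> \<in> expos n \<and> \<beta> \<in> expos n"
proof -
  have "keys (\<alpha> + \<beta>) = keys \<alpha> \<union> keys \<beta>"
    by (auto simp: in_keys_iff lookup_add)
  then show ?thesis by (simp add: expos_def)
qed

lemma set_std_word: "set (std_word n \<alpha>) \<subseteq> {..<n}"
  by (auto simp: std_word_def)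

lemma count_list_replicate': "count_list (replicate m x) y = (if x = y then m else 0)"
  by (induction m) auto

lemma count_std_word: "count_list (std_word n \<alpha>) i = (if i < n then lookup \<alpha> i else 0)"
proof (induction n)
  case 0 then show ?case by (simp add: std_word_def)
next
  case (Suc n)
  have "std_word (Suc n) \<alpha> = std_word n \<alpha> @ replicate (lookup \<alpha> n) n" by (simp add: std_word_def)
  then show ?case using Suc by (auto simp: count_list_replicate')
qed

lemma exw_std_word [simp]:
  assumes "\<alpha> \<in> expos n" shows "exw (std_word n \<alpha>) = \<alpha>"
proof (rule poly_mapping_eqI)
  fix i show "lookup (exw (std_word n \<alpha>)) i = lookup \<alpha> i"
    using assms by (auto simp: lookup_exw count_std_word expos_def in_keys_iff)
qed

lemma std_word_eq_iff:
  "\<alpha> \<in> expos n \<Longrightarrow> \<beta> \<in> expos n \<Longrightarrow> std_word n \<alpha> = std_word n \<beta> \<longleftrightarrow> \<alpha> = \<beta>"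
  by (metis exw_std_word)

lemma sorted_std_word: "sorted (std_word n \<alpha>)"
proof (induction n)
  case 0 then show ?case by (simp add: std_word_def)
next
  case (Suc n)
  have "std_word (Suc n) \<alpha> = std_word n \<alpha> @ replicate (lookup \<alpha> n) n" by (simp add: std_word_def)
  then show ?case using Suc set_std_word[of n \<alpha>] by (auto simp: sorted_append)
qed

text \<open>A sorted word is determined by the multiplicities of its letters.\<close>

lemma sorted_eq_std_word:
  assumes "sorted w" "set w \<subseteq> {..<n}"
  shows "w = std_word n (exw w)"
proof -
  have "count (mset w) i = count (mset (std_word n (exw w))) i" for i
    using assms(2) by (auto simp: count_mset_0_iff count_std_word lookup_exw count_list_0_iff count_mset)
  then have "mset w = mset (std_word n (exw w))" by (rule multiset_eqI)
  then show ?thesis using sorted_std_word assms(1) properties_for_sort by metis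
qed

text \<open>The divisibility order on the monomials of a free module.\<close>

definition mdvd :: "nat \<Rightarrow> expo \<times> 'e \<Rightarrow> expo \<times> 'e \<Rightarrow> bool" where
  "mdvd n \<mu> \<nu> \<longleftrightarrow> snd \<mu> = snd \<nu> \<and> (\<exists>\<gamma>\<in>expos n. fst \<nu> = fst \<mu> + \<gamma>)"

lemma mdvd_iff:
  assumes "fst \<nu> \<in> expos n"
  shows "mdvd n \<mu> \<nu> \<longleftrightarrow> snd \<mu> = snd \<nu> \<and> (\<forall>i. lookup (fst \<mu>) i \<le> lookup (fst \<nu>) i)"
proof
  assume "snd \<mu> = snd \<nu> \<and> (\<forall>i. lookup (fst \<mu>) i \<le> lookup (fst \<nu>) i)"
  then have "fst \<nu> = fst \<mu> + (fst \<nu> - fst \<mu>)"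
    by (intro poly_mapping_eqI) (simp add: lookup_add lookup_minus)
  then show "mdvd n \<mu> \<nu>" using assms plus_in_expos unfolding mdvd_def
    by (metis \<open>snd \<mu> = snd \<nu> \<and> _\<close>)
qed (auto simp: mdvd_def lookup_add)

text \<open>A sequence has a monotone subsequence, and a decreasing sequence of natural numbers is eventually constant.\<close>

lemma nat_seq_incseq_subseq:
  fixes g :: "nat \<Rightarrow> nat"
  shows "\<exists>s. strict_mono s \<and> incseq (g \<circ> s)"
proof -
  obtain s where s: "strict_mono s" "monoseq (\<lambda>k. g (s k))" using seq_monosub by blast
  show ?thesis
  proof (cases "incseq (\<lambda>k. g (s k))")
    case True then show ?thesis using s by (auto simp: comp_def)
  next
    case False
    then have dec: "decseq (\<lambda>k. g (s k))" using s by (auto simp: monoseq_iff)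
    obtain N where N: "\<And>k. g (s N) \<le> g (s k)"
      using ex_has_least_nat[of "\<lambda>_. True" 0 "\<lambda>k. g (s k)"] by blast
    have "g (s (k + N)) = g (s N)" for k
      using N[of "k + N"] decseqD[OF dec, of N "k + N"] by simp
    then have "incseq (g \<circ> (\<lambda>k. s (k + N)))" by (simp add: incseq_def)
    moreover have "strict_mono (\<lambda>k. s (k + N))" using s(1) by (simp add: strict_mono_def)
    ultimately show ?thesis by blast
  qed
qed

lemma dickson_subseq:
  fixes f :: "nat \<Rightarrow> expo"
  shows "\<exists>s. strict_mono s \<and> (\<forall>i<n. incseq (\<lambda>k. lookup (f (s k)) i))"
proof (induction n)
  case 0
  show ?case by (rule exI[of _ id]) (simp add: strict_mono_def)
next
  case (Suc n)
  then obtain s where s: "strict_mono s" "\<forall>i<n. incseq (\<lambda>k. lookup (f (s k)) i)" by blast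
  obtain r where r: "strict_mono r" "incseq ((\<lambda>k. lookup (f (s k)) n) \<circ> r)"
    using nat_seq_incseq_subseq by blast
  have "incseq (\<lambda>k. lookup (f ((s \<circ> r) k)) i)" if "i < Suc n" for i
  proof (cases "i = n")
    case True then show ?thesis using r(2) by (simp add: comp_def)
  next
    case False
    then have "incseq (\<lambda>k. lookup (f (s k)) i)" using s(2) that by simp
    then show ?thesis using r(1) unfolding incseq_def strict_mono_def comp_def
      by (meson monoD r(1) strict_mono_mono)
  qed
  moreover have "strict_mono (s \<circ> r)" using s(1) r(1) by (simp add: strict_mono_def)
  ultimately show ?case by blast
qed

text \<open>Dickson's lemma: some component \<open>e\<close> occurs infinitely often, and along a subsequence all exponents are
  increasing.\<close>

lemma dickson:
  fixes f :: "nat \<Rightarrow> expo \<times> 'e"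
  assumes "finite E" "\<And>k. f k \<in> expos n \<times> E"
  shows "\<exists>i j. i < j \<and> mdvd n (f i) (f j)"
proof -
  have "(snd \<circ> f) ` UNIV \<subseteq> E" using assms(2) by (auto simp: mem_Times_iff)
  then have "finite ((snd \<circ> f) ` UNIV)" using assms(1) finite_subset by blast
  then obtain e where inf: "infinite {k. snd (f k) = e}"
    using pigeonhole_infinite[of "UNIV :: nat set" "snd \<circ> f"] by auto
  obtain t :: "nat \<Rightarrow> nat" where "strict_mono t" "\<forall>k. t k \<in> {k. snd (f k) = e}"
    using infinite_enumerate[OF inf] by (elim exE conjE)
  then have t: "strict_mono t" "\<And>k. snd (f (t k)) = e" by simp_all
  obtain s where s: "strict_mono s" "\<forall>i<n. incseq (\<lambda>k. lookup ((fst \<circ> f \<circ> t) (s k)) i)"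
    using dickson_subseq by blast
  have "lookup (fst (f (t (s 0)))) i \<le> lookup (fst (f (t (s 1)))) i" for i
  proof (cases "i < n")
    case True
    then show ?thesis using s(2) incseqD[of _ 0 1] by fastforce
  next
    case False
    have "fst (f (t (s 0))) \<in> expos n" using assms(2) by (auto simp: mem_Times_iff)
    then have "i \<notin> keys (fst (f (t (s 0))))" using False by (auto simp: expos_def)
    then show ?thesis by (simp add: in_keys_iff)
  qed
  moreover have "fst (f (t (s 1))) \<in> expos n" using assms(2) by (auto simp: mem_Times_iff)
  ultimately have "mdvd n (f (t (s 0))) (f (t (s 1)))" by (simp add: mdvd_iff t)
  moreover have "t (s 0) < t (s 1)" using t(1) s(1) by (simp add: strict_mono_def)
  ultimately show ?thesis by blast
qed

section \<open>The free algebra\<close>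

lemma zero_nil: "(0 :: 'a list) = []" by (simp add: zero_list_def)
lemma plus_append: "(v :: 'a list) + w = v @ w" by (simp add: plus_list_def)

lemma single_nil_one: "Poly_Mapping.single [] 1 = 1" by (metis single_one zero_nil)

lemma falg_mult_simps:
  "word v * word w = word (v @ w)" "scalar a * word w = Poly_Mapping.single w a"
  "word w * scalar a = Poly_Mapping.single w a" "scalar a * scalar b = scalar (a * b)"
  "scalar 1 = 1" "scalar 0 = 0" "word [] = 1" "gen i = word [i]"
  by (simp_all add: word_def scalar_def gen_def mult_single plus_append single_nil_one)

lemma scalar_add: "scalar (a + b) = scalar a + scalar b"
  by (simp add: scalar_def single_add)

lemma scalar_uminus: "scalar (- a) = - scalar a"
  by (simp add: scalar_def single_uminus)

lemma lookup_scalar_mult [simp]: "lookup (scalar a * f) w = a * lookup f w"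
proof -
  have "scalar a * f = Poly_Mapping.map ((*) a) f"
    by (simp add: scalar_def mult_map_scale_conv_mult zero_nil)
  then show ?thesis by (simp add: Poly_Mapping.map.rep_eq when_def)
qed

lemma falg_expand: "f = (\<Sum>w\<in>keys f. scalar (lookup f w) * word w)"
proof (rule poly_mapping_eqI)
  fix v
  have "(\<Sum>w\<in>keys f. lookup f w * lookup (word w) v) = (\<Sum>w\<in>keys f. if w = v then lookup f v else 0)"
    by (intro sum.cong) (auto simp: word_def lookup_single when_def)
  then show "lookup f v = lookup (\<Sum>w\<in>keys f. scalar (lookup f w) * word w) v"
    by (simp add: lookup_sum sum.delta in_keys_iff)
qed

lemma scalar_commute: "f * scalar a = scalar a * f"
proof -
  have "f * scalar a = (\<Sum>w\<in>keys f. scalar (lookup f w) * (word w * scalar a))"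
    by (subst falg_expand[of f]) (simp add: sum_distrib_right mult.assoc)
  also have "\<dots> = (\<Sum>w\<in>keys f. scalar a * (scalar (lookup f w) * word w))"
    by (intro sum.cong) (simp_all add: falg_mult_simps scalar_def mult_single plus_append word_def mult.commute)
  also have "\<dots> = scalar a * f"
    by (subst sum_distrib_left[symmetric]) (simp flip: falg_expand)
  finally show ?thesis .
qed

lemma scalar_left_commute: "f * (scalar a * g) = scalar a * (f * g)"
  by (metis mult.assoc scalar_commute)

lemma carrier_free_algebra: "f \<in> carrier (free_algebra n) \<longleftrightarrow> (\<forall>w\<in>keys f. set w \<subseteq> {..<n})"
  by (simp add: free_algebra_def)

lemma free_algebra_simps [simp]:
  "monoid.mult (free_algebra n) = (*)" "one (free_algebra n) = 1" "zero (free_algebra n) = 0"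
  "add (free_algebra n) = (+)"
  by (simp_all add: free_algebra_def)

lemma carrier_zero [simp]: "0 \<in> carrier (free_algebra n)"
  and carrier_one [simp]: "1 \<in> carrier (free_algebra n)"
  and carrier_word [simp]: "word w \<in> carrier (free_algebra n) \<longleftrightarrow> set w \<subseteq> {..<n}"
  and carrier_scalar [simp]: "scalar a \<in> carrier (free_algebra n)"
  by (auto simp: carrier_free_algebra word_def scalar_def zero_nil)

lemma carrier_add [simp]: "f \<in> carrier (free_algebra n) \<Longrightarrow> g \<in> carrier (free_algebra n) \<Longrightarrow>
    f + g \<in> carrier (free_algebra n)"
  unfolding carrier_free_algebra using keys_add[of f g] by blast

lemma carrier_uminus [simp]: "f \<in> carrier (free_algebra n) \<Longrightarrow> - f \<in> carrier (free_algebra n)"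
  unfolding carrier_free_algebra by (auto simp: in_keys_iff)

lemma carrier_diff [simp]: "f \<in> carrier (free_algebra n) \<Longrightarrow> g \<in> carrier (free_algebra n) \<Longrightarrow>
    f - g \<in> carrier (free_algebra n)"
  using carrier_add[of f n "- g"] by simp

lemma carrier_mult [simp]: "f \<in> carrier (free_algebra n) \<Longrightarrow> g \<in> carrier (free_algebra n) \<Longrightarrow>
    f * g \<in> carrier (free_algebra n)"
  unfolding carrier_free_algebra using keys_mult[of f g] by (fastforce simp: plus_append)

lemma carrier_sum [simp]: "(\<And>i. i \<in> S \<Longrightarrow> f i \<in> carrier (free_algebra n)) \<Longrightarrow>
    sum f S \<in> carrier (free_algebra n)"
  by (induction S rule: infinite_finite_induct) auto

lemma ring_free_algebra: "ring (free_algebra n)"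
proof (rule ringI)
  show "abelian_group (free_algebra n)"
  proof (rule abelian_groupI)
    fix x assume "x \<in> carrier (free_algebra n)"
    then show "\<exists>y\<in>carrier (free_algebra n). y \<oplus>\<^bsub>free_algebra n\<^esub> x = \<zero>\<^bsub>free_algebra n\<^esub>"
      by (intro bexI[of _ "- x"]) auto
  qed (auto simp: ac_simps)
  show "monoid (free_algebra n)" by (rule monoidI) (auto simp: mult.assoc)
qed (auto simp: algebra_simps)

lemma a_inv_free_algebra: "x \<in> carrier (free_algebra n) \<Longrightarrow> \<ominus>\<^bsub>free_algebra n\<^esub> x = - x"
  using abelian_group.minus_equality[OF ring.is_abelian_group[OF ring_free_algebra], of n "- x" x]
  by simp

lemma std_polys_carrier: "f \<in> std_polys n \<Longrightarrow> f \<in> carrier (free_algebra n)"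
  unfolding std_polys_def carrier_free_algebra using set_std_word by fastforce

lemma comm_rel_carrier:
  "d i j \<in> std_polys n \<Longrightarrow> i < n \<Longrightarrow> j < n \<Longrightarrow> comm_rel c d i j \<in> carrier (free_algebra n)"
  by (auto simp: comm_rel_def falg_mult_simps(8) std_polys_carrier)

section \<open>Leading exponents\<close>

lemma lead_eq_SomeI:
  assumes "y \<in> Y" "\<And>z. z \<in> Y \<Longrightarrow> z = y \<or> prec z y" "irreflp_on K prec" "transp_on K prec" "Y \<subseteq> K"
  shows "lead prec Y = Some y"
proof -
  have "(THE y. y \<in> Y \<and> (\<forall>z\<in>Y. z = y \<or> prec z y)) = y"
  proof (rule the_equality)
    fix y' assume y': "y' \<in> Y \<and> (\<forall>z\<in>Y. z = y' \<or> prec z y')"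
    show "y' = y"
    proof (rule ccontr)
      assume "y' \<noteq> y"
      then have "prec y y'" "prec y' y" using assms(1) assms(2)[of y'] y' by auto
      moreover have "y \<in> K" "y' \<in> K" using assms(1,5) y' by blast+
      ultimately have "prec y y" using assms(4) unfolding transp_on_def by blast
      then show False using assms unfolding irreflp_on_def by blast
    qed
  qed (use assms in blast)
  then show ?thesis using assms(1) by (auto simp: lead_def)
qed

lemma lead_Some:
  assumes "finite Y" "Y \<noteq> {}" "irreflp_on K prec" "transp_on K prec" "totalp_on K prec" "Y \<subseteq> K"
  obtains y where "lead prec Y = Some y" "y \<in> Y" "\<And>z. z \<in> Y \<Longrightarrow> z = y \<or> prec z y"
proof -
  have "\<exists>y\<in>Y. \<forall>z\<in>Y. z = y \<or> prec z y"
    using assms(1,2,6)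
  proof (induction rule: finite_ne_induct)
    case (insert x Y)
    then obtain y where y: "y \<in> Y" "\<forall>z\<in>Y. z = y \<or> prec z y" by auto
    show ?case
    proof (cases "x = y \<or> prec x y")
      case True then show ?thesis using y by blast
    next
      case False
      then have "prec y x" using assms(5) insert.prems y(1) unfolding totalp_on_def by blast
      then have "\<forall>z\<in>Y. prec z x" using y insert.prems assms(4) unfolding transp_on_def
        by (metis insert_subset subsetD)
      then show ?thesis by blast
    qed
  qed simp
  then obtain y where "y \<in> Y" "\<And>z. z \<in> Y \<Longrightarrow> z = y \<or> prec z y" by blast
  then show ?thesis using that lead_eq_SomeI[OF _ _ assms(3,4,6)] by metis
qed

lemma finite_supp: "finite (supp n t)"
proof (rule finite_imageD)
  show "finite (std_word n ` supp n t)"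
    by (rule finite_subset[of _ "keys t"]) (auto simp: supp_def)
  show "inj_on (std_word n) (supp n t)"
    by (auto simp: inj_on_def supp_def std_word_eq_iff)
qed

lemma single_in_expos [simp]: "Poly_Mapping.single i (Suc 0) \<in> expos n \<longleftrightarrow> i < n"
  by (auto simp: expos_def)

section \<open>Vectors over the free algebra\<close>

text \<open>Representatives of elements of \<open>A\<^sup>E\<close> are functions on the whole type of indices that vanish outside
  \<open>E\<close>; in this way they live in one vector space and the library's theory of spans applies.\<close>

definition vscale :: "'k::field \<Rightarrow> ('e \<Rightarrow> 'k falg) \<Rightarrow> 'e \<Rightarrow> 'k falg" where
  "vscale a t = (\<lambda>e. scalar a * t e)"

definition emb :: "'e \<Rightarrow> ('k::field) falg \<Rightarrow> 'e \<Rightarrow> 'k falg" where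
  "emb e f = (\<lambda>e'. if e' = e then f else 0)"

definition lmul :: "('k::field) falg \<Rightarrow> ('e \<Rightarrow> 'k falg) \<Rightarrow> 'e \<Rightarrow> 'k falg" where
  "lmul f t = (\<lambda>e. f * t e)"

definition rmul :: "('e \<Rightarrow> ('k::field) falg) \<Rightarrow> 'k falg \<Rightarrow> 'e \<Rightarrow> 'k falg" where
  "rmul t f = (\<lambda>e. t e * f)"

global_interpretation fv: vector_space "vscale :: 'k::field \<Rightarrow> ('e \<Rightarrow> 'k falg) \<Rightarrow> 'e \<Rightarrow> 'k falg"
  by standard (auto simp: vscale_def fun_eq_iff algebra_simps scalar_add falg_mult_simps mult.assoc[symmetric])

lemma vscale_apply: "vscale a t e = scalar a * t e" by (simp add: vscale_def)
lemma emb_apply: "emb e f e' = (if e' = e then f else 0)" by (simp add: emb_def)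
lemma lmul_apply: "lmul f t e = f * t e" by (simp add: lmul_def)
lemma rmul_apply: "rmul t f e = t e * f" by (simp add: rmul_def)

lemmas vec_apply = vscale_apply emb_apply lmul_apply rmul_apply
  plus_fun_apply zero_fun_apply minus_apply uminus_apply

declare plus_fun_apply [simp del] zero_fun_apply [simp del] minus_apply [simp del] uminus_apply [simp del]

lemma lmul_linear: "lmul f (s + t) = lmul f s + lmul f t" "lmul f (vscale a t) = vscale a (lmul f t)"
    "lmul f (s - t) = lmul f s - lmul f t"
  and rmul_linear: "rmul (s + t) f = rmul s f + rmul t f" "rmul (vscale a t) f = vscale a (rmul t f)"
    "rmul (s - t) f = rmul s f - rmul t f"
  and emb_linear: "emb e (f + g) = emb e f + emb e g" "emb e (scalar a * f) = vscale a (emb e f)"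
    "emb e (f - g) = emb e f - emb e g" "emb e 0 = 0"
  by (auto simp: fun_eq_iff vec_apply algebra_simps mult.assoc scalar_left_commute)

lemma lmul_lmul: "lmul f (lmul g t) = lmul (f * g) t"
  and lmul_add: "lmul (f + g) t = lmul f t + lmul g t"
  and lmul_diff: "lmul (f - g) t = lmul f t - lmul g t"
  and lmul_scalar: "lmul (scalar a * f) t = vscale a (lmul f t)"
  and lmul_one: "lmul 1 t = t" and lmul_zero: "lmul 0 t = 0"
  and lmul_emb: "lmul f (emb e g) = emb e (f * g)"
  and rmul_emb: "rmul (emb e g) f = emb e (g * f)"
  and rmul_lmul: "rmul (lmul f t) g = lmul f (rmul t g)"
  and rmul_rmul: "rmul (rmul t f) g = rmul t (f * g)"
  and rmul_one: "rmul t 1 = t"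
  by (auto simp: fun_eq_iff vec_apply algebra_simps)

lemma sum_fun_apply: "sum f S e = (\<Sum>s\<in>S. f s e)" for f :: "'x \<Rightarrow> 'e \<Rightarrow> 'k::field falg"
  by (induction S rule: infinite_finite_induct) (auto simp: vec_apply)

lemma emb_sum: "emb e (sum f S) = (\<Sum>s\<in>S. emb e (f s))"
  by (induction S rule: infinite_finite_induct) (auto simp: emb_linear)

lemma lmul_sum: "lmul (sum f S) t = (\<Sum>s\<in>S. lmul (f s) t)"
  by (induction S rule: infinite_finite_induct) (simp_all add: lmul_add lmul_zero)

text \<open>Linear maps preserve membership in spans, in the form used for one-sided multiplications.\<close>

lemma fv_span_map:
  assumes "x \<in> fv.span B" "\<And>y. y \<in> B \<Longrightarrow> T y \<in> fv.span C"
    "\<And>x y. T (x + y) = T x + T y" "\<And>a x. T (vscale a x) = vscale a (T x)"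
  shows "T x \<in> fv.span C"
  using assms(1)
proof (induction rule: fv.span_induct_alt)
  case base
  have "T (vscale 0 0) = vscale 0 (T 0)" by (rule assms(4))
  then have "T 0 = 0" by (simp only: fv.scale_zero_left)
  then show ?case by (simp only: fv.span_zero)
next
  case (step a x y)
  then show ?case using assms(2)[of x] by (simp add: assms(3,4) fv.span_add fv.span_scale)
qed

section \<open>The order filtration\<close>

definition shift :: "nat list \<Rightarrow> expo \<times> 'e \<Rightarrow> expo \<times> 'e" where
  "shift w \<mu> = (fst \<mu> + exw w, snd \<mu>)"

lemma shift_simps [simp]: "shift [] \<mu> = \<mu>" "shift v (shift w \<mu>) = shift (v @ w) \<mu>"
  "snd (shift w \<mu>) = snd \<mu>"
  by (auto simp: shift_def ac_simps)

text \<open>Decreases when two adjacent letters in the wrong order are exchanged.\<close>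

fun inversion_weight :: "nat list \<Rightarrow> nat" where
  "inversion_weight [] = 0"
| "inversion_weight (x # xs) = x * length (x # xs) + inversion_weight xs"

lemma inversion_weight_swap:
  "i < j \<Longrightarrow> inversion_weight (m @ [i, j] @ m') < inversion_weight (m @ [j, i] @ m')"
  by (induction m) (auto simp: algebra_simps)

lemma not_sorted_inversion:
  "\<not> sorted w \<Longrightarrow> \<exists>m i j m'. w = m @ [j, i] @ m' \<and> (i :: nat) < j"
proof (induction w)
  case (Cons x w)
  show ?case
  proof (cases "sorted w")
    case True
    then obtain y u where "w = y # u" "y < x" using Cons.prems
      by (cases w) (fastforce simp: not_le)+
    then show ?thesis by (intro exI[of _ "[]"]) auto
  next
    case False
    then show ?thesis using Cons.IH by (metis append_Cons)
  qed
qed simp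

text \<open>\<open>J\<close> is the ideal of relations of \<open>A\<close>, which all data have in common. It is a parameter of its own
  because \<open>E\<close> may be empty.\<close>

locale pbw_data =
  fixes n :: nat and E :: "'e set"
    and c :: "'e \<Rightarrow> nat \<Rightarrow> nat \<Rightarrow> 'k::field" and d :: "'e \<Rightarrow> nat \<Rightarrow> nat \<Rightarrow> 'k falg"
    and I :: "'e \<Rightarrow> 'k falg set" and prec :: "expo \<times> 'e \<Rightarrow> expo \<times> 'e \<Rightarrow> bool"
    and J :: "'k falg set"
  assumes fin_E: "finite E" and ord: "module_monomial_ordering n E prec"
    and datum: "e \<in> E \<Longrightarrow> pbw_datum n (c e) (d e) (I e) (induced prec e)"
    and J_eq: "e \<in> E \<Longrightarrow> defining_ideal n (c e) (d e) (I e) = J"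
    and J_ideal: "ideal J (free_algebra n)"
begin

abbreviation "F \<equiv> carrier (free_algebra n) :: 'k falg set"
abbreviation "K \<equiv> expos n \<times> E"
abbreviation "letters w \<equiv> set w \<subseteq> {..<n}"

text \<open>\<open>monv \<mu>\<close> is the standard monomial \<open>\<mu>\<close> as a vector, \<open>JE\<close> the space of vectors that represent zero, and
  \<open>V P\<close> the space of vectors represented by combinations of the monomials in \<open>P\<close>.\<close>

definition "below \<mu> = {\<nu> \<in> K. prec \<nu> \<mu>}"
definition "beneath \<mu> = {\<nu> \<in> K. \<nu> = \<mu> \<or> prec \<nu> \<mu>}"
definition monv :: "expo \<times> 'e \<Rightarrow> 'e \<Rightarrow> 'k falg" where
  "monv \<mu> = emb (snd \<mu>) (word (std_word n (fst \<mu>)))"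
definition "JE = {t. (\<forall>e\<in>E. t e \<in> J) \<and> (\<forall>e. e \<notin> E \<longrightarrow> t e = 0)}"
definition "Vecs = {t. (\<forall>e\<in>E. t e \<in> F) \<and> (\<forall>e. e \<notin> E \<longrightarrow> t e = 0)}"
definition "V P = fv.span (JE \<union> monv ` P)"

lemma prec_irrefl: "\<mu> \<in> K \<Longrightarrow> \<not> prec \<mu> \<mu>"
  and prec_trans: "\<lbrakk>prec \<mu> \<nu>; prec \<nu> \<rho>; \<mu> \<in> K; \<nu> \<in> K; \<rho> \<in> K\<rbrakk> \<Longrightarrow> prec \<mu> \<rho>"
  and prec_total: "\<lbrakk>\<mu> \<in> K; \<nu> \<in> K; \<mu> \<noteq> \<nu>\<rbrakk> \<Longrightarrow> prec \<mu> \<nu> \<or> prec \<nu> \<mu>"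
  using ord unfolding module_monomial_ordering_def irreflp_on_def transp_on_def totalp_on_def
  by blast+

lemma shift_in_K [simp]: "letters w \<Longrightarrow> shift w \<mu> \<in> K \<longleftrightarrow> \<mu> \<in> K"
  by (cases \<mu>) (simp add: shift_def)

lemma shift_mono:
  assumes "prec \<mu> \<nu>" "\<mu> \<in> K" "\<nu> \<in> K" "letters w"
  shows "prec (shift w \<mu>) (shift w \<nu>)"
  using assms ord unfolding module_monomial_ordering_def shift_def
  by (cases \<mu>; cases \<nu>) (metis exw_in_expos fst_conv mem_Sigma_iff snd_conv)

lemma add_mono_prec:
  assumes "prec (\<alpha>, e) (\<beta>, e)" "\<alpha> \<in> expos n" "\<beta> \<in> expos n" "\<gamma> \<in> expos n" "e \<in> E"
  shows "prec (\<alpha> + \<gamma>, e) (\<beta> + \<gamma>, e)"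
  using assms ord unfolding module_monomial_ordering_def by blast

lemma mdvd_prec:
  assumes "mdvd n \<mu> \<nu>" "\<mu> \<in> K"
  shows "\<nu> = \<mu> \<or> prec \<mu> \<nu>"
proof -
  obtain \<gamma> e where \<gamma>: "\<gamma> \<in> expos n" "fst \<nu> = fst \<mu> + \<gamma>" "snd \<mu> = e" "snd \<nu> = e" "e \<in> E"
    using assms unfolding mdvd_def by (auto simp: mem_Times_iff)
  have "0 = \<gamma> \<or> prec (0, e) (\<gamma>, e)"
    using datum[OF \<gamma>(5)] \<gamma>(1) unfolding pbw_datum_def well_ordering_def induced_def by blast
  then show ?thesis
    using add_mono_prec[of 0 e \<gamma> "fst \<mu>"] \<gamma> assms(2)
    by (cases \<mu>; cases \<nu>) (auto simp: ac_simps)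
qed

lemma mdvd_shift: "letters w \<Longrightarrow> mdvd n \<mu> (shift w \<mu>)"
  by (auto simp: mdvd_def shift_def intro!: bexI[of _ "exw w"])

text \<open>By Dickson's lemma an infinite descending chain would contain a monomial that divides a later one, while
  divisors are not larger for a well-ordering.\<close>

lemma wf_prec: "wf {(\<mu>, \<nu>). \<mu> \<in> K \<and> \<nu> \<in> K \<and> prec \<mu> \<nu>}"
  unfolding wf_iff_no_infinite_down_chain
proof
  assume "\<exists>f. \<forall>i. (f (Suc i), f i) \<in> {(\<mu>, \<nu>). \<mu> \<in> K \<and> \<nu> \<in> K \<and> prec \<mu> \<nu>}"
  then obtain f where "\<forall>i. (f (Suc i), f i) \<in> {(\<mu>, \<nu>). \<mu> \<in> K \<and> \<nu> \<in> K \<and> prec \<mu> \<nu>}" by (rule exE)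
  then have "f i \<in> K \<and> prec (f (Suc i)) (f i)" for i by (drule_tac x = i in spec) simp
  then have f: "\<And>i. f i \<in> K" "\<And>i. prec (f (Suc i)) (f i)" by blast+
  have less: "prec (f j) (f i)" if "i < j" for i j
    using that
  proof (induction j)
    case (Suc j)
    then show ?case using f prec_trans less_Suc_eq by metis
  qed simp
  obtain i j where "i < j" "mdvd n (f i) (f j)" using dickson[OF fin_E f(1)] by blast
  then show False using mdvd_prec[of "f i" "f j"] less[of i j] f(1) prec_irrefl prec_trans by metis
qed

lemma prec_induct [consumes 1, case_names less]:
  assumes "\<mu> \<in> K" "\<And>\<mu>. \<mu> \<in> K \<Longrightarrow> (\<And>\<nu>. \<nu> \<in> K \<Longrightarrow> prec \<nu> \<mu> \<Longrightarrow> P \<nu>) \<Longrightarrow> P \<mu>"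
  shows "P \<mu>"
proof -
  have "\<mu> \<in> K \<longrightarrow> P \<mu>"
  proof (induction rule: wf_induct_rule[OF wf_prec])
    case (1 \<mu>)
    show ?case
    proof
      assume \<mu>: "\<mu> \<in> K"
      show "P \<mu>"
      proof (rule assms(2)[OF \<mu>])
        fix \<nu> assume "\<nu> \<in> K" "prec \<nu> \<mu>"
        then show "P \<nu>" using 1[of \<nu>] \<mu> by simp
      qed
    qed
  qed
  then show ?thesis using assms(1) by blast
qed

lemma below_subset: "below \<mu> \<subseteq> K" and beneath_subset: "beneath \<mu> \<subseteq> K"
  by (auto simp: below_def beneath_def)

lemma beneath_below: "prec \<mu> \<nu> \<Longrightarrow> \<mu> \<in> K \<Longrightarrow> \<nu> \<in> K \<Longrightarrow> beneath \<mu> \<subseteq> below \<nu>"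
  and below_beneath: "below \<mu> \<subseteq> beneath \<mu>"
  and below_mono: "prec \<mu> \<nu> \<Longrightarrow> \<mu> \<in> K \<Longrightarrow> \<nu> \<in> K \<Longrightarrow> below \<mu> \<subseteq> below \<nu>"
  by (auto simp: below_def beneath_def intro: prec_trans)

lemma beneath_eq: "\<mu> \<in> K \<Longrightarrow> beneath \<mu> = insert \<mu> (below \<mu>)"
  by (auto simp: below_def beneath_def)

interpretation J: ideal J "free_algebra n" by (rule J_ideal)

lemma J_carrier: "f \<in> J \<Longrightarrow> f \<in> F"
  using J.a_subset by (rule subsetD)

lemma J_closed: "0 \<in> J" "f \<in> J \<Longrightarrow> g \<in> J \<Longrightarrow> f + g \<in> J"
  "f \<in> J \<Longrightarrow> h \<in> F \<Longrightarrow> h * f \<in> J" "f \<in> J \<Longrightarrow> h \<in> F \<Longrightarrow> f * h \<in> J"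
  using additive_subgroup.zero_closed[OF J.additive_subgroup_axioms]
    additive_subgroup.a_closed[OF J.additive_subgroup_axioms, of f g]
    J.I_l_closed[of f h] J.I_r_closed[of f h] by simp_all

lemma J_uminus: "f \<in> J \<Longrightarrow> - f \<in> J"
  using additive_subgroup.a_inv_closed[OF J.additive_subgroup_axioms, of f] a_inv_free_algebra[of f n] J_carrier[of f] by simp

lemma J_diff: "f \<in> J \<Longrightarrow> g \<in> J \<Longrightarrow> f - g \<in> J"
  using J_closed(2)[of f "- g"] J_uminus[of g] by simp

lemma JE_subspace: "fv.subspace JE"
  by (auto simp: vec_apply fv.subspace_def JE_def J_closed)

lemma span_JE: "fv.span JE = JE" using JE_subspace by simp

lemma emb_JE: "e \<in> E \<Longrightarrow> f \<in> J \<Longrightarrow> emb e f \<in> JE"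
  by (auto simp: JE_def vec_apply J_closed)

lemma JE_lmul: "t \<in> JE \<Longrightarrow> f \<in> F \<Longrightarrow> lmul f t \<in> JE"
  and JE_rmul: "t \<in> JE \<Longrightarrow> f \<in> F \<Longrightarrow> rmul t f \<in> JE"
  by (auto simp: JE_def vec_apply J_closed)

lemma lmul_J: "t \<in> Vecs \<Longrightarrow> f \<in> J \<Longrightarrow> lmul f t \<in> JE"
  by (auto simp: JE_def Vecs_def vec_apply intro: J_closed(4))

lemma Vecs_subspace: "fv.subspace Vecs"
  by (auto simp: fv.subspace_def Vecs_def vec_apply)

lemma Vecs_lmul: "t \<in> Vecs \<Longrightarrow> f \<in> F \<Longrightarrow> lmul f t \<in> Vecs"
  and Vecs_rmul: "t \<in> Vecs \<Longrightarrow> f \<in> F \<Longrightarrow> rmul t f \<in> Vecs"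
  by (auto simp: Vecs_def vec_apply)

lemma JE_Vecs: "t \<in> JE \<Longrightarrow> t \<in> Vecs" by (auto simp: JE_def Vecs_def J_carrier)

lemma emb_Vecs: "e \<in> E \<Longrightarrow> f \<in> F \<Longrightarrow> emb e f \<in> Vecs" by (auto simp: Vecs_def vec_apply)

lemma V_mono: "P \<subseteq> Q \<Longrightarrow> V P \<subseteq> V Q"
  unfolding V_def by (intro fv.span_mono) auto

lemma JE_V: "t \<in> JE \<Longrightarrow> t \<in> V P" and monv_V: "\<mu> \<in> P \<Longrightarrow> monv \<mu> \<in> V P"
  unfolding V_def by (auto intro: fv.span_base)

lemma V_closed: "s \<in> V P \<Longrightarrow> t \<in> V P \<Longrightarrow> s + t \<in> V P" "s \<in> V P \<Longrightarrow> t \<in> V P \<Longrightarrow> s - t \<in> V P"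
  "t \<in> V P \<Longrightarrow> vscale a t \<in> V P" "0 \<in> V P" "(\<And>x. x \<in> S \<Longrightarrow> f x \<in> V P) \<Longrightarrow> sum f S \<in> V P"
  unfolding V_def by (auto intro: fv.span_add fv.span_diff fv.span_scale fv.span_zero fv.span_sum)

text \<open>\<open>has_lead t \<mu>\<close>: modulo \<open>J\<close> and smaller standard monomials, \<open>t\<close> is a nonzero multiple of the
  monomial \<open>\<mu>\<close>.\<close>

definition "has_lead t \<mu> \<longleftrightarrow> (\<exists>a. a \<noteq> 0 \<and> t - vscale a (monv \<mu>) \<in> V (below \<mu>))"

lemma has_lead_beneath:
  assumes "has_lead t \<mu>" "\<mu> \<in> K" shows "t \<in> V (beneath \<mu>)"
proof -
  obtain a where "t - vscale a (monv \<mu>) \<in> V (below \<mu>)" using assms unfolding has_lead_def by blast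
  then have "t - vscale a (monv \<mu>) \<in> V (beneath \<mu>)" using V_mono[OF below_beneath] by blast
  moreover have "vscale a (monv \<mu>) \<in> V (beneath \<mu>)"
    using assms(2) by (intro V_closed monv_V) (simp add: beneath_def)
  ultimately show ?thesis using V_closed(1) by fastforce
qed

lemma beneath_split:
  assumes "t \<in> V (beneath \<mu>)" "\<mu> \<in> K"
  obtains a where "t - vscale a (monv \<mu>) \<in> V (below \<mu>)"
proof -
  have "JE \<union> monv ` beneath \<mu> = insert (monv \<mu>) (JE \<union> monv ` below \<mu>)"
    using beneath_eq[OF assms(2)] by auto
  then show ?thesis using assms(1) that unfolding V_def by (auto simp: fv.span_breakdown_eq)
qed

lemma beneath_cases:
  assumes "t \<in> V (beneath \<mu>)" "\<mu> \<in> K"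
  shows "t \<in> V (below \<mu>) \<or> has_lead t \<mu>"
proof -
  obtain a where a: "t - vscale a (monv \<mu>) \<in> V (below \<mu>)" using beneath_split[OF assms] .
  show ?thesis
  proof (cases "a = 0")
    case True
    then show ?thesis using a by simp
  next
    case False
    then show ?thesis using a unfolding has_lead_def by blast
  qed
qed

lemma has_lead_scale: "has_lead t \<mu> \<Longrightarrow> b \<noteq> 0 \<Longrightarrow> has_lead (vscale b t) \<mu>"
proof -
  assume "has_lead t \<mu>" and b: "b \<noteq> 0"
  then obtain a where a: "a \<noteq> 0" "t - vscale a (monv \<mu>) \<in> V (below \<mu>)"
    unfolding has_lead_def by blast
  have "vscale b t - vscale (b * a) (monv \<mu>) = vscale b (t - vscale a (monv \<mu>))"
    by (simp add: fv.scale_right_diff_distrib)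
  then have "vscale b t - vscale (b * a) (monv \<mu>) \<in> V (below \<mu>)" using V_closed(3)[OF a(2)] by simp
  then show ?thesis using a(1) b unfolding has_lead_def by (intro exI[of _ "b * a"]) simp
qed

lemma has_lead_perturb:
  assumes "has_lead t \<mu>" "s - t \<in> V (below \<mu>)" shows "has_lead s \<mu>"
proof -
  obtain a where a: "a \<noteq> 0" "t - vscale a (monv \<mu>) \<in> V (below \<mu>)"
    using assms(1) unfolding has_lead_def by blast
  have "s - vscale a (monv \<mu>) = (s - t) + (t - vscale a (monv \<mu>))" by simp
  then have "s - vscale a (monv \<mu>) \<in> V (below \<mu>)" using V_closed(1)[OF assms(2) a(2)] by simp
  then show ?thesis using a(1) unfolding has_lead_def by blast
qed

lemma has_lead_cancel:
  assumes "has_lead s \<mu>" "t \<in> V (beneath \<mu>)" "\<mu> \<in> K"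
  obtains b where "t - vscale b s \<in> V (below \<mu>)"
proof -
  obtain a where a: "a \<noteq> 0" "s - vscale a (monv \<mu>) \<in> V (below \<mu>)"
    using assms(1) unfolding has_lead_def by blast
  obtain a' where a': "t - vscale a' (monv \<mu>) \<in> V (below \<mu>)" using beneath_split[OF assms(2,3)] .
  have "t - vscale (a' / a) s = (t - vscale a' (monv \<mu>)) - vscale (a' / a) (s - vscale a (monv \<mu>))"
    using a(1) by (simp add: fv.scale_right_diff_distrib)
  then show ?thesis using that V_closed(2)[OF a' V_closed(3)[OF a(2)]] by metis
qed

lemma le_supp_prec:
  assumes "e \<in> E" "le n (induced prec e) f = Some \<alpha>" "\<delta> \<in> supp n f"
  shows "\<delta> = \<alpha> \<or> prec (\<delta>, e) (\<alpha>, e)" "\<alpha> \<in> supp n f"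
proof -
  have i: "irreflp_on (expos n) (induced prec e)" "transp_on (expos n) (induced prec e)"
    "totalp_on (expos n) (induced prec e)"
    using datum[OF assms(1)]
    unfolding pbw_datum_def commutation_system_def monomial_ordering_def by blast+
  have s: "supp n f \<subseteq> expos n" by (auto simp: supp_def)
  obtain y where "lead (induced prec e) (supp n f) = Some y" "y \<in> supp n f"
    "\<And>z. z \<in> supp n f \<Longrightarrow> z = y \<or> induced prec e z y"
    using lead_Some[OF finite_supp _ i s] assms(3) by blast
  then show "\<delta> = \<alpha> \<or> prec (\<delta>, e) (\<alpha>, e)" "\<alpha> \<in> supp n f"
    using assms unfolding le_def induced_def by auto
qed

lemma commutation:
  assumes "e \<in> E" "i < j" "j < n"
  shows "c e i j \<noteq> 0" "d e i j \<in> std_polys n" "comm_rel (c e) (d e) i j \<in> J"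
    "u \<in> keys (d e i j) \<Longrightarrow> prec (exw u, e) (exw [i, j], e)"
proof -
  have cs: "commutation_system n (c e) (d e) (induced prec e)"
    and I: "I e \<subseteq> std_polys n"
    using datum[OF assms(1)] by (auto simp: pbw_datum_def)
  from cs have cs': "c e i j \<noteq> 0" "d e i j \<in> std_polys n" "d e i j = 0 \<or>
      (\<exists>\<alpha>. le n (induced prec e) (d e i j) = Some \<alpha> \<and>
         induced prec e \<alpha> (Poly_Mapping.single i 1 + Poly_Mapping.single j 1))"
    using assms(2,3) unfolding commutation_system_def by blast+
  then show "c e i j \<noteq> 0" "d e i j \<in> std_polys n" by auto
  have "comm_rels n (c e) (d e) \<subseteq> F"
    using cs unfolding commutation_system_def comm_rels_def by (auto intro!: comm_rel_carrier)
  moreover have "I e \<subseteq> F" using I std_polys_carrier by blast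
  ultimately have "I e \<union> comm_rels n (c e) (d e) \<subseteq> Idl\<^bsub>free_algebra n\<^esub> (I e \<union> comm_rels n (c e) (d e))"
    by (intro ring.genideal_self ring_free_algebra) auto
  then show "comm_rel (c e) (d e) i j \<in> J"
    using J_eq[OF assms(1)] assms(2,3) unfolding defining_ideal_def comm_rels_def by blast
  assume u: "u \<in> keys (d e i j)"
  then obtain \<alpha> where \<alpha>: "le n (induced prec e) (d e i j) = Some \<alpha>"
      "prec (\<alpha>, e) (exw [i, j], e)"
    using cs'(3) by (auto simp: induced_def)
  obtain \<delta> where \<delta>: "\<delta> \<in> expos n" "u = std_word n \<delta>" using u cs'(2) by (auto simp: std_polys_def)
  then have "\<delta> \<in> supp n (d e i j)" using u by (auto simp: supp_def)
  note le_supp_prec[OF assms(1) \<alpha>(1) this]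
  moreover have "\<alpha> \<in> expos n" using calculation(2) by (auto simp: supp_def)
  ultimately show "prec (exw u, e) (exw [i, j], e)"
    using \<alpha>(2) \<delta> prec_trans[of "(\<delta>, e)" "(\<alpha>, e)" "(exw [i, j], e)"] assms by auto
qed

text \<open>The induction is on the exponent and then on the inversions of the word. A replacement keeps the exponent and
  removes inversions in its first summand, \<open>c\<^sub>i\<^sub>j\<close> being nonzero; the terms coming from \<open>d\<^sub>i\<^sub>j\<close> have
  smaller exponents.\<close>

lemma word_has_lead:
  assumes "e \<in> E" "letters w"
  shows "has_lead (emb e (word w)) (exw w, e)"
proof -
  have "\<forall>w. letters w \<longrightarrow> (exw w, e) = \<mu> \<longrightarrow> has_lead (emb e (word w)) \<mu>" if "\<mu> \<in> K" for \<mu>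
    using that
  proof (induction rule: prec_induct)
    case (less \<mu>)
    have "letters w \<longrightarrow> (exw w, e) = \<mu> \<longrightarrow> has_lead (emb e (word w)) \<mu>" for w
    proof (induction "inversion_weight w" arbitrary: w rule: less_induct)
      case (less w)
      show ?case
      proof (intro impI)
        assume w: "letters w" "(exw w, e) = \<mu>"
        show "has_lead (emb e (word w)) \<mu>"
        proof (cases "sorted w")
          case True
          then have "emb e (word w) = monv \<mu>"
            using sorted_eq_std_word[OF True w(1)] w(2) by (auto simp: monv_def)
          then show ?thesis unfolding has_lead_def
            by (intro exI[of _ 1]) (simp add: V_closed(4))
        next
          case False
          then obtain m i j m' where mm: "w = m @ [j, i] @ m'" "i < j"
            using not_sorted_inversion by blast
          let ?v = "m @ [i, j] @ m'"
          have l: "letters m" "letters m'" "j < n" "letters ?v" using w mm by auto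
          note com = commutation[OF assms(1) mm(2) l(3)]
          have "exw ?v = exw w" using mm by (simp add: ac_simps)
          then have v: "has_lead (emb e (word ?v)) \<mu>"
            using less.hyps[of ?v] inversion_weight_swap[OF mm(2)] mm(1) l(4) w(2) by simp
          have rel: "word w = scalar (c e i j) * word ?v + word m * d e i j * word m'
              + word m * comm_rel (c e) (d e) i j * word m'"
            unfolding mm(1) comm_rel_def
            by (simp add: algebra_simps falg_mult_simps(8))
              (simp add: mult.assoc scalar_left_commute falg_mult_simps(1))
          have "word m * d e i j * word m'
              = (\<Sum>u\<in>keys (d e i j). scalar (lookup (d e i j) u) * word (m @ u @ m'))"
            by (subst falg_expand[of "d e i j"])
              (simp add: sum_distrib_left sum_distrib_right mult.assoc scalar_left_commute falg_mult_simps(1))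
          then have "emb e (word m * d e i j * word m')
              = (\<Sum>u\<in>keys (d e i j). vscale (lookup (d e i j) u) (emb e (word (m @ u @ m'))))"
            by (simp add: emb_sum emb_linear)
          also have "\<dots> \<in> V (below \<mu>)"
          proof (intro V_closed)
            fix u assume u: "u \<in> keys (d e i j)"
            let ?u = "m @ u @ m'"
            have lu: "letters u" using u std_polys_carrier[OF com(2)] by (auto simp: carrier_free_algebra)
            have "prec (shift (m @ m') (exw u, e)) (shift (m @ m') (exw [i, j], e))"
              by (rule shift_mono[OF com(4)[OF u]]) (use lu l mm assms(1) in auto)
            then have p: "prec (exw ?u, e) \<mu>"
              unfolding w(2)[symmetric] mm(1) by (simp add: shift_def ac_simps)
            have K: "(exw ?u, e) \<in> K" using lu l assms(1) by simp
            have "has_lead (emb e (word ?u)) (exw ?u, e)"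
              using \<open>\<And>\<nu>. \<lbrakk>\<nu> \<in> K; prec \<nu> \<mu>\<rbrakk> \<Longrightarrow> _\<close>[OF K p] lu l by simp
            then have "emb e (word ?u) \<in> V (beneath (exw ?u, e))" using has_lead_beneath K by blast
            then show "emb e (word ?u) \<in> V (below \<mu>)"
              using V_mono[OF beneath_below[OF p K \<open>\<mu> \<in> K\<close>]] by blast
          qed
          finally have dpart: "emb e (word m * d e i j * word m') \<in> V (below \<mu>)" .
          have "word m * comm_rel (c e) (d e) i j * word m' \<in> J"
            using com(3) l by (intro J_closed) auto
          then have jpart: "emb e (word m * comm_rel (c e) (d e) i j * word m') \<in> V (below \<mu>)"
            by (intro JE_V emb_JE assms(1))
          have "emb e (word w) - vscale (c e i j) (emb e (word ?v)) \<in> V (below \<mu>)"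
            using V_closed(1)[OF dpart jpart] unfolding rel by (simp add: emb_linear)
          then show ?thesis
            by (rule has_lead_perturb[OF has_lead_scale[OF v com(1)]])
        qed
      qed
    qed
    then show ?case by blast
  qed
  then show ?thesis using assms by simp
qed

end

context pbw_data
begin

section \<open>Normal forms\<close>

text \<open>\<open>Ld\<close> collects the monomials divisible by leading monomials of the sets \<open>I e\<close>; \<open>stdv P\<close> consists of the
  vectors that are, literally and not only modulo \<open>J\<close>, combinations of the standard monomials in \<open>P\<close>.\<close>

definition "Ld = {\<mu> \<in> K. fst \<mu> \<in> Lexps n (induced prec (snd \<mu>)) (I (snd \<mu>))}"

definition stdv :: "(expo \<times> 'e) set \<Rightarrow> ('e \<Rightarrow> 'k falg) set" where
  "stdv P = {s. \<forall>e w. lookup (s e) w \<noteq> 0 \<longrightarrow> (\<exists>\<alpha>. (\<alpha>, e) \<in> P \<and> w = std_word n \<alpha>)}"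

lemma Lexps_eq: "e \<in> E \<Longrightarrow> Lexps n (induced prec e) (I e) = lexps n (induced prec e) (J \<inter> std_polys n)"
  using datum[of e] J_eq[of e] unfolding pbw_datum_def by metis

lemma vec_expand:
  assumes "\<And>e. e \<notin> E \<Longrightarrow> t e = 0"
  shows "t = (\<Sum>e\<in>E. emb e (t e))"
proof
  fix e
  have "(\<Sum>e'\<in>E. emb e' (t e') e) = (\<Sum>e'\<in>E. if e' = e then t e else 0)"
    by (intro sum.cong) (auto simp: emb_def)
  then show "t e = (\<Sum>e\<in>E. emb e (t e)) e"
    using assms fin_E by (simp add: sum_fun_apply sum.delta)
qed

lemma emb_expand: "emb e f = (\<Sum>w\<in>keys f. vscale (lookup f w) (emb e (word w)))"
  by (subst falg_expand[of f]) (simp add: emb_sum emb_linear)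

lemma vec_expand2:
  assumes "\<And>e. e \<notin> E \<Longrightarrow> t e = 0"
  shows "t = (\<Sum>e\<in>E. \<Sum>w\<in>keys (t e). vscale (lookup (t e) w) (emb e (word w)))"
  by (subst vec_expand[OF assms], assumption) (rule sum.cong[OF refl emb_expand])

lemma lmul_expand: "lmul f t = (\<Sum>w\<in>keys f. vscale (lookup f w) (lmul (word w) t))"
  by (subst falg_expand[of f]) (simp add: lmul_sum lmul_scalar)

lemma stdv_subspace: "fv.subspace (stdv P)"
  unfolding fv.subspace_def
proof (intro conjI ballI allI)
  show "0 \<in> stdv P" by (simp add: stdv_def vec_apply)
  show "x + y \<in> stdv P" if "x \<in> stdv P" "y \<in> stdv P" for x y
  proof -
    have "lookup (x e) w \<noteq> 0 \<or> lookup (y e) w \<noteq> 0" if "lookup ((x + y) e) w \<noteq> 0" for e w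
      using that by (auto simp: vec_apply lookup_add)
    then show ?thesis using that unfolding stdv_def by blast
  qed
  show "vscale a x \<in> stdv P" if "x \<in> stdv P" for a x
    using that by (auto simp: stdv_def vec_apply)
qed

lemma stdv_span:
  assumes "P \<subseteq> K" shows "fv.span (monv ` P) = stdv P"
proof
  have "monv \<mu> \<in> stdv P" if "\<mu> \<in> P" for \<mu>
    using that by (cases \<mu>) (auto simp: stdv_def monv_def vec_apply word_def lookup_single when_def split: if_splits)
  then show "fv.span (monv ` P) \<subseteq> stdv P" by (intro fv.span_minimal stdv_subspace) auto
  show "stdv P \<subseteq> fv.span (monv ` P)"
  proof
    fix s assume s: "s \<in> stdv P"
    have "s e = 0" if "e \<notin> E" for e
    proof (rule poly_mapping_eqI)
      show "lookup (s e) w = lookup 0 w" for w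
        using s that assms unfolding stdv_def by auto
    qed
    then have "s = (\<Sum>e\<in>E. \<Sum>w\<in>keys (s e). vscale (lookup (s e) w) (emb e (word w)))"
      using vec_expand2[of s] by simp
    also have "\<dots> \<in> fv.span (monv ` P)"
    proof (intro fv.span_sum fv.span_scale)
      fix e w assume "w \<in> keys (s e)"
      then obtain \<alpha> where "(\<alpha>, e) \<in> P" "w = std_word n \<alpha>"
        using s unfolding stdv_def by (auto simp: in_keys_iff)
      then have "emb e (word w) = monv (\<alpha>, e)" by (simp add: monv_def)
      then show "emb e (word w) \<in> fv.span (monv ` P)" using \<open>(\<alpha>, e) \<in> P\<close>
        by (auto intro: fv.span_base)
    qed
    finally show "s \<in> fv.span (monv ` P)" .
  qed
qed

lemma V_iff: "P \<subseteq> K \<Longrightarrow> t \<in> V P \<longleftrightarrow> (\<exists>s\<in>stdv P. t - s \<in> JE)"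
proof -
  assume P: "P \<subseteq> K"
  have "V P = {x + y | x y. x \<in> JE \<and> y \<in> stdv P}"
    unfolding V_def fv.span_Un span_JE stdv_span[OF P] ..
  moreover have "(\<exists>x y. t = x + y \<and> x \<in> JE \<and> y \<in> stdv P) \<longleftrightarrow> (\<exists>s\<in>stdv P. t - s \<in> JE)"
    by (metis add_diff_cancel_right' diff_add_cancel)
  ultimately show ?thesis by auto
qed

lemma stdv_mono: "P \<subseteq> Q \<Longrightarrow> stdv P \<subseteq> stdv Q"
  unfolding stdv_def by blast

lemma stdv_supp: "s \<in> stdv P \<Longrightarrow> P \<subseteq> K \<Longrightarrow> \<alpha> \<in> supp n (s e) \<Longrightarrow> (\<alpha>, e) \<in> P"
  unfolding stdv_def supp_def by (auto simp: in_keys_iff) (metis SigmaD1 exw_std_word subsetD)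

lemma stdv_std_polys: "s \<in> stdv P \<Longrightarrow> P \<subseteq> K \<Longrightarrow> s e \<in> std_polys n"
  unfolding stdv_def std_polys_def by (force simp: in_keys_iff)

lemma std_poly_zero: "f \<in> std_polys n \<Longrightarrow> supp n f = {} \<Longrightarrow> f = 0"
  by (rule poly_mapping_eqI) (auto simp: supp_def std_polys_def in_keys_iff)

lemma induced_order:
  "e \<in> E \<Longrightarrow> irreflp_on (expos n) (induced prec e)" "e \<in> E \<Longrightarrow> transp_on (expos n) (induced prec e)"
  "e \<in> E \<Longrightarrow> totalp_on (expos n) (induced prec e)"
  using datum[of e] unfolding pbw_datum_def commutation_system_def monomial_ordering_def by blast+

lemma supp_expos: "supp n f \<subseteq> expos n" by (auto simp: supp_def)

lemma lexps_supp:
  assumes "e \<in> E" "\<alpha> \<in> lexps n (induced prec e) Fs"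
  obtains f where "f \<in> Fs" "\<alpha> \<in> supp n f" "\<And>\<delta>. \<delta> \<in> supp n f \<Longrightarrow> \<delta> = \<alpha> \<or> prec (\<delta>, e) (\<alpha>, e)"
proof -
  obtain f where f: "f \<in> Fs" "le n (induced prec e) f = Some \<alpha>"
    using assms(2) by (auto simp: lexps_def)
  then have "supp n f \<noteq> {}" by (auto simp: le_def lead_def split: if_splits)
  then show ?thesis using that le_supp_prec[OF assms(1) f(2)] f(1) by blast
qed

lemma lexpsI:
  assumes "e \<in> E" "f \<in> Fs" "\<alpha> \<in> supp n f" "\<And>\<delta>. \<delta> \<in> supp n f \<Longrightarrow> \<delta> = \<alpha> \<or> prec (\<delta>, e) (\<alpha>, e)"
  shows "\<alpha> \<in> lexps n (induced prec e) Fs"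
proof -
  have "le n (induced prec e) f = Some \<alpha>" unfolding le_def
    by (rule lead_eq_SomeI[OF assms(3) _ induced_order(1,2)[OF assms(1)] supp_expos])
      (use assms(4) in \<open>auto simp: induced_def\<close>)
  moreover have "f \<noteq> 0" using assms(3) by (auto simp: supp_def)
  ultimately show ?thesis using assms(2) by (auto simp: lexps_def)
qed

text \<open>By the hypothesis on \<open>L(I)\<close>, \<open>Ld\<close> consists of the leading monomials of the standard polynomials in \<open>J\<close>. Such a
  polynomial expresses its leading monomial by smaller ones modulo \<open>J\<close>, and conversely.\<close>

lemma Ld_iff:
  assumes "\<mu> \<in> K" shows "\<mu> \<in> Ld \<longleftrightarrow> monv \<mu> \<in> V (below \<mu>)"
proof -
  obtain \<alpha> e where \<mu>: "\<mu> = (\<alpha>, e)" "\<alpha> \<in> expos n" "e \<in> E" using assms by (cases \<mu>) auto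
  have eq: "\<mu> \<in> Ld \<longleftrightarrow> \<alpha> \<in> lexps n (induced prec e) (J \<inter> std_polys n)"
    using assms \<mu> by (simp add: Ld_def Lexps_eq)
  show ?thesis unfolding eq
  proof
    assume "\<alpha> \<in> lexps n (induced prec e) (J \<inter> std_polys n)"
    then obtain f where f: "f \<in> J \<inter> std_polys n" "\<alpha> \<in> supp n f"
        "\<And>\<delta>. \<delta> \<in> supp n f \<Longrightarrow> \<delta> = \<alpha> \<or> prec (\<delta>, e) (\<alpha>, e)"
      using lexps_supp[OF \<mu>(3)] by blast
    let ?a = "lookup f (std_word n \<alpha>)"
    define s where "s = vscale ?a (monv \<mu>) - emb e f"
    have a: "?a \<noteq> 0" using f(2) by (auto simp: supp_def in_keys_iff)
    have "s \<in> stdv (below \<mu>)" unfolding stdv_def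
    proof (intro CollectI allI impI)
      fix e' w assume nz: "lookup (s e') w \<noteq> 0"
      then have e': "e' = e" by (auto simp: s_def monv_def \<mu> vec_apply split: if_splits)
      then have l: "lookup (s e') w = (if w = std_word n \<alpha> then 0 else - lookup f w)"
        by (auto simp: s_def monv_def \<mu> vec_apply lookup_minus word_def lookup_single when_def)
      then have w: "w \<in> keys f" "w \<noteq> std_word n \<alpha>" using nz by (auto simp: in_keys_iff split: if_splits)
      then obtain \<delta> where \<delta>: "\<delta> \<in> expos n" "w = std_word n \<delta>" using f(1) by (auto simp: std_polys_def)
      then have "\<delta> \<in> supp n f" "\<delta> \<noteq> \<alpha>" using w by (auto simp: supp_def)
      then have "(\<delta>, e) \<in> below \<mu>" using f(3) \<mu> \<delta> by (auto simp: below_def)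
      then show "\<exists>\<alpha>. (\<alpha>, e') \<in> below \<mu> \<and> w = std_word n \<alpha>" using \<delta> e' by blast
    qed
    moreover have "vscale ?a (monv \<mu>) - s \<in> JE" using f(1) \<mu> by (auto simp: s_def intro: emb_JE)
    ultimately have "vscale ?a (monv \<mu>) \<in> V (below \<mu>)" using V_iff[OF below_subset] by blast
    from V_closed(3)[OF this, of "inverse ?a"] show "monv \<mu> \<in> V (below \<mu>)" using a by simp
  next
    assume "monv \<mu> \<in> V (below \<mu>)"
    then obtain s where s: "s \<in> stdv (below \<mu>)" "monv \<mu> - s \<in> JE" using V_iff[OF below_subset] by blast
    have sa: "lookup (s e) (std_word n \<alpha>) = 0"
    proof (rule ccontr)
      assume "lookup (s e) (std_word n \<alpha>) \<noteq> 0"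
      then have "\<alpha> \<in> supp n (s e)" using \<mu> by (auto simp: supp_def in_keys_iff)
      then have "(\<alpha>, e) \<in> below \<mu>" by (rule stdv_supp[OF s(1) below_subset])
      then show False using prec_irrefl assms \<mu> by (auto simp: below_def)
    qed
    let ?f = "word (std_word n \<alpha>) - s e"
    have "?f \<in> J" using s(2) \<mu> by (auto simp: JE_def monv_def vec_apply)
    moreover have keys: "keys ?f \<subseteq> insert (std_word n \<alpha>) (keys (s e))"
      by (auto simp: in_keys_iff lookup_minus word_def lookup_single when_def split: if_splits)
    then have "?f \<in> std_polys n"
      using stdv_std_polys[OF s(1) below_subset, of e] \<mu> by (auto simp: std_polys_def)
    ultimately have 1: "?f \<in> J \<inter> std_polys n" by blast
    have 2: "\<alpha> \<in> supp n ?f" using \<mu> sa by (auto simp: supp_def in_keys_iff lookup_minus word_def)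
    have 3: "\<delta> = \<alpha> \<or> prec (\<delta>, e) (\<alpha>, e)" if "\<delta> \<in> supp n ?f" for \<delta>
    proof -
      have "\<delta> = \<alpha> \<or> \<delta> \<in> supp n (s e)" using that keys \<mu> by (auto simp: supp_def std_word_eq_iff)
      then show ?thesis using stdv_supp[OF s(1) below_subset] \<mu> by (auto simp: below_def)
    qed
    show "\<alpha> \<in> lexps n (induced prec e) (J \<inter> std_polys n)" by (rule lexpsI[OF \<mu>(3) 1 2 3])
  qed
qed

text \<open>A leading monomial that cancels modulo smaller ones is itself congruent to a combination of smaller ones.\<close>

lemma has_lead_Ld:
  assumes "has_lead t \<mu>" "t \<in> V (below \<mu>)" "\<mu> \<in> K" shows "\<mu> \<in> Ld"
proof -
  obtain a where a: "a \<noteq> 0" "t - vscale a (monv \<mu>) \<in> V (below \<mu>)" using assms(1) unfolding has_lead_def by blast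
  have "vscale a (monv \<mu>) \<in> V (below \<mu>)" using V_closed(2)[OF assms(2) a(2)] by simp
  from V_closed(3)[OF this, of "inverse a"] show ?thesis using a(1) Ld_iff[OF assms(3)] by simp
qed

lemma has_lead_prec:
  assumes "has_lead x \<rho>" "\<rho> \<in> K" "\<rho> \<notin> Ld" "x \<in> V (below \<nu>)" "\<nu> \<in> K" shows "prec \<rho> \<nu>"
proof (rule ccontr)
  assume "\<not> prec \<rho> \<nu>"
  then have "below \<nu> \<subseteq> below \<rho>" using prec_total[OF assms(2,5)] below_mono assms(2,5) by blast
  then have "x \<in> V (below \<rho>)" using V_mono assms(4) by blast
  then show False using has_lead_Ld[OF assms(1) _ assms(2)] assms(3) by blast
qed

lemma V_subset:
  assumes "\<And>\<mu>. \<mu> \<in> P \<Longrightarrow> monv \<mu> \<in> V Q" shows "V P \<subseteq> V Q"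
  unfolding V_def[of P] by (rule fv.span_minimal) (use assms JE_V in \<open>auto simp: V_def\<close>)

text \<open>Monomials in \<open>Ld\<close> are replaced by smaller ones; well-foundedness makes this end.\<close>

lemma V_normal:
  assumes "P \<subseteq> K" "\<And>\<mu>. \<mu> \<in> P \<Longrightarrow> below \<mu> \<subseteq> P"
  shows "V P = V (P - Ld)"
proof
  have "\<mu> \<in> P \<longrightarrow> monv \<mu> \<in> V (P - Ld)" if "\<mu> \<in> K" for \<mu>
    using that
  proof (induction rule: prec_induct)
    case (less \<mu>)
    show ?case
    proof
      assume P: "\<mu> \<in> P"
      show "monv \<mu> \<in> V (P - Ld)"
      proof (cases "\<mu> \<in> Ld")
        case True
        have "V (below \<mu>) \<subseteq> V (P - Ld)"
          by (rule V_subset) (use less(2) assms(2)[OF P] in \<open>auto simp: below_def\<close>)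
        then show ?thesis using True Ld_iff[OF less(1)] by blast
      qed (use P in \<open>auto intro: monv_V\<close>)
    qed
  qed
  then show "V P \<subseteq> V (P - Ld)" using assms(1) by (intro V_subset) auto
  show "V (P - Ld) \<subseteq> V P" by (rule V_mono) auto
qed

lemma stdv_lead:
  assumes "r \<in> stdv P" "P \<subseteq> K" "r \<noteq> 0"
  obtains \<mu> where "\<mu> \<in> P" "fst \<mu> \<in> supp n (r (snd \<mu>))"
    "\<And>\<alpha> e. \<alpha> \<in> supp n (r e) \<Longrightarrow> (\<alpha>, e) = \<mu> \<or> prec (\<alpha>, e) \<mu>"
proof -
  let ?Y = "{(\<alpha>, e). \<alpha> \<in> supp n (r e) \<and> e \<in> E}"
  have "finite (\<Union>e\<in>E. (\<lambda>\<alpha>. (\<alpha>, e)) ` supp n (r e))" using fin_E finite_supp by auto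
  then have fin: "finite ?Y" by (rule finite_subset[rotated]) auto
  obtain e where "r e \<noteq> 0" using assms(3) by (auto simp: fun_eq_iff vec_apply)
  then obtain \<alpha> where "\<alpha> \<in> supp n (r e)" using std_poly_zero stdv_std_polys[OF assms(1,2)] by blast
  moreover have "e \<in> E" using stdv_supp[OF assms(1,2) calculation] assms(2) by auto
  ultimately have ne: "?Y \<noteq> {}" by blast
  obtain \<mu> where \<mu>: "\<mu> \<in> ?Y" "\<And>\<nu>. \<nu> \<in> ?Y \<Longrightarrow> \<nu> = \<mu> \<or> prec \<nu> \<mu>"
    by (rule lead_Some[OF fin ne, of K prec])
      (use ord supp_expos in \<open>auto simp: module_monomial_ordering_def\<close>)
  have "(\<alpha>, e) = \<mu> \<or> prec (\<alpha>, e) \<mu>" if "\<alpha> \<in> supp n (r e)" for \<alpha> e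
    using \<mu>(2)[of "(\<alpha>, e)"] that stdv_supp[OF assms(1,2) that] assms(2) by auto
  moreover have "\<mu> \<in> P" using \<mu>(1) stdv_supp[OF assms(1,2)] by auto
  ultimately show ?thesis using that \<mu>(1) by auto
qed

lemma stdv_has_lead:
  assumes "r \<in> stdv P" "P \<subseteq> K" "\<mu> \<in> K" "fst \<mu> \<in> supp n (r (snd \<mu>))"
    "\<And>\<alpha> e. \<alpha> \<in> supp n (r e) \<Longrightarrow> (\<alpha>, e) = \<mu> \<or> prec (\<alpha>, e) \<mu>"
  shows "has_lead r \<mu>"
proof -
  obtain \<alpha> e where \<mu>: "\<mu> = (\<alpha>, e)" by (cases \<mu>)
  let ?a = "lookup (r e) (std_word n \<alpha>)"
  have "?a \<noteq> 0" using assms(4) \<mu> by (auto simp: supp_def in_keys_iff)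
  moreover have "r - vscale ?a (monv \<mu>) \<in> stdv (below \<mu>)" unfolding stdv_def
  proof (intro CollectI allI impI)
    fix e' w assume nz: "lookup ((r - vscale ?a (monv \<mu>)) e') w \<noteq> 0"
    have l: "lookup ((r - vscale ?a (monv \<mu>)) e') w
        = (if e' = e \<and> w = std_word n \<alpha> then 0 else lookup (r e') w)"
      by (auto simp: monv_def \<mu> vec_apply lookup_minus word_def lookup_single when_def)
    then have "lookup (r e') w \<noteq> 0" "\<not> (e' = e \<and> w = std_word n \<alpha>)" using nz by (auto split: if_splits)
    then obtain \<delta> where \<delta>: "(\<delta>, e') \<in> P" "w = std_word n \<delta>" using assms(1) unfolding stdv_def by blast
    then have "\<delta> \<in> supp n (r e')" using assms(2) \<open>lookup (r e') w \<noteq> 0\<close>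
      by (auto simp: supp_def in_keys_iff)
    then have "(\<delta>, e') \<in> below \<mu>"
      using assms(5)[of \<delta> e'] \<delta> assms(2) \<open>\<not> (e' = e \<and> w = std_word n \<alpha>)\<close> \<mu> by (auto simp: below_def)
    then show "\<exists>\<alpha>. (\<alpha>, e') \<in> below \<mu> \<and> w = std_word n \<alpha>" using \<delta> by blast
  qed
  then have "r - vscale ?a (monv \<mu>) \<in> V (below \<mu>)"
    using stdv_span[OF below_subset] unfolding V_def using fv.span_mono by blast
  ultimately show ?thesis unfolding has_lead_def by blast
qed

text \<open>The leading monomial of a nonzero combination of monomials outside \<open>Ld\<close> would be congruent to a combination
  of smaller ones.\<close>

lemma normal_unique:
  assumes "r \<in> stdv (K - Ld)" "r \<in> JE" shows "r = 0"
proof (rule ccontr)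
  assume "r \<noteq> 0"
  then obtain \<mu> where \<mu>: "\<mu> \<in> K - Ld" "fst \<mu> \<in> supp n (r (snd \<mu>))"
    "\<And>\<alpha> e. \<alpha> \<in> supp n (r e) \<Longrightarrow> (\<alpha>, e) = \<mu> \<or> prec (\<alpha>, e) \<mu>"
    using stdv_lead[OF assms(1)] by blast
  then have "has_lead r \<mu>" by (intro stdv_has_lead[OF assms(1)]) auto
  then show False using has_lead_Ld[OF _ JE_V[OF assms(2)]] \<mu>(1) by blast
qed

lemma emb_word_V: "e \<in> E \<Longrightarrow> letters w \<Longrightarrow> emb e (word w) \<in> V K"
  using has_lead_beneath[OF word_has_lead] V_mono[OF beneath_subset] by fastforce

lemma Vecs_V: "Vecs \<subseteq> V K"
proof
  fix t assume t: "t \<in> Vecs"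
  then have "t = (\<Sum>e\<in>E. \<Sum>w\<in>keys (t e). vscale (lookup (t e) w) (emb e (word w)))"
    using vec_expand2[of t] unfolding Vecs_def by simp
  also have "\<dots> \<in> V K"
    by (intro V_closed emb_word_V) (use t in \<open>auto simp: Vecs_def carrier_free_algebra\<close>)
  finally show "t \<in> V K" .
qed

lemma normal_form:
  assumes "P \<subseteq> K" "\<And>\<mu>. \<mu> \<in> P \<Longrightarrow> below \<mu> \<subseteq> P" "t \<in> V P"
  obtains r where "r \<in> stdv (P - Ld)" "t - r \<in> JE"
  using assms V_normal[OF assms(1,2)] V_iff[of "P - Ld" t] by blast

section \<open>Cosets, representatives and leading data\<close>

abbreviation "coset f \<equiv> J +>\<^bsub>free_algebra n\<^esub> f"

text \<open>The element of \<open>A\<^sup>E\<close> represented by \<open>t\<close>.\<close>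

definition cls :: "('e \<Rightarrow> 'k falg) \<Rightarrow> 'e \<Rightarrow> 'k falg set" where
  "cls t = (\<lambda>e\<in>E. coset (t e))"

lemma in_coset: "g \<in> coset f \<longleftrightarrow> g - f \<in> J"
proof -
  have "g \<in> coset f \<longleftrightarrow> (\<exists>h\<in>J. g = h + f)" by (simp add: a_r_coset_def')
  also have "\<dots> \<longleftrightarrow> g - f \<in> J" by (metis add_diff_cancel_right' diff_add_cancel)
  finally show ?thesis .
qed

lemma coset_eq_iff: "coset f = coset g \<longleftrightarrow> f - g \<in> J"
proof
  assume "coset f = coset g"
  moreover have "f \<in> coset f" by (simp add: in_coset J_closed)
  ultimately show "f - g \<in> J" using in_coset by blast
next
  assume fg: "f - g \<in> J"
  have "h - f \<in> J \<longleftrightarrow> h - g \<in> J" for h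
    using J_diff[of "h - g" "f - g"] J_closed(2)[of "h - f" "f - g"] fg by auto
  then show "coset f = coset g" using in_coset by blast
qed

lemma cls_eq_iff: "s \<in> Vecs \<Longrightarrow> t \<in> Vecs \<Longrightarrow> cls s = cls t \<longleftrightarrow> s - t \<in> JE"
proof -
  assume st: "s \<in> Vecs" "t \<in> Vecs"
  have "cls s = cls t \<longleftrightarrow> (\<forall>e\<in>E. coset (s e) = coset (t e))"
  proof
    assume "cls s = cls t"
    then have "cls s e = cls t e" for e by simp
    then show "\<forall>e\<in>E. coset (s e) = coset (t e)" unfolding cls_def by (metis restrict_apply')
  qed (auto simp: cls_def intro: restrict_ext)
  also have "\<dots> \<longleftrightarrow> s - t \<in> JE" using st by (auto simp: coset_eq_iff JE_def Vecs_def vec_apply)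
  finally show ?thesis .
qed

text \<open>A combination of standard monomials outside \<open>Ld\<close> is the representative \<open>\<tau>\<close> of its coset, by the
  uniqueness of normal forms.\<close>

lemma tau_coset:
  assumes r: "r \<in> stdv (K - Ld)" and e: "e \<in> E" and f: "f - r e \<in> J"
  shows "tau n (induced prec e) (I e) (coset f) = r e"
  unfolding tau_def
proof (rule the_equality)
  have "r e - f \<in> J" using J_uminus[OF f] by simp
  moreover have "supp n (r e) \<inter> Lexps n (induced prec e) (I e) = {}"
    using stdv_supp[OF r, of _ e] by (fastforce simp: Ld_def)
  ultimately show "r e \<in> coset f \<and> r e \<in> std_polys n \<and> supp n (r e) \<inter> Lexps n (induced prec e) (I e) = {}"
    using stdv_std_polys[OF r] by (auto simp: in_coset)
  fix t assume t: "t \<in> coset f \<and> t \<in> std_polys n \<and> supp n t \<inter> Lexps n (induced prec e) (I e) = {}"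
  have ts: "emb e t \<in> stdv (K - Ld)" unfolding stdv_def
  proof (intro CollectI allI impI)
    fix e' w assume nz: "lookup (emb e t e') w \<noteq> 0"
    then have e': "e' = e" "w \<in> keys t" by (auto simp: vec_apply in_keys_iff split: if_splits)
    then obtain \<delta> where \<delta>: "\<delta> \<in> expos n" "w = std_word n \<delta>" using t by (auto simp: std_polys_def)
    then have "\<delta> \<in> supp n t" using e' by (auto simp: supp_def)
    then have "(\<delta>, e) \<in> K - Ld" using t \<delta> e by (auto simp: Ld_def)
    then show "\<exists>\<alpha>. (\<alpha>, e') \<in> K - Ld \<and> w = std_word n \<alpha>" using \<delta> e' by blast
  qed
  have rs: "emb e (r e) \<in> stdv (K - Ld)" using r unfolding stdv_def by (auto simp: vec_apply split: if_splits)
  have "emb e t - emb e (r e) \<in> stdv (K - Ld)"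
    using fv.subspace_diff[OF stdv_subspace ts rs] .
  moreover have "t - r e \<in> J" using J_closed(2)[of "t - f" "f - r e"] t f by (auto simp: in_coset)
  then have "emb e t - emb e (r e) \<in> JE" using emb_JE[OF e, of "t - r e"] by (simp add: emb_linear)
  ultimately have "emb e t - emb e (r e) = 0" by (rule normal_unique)
  then have "(emb e t - emb e (r e)) e = 0" by (simp only: zero_fun_apply)
  then show "t = r e" by (simp add: vec_apply)
qed

lemma vtau_cls:
  assumes "r \<in> stdv (K - Ld)" "t - r \<in> JE"
  shows "vtau n E I prec (cls t) = (\<lambda>e\<in>E. r e)"
  unfolding vtau_def
proof (rule restrict_ext)
  fix e assume "e \<in> E"
  then show "tau n (induced prec e) (I e) (cls t e) = r e"
    using tau_coset[OF assms(1), of e "t e"] assms(2) by (auto simp: cls_def JE_def vec_apply)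
qed

lemma vsupp_cls:
  assumes "r \<in> stdv (K - Ld)" "t - r \<in> JE"
  shows "vsupp n E (vtau n E I prec (cls t)) = {(\<alpha>, e). \<alpha> \<in> supp n (r e)}"
  using stdv_supp[OF assms(1)] by (auto simp: vsupp_def vtau_cls[OF assms])

lemma lec_JE:
  assumes "t \<in> JE" shows "lec n E I prec (cls t) = None"
proof -
  have "0 \<in> stdv (K - Ld)" using fv.subspace_0[OF stdv_subspace] .
  moreover have "t - 0 \<in> JE" using assms by simp
  ultimately show ?thesis using vsupp_cls[of 0 t] by (simp add: lec_def lead_def supp_def vec_apply)
qed

text \<open>Reduction to normal form involves only smaller monomials, so a leading monomial outside \<open>Ld\<close>
  survives; it is the leading monomial of the class.\<close>

lemma lec_has_lead:
  assumes "\<mu> \<in> K" "\<mu> \<notin> Ld" "has_lead t \<mu>"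
  shows "lec n E I prec (cls t) = Some \<mu>"
proof -
  have "below \<nu> \<subseteq> beneath \<mu>" if "\<nu> \<in> beneath \<mu>" for \<nu>
    using that below_beneath below_mono[of \<nu> \<mu>] assms(1) by (auto simp: beneath_def)
  then obtain r where r: "r \<in> stdv (beneath \<mu> - Ld)" "t - r \<in> JE"
    using normal_form[OF beneath_subset _ has_lead_beneath[OF assms(3,1)]] by blast
  then have r': "r \<in> stdv (K - Ld)" using stdv_mono[of "beneath \<mu> - Ld" "K - Ld"] beneath_subset by blast
  let ?Y = "{(\<alpha>, e). \<alpha> \<in> supp n (r e)}"
  have Y: "?Y \<subseteq> beneath \<mu>" using stdv_supp[OF r(1)] beneath_subset by blast
  have "\<mu> \<in> ?Y"
  proof (rule ccontr)
    assume "\<mu> \<notin> ?Y"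
    then have "?Y \<subseteq> below \<mu>" using Y by (auto simp: beneath_def below_def)
    have "r \<in> stdv (below \<mu>)" unfolding stdv_def
    proof (intro CollectI allI impI)
      fix e w assume nz: "lookup (r e) w \<noteq> 0"
      then obtain \<alpha> where \<alpha>: "(\<alpha>, e) \<in> beneath \<mu> - Ld" "w = std_word n \<alpha>"
        using r(1) unfolding stdv_def by blast
      then have "\<alpha> \<in> supp n (r e)" using nz by (auto simp: supp_def in_keys_iff beneath_def)
      then show "\<exists>\<alpha>. (\<alpha>, e) \<in> below \<mu> \<and> w = std_word n \<alpha>"
        using \<open>?Y \<subseteq> below \<mu>\<close> \<alpha>(2) by auto
    qed
    then have "t \<in> V (below \<mu>)" using r(2) V_iff[OF below_subset] by blast
    then show False using has_lead_Ld[OF assms(3) _ assms(1)] assms(2) by blast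
  qed
  then have "lead prec ?Y = Some \<mu>"
    using Y ord by (intro lead_eq_SomeI[of _ _ _ K])
      (auto simp: beneath_def module_monomial_ordering_def)
  then show ?thesis using vsupp_cls[OF r' r(2)] by (simp add: lec_def)
qed

lemma lead_cases:
  assumes "t \<in> Vecs"
  obtains "t \<in> JE" | \<mu> where "\<mu> \<in> K" "\<mu> \<notin> Ld" "has_lead t \<mu>"
proof -
  have "below \<nu> \<subseteq> K" for \<nu> by (rule below_subset)
  then obtain r where r: "r \<in> stdv (K - Ld)" "t - r \<in> JE"
    using normal_form[of K t] Vecs_V assms by blast
  show ?thesis
  proof (cases "r = 0")
    case True then show ?thesis using r that by simp
  next
    case False
    then obtain \<mu> where \<mu>: "\<mu> \<in> K - Ld" "fst \<mu> \<in> supp n (r (snd \<mu>))"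
      "\<And>\<alpha> e. \<alpha> \<in> supp n (r e) \<Longrightarrow> (\<alpha>, e) = \<mu> \<or> prec (\<alpha>, e) \<mu>"
      using stdv_lead[OF r(1)] by blast
    then have "has_lead r \<mu>" by (intro stdv_has_lead[OF r(1)]) auto
    then have "has_lead t \<mu>" using has_lead_perturb JE_V[OF r(2)] by blast
    then show ?thesis using that \<mu>(1) by blast
  qed
qed

end

text \<open>A common multiple of the monomials \<open>\<alpha>\<close> and \<open>\<beta>\<close> is a multiple of their least common multiple; \<open>\<beta> - \<alpha>\<close> and
  \<open>\<alpha> - \<beta>\<close> (truncated) are the cofactors.\<close>

lemma exists_complement:
  fixes \<alpha> \<beta> \<omega> \<omega>' :: expo
  assumes "\<alpha> + \<omega> = \<beta> + \<omega>'" "\<omega> \<in> expos n"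
  obtains \<delta> where "\<delta> \<in> expos n" "\<omega> = \<delta> + (\<beta> - \<alpha>)" "\<omega>' = \<delta> + (\<alpha> - \<beta>)"
proof -
  have l: "lookup \<alpha> i + lookup \<omega> i = lookup \<beta> i + lookup \<omega>' i" for i
    using arg_cong[OF assms(1), of "\<lambda>p. lookup p i"] by (simp add: lookup_add)
  let ?\<delta> = "\<omega> - (\<beta> - \<alpha>)"
  have "\<omega> = ?\<delta> + (\<beta> - \<alpha>)"
  proof (rule poly_mapping_eqI)
    show "lookup \<omega> i = lookup (?\<delta> + (\<beta> - \<alpha>)) i" for i
      using l[of i] by (simp add: lookup_add lookup_minus)
  qed
  moreover have "\<omega>' = ?\<delta> + (\<alpha> - \<beta>)"
  proof (rule poly_mapping_eqI)
    show "lookup \<omega>' i = lookup (?\<delta> + (\<alpha> - \<beta>)) i" for i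
      using l[of i] by (simp add: lookup_add lookup_minus)
  qed
  moreover have "?\<delta> \<in> expos n" using calculation(1) assms(2) plus_in_expos by metis
  ultimately show ?thesis using that by blast
qed

context pbw_data
begin

section \<open>Representations with bounded leading terms\<close>

text \<open>Here \<open>ld h\<close> is the leading monomial of \<open>h\<close>: the vectors that have, modulo \<open>J\<close>, a representation by multiples of
  elements of \<open>H\<close> whose leading monomials all lie in \<open>P\<close>.\<close>

definition span_le where
  "span_le H ld P = fv.span (JE \<union> {lmul (word w) h | w h. h \<in> H \<and> letters w \<and> shift w (ld h) \<in> P})"

text \<open>The product of a word with a standard monomial is again, up to scalar, order of letters, and smaller
  terms, a standard monomial.\<close>

lemma has_lead_lmul:
  assumes "has_lead t \<mu>" "\<mu> \<in> K" "letters w"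
  shows "has_lead (lmul (word w) t) (shift w \<mu>)"
proof -
  have mon: "has_lead (lmul (word w) (monv \<nu>)) (shift w \<nu>)" if "\<nu> \<in> K" for \<nu>
  proof -
    have "lmul (word w) (monv \<nu>) = emb (snd \<nu>) (word (w @ std_word n (fst \<nu>)))"
      by (simp add: monv_def lmul_emb falg_mult_simps)
    moreover have "shift w \<nu> = (exw (w @ std_word n (fst \<nu>)), snd \<nu>)"
      using that by (auto simp: shift_def ac_simps)
    ultimately show ?thesis
      using word_has_lead[of "snd \<nu>" "w @ std_word n (fst \<nu>)"] that assms(3) set_std_word[of n "fst \<nu>"]
      by (auto simp: mem_Times_iff)
  qed
  obtain a where a: "a \<noteq> 0" "t - vscale a (monv \<mu>) \<in> V (below \<mu>)"
    using assms(1) unfolding has_lead_def by blast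
  have "lmul (word w) (t - vscale a (monv \<mu>)) \<in> V (below (shift w \<mu>))"
    unfolding V_def
  proof (rule fv_span_map[OF a(2)[unfolded V_def]])
    fix y assume "y \<in> JE \<union> monv ` below \<mu>"
    then show "lmul (word w) y \<in> fv.span (JE \<union> monv ` below (shift w \<mu>))"
      unfolding V_def[symmetric]
    proof
      assume "y \<in> JE"
      then show "lmul (word w) y \<in> V (below (shift w \<mu>))" by (intro JE_V JE_lmul) (use assms in auto)
    next
      assume "y \<in> monv ` below \<mu>"
      then obtain \<nu> where \<nu>: "y = monv \<nu>" "\<nu> \<in> K" "prec \<nu> \<mu>" by (auto simp: below_def)
      have "lmul (word w) y \<in> V (beneath (shift w \<nu>))"
        using has_lead_beneath[OF mon[OF \<nu>(2)]] \<nu> assms(3) by simp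
      moreover have "beneath (shift w \<nu>) \<subseteq> below (shift w \<mu>)"
        using shift_mono[OF \<nu>(3,2) assms(2,3)] \<nu>(2) assms by (intro beneath_below) auto
      ultimately show "lmul (word w) y \<in> V (below (shift w \<mu>))" using V_mono by blast
    qed
  qed (simp_all only: lmul_linear)
  then have "lmul (word w) t - vscale a (lmul (word w) (monv \<mu>)) \<in> V (below (shift w \<mu>))"
    by (simp only: lmul_linear)
  then show ?thesis
    using has_lead_perturb has_lead_scale[OF mon[OF assms(2)] a(1)] by blast
qed

lemma span_le_mono: "P \<subseteq> Q \<Longrightarrow> span_le H ld P \<subseteq> span_le H ld Q"
  unfolding span_le_def by (rule fv.span_mono) blast

lemma span_le_closed: "s \<in> span_le H ld P \<Longrightarrow> t \<in> span_le H ld P \<Longrightarrow> s + t \<in> span_le H ld P"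
  "s \<in> span_le H ld P \<Longrightarrow> t \<in> span_le H ld P \<Longrightarrow> s - t \<in> span_le H ld P"
  "t \<in> span_le H ld P \<Longrightarrow> vscale a t \<in> span_le H ld P"
  "(\<And>x. x \<in> S \<Longrightarrow> f x \<in> span_le H ld P) \<Longrightarrow> sum f S \<in> span_le H ld P"
  "t \<in> JE \<Longrightarrow> t \<in> span_le H ld P"
  "h \<in> H \<Longrightarrow> letters w \<Longrightarrow> shift w (ld h) \<in> P \<Longrightarrow> lmul (word w) h \<in> span_le H ld P"
  unfolding span_le_def
  by (auto intro: fv.span_add fv.span_diff fv.span_scale fv.span_sum) (auto intro!: fv.span_base)

text \<open>A representation uses finitely many multiples; take the largest of their leading monomials as bound.\<close>

lemma span_le_bound:
  assumes "x \<in> span_le H ld P" "P \<subseteq> K"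
  shows "x \<in> JE \<or> (\<exists>\<nu>\<in>P. x \<in> span_le H ld (beneath \<nu>))"
  using assms(1) unfolding span_le_def[of _ _ P]
proof (induction rule: fv.span_induct_alt)
  case base
  show ?case using fv.subspace_0[OF JE_subspace] by blast
next
  case (step a x y)
  have *: "s + t \<in> span_le H ld (beneath \<nu>)" if "s \<in> span_le H ld (beneath \<nu>)" "t \<in> JE" for s t \<nu>
    using that span_le_closed(1)[OF _ span_le_closed(5)] by blast
  have "x \<in> JE \<or> (\<exists>\<mu>\<in>P. x \<in> span_le H ld (beneath \<mu>))"
  proof -
    have "lmul (word w) h \<in> span_le H ld (beneath (shift w (ld h)))"
      if "h \<in> H" "letters w" "shift w (ld h) \<in> P" for w h
    proof -
      have "shift w (ld h) \<in> K" by (rule subsetD[OF assms(2) that(3)])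
      then have "shift w (ld h) \<in> beneath (shift w (ld h))" by (simp add: beneath_def)
      then show ?thesis by (rule span_le_closed(6)[OF that(1,2)])
    qed
    with step(1) show ?thesis by auto
  qed
  then consider "x \<in> JE" | \<mu> where "\<mu> \<in> P" "x \<in> span_le H ld (beneath \<mu>)" by blast
  then show ?case
  proof cases
    case 1
    then have "vscale a x \<in> JE" using fv.subspace_scale[OF JE_subspace] by blast
    with step(2) have "y + vscale a x \<in> JE \<or> (\<exists>\<nu>\<in>P. y + vscale a x \<in> span_le H ld (beneath \<nu>))"
      using *[of y _ "vscale a x"] fv.subspace_add[OF JE_subspace] by blast
    then show ?thesis by (simp only: add.commute)
  next
    case (2 \<mu>)
    then have sx: "vscale a x \<in> span_le H ld (beneath \<mu>)" using span_le_closed(3) by blast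
    from step(2) show ?thesis
    proof
      assume "y \<in> JE"
      then show ?thesis using * sx 2(1) by blast
    next
      assume "\<exists>\<nu>\<in>P. y \<in> span_le H ld (beneath \<nu>)"
      then obtain \<nu> where \<nu>: "\<nu> \<in> P" "y \<in> span_le H ld (beneath \<nu>)" by blast
      have "beneath \<mu> \<subseteq> beneath \<nu> \<or> beneath \<nu> \<subseteq> beneath \<mu>"
        using prec_total[of \<mu> \<nu>] beneath_below below_beneath 2(1) \<nu>(1) assms(2) by blast
      then show ?thesis using span_le_mono sx \<nu> 2(1) span_le_closed(1) by blast
    qed
  qed
qed

text \<open>The leading monomials are given by a function, since \<open>has_lead\<close> determines them only outside \<open>Ld\<close>.\<close>

definition "lead_system H ld \<longleftrightarrow> H \<subseteq> Vecs \<and> (\<forall>h\<in>H. ld h \<in> K \<and> has_lead h (ld h))"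

lemma lead_systemD:
  assumes "lead_system H ld" "h \<in> H" shows "h \<in> Vecs" "ld h \<in> K" "has_lead h (ld h)"
  using assms unfolding lead_system_def by auto

lemma span_le_V:
  assumes "lead_system H ld" "P \<subseteq> K" "\<And>\<mu>. \<mu> \<in> P \<Longrightarrow> below \<mu> \<subseteq> P"
  shows "span_le H ld P \<subseteq> V P"
proof -
  have "lmul (word w) h \<in> V P" if "h \<in> H" "letters w" "shift w (ld h) \<in> P" for w h
  proof -
    have "has_lead (lmul (word w) h) (shift w (ld h))"
      by (rule has_lead_lmul[OF lead_systemD(3,2)[OF assms(1) that(1)] that(2)])
    moreover have K: "shift w (ld h) \<in> K" by (rule subsetD[OF assms(2) that(3)])
    ultimately have "lmul (word w) h \<in> V (beneath (shift w (ld h)))" by (rule has_lead_beneath)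
    moreover have "beneath (shift w (ld h)) \<subseteq> P"
      using beneath_eq[OF K] assms(3)[OF that(3)] that(3) by simp
    ultimately show ?thesis using V_mono by blast
  qed
  moreover have "fv.subspace (V P)" by (simp add: V_def)
  ultimately show ?thesis unfolding span_le_def
    by (intro fv.span_minimal) (use JE_V in auto)
qed

lemma below_closed: "\<mu> \<in> K \<Longrightarrow> \<nu> \<in> below \<mu> \<Longrightarrow> below \<nu> \<subseteq> below \<mu>"
  using below_mono by (auto simp: below_def)

lemma beneath_closed: "\<mu> \<in> K \<Longrightarrow> \<nu> \<in> beneath \<mu> \<Longrightarrow> below \<nu> \<subseteq> beneath \<mu>"
  using below_mono below_beneath by (fastforce simp: beneath_def below_def intro: prec_trans)

lemma span_le_lmul:
  assumes "lead_system H ld" "\<nu> \<in> K" "letters v" "x \<in> span_le H ld (below \<nu>)"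
  shows "lmul (word v) x \<in> span_le H ld (below (shift v \<nu>))"
  unfolding span_le_def
proof (rule fv_span_map[OF assms(4)[unfolded span_le_def]])
  fix y assume "y \<in> JE \<union> {lmul (word w) h |w h. h \<in> H \<and> letters w \<and> shift w (ld h) \<in> below \<nu>}"
  then show "lmul (word v) y \<in> fv.span (JE \<union> {lmul (word w) h |w h. h \<in> H \<and> letters w \<and> shift w (ld h) \<in> below (shift v \<nu>)})"
    unfolding span_le_def[symmetric]
  proof
    assume "y \<in> JE"
    then show "lmul (word v) y \<in> span_le H ld (below (shift v \<nu>))"
      by (intro span_le_closed(5) JE_lmul) (use assms in auto)
  next
    assume "y \<in> {lmul (word w) h |w h. h \<in> H \<and> letters w \<and> shift w (ld h) \<in> below \<nu>}"
    then obtain w h where wh: "y = lmul (word w) h" "h \<in> H" "letters w" "shift w (ld h) \<in> below \<nu>" by blast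
    then have wh4: "shift w (ld h) \<in> K" "prec (shift w (ld h)) \<nu>" unfolding below_def by blast+
    have "prec (shift v (shift w (ld h))) (shift v \<nu>)" by (rule shift_mono[OF wh4(2,1) assms(2,3)])
    then have "shift (v @ w) (ld h) \<in> below (shift v \<nu>)"
      using lead_systemD(2)[OF assms(1) wh(2)] wh(3) assms(3) by (simp add: below_def)
    moreover have "lmul (word v) y = lmul (word (v @ w)) h" by (simp add: wh lmul_lmul falg_mult_simps)
    ultimately show "lmul (word v) y \<in> span_le H ld (below (shift v \<nu>))"
      using wh assms(3) by (auto intro!: span_le_closed(6))
  qed
qed (simp_all only: lmul_linear)

text \<open>The order of the letters in a cofactor is immaterial up to a scalar and multiples with smaller leading monomials,
  because two words with the same exponent are proportional modulo smaller monomials.\<close>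

lemma span_le_word:
  assumes ls: "lead_system H ld" and h: "h \<in> H" and vw: "letters v" "letters w" "exw v = exw w"
  obtains a where "lmul (word v) h - vscale a (lmul (word w) h) \<in> span_le H ld (below (shift v (ld h)))"
proof -
  let ?e = "snd (ld h)"
  let ?\<mu> = "(exw v, ?e)"
  have ldh: "ld h \<in> K" "h \<in> Vecs" using lead_systemD[OF ls h] by auto
  then have e: "?e \<in> E" by (auto simp: mem_Times_iff)
  have \<mu>: "?\<mu> \<in> K" using e vw by simp
  have "has_lead (emb ?e (word v)) ?\<mu>" "has_lead (emb ?e (word w)) ?\<mu>"
    using word_has_lead[OF e vw(1)] word_has_lead[OF e vw(2)] vw(3) by simp_all
  then obtain a where a: "emb ?e (word v) - vscale a (emb ?e (word w)) \<in> V (below ?\<mu>)"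
    using has_lead_cancel has_lead_beneath \<mu> by metis
  then obtain s where s: "s \<in> stdv (below ?\<mu>)"
      "emb ?e (word v) - vscale a (emb ?e (word w)) - s \<in> JE"
    using V_iff[OF below_subset] by blast
  have "word v - scalar a * word w - s ?e \<in> J"
    using s(2) e by (auto simp: JE_def vec_apply)
  then have "lmul (word v - scalar a * word w - s ?e) h \<in> JE" by (rule lmul_J[OF ldh(2)])
  then have 1: "lmul (word v - scalar a * word w - s ?e) h \<in> span_le H ld (below (shift v (ld h)))"
    by (rule span_le_closed(5))
  have 2: "lmul (s ?e) h \<in> span_le H ld (below (shift v (ld h)))"
    unfolding lmul_expand[of "s ?e"]
  proof (intro span_le_closed(3,4,6) h)
    fix u assume "u \<in> keys (s ?e)"
    then obtain \<delta> where \<delta>: "(\<delta>, ?e) \<in> below ?\<mu>" "u = std_word n \<delta>"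
      using s(1) unfolding stdv_def by (auto simp: in_keys_iff)
    then have d: "\<delta> \<in> expos n" "prec (\<delta>, ?e) (exw v, ?e)" by (auto simp: below_def)
    then show u: "letters u" using \<delta> set_std_word by blast
    have "prec (\<delta> + fst (ld h), ?e) (exw v + fst (ld h), ?e)"
      by (rule add_mono_prec[OF d(2,1)]) (use vw e ldh in \<open>auto simp: mem_Times_iff\<close>)
    then have "prec (shift u (ld h)) (shift v (ld h))"
      using d(1) \<delta>(2) by (simp add: shift_def ac_simps)
    then show "shift u (ld h) \<in> below (shift v (ld h))" using u ldh(1) by (simp add: below_def)
  qed
  have "lmul (word v) h - vscale a (lmul (word w) h)
      = lmul (word v - scalar a * word w - s ?e) h + lmul (s ?e) h"
    by (simp add: lmul_diff lmul_scalar)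
  then show ?thesis by (intro that[of a]) (simp only: span_le_closed(1)[OF 1 2])
qed

text \<open>For each pair the S-vector formed with the cofactors of the least common multiple has to be
  represented with smaller leading monomials. The scalar in the S-vector is left open by the use of \<open>insert\<close>. The second
  part concerns the leading monomials of the ideal, which become reducible in the quotient.\<close>

definition critical_pairs_reduce where
  "critical_pairs_reduce H ld \<longleftrightarrow>
    (\<forall>h\<in>H. \<forall>h'\<in>H. snd (ld h) = snd (ld h') \<longrightarrow>
      (\<exists>a a'. letters a \<and> letters a' \<and> exw a = fst (ld h') - fst (ld h) \<and> exw a' = fst (ld h) - fst (ld h') \<and>
        lmul (word a) h \<in> fv.span (insert (lmul (word a') h') (span_le H ld (below (shift a (ld h))))))) \<and>
    (\<forall>h\<in>H. \<forall>l\<in>lexps n (induced prec (snd (ld h))) (I (snd (ld h))).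
      (\<exists>a. letters a \<and> exw a = l - fst (ld h) \<and>
        lmul (word a) h \<in> span_le H ld (below (shift a (ld h)))))"

lemma span_insert_span_le:
  "x \<in> fv.span (insert y (span_le H ld P)) \<longleftrightarrow> (\<exists>k. x - vscale k y \<in> span_le H ld P)"
  by (simp add: fv.span_breakdown_eq) (simp add: span_le_def fv.span_span)

text \<open>Any coincidence of leading monomials of multiples comes from the one at the least common multiple by
  multiplication with a further word.\<close>

lemma critical_multiple:
  assumes ls: "lead_system H ld" and cp: "critical_pairs_reduce H ld"
    and h: "h \<in> H" "h' \<in> H" "letters w" "letters w'" "shift w (ld h) = shift w' (ld h')"
  obtains k where "lmul (word w) h - vscale k (lmul (word w') h') \<in> span_le H ld (below (shift w (ld h)))"
proof -
  have e: "snd (ld h) = snd (ld h')" using h(5) by (simp add: shift_def prod_eq_iff)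
  obtain a a' where a: "letters a" "letters a'" "exw a = fst (ld h') - fst (ld h)"
      "exw a' = fst (ld h) - fst (ld h')"
      "lmul (word a) h \<in> fv.span (insert (lmul (word a') h') (span_le H ld (below (shift a (ld h)))))"
    using cp h(1,2) e unfolding critical_pairs_reduce_def by blast
  obtain k where k: "lmul (word a) h - vscale k (lmul (word a') h') \<in> span_le H ld (below (shift a (ld h)))"
    using a(5) unfolding span_insert_span_le by blast
  have "fst (ld h) + exw w = fst (ld h') + exw w'" using h(5) by (simp add: shift_def prod_eq_iff)
  then obtain \<delta> where \<delta>: "\<delta> \<in> expos n" "exw w = \<delta> + exw a" "exw w' = \<delta> + exw a'"
    using exists_complement[of "fst (ld h)" "exw w" "fst (ld h')" "exw w'" n] h(3) a by auto
  define v where "v = std_word n \<delta>"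
  have v: "letters v" "exw v = \<delta>" using \<delta>(1) set_std_word by (auto simp: v_def)
  have sh: "shift v (shift a (ld h)) = shift w (ld h)" "shift (v @ a') (ld h') = shift w' (ld h')"
    using \<delta> v by (simp_all add: shift_def ac_simps)
  have K: "shift a (ld h) \<in> K" using lead_systemD(2)[OF ls h(1)] a(1) by simp
  have 1: "lmul (word (v @ a)) h - vscale k (lmul (word (v @ a')) h') \<in> span_le H ld (below (shift w (ld h)))"
    using span_le_lmul[OF ls K v(1) k] sh(1) by (simp add: lmul_linear lmul_lmul falg_mult_simps)
  obtain b where b: "lmul (word w) h - vscale b (lmul (word (v @ a)) h) \<in> span_le H ld (below (shift w (ld h)))"
    using span_le_word[OF ls h(1), of w "v @ a"] h(3) v a(1) \<delta> by auto
  obtain b' where b': "lmul (word (v @ a')) h' - vscale b' (lmul (word w') h') \<in> span_le H ld (below (shift w (ld h)))"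
    using span_le_word[OF ls h(2), of "v @ a'" w'] h(4,5) v a(2) \<delta> sh by auto
  have "lmul (word w) h - vscale (b * k * b') (lmul (word w') h')
    = (lmul (word w) h - vscale b (lmul (word (v @ a)) h))
      + vscale b (lmul (word (v @ a)) h - vscale k (lmul (word (v @ a')) h'))
      + vscale (b * k) (lmul (word (v @ a')) h' - vscale b' (lmul (word w') h'))"
    by (simp add: fv.scale_right_diff_distrib)
  also have "\<dots> \<in> span_le H ld (below (shift w (ld h)))"
    by (intro span_le_closed(1,3) b 1 b')
  finally show ?thesis using that by blast
qed

lemma critical_ideal:
  assumes ls: "lead_system H ld" and cp: "critical_pairs_reduce H ld"
    and h: "h \<in> H" "letters w" "shift w (ld h) \<in> Ld"
  shows "lmul (word w) h \<in> span_le H ld (below (shift w (ld h)))"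
proof -
  let ?e = "snd (ld h)"
  have eE: "?e \<in> E" using lead_systemD(2)[OF ls h(1)] by (auto simp: mem_Times_iff)
  have "fst (ld h) + exw w \<in> Lexps n (induced prec ?e) (I ?e)"
    using h(3) by (simp add: Ld_def shift_def)
  then obtain l \<gamma> where l: "fst (ld h) + exw w = l + \<gamma>" "l \<in> lexps n (induced prec ?e) (I ?e)"
    unfolding Lexps_def by blast
  obtain a where a: "letters a" "exw a = l - fst (ld h)"
      "lmul (word a) h \<in> span_le H ld (below (shift a (ld h)))"
    using cp h(1) l(2) unfolding critical_pairs_reduce_def by blast
  obtain \<delta> where \<delta>: "\<delta> \<in> expos n" "exw w = \<delta> + exw a"
    using exists_complement[OF l(1), of n] h(2) a by auto
  define v where "v = std_word n \<delta>"
  have v: "letters v" "exw v = \<delta>" using \<delta>(1) set_std_word by (auto simp: v_def)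
  have sh: "shift v (shift a (ld h)) = shift w (ld h)"
    using \<delta> v by (simp_all add: shift_def ac_simps)
  have K: "shift a (ld h) \<in> K" using lead_systemD(2)[OF ls h(1)] a(1) by simp
  have 1: "lmul (word (v @ a)) h \<in> span_le H ld (below (shift w (ld h)))"
    using span_le_lmul[OF ls K v(1) a(3)] sh(1) by (simp add: lmul_linear lmul_lmul falg_mult_simps)
  obtain b where b: "lmul (word w) h - vscale b (lmul (word (v @ a)) h) \<in> span_le H ld (below (shift w (ld h)))"
    using span_le_word[OF ls h(1), of w "v @ a"] h(2) v a(1) \<delta> by auto
  show ?thesis using span_le_closed(1)[OF b span_le_closed(3)[OF 1, of b]] by simp
qed

text \<open>Descend from an arbitrary bound \<open>\<nu>\<close> of a representation of \<open>x\<close> to \<open>\<mu>\<close>. If \<open>\<nu>\<close> is larger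
  than \<open>\<mu>\<close>, all multiples with leading monomial exactly \<open>\<nu>\<close> are, modulo smaller ones, multiples of a single
  \<open>u\<close>. If \<open>\<nu>\<close> is not in \<open>Ld\<close>, the coefficient of \<open>u\<close> vanishes by comparison of leading monomials; if
  it is, \<open>u\<close> itself can be rewritten.\<close>

theorem buchberger:
  assumes ls: "lead_system H ld" and cp: "critical_pairs_reduce H ld"
    and x: "x \<in> span_le H ld K" "x \<in> V (beneath \<mu>)" "\<mu> \<in> K"
  shows "x \<in> span_le H ld (beneath \<mu>)"
proof -
  have "x \<in> span_le H ld (beneath \<nu>) \<longrightarrow> x \<in> span_le H ld (beneath \<mu>)" if "\<nu> \<in> K" for \<nu>
    using that
  proof (induction rule: prec_induct)
    case (less \<nu>)
    show ?case
    proof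
      assume xn: "x \<in> span_le H ld (beneath \<nu>)"
      show "x \<in> span_le H ld (beneath \<mu>)"
      proof (cases "prec \<mu> \<nu>")
        case False
        then have "\<nu> \<in> beneath \<mu>" using prec_total[OF less(1) x(3)] less(1) by (auto simp: beneath_def)
        then have "beneath \<nu> \<subseteq> beneath \<mu>"
          using beneath_closed[OF x(3)] beneath_eq[OF less(1)] by simp
        then show ?thesis using xn span_le_mono by blast
      next
        case True
        have xV: "x \<in> V (below \<nu>)"
          using x(2) V_mono[OF beneath_below[OF True x(3) less(1)]] by blast
        have "x \<in> span_le H ld (below \<nu>)"
        proof (cases "\<exists>h\<in>H. \<exists>w. letters w \<and> shift w (ld h) = \<nu>")
          case False
          have "span_le H ld (beneath \<nu>) \<subseteq> span_le H ld (below \<nu>)" unfolding span_le_def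
            by (rule fv.span_mono) (use False beneath_eq[OF less(1)] in auto)
          then show ?thesis using xn by blast
        next
          case True
          then obtain h0 w0 where h0: "h0 \<in> H" "letters w0" "shift w0 (ld h0) = \<nu>" by blast
          let ?u = "lmul (word w0) h0"
          have "lmul (word w) h \<in> fv.span (insert ?u (span_le H ld (below \<nu>)))"
            if wh: "h \<in> H" "letters w" "shift w (ld h) \<in> beneath \<nu>" for w h
          proof (cases "shift w (ld h) = \<nu>")
            case True
            then obtain k where "lmul (word w) h - vscale k ?u \<in> span_le H ld (below \<nu>)"
              using critical_multiple[OF ls cp wh(1) h0(1) wh(2) h0(2)] h0(3) by metis
            then show ?thesis unfolding span_insert_span_le by blast
          next
            case False
            then have "shift w (ld h) \<in> below \<nu>" using wh(3) by (auto simp: beneath_def below_def)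
            then have "lmul (word w) h \<in> span_le H ld (below \<nu>)" using wh by (intro span_le_closed(6))
            then show ?thesis by (auto intro: fv.span_base)
          qed
          moreover have "JE \<subseteq> fv.span (insert ?u (span_le H ld (below \<nu>)))"
            using span_le_closed(5) by (auto intro!: fv.span_base)
          ultimately have "span_le H ld (beneath \<nu>) \<subseteq> fv.span (insert ?u (span_le H ld (below \<nu>)))"
            unfolding span_le_def[of _ _ "beneath \<nu>"] by (intro fv.span_minimal fv.subspace_span) auto
          then obtain k where k: "x - vscale k ?u \<in> span_le H ld (below \<nu>)"
            using xn span_insert_span_le by blast
          show ?thesis
          proof (cases "\<nu> \<in> Ld")
            case True
            then have "?u \<in> span_le H ld (below \<nu>)"
              using critical_ideal[OF ls cp h0(1,2)] h0(3) by simp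
            then show ?thesis using span_le_closed(1)[OF k span_le_closed(3), of ?u k] by simp
          next
            case False
            have "k = 0"
            proof (rule ccontr)
              assume k0: "k \<noteq> 0"
              have lead: "has_lead ?u \<nu>"
                using has_lead_lmul[OF lead_systemD(3,2)[OF ls h0(1)] h0(2)] h0(3) by simp
              have "x - vscale k ?u \<in> V (below \<nu>)"
                using k span_le_V[OF ls below_subset below_closed[OF less(1)]] by blast
              then have "vscale k ?u \<in> V (below \<nu>)" using V_closed(2)[OF xV] by fastforce
              from V_closed(3)[OF this, of "inverse k"] have "?u \<in> V (below \<nu>)" using k0 by simp
              then show False using has_lead_Ld[OF lead _ less(1)] False by blast
            qed
            then show ?thesis using k by simp
          qed
        qed
        then have "x \<in> JE \<or> (\<exists>\<rho>\<in>below \<nu>. x \<in> span_le H ld (beneath \<rho>))"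
          by (rule span_le_bound[OF _ below_subset])
        then show ?thesis using less(2) span_le_closed(5) by (auto simp: below_def)
      qed
    qed
  qed
  then show ?thesis using span_le_bound[OF x(1)] span_le_closed(5) by blast
qed

section \<open>The reduced Groebner basis of a submodule\<close>

text \<open>A submodule is represented by its preimage \<open>N\<close>, which contains \<open>JE\<close>; so \<open>Ld\<close> is part of \<open>leads N\<close>. For
  each \<open>\<mu>\<close> in \<open>leads N\<close>, \<open>red_elem N \<mu>\<close> is the only element of \<open>N\<close> that is \<open>\<mu>\<close> minus a combination of smaller
  monomials outside \<open>leads N\<close>. For the minimal \<open>\<mu>\<close> outside \<open>Ld\<close> these elements form the reduced Groebner
  basis.\<close>

definition "submod N \<longleftrightarrow> fv.subspace N \<and> JE \<subseteq> N \<and> N \<subseteq> Vecs \<and>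
  (\<forall>t\<in>N. \<forall>w. letters w \<longrightarrow> lmul (word w) t \<in> N)"

definition "leads N = {\<mu> \<in> K. \<exists>t\<in>N. has_lead t \<mu>}"

definition "min_leads N = {\<mu> \<in> leads N. \<forall>\<nu>\<in>leads N. mdvd n \<nu> \<mu> \<longrightarrow> \<nu> = \<mu>}"

definition "red_elem N \<mu> = (THE t. t \<in> N \<and> monv \<mu> - t \<in> stdv (below \<mu> - leads N))"

lemma submodD:
  assumes "submod N"
  shows "fv.subspace N" "t \<in> JE \<Longrightarrow> t \<in> N" "t \<in> N \<Longrightarrow> t \<in> Vecs"
    "t \<in> N \<Longrightarrow> letters w \<Longrightarrow> lmul (word w) t \<in> N"
  using assms unfolding submod_def by auto

lemma Ld_leads: "submod N \<Longrightarrow> Ld \<subseteq> leads N"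
proof
  fix \<mu> assume N: "submod N" and \<mu>: "\<mu> \<in> Ld"
  then have K: "\<mu> \<in> K" by (auto simp: Ld_def)
  then have "0 - vscale 1 (monv \<mu>) \<in> V (below \<mu>)"
    using \<mu> Ld_iff V_closed(2)[OF V_closed(4)] by simp
  then have "has_lead 0 \<mu>" unfolding has_lead_def by (intro exI[of _ 1]) simp
  then show "\<mu> \<in> leads N" using K fv.subspace_0[OF submodD(1)[OF N]] by (auto simp: leads_def)
qed

lemma mdvd_words:
  assumes "mdvd n \<mu> \<nu>" obtains w where "letters w" "\<nu> = shift w \<mu>"
proof -
  obtain \<gamma> where "\<gamma> \<in> expos n" "fst \<nu> = fst \<mu> + \<gamma>" "snd \<mu> = snd \<nu>" using assms by (auto simp: mdvd_def)
  then show ?thesis using that[of "std_word n \<gamma>"] set_std_word by (auto simp: shift_def prod_eq_iff)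
qed

lemma leads_mdvd: "submod N \<Longrightarrow> \<mu> \<in> leads N \<Longrightarrow> mdvd n \<mu> \<nu> \<Longrightarrow> \<nu> \<in> leads N"
proof -
  assume N: "submod N" and \<mu>: "\<mu> \<in> leads N" and "mdvd n \<mu> \<nu>"
  then obtain w where w: "letters w" "\<nu> = shift w \<mu>" using mdvd_words by blast
  obtain t where t: "t \<in> N" "has_lead t \<mu>" "\<mu> \<in> K" using \<mu> by (auto simp: leads_def)
  then show "\<nu> \<in> leads N" using has_lead_lmul[OF t(2,3) w(1)] submodD(4)[OF N t(1) w(1)] w
    by (auto simp: leads_def)
qed

lemma Ld_mdvd: "\<mu> \<in> Ld \<Longrightarrow> mdvd n \<mu> \<nu> \<Longrightarrow> \<nu> \<in> Ld"
proof -
  assume \<mu>: "\<mu> \<in> Ld" and "mdvd n \<mu> \<nu>"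
  then obtain w where w: "letters w" "\<nu> = shift w \<mu>" using mdvd_words by blast
  have K: "\<mu> \<in> K" using \<mu> by (auto simp: Ld_def)
  obtain \<alpha> \<gamma> where "fst \<mu> = \<alpha> + \<gamma>" "\<alpha> \<in> lexps n (induced prec (snd \<mu>)) (I (snd \<mu>))" "\<gamma> \<in> expos n"
    using \<mu> by (auto simp: Ld_def Lexps_def)
  then have "fst \<nu> \<in> Lexps n (induced prec (snd \<mu>)) (I (snd \<mu>))"
    using w unfolding Lexps_def
    by (intro CollectI exI[of _ \<alpha>] exI[of _ "\<gamma> + exw w"]) (simp add: shift_def add.assoc)
  then show "\<nu> \<in> Ld" using w K by (auto simp: Ld_def)
qed

lemma finite_min_leads: "finite (min_leads N)"
proof (rule ccontr)
  assume "infinite (min_leads N)"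
  then obtain f :: "nat \<Rightarrow> expo \<times> 'e" where f: "inj f" "range f \<subseteq> min_leads N"
    using infinite_countable_subset by blast
  have "f k \<in> K" for k using f(2) by (auto simp: min_leads_def leads_def)
  then obtain i j where ij: "i < j" "mdvd n (f i) (f j)" using dickson[OF fin_E] by blast
  moreover have "f i \<in> leads N" "f j \<in> min_leads N" using f(2) by (auto simp: min_leads_def)
  ultimately have "f i = f j" by (auto simp: min_leads_def)
  then show False using f(1) ij(1) by (auto dest: injD)
qed

lemma min_leads_dvd:
  assumes "\<mu> \<in> leads N" shows "\<exists>\<nu>\<in>min_leads N. mdvd n \<nu> \<mu>"
proof -
  have "\<mu> \<in> leads N \<longrightarrow> (\<exists>\<nu>\<in>min_leads N. mdvd n \<nu> \<mu>)" if "\<mu> \<in> K" for \<mu>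
    using that
  proof (induction rule: prec_induct)
    case (less \<mu>)
    show ?case
    proof
      assume \<mu>: "\<mu> \<in> leads N"
      show "\<exists>\<nu>\<in>min_leads N. mdvd n \<nu> \<mu>"
      proof (cases "\<mu> \<in> min_leads N")
        case True
        moreover have "mdvd n \<mu> \<mu>" by (auto simp: mdvd_def intro!: bexI[of _ 0])
        ultimately show ?thesis by blast
      next
        case False
        then obtain \<nu> where \<nu>: "\<nu> \<in> leads N" "mdvd n \<nu> \<mu>" "\<nu> \<noteq> \<mu>" using \<mu> by (auto simp: min_leads_def)
        then have K: "\<nu> \<in> K" by (auto simp: leads_def)
        then have "prec \<nu> \<mu>" using mdvd_prec[OF \<nu>(2)] \<nu>(3) by blast
        then obtain \<rho> where \<rho>: "\<rho> \<in> min_leads N" "mdvd n \<rho> \<nu>" using less(2)[OF K] \<nu>(1) by blast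
        have "mdvd n \<rho> \<mu>" using \<rho>(2) \<nu>(2) unfolding mdvd_def by (auto simp: add.assoc)
        then show ?thesis using \<rho>(1) by blast
      qed
    qed
  qed
  then show ?thesis using assms by (auto simp: leads_def)
qed

text \<open>Reduction modulo \<open>N\<close>: a monomial in \<open>leads N\<close> is congruent to a combination of smaller ones.\<close>

lemma reduce_mod:
  assumes N: "submod N" and P: "P \<subseteq> K" "\<And>\<mu>. \<mu> \<in> P \<Longrightarrow> below \<mu> \<subseteq> P" and t: "t \<in> V P"
  obtains r where "r \<in> stdv (P - leads N)" "t - r \<in> N"
proof -
  let ?S = "fv.span (N \<union> monv ` (P - leads N))"
  have NS: "t \<in> ?S" if "t \<in> N" for t using that by (auto intro: fv.span_base)
  have VS: "V P' \<subseteq> ?S" if "\<And>\<mu>. \<mu> \<in> P' \<Longrightarrow> monv \<mu> \<in> ?S" for P'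
    unfolding V_def using that NS submodD(2)[OF N] by (intro fv.span_minimal fv.subspace_span) auto
  have "\<mu> \<in> P \<longrightarrow> monv \<mu> \<in> ?S" if "\<mu> \<in> K" for \<mu>
    using that
  proof (induction rule: prec_induct)
    case (less \<mu>)
    show ?case
    proof
      assume \<mu>: "\<mu> \<in> P"
      show "monv \<mu> \<in> ?S"
      proof (cases "\<mu> \<in> leads N")
        case True
        then obtain s a where s: "s \<in> N" "a \<noteq> 0" "s - vscale a (monv \<mu>) \<in> V (below \<mu>)"
          by (auto simp: leads_def has_lead_def)
        have "V (below \<mu>) \<subseteq> ?S" by (rule VS) (use less(2) P(2)[OF \<mu>] in \<open>auto simp: below_def\<close>)
        then have "vscale a (monv \<mu>) \<in> ?S" using fv.span_diff[OF NS[OF s(1)], of "s - vscale a (monv \<mu>)"] s(3)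
          by auto
        from fv.span_scale[OF this, of "inverse a"] show ?thesis using s(2) by simp
      qed (use \<mu> in \<open>auto intro: fv.span_base\<close>)
    qed
  qed
  then have "t \<in> ?S" using VS[of P] P(1) t by blast
  moreover have "fv.span N = N" using submodD(1)[OF N] by simp
  moreover have "fv.span (monv ` (P - leads N)) = stdv (P - leads N)" using P(1) by (intro stdv_span) auto
  ultimately obtain x y where "t = x + y" "x \<in> N" "y \<in> stdv (P - leads N)"
    unfolding fv.span_Un by auto
  then show ?thesis using that[of y] by simp
qed

lemma irreducible_zero:
  assumes "r \<in> stdv (K - leads N)" "r \<in> N" shows "r = 0"
proof (rule ccontr)
  assume "r \<noteq> 0"
  then obtain \<mu> where \<mu>: "\<mu> \<in> K - leads N" "fst \<mu> \<in> supp n (r (snd \<mu>))"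
    "\<And>\<alpha> e. \<alpha> \<in> supp n (r e) \<Longrightarrow> (\<alpha>, e) = \<mu> \<or> prec (\<alpha>, e) \<mu>"
    using stdv_lead[OF assms(1)] by blast
  then have "has_lead r \<mu>" by (intro stdv_has_lead[OF assms(1)]) auto
  then show False using \<mu>(1) assms(2) by (auto simp: leads_def)
qed

lemma red_elem:
  assumes N: "submod N" and \<mu>: "\<mu> \<in> K" and lead: "\<mu> \<in> leads N"
  shows "red_elem N \<mu> \<in> N" "monv \<mu> - red_elem N \<mu> \<in> stdv (below \<mu> - leads N)"
proof -
  obtain s a where s: "s \<in> N" "a \<noteq> 0" "s - vscale a (monv \<mu>) \<in> V (below \<mu>)"
    using lead by (auto simp: leads_def has_lead_def)
  obtain r where r: "r \<in> stdv (below \<mu> - leads N)" "s - vscale a (monv \<mu>) - r \<in> N"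
    using reduce_mod[OF N below_subset below_closed[OF \<mu>] s(3)] by blast
  let ?t = "monv \<mu> + vscale (inverse a) r"
  have "vscale (inverse a) (s - (s - vscale a (monv \<mu>) - r)) \<in> N"
    by (intro fv.subspace_scale fv.subspace_diff submodD(1)[OF N] s(1) r(2))
  then have t1: "?t \<in> N" using s(2) by (simp add: fv.scale_right_distrib add.commute)
  have t2: "monv \<mu> - ?t \<in> stdv (below \<mu> - leads N)"
    using fv.subspace_neg[OF stdv_subspace fv.subspace_scale[OF stdv_subspace r(1)]] by simp
  have uniq: "t = ?t" if "t \<in> N \<and> monv \<mu> - t \<in> stdv (below \<mu> - leads N)" for t
  proof -
    have "(monv \<mu> - t) - (monv \<mu> - ?t) \<in> stdv (below \<mu> - leads N)"
      by (rule fv.subspace_diff[OF stdv_subspace _ t2]) (use that in blast)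
    then have "?t - t \<in> stdv (below \<mu> - leads N)" by (simp add: algebra_simps)
    moreover have "below \<mu> - leads N \<subseteq> K - leads N" using below_subset by blast
    ultimately have "?t - t \<in> stdv (K - leads N)" using stdv_mono by blast
    moreover have "?t - t \<in> N" using fv.subspace_diff[OF submodD(1)[OF N] t1] that by blast
    ultimately have "?t - t = 0" by (rule irreducible_zero)
    then show ?thesis by (simp only: right_minus_eq)
  qed
  show "red_elem N \<mu> \<in> N" "monv \<mu> - red_elem N \<mu> \<in> stdv (below \<mu> - leads N)"
    unfolding red_elem_def
    using theI[of "\<lambda>t. t \<in> N \<and> monv \<mu> - t \<in> stdv (below \<mu> - leads N)", OF conjI[OF t1 t2] uniq] by auto
qed

lemma red_elem_has_lead:
  assumes "submod N" "\<mu> \<in> leads N" shows "has_lead (red_elem N \<mu>) \<mu>"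
proof -
  have K: "\<mu> \<in> K" using assms by (auto simp: leads_def)
  have "monv \<mu> - red_elem N \<mu> \<in> V (below \<mu>)"
    using red_elem(2)[OF assms(1) K assms(2)] stdv_mono[of "below \<mu> - leads N" "below \<mu>"]
      stdv_span[OF below_subset] unfolding V_def using fv.span_mono[of "monv ` below \<mu>"] by blast
  from V_closed(3)[OF this, of "-1"]
  show ?thesis unfolding has_lead_def by (intro exI[of _ 1]) simp
qed

text \<open>Division: if the leading monomials of \<open>H\<close> divide all leading monomials of \<open>N\<close> outside \<open>Ld\<close>, leading terms of
  \<open>x\<close> can be removed one after the other.\<close>

lemma division:
  assumes N: "submod N" and H: "H \<subseteq> N" "\<And>h. h \<in> H \<Longrightarrow> has_lead h (ld h) \<and> ld h \<in> K"
    and dvd: "\<And>\<mu>. \<mu> \<in> leads N - Ld \<Longrightarrow> \<exists>h\<in>H. mdvd n (ld h) \<mu>"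
    and \<nu>: "\<nu> \<in> K" "x \<in> N" "x \<in> V (beneath \<nu>)"
  shows "x \<in> span_le H ld (beneath \<nu>)"
proof -
  have "\<forall>x. x \<in> N \<longrightarrow> x \<in> V (beneath \<nu>) \<longrightarrow> x \<in> span_le H ld (beneath \<nu>)"
    using \<nu>(1)
  proof (induction rule: prec_induct)
    case (less \<nu>)
    have low: "x \<in> span_le H ld (beneath \<nu>)" if x: "x \<in> N" "x \<in> V (below \<nu>)" for x
    proof -
      consider "x \<in> JE" | \<rho> where "\<rho> \<in> K" "\<rho> \<notin> Ld" "has_lead x \<rho>"
        using lead_cases[OF submodD(3)[OF N x(1)]] by blast
      then show ?thesis
      proof cases
        case 1 then show ?thesis by (rule span_le_closed(5))
      next
        case (2 \<rho>)
        have "prec \<rho> \<nu>" by (rule has_lead_prec[OF 2(3,1,2) x(2) less(1)])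
        then have "x \<in> span_le H ld (beneath \<rho>)" "beneath \<rho> \<subseteq> beneath \<nu>"
          using less 2 x(1) has_lead_beneath beneath_below below_beneath by blast+
        then show ?thesis using span_le_mono by blast
      qed
    qed
    show ?case
    proof (intro allI impI)
      fix x assume x: "x \<in> N" "x \<in> V (beneath \<nu>)"
      show "x \<in> span_le H ld (beneath \<nu>)"
      proof (cases "\<nu> \<in> leads N")
        case False
        then have "x \<in> V (below \<nu>)" using beneath_cases[OF x(2) less(1)] x(1) less(1) by (auto simp: leads_def)
        then show ?thesis using low x(1) by blast
      next
        case True
        show ?thesis
        proof (cases "\<nu> \<in> Ld")
          case True
          have "V (beneath \<nu>) \<subseteq> V (below \<nu>)"
            by (rule V_subset) (use beneath_eq[OF less(1)] True Ld_iff[OF less(1)] monv_V in auto)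
          then show ?thesis using low x by blast
        next
          case False
          then obtain h w where h: "h \<in> H" "letters w" "\<nu> = shift w (ld h)"
            using dvd[of \<nu>] True mdvd_words by blast
          let ?u = "lmul (word w) h"
          have "has_lead ?u \<nu>" using has_lead_lmul h H(2) by blast
          then obtain b where b: "x - vscale b ?u \<in> V (below \<nu>)"
            using has_lead_cancel x(2) less(1) by blast
          have "?u \<in> N" using h H(1) submodD(4)[OF N] by blast
          then have "x - vscale b ?u \<in> N"
            by (intro fv.subspace_diff fv.subspace_scale submodD(1)[OF N] x(1))
          then have "x - vscale b ?u \<in> span_le H ld (beneath \<nu>)" using low b by blast
          moreover have "vscale b ?u \<in> span_le H ld (beneath \<nu>)"
            by (intro span_le_closed(3,6) h) (use h less(1) in \<open>simp add: beneath_def\<close>)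
          ultimately show ?thesis using span_le_closed(1) by fastforce
        qed
      qed
    qed
  qed
  then show ?thesis using \<nu>(2,3) by blast
qed

end

context pbw_data
begin

section \<open>Submodules of the free module\<close>

abbreviation "A \<equiv> free_algebra n Quot J"

interpretation J: ideal J "free_algebra n" by (rule J_ideal)
interpretation A: ring A by (rule J.quotient_is_ring)

lemma A_simps:
  "f \<in> F \<Longrightarrow> g \<in> F \<Longrightarrow> coset f \<otimes>\<^bsub>A\<^esub> coset g = coset (f * g)"
  "f \<in> F \<Longrightarrow> g \<in> F \<Longrightarrow> coset f \<oplus>\<^bsub>A\<^esub> coset g = coset (f + g)"
  "\<zero>\<^bsub>A\<^esub> = coset 0" "f \<in> F \<Longrightarrow> coset f \<in> carrier A"
proof -
  note h = J.rcos_ring_hom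
  show "f \<in> F \<Longrightarrow> g \<in> F \<Longrightarrow> coset f \<otimes>\<^bsub>A\<^esub> coset g = coset (f * g)"
    using ring_hom_mult[OF h, of f g] by simp
  show "f \<in> F \<Longrightarrow> g \<in> F \<Longrightarrow> coset f \<oplus>\<^bsub>A\<^esub> coset g = coset (f + g)"
    using ring_hom_add[OF h, of f g] by simp
  show "f \<in> F \<Longrightarrow> coset f \<in> carrier A" by (rule ring_hom_closed[OF h])
  have "coset 0 = J" using in_coset[of _ 0] by auto
  then show "\<zero>\<^bsub>A\<^esub> = coset 0" by (simp add: FactRing_def)
qed

lemma carrier_A: "a \<in> carrier A \<Longrightarrow> \<exists>f\<in>F. a = coset f"
  by (auto simp: FactRing_def A_RCOSETS_def')

lemma Vecs_carrier: "t \<in> Vecs \<Longrightarrow> e \<in> E \<Longrightarrow> t e \<in> F" by (simp add: Vecs_def)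

lemma cls_ops:
  "s \<in> Vecs \<Longrightarrow> t \<in> Vecs \<Longrightarrow> (\<lambda>e\<in>E. cls s e \<oplus>\<^bsub>A\<^esub> cls t e) = cls (s + t)"
  "f \<in> F \<Longrightarrow> t \<in> Vecs \<Longrightarrow> (\<lambda>e\<in>E. coset f \<otimes>\<^bsub>A\<^esub> cls t e) = cls (lmul f t)"
  "f \<in> F \<Longrightarrow> t \<in> Vecs \<Longrightarrow> (\<lambda>e\<in>E. cls t e \<otimes>\<^bsub>A\<^esub> coset f) = cls (rmul t f)"
  "vzero A E = cls 0" "t \<in> Vecs \<Longrightarrow> cls t \<in> free_module A E"
  by (auto simp: cls_def A_simps Vecs_carrier vec_apply vzero_def free_module_def intro!: restrict_ext)

lemma free_module_cls:
  assumes "m \<in> free_module A E" obtains t where "t \<in> Vecs" "m = cls t"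
proof -
  have m: "m e \<in> carrier A" if "e \<in> E" for e using assms that by (auto simp: free_module_def)
  have "\<exists>f. f \<in> F \<and> m e = coset f" if "e \<in> E" for e using carrier_A[OF m[OF that]] by blast
  then obtain f where f: "\<And>e. e \<in> E \<Longrightarrow> f e \<in> F" "\<And>e. e \<in> E \<Longrightarrow> m e = coset (f e)" by metis
  let ?t = "\<lambda>e. if e \<in> E then f e else 0"
  have "?t \<in> Vecs" using f(1) by (auto simp: Vecs_def)
  moreover have "m = cls ?t"
  proof
    fix e show "m e = cls ?t e"
    proof (cases "e \<in> E")
      case True
      then show ?thesis using f(2) by (simp add: cls_def)
    next
      case False
      have "m \<in> E \<rightarrow>\<^sub>E carrier A" using assms by (simp only: free_module_def)
      from PiE_arb[OF this False] show ?thesis using False by (simp add: cls_def)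
    qed
  qed
  ultimately show ?thesis using that by blast
qed

text \<open>The representatives of the left submodule generated by \<open>G\<close>, or of the two-sided one if \<open>two\<close> holds.\<close>

definition "gen_vecs two G = fv.span (JE \<union>
  {lmul (word w) (rmul g (word w')) | w g w'. g \<in> G \<and> letters w \<and> letters w' \<and> (two \<or> w' = [])})"

text \<open>It suffices to consider products of generators with words.\<close>

lemma submodI:
  assumes "B \<subseteq> Vecs" "\<And>b w. b \<in> B \<Longrightarrow> letters w \<Longrightarrow> lmul (word w) b \<in> fv.span (JE \<union> B)"
  shows "submod (fv.span (JE \<union> B))"
proof -
  have "fv.span (JE \<union> B) \<subseteq> Vecs"
    using assms(1) JE_Vecs by (intro fv.span_minimal Vecs_subspace) auto
  moreover have "lmul (word w) t \<in> fv.span (JE \<union> B)" if "t \<in> fv.span (JE \<union> B)" "letters w" for t w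
  proof (rule fv_span_map[OF that(1)])
    fix y assume "y \<in> JE \<union> B"
    then show "lmul (word w) y \<in> fv.span (JE \<union> B)"
      using assms(2)[OF _ that(2)] JE_lmul[of y "word w"] that(2) by (auto intro: fv.span_base)
  qed (simp_all only: lmul_linear)
  ultimately show ?thesis unfolding submod_def by (auto intro: fv.span_base)
qed

lemma submod_gen: "G \<subseteq> Vecs \<Longrightarrow> submod (gen_vecs two G)"
  unfolding gen_vecs_def
proof (rule submodI)
  assume G: "G \<subseteq> Vecs"
  then show "{lmul (word w) (rmul g (word w')) | w g w'. g \<in> G \<and> letters w \<and> letters w' \<and> (two \<or> w' = [])} \<subseteq> Vecs"
    by (auto intro!: Vecs_lmul Vecs_rmul)
  fix b w assume "b \<in> {lmul (word w) (rmul g (word w')) | w g w'. g \<in> G \<and> letters w \<and> letters w' \<and> (two \<or> w' = [])}"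
    and w: "letters w"
  then obtain v g w' where b: "b = lmul (word v) (rmul g (word w'))" "g \<in> G" "letters v" "letters w'" "two \<or> w' = []"
    by blast
  then have "lmul (word w) b = lmul (word (w @ v)) (rmul g (word w'))" by (simp add: lmul_lmul falg_mult_simps)
  then show "lmul (word w) b \<in> fv.span (JE \<union> {lmul (word w) (rmul g (word w')) | w g w'. g \<in> G \<and> letters w \<and> letters w' \<and> (two \<or> w' = [])})"
    using b w by (intro fv.span_base UnI2 CollectI exI[of _ "w @ v"] exI[of _ g] exI[of _ w']) auto
qed

lemma gen_vecs_base: "g \<in> G \<Longrightarrow> g \<in> gen_vecs two G"
  unfolding gen_vecs_def
  by (intro fv.span_base UnI2 CollectI exI[of _ "[]"] exI[of _ g]) (simp add: falg_mult_simps lmul_one rmul_one)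

lemma lmul_submod: "submod N \<Longrightarrow> t \<in> N \<Longrightarrow> f \<in> F \<Longrightarrow> lmul f t \<in> N"
proof -
  assume N: "submod N" "t \<in> N" and f: "f \<in> F"
  note sub = submodD(1)[OF N(1)]
  show ?thesis unfolding lmul_expand[of f]
  proof (intro fv.subspace_sum[OF sub] fv.subspace_scale[OF sub])
    show "lmul (word w) t \<in> N" if "w \<in> keys f" for w
      using submodD(4)[OF N] that f by (simp add: carrier_free_algebra)
  qed
qed

lemma rmul_expand: "rmul t f = (\<Sum>w\<in>keys f. vscale (lookup f w) (rmul t (word w)))"
proof
  fix e
  have "t e * f = (\<Sum>w\<in>keys f. scalar (lookup f w) * (t e * word w))"
    by (subst falg_expand[of f]) (simp add: sum_distrib_left scalar_left_commute)
  then show "rmul t f e = (\<Sum>w\<in>keys f. vscale (lookup f w) (rmul t (word w))) e"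
    by (simp add: sum_fun_apply vec_apply)
qed

definition "rclosed N \<longleftrightarrow> (\<forall>t\<in>N. \<forall>w. letters w \<longrightarrow> rmul t (word w) \<in> N)"

lemma rmul_submod: "submod N \<Longrightarrow> rclosed N \<Longrightarrow> t \<in> N \<Longrightarrow> f \<in> F \<Longrightarrow> rmul t f \<in> N"
proof -
  assume N: "submod N" "rclosed N" "t \<in> N" and f: "f \<in> F"
  note sub = submodD(1)[OF N(1)]
  show ?thesis unfolding rmul_expand[of t f]
  proof (intro fv.subspace_sum[OF sub] fv.subspace_scale[OF sub])
    show "rmul t (word w) \<in> N" if "w \<in> keys f" for w
      using N(2,3) that f by (simp add: carrier_free_algebra rclosed_def)
  qed
qed

lemma rclosed_gen: "rclosed (gen_vecs True G)"
  unfolding rclosed_def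
proof (intro ballI allI impI)
  fix t v assume t: "t \<in> gen_vecs True G" and v: "letters v"
  show "rmul t (word v) \<in> gen_vecs True G"
    unfolding gen_vecs_def
  proof (rule fv_span_map[OF t[unfolded gen_vecs_def]])
    fix y assume "y \<in> JE \<union> {lmul (word w) (rmul g (word w')) | w g w'. g \<in> G \<and> letters w \<and> letters w' \<and> (True \<or> w' = [])}"
    then show "rmul y (word v) \<in> fv.span (JE \<union> {lmul (word w) (rmul g (word w')) | w g w'. g \<in> G \<and> letters w \<and> letters w' \<and> (True \<or> w' = [])})"
    proof
      assume "y \<in> JE"
      then show ?thesis using JE_rmul[of y "word v"] v by (intro fv.span_base UnI1) auto
    next
      assume "y \<in> {lmul (word w) (rmul g (word w')) | w g w'. g \<in> G \<and> letters w \<and> letters w' \<and> (True \<or> w' = [])}"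
      then obtain w g w' where y: "y = lmul (word w) (rmul g (word w'))" "g \<in> G" "letters w" "letters w'" by blast
      then have "rmul y (word v) = lmul (word w) (rmul g (word (w' @ v)))"
        by (simp add: rmul_lmul rmul_rmul falg_mult_simps)
      then show ?thesis using y v
        by (intro fv.span_base UnI2 CollectI exI[of _ w] exI[of _ g] exI[of _ "w' @ v"]) auto
    qed
  qed (simp_all only: rmul_linear)
qed

lemma left_submodule_cls:
  assumes N: "submod N" shows "left_submodule A E (cls ` N)"
  unfolding left_submodule_def
proof (intro conjI ballI)
  show "cls ` N \<subseteq> free_module A E" using cls_ops(5) submodD(3)[OF N] by blast
  show "vzero A E \<in> cls ` N" using cls_ops(4) fv.subspace_0[OF submodD(1)[OF N]] by simp
  show "(\<lambda>e\<in>E. u e \<oplus>\<^bsub>A\<^esub> v e) \<in> cls ` N" if uv: "u \<in> cls ` N" "v \<in> cls ` N" for u v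
  proof -
    obtain s t where st: "u = cls s" "v = cls t" "s \<in> N" "t \<in> N" using uv by blast
    then have "(\<lambda>e\<in>E. u e \<oplus>\<^bsub>A\<^esub> v e) = cls (s + t)" using cls_ops(1) submodD(3)[OF N] by simp
    then show ?thesis using fv.subspace_add[OF submodD(1)[OF N] st(3,4)] by blast
  qed
  show "(\<lambda>e\<in>E. a \<otimes>\<^bsub>A\<^esub> u e) \<in> cls ` N" if au: "a \<in> carrier A" "u \<in> cls ` N" for a u
  proof -
    obtain f t where ft: "a = coset f" "f \<in> F" "u = cls t" "t \<in> N" using au carrier_A by blast
    then have "(\<lambda>e\<in>E. a \<otimes>\<^bsub>A\<^esub> u e) = cls (lmul f t)" using cls_ops(2) submodD(3)[OF N] by simp
    then show ?thesis using lmul_submod[OF N ft(4,2)] by blast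
  qed
qed

lemma two_sided_submodule_cls:
  assumes N: "submod N" "rclosed N" shows "two_sided_submodule A E (cls ` N)"
  unfolding two_sided_submodule_def
proof (intro conjI ballI)
  show "left_submodule A E (cls ` N)" by (rule left_submodule_cls[OF N(1)])
  show "(\<lambda>e\<in>E. u e \<otimes>\<^bsub>A\<^esub> a) \<in> cls ` N" if au: "a \<in> carrier A" "u \<in> cls ` N" for a u
  proof -
    obtain f t where ft: "a = coset f" "f \<in> F" "u = cls t" "t \<in> N" using au carrier_A by blast
    then have "(\<lambda>e\<in>E. u e \<otimes>\<^bsub>A\<^esub> a) = cls (rmul t f)" using cls_ops(3) submodD(3)[OF N(1)] by simp
    then show ?thesis using rmul_submod[OF N ft(4,2)] by blast
  qed
qed

lemma cls_JE: "t \<in> JE \<Longrightarrow> cls t = cls 0"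
  using cls_eq_iff[of t 0] JE_Vecs fv.subspace_0[OF Vecs_subspace] by simp

lemma cls_gen_subset:
  assumes G: "G \<subseteq> Vecs" and M: "left_submodule A E M" "cls ` G \<subseteq> M"
    and two: "two \<Longrightarrow> two_sided_submodule A E M"
  shows "cls ` gen_vecs two G \<subseteq> M"
proof -
  have sub: "\<And>u v. u \<in> M \<Longrightarrow> v \<in> M \<Longrightarrow> (\<lambda>e\<in>E. u e \<oplus>\<^bsub>A\<^esub> v e) \<in> M"
    "\<And>a u. a \<in> carrier A \<Longrightarrow> u \<in> M \<Longrightarrow> (\<lambda>e\<in>E. a \<otimes>\<^bsub>A\<^esub> u e) \<in> M" "vzero A E \<in> M"
    using M(1) unfolding left_submodule_def by blast+
  let ?B = "{lmul (word w) (rmul g (word w')) | w g w'. g \<in> G \<and> letters w \<and> letters w' \<and> (two \<or> w' = [])}"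
  have B: "cls b \<in> M \<and> b \<in> Vecs" if "b \<in> JE \<union> ?B" for b
    using that
  proof
    assume "b \<in> JE" then show ?thesis using cls_JE sub(3) cls_ops(4) JE_Vecs by simp
  next
    assume "b \<in> ?B"
    then obtain w g w' where b: "b = lmul (word w) (rmul g (word w'))" "g \<in> G" "letters w" "letters w'"
      "two \<or> w' = []" by blast
    have g: "g \<in> Vecs" "cls g \<in> M" using b(2) G M(2) by auto
    have "cls (rmul g (word w')) \<in> M"
    proof (cases two)
      case True
      then have "(\<lambda>e\<in>E. cls g e \<otimes>\<^bsub>A\<^esub> coset (word w')) \<in> M"
        using two g(2) A_simps(4)[of "word w'"] b(4) unfolding two_sided_submodule_def by simp
      then show ?thesis using cls_ops(3)[of "word w'" g] b(4) g(1) by simp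
    next
      case False
      then show ?thesis using b(5) g by (simp add: falg_mult_simps rmul_one)
    qed
    moreover have gw: "rmul g (word w') \<in> Vecs" using g(1) b(4) by (intro Vecs_rmul) auto
    ultimately have "cls b \<in> M"
      using sub(2)[of "coset (word w)" "cls (rmul g (word w'))"] A_simps(4)[of "word w"] b(1,3)
        cls_ops(2)[of "word w" "rmul g (word w')"] by simp
    then show ?thesis using b gw by (auto intro!: Vecs_lmul)
  qed
  have "cls t \<in> M \<and> t \<in> Vecs" if "t \<in> gen_vecs two G" for t
    using that unfolding gen_vecs_def
  proof (induction rule: fv.span_induct_alt)
    case base
    then show ?case using sub(3) cls_ops(4) fv.subspace_0[OF Vecs_subspace] by simp
  next
    case (step a x y)
    have x: "cls x \<in> M" "x \<in> Vecs" using B[OF step(1)] by auto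
    have vx: "vscale a x = lmul (scalar a) x" by (simp add: vscale_def lmul_def)
    have "cls (lmul (scalar a) x) \<in> M"
      using sub(2)[OF A_simps(4)[of "scalar a"] x(1)] cls_ops(2)[of "scalar a" x] x(2) by simp
    moreover have sV: "lmul (scalar a) x \<in> Vecs" using x(2) by (intro Vecs_lmul) auto
    ultimately have "cls (lmul (scalar a) x + y) \<in> M"
      using sub(1) cls_ops(1)[of "lmul (scalar a) x" y] step(2) by fastforce
    then show ?case unfolding vx using fv.subspace_add[OF Vecs_subspace sV] step(2) by blast
  qed
  then show ?thesis by blast
qed

lemma left_hull:
  assumes "G \<subseteq> Vecs" shows "left_submodule A E hull (cls ` G) = cls ` gen_vecs False G"
proof (rule hull_unique)
  show "cls ` G \<subseteq> cls ` gen_vecs False G" using gen_vecs_base by blast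
  show "left_submodule A E (cls ` gen_vecs False G)" by (rule left_submodule_cls[OF submod_gen[OF assms]])
  show "cls ` gen_vecs False G \<subseteq> M" if "cls ` G \<subseteq> M" "left_submodule A E M" for M
    by (rule cls_gen_subset[OF assms that(2,1)]) simp
qed

lemma two_sided_hull:
  assumes "G \<subseteq> Vecs" shows "two_sided_submodule A E hull (cls ` G) = cls ` gen_vecs True G"
proof (rule hull_unique)
  show "cls ` G \<subseteq> cls ` gen_vecs True G" using gen_vecs_base by blast
  show "two_sided_submodule A E (cls ` gen_vecs True G)"
    by (rule two_sided_submodule_cls[OF submod_gen[OF assms] rclosed_gen])
  show "cls ` gen_vecs True G \<subseteq> M" if "cls ` G \<subseteq> M" "two_sided_submodule A E M" for M
    using cls_gen_subset[OF assms _ that(1)] that(2) by (simp add: two_sided_submodule_def)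
qed

section \<open>Bounded representations give Groebner bases\<close>

text \<open>Collecting the words that multiply the same \<open>h\<close> gives its coefficient.\<close>

lemma span_le_coeffs:
  assumes "finite H" "x \<in> span_le H ld P"
  shows "\<exists>b. (\<forall>h\<in>H. \<forall>w\<in>keys (b h). letters w \<and> shift w (ld h) \<in> P) \<and>
    x - (\<Sum>h\<in>H. lmul (b h) h) \<in> JE"
  using assms(2) unfolding span_le_def
proof (induction rule: fv.span_induct_alt)
  case base
  show ?case
    by (intro exI[of _ "\<lambda>_. 0"] conjI) (simp_all add: lmul_zero fv.subspace_0[OF JE_subspace])
next
  case (step a x y)
  then obtain b where b: "\<forall>h\<in>H. \<forall>w\<in>keys (b h). letters w \<and> shift w (ld h) \<in> P"
    "y - (\<Sum>h\<in>H. lmul (b h) h) \<in> JE" by blast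
  from step(1) show ?case
  proof
    assume "x \<in> JE"
    then have "vscale a x + (y - (\<Sum>h\<in>H. lmul (b h) h)) \<in> JE"
      by (intro fv.subspace_add[OF JE_subspace] fv.subspace_scale[OF JE_subspace] b(2))
    then show ?thesis using b(1) by (intro exI[of _ b]) (simp add: algebra_simps)
  next
    assume "x \<in> {lmul (word w) h |w h. h \<in> H \<and> letters w \<and> shift w (ld h) \<in> P}"
    then obtain w h where wh: "x = lmul (word w) h" "h \<in> H" "letters w" "shift w (ld h) \<in> P" by blast
    define b' where "b' = b(h := b h + scalar a * word w)"
    have "\<forall>g\<in>H. \<forall>u\<in>keys (b' g). letters u \<and> shift u (ld g) \<in> P"
    proof (intro ballI)
      fix g u assume g: "g \<in> H" "u \<in> keys (b' g)"
      then have "u \<in> keys (b g) \<or> g = h \<and> u = w"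
        using keys_add[of "b h" "scalar a * word w"]
        by (auto simp: b'_def falg_mult_simps split: if_splits)
      then show "letters u \<and> shift u (ld g) \<in> P" using b(1) g(1) wh by blast
    qed
    moreover have "(\<Sum>g\<in>H. lmul (b' g) g) = (\<Sum>g\<in>H. lmul (b g) g + (if g = h then vscale a x else 0))"
      by (intro sum.cong) (simp_all add: b'_def lmul_add lmul_scalar wh(1))
    then have "(\<Sum>g\<in>H. lmul (b' g) g) = (\<Sum>g\<in>H. lmul (b g) g) + vscale a x"
      using assms(1) wh(2) by (simp add: sum.distrib sum.delta)
    then have "(vscale a x + y) - (\<Sum>g\<in>H. lmul (b' g) g) \<in> JE"
      using b(2) by (simp add: algebra_simps)
    ultimately show ?thesis by blast
  qed
qed

text \<open>The normal form of \<open>f\<close> involves only monomials that are not larger than the words in \<open>f\<close>; translation by the leading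
  exponent of \<open>h\<close> preserves this.\<close>

lemma term_lec_bound:
  assumes h: "has_lead h (ld h)" "ld h \<in> K" "ld h \<notin> Ld" and \<nu>: "\<nu> \<in> K"
    and f: "\<And>w. w \<in> keys f \<Longrightarrow> letters w \<and> shift w (ld h) \<in> beneath \<nu>"
  shows "preceq prec (term_lec n E I prec (coset f) (cls h)) (Some \<nu>)"
proof -
  obtain \<alpha> e where l: "ld h = (\<alpha>, e)" by (cases "ld h")
  have e: "e \<in> E" "\<alpha> \<in> expos n" using h(2) l by auto
  have lec: "lec n E I prec (cls h) = Some (\<alpha>, e)" using lec_has_lead[OF h(2,3,1)] l by simp
  let ?P = "\<Union>w\<in>keys f. beneath (exw w, e)"
  have Kw: "(exw w, e) \<in> K" if "w \<in> keys f" for w using f[OF that] e by simp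
  have P: "?P \<subseteq> K" using beneath_subset by blast
  have "emb e f \<in> V ?P"
    unfolding emb_expand[of e f]
  proof (intro V_closed)
    fix w assume w: "w \<in> keys f"
    then have "emb e (word w) \<in> V (beneath (exw w, e))"
      using has_lead_beneath[OF word_has_lead[OF e(1)] Kw[OF w]] f by blast
    moreover have "beneath (exw w, e) \<subseteq> ?P" using w by blast
    ultimately show "emb e (word w) \<in> V ?P" using V_mono by blast
  qed
  moreover have "below \<mu> \<subseteq> ?P" if "\<mu> \<in> ?P" for \<mu>
    using that beneath_closed Kw by blast
  ultimately obtain r where r: "r \<in> stdv (?P - Ld)" "emb e f - r \<in> JE" using normal_form[OF P] by blast
  have "f - r e \<in> J" using r(2) e(1) by (auto simp: JE_def vec_apply)
  moreover have "r \<in> stdv (K - Ld)" using r(1) stdv_mono[of "?P - Ld" "K - Ld"] P by blast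
  ultimately have tau: "tau n (induced prec e) (I e) (coset f) = r e" using tau_coset e(1) by blast
  show ?thesis
  proof (cases "le n (induced prec e) (r e)")
    case None
    then show ?thesis by (simp add: term_lec_def lec le_comp_def tau)
  next
    case (Some \<gamma>)
    then have "supp n (r e) \<noteq> {}" by (auto simp: le_def lead_def split: if_splits)
    then have "\<gamma> \<in> supp n (r e)" using le_supp_prec(2)[OF e(1) Some] by blast
    then have "(\<gamma>, e) \<in> ?P - Ld" using stdv_supp[OF r(1)] P by blast
    then obtain w where w: "w \<in> keys f" "(\<gamma>, e) \<in> beneath (exw w, e)" by blast
    have \<gamma>: "\<gamma> \<in> expos n" using w(2) by (auto simp: beneath_def)
    have sh: "(\<alpha> + exw w, e) \<in> beneath \<nu>" using f[OF w(1)] l by (simp add: shift_def)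
    have "\<gamma> = exw w \<or> prec (\<gamma> + \<alpha>, e) (exw w + \<alpha>, e)"
      using w(2) add_mono_prec[of \<gamma> e "exw w" \<alpha>] e Kw[OF w(1)] by (auto simp: beneath_def)
    then have "(\<alpha> + \<gamma>, e) \<in> beneath \<nu>"
      using sh beneath_closed[OF \<nu> sh] \<gamma> e by (auto simp: below_def ac_simps)
    then show ?thesis using Some by (auto simp: term_lec_def lec le_comp_def tau beneath_def)
  qed
qed

lemma finsum_coset:
  "finite S \<Longrightarrow> (\<And>s. s \<in> S \<Longrightarrow> f s \<in> F) \<Longrightarrow> (\<Oplus>\<^bsub>A\<^esub>s\<in>S. coset (f s)) = coset (\<Sum>s\<in>S. f s)"
proof (induction S rule: finite_induct)
  case empty
  then show ?case by (simp add: A_simps)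
next
  case (insert x S)
  then have "(\<Oplus>\<^bsub>A\<^esub>s\<in>insert x S. coset (f s)) = coset (f x) \<oplus>\<^bsub>A\<^esub> (\<Oplus>\<^bsub>A\<^esub>s\<in>S. coset (f s))"
    by (intro A.finsum_insert) (auto simp: A_simps)
  then show ?case using insert by (simp add: A_simps)
qed

text \<open>For \<open>x\<close> with leading monomial \<open>\<mu>\<close> outside \<open>Ld\<close> a representation bounded by \<open>\<mu>\<close> is what the definition asks for;
  if \<open>x\<close> represents zero, all coefficients are zero.\<close>

theorem groebner_basis_cls:
  assumes H: "finite H" "lead_system H ld" "inj_on ld H" "\<And>h. h \<in> H \<Longrightarrow> ld h \<notin> Ld" "H \<subseteq> N"
    and N: "submod N" and rep: "\<And>x \<mu>. x \<in> N \<Longrightarrow> \<mu> \<in> K \<Longrightarrow> x \<in> V (beneath \<mu>) \<Longrightarrow> x \<in> span_le H ld (beneath \<mu>)"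
  shows "groebner_basis n A E I prec (cls ` N) (cls ` H)"
  unfolding groebner_basis_def
proof (intro conjI ballI)
  show "left_submodule A E (cls ` N)" by (rule left_submodule_cls[OF N])
  show "finite (cls ` H)" using H(1) by simp
  show "cls ` H \<subseteq> cls ` N" using H(5) by blast
  have lecH: "lec n E I prec (cls h) = Some (ld h)" if "h \<in> H" for h
    by (rule lec_has_lead[OF lead_systemD(2)[OF H(2) that] H(4)[OF that] lead_systemD(3)[OF H(2) that]])
  have inj: "inj_on cls H"
    by (rule inj_onI) (metis H(3) inj_onD lecH option.inject)
  fix m assume "m \<in> cls ` N"
  then obtain x where x: "x \<in> N" "m = cls x" by blast
  have xV: "x \<in> Vecs" using submodD(3)[OF N x(1)] .
  have main: "\<exists>a\<in>cls ` H \<rightarrow> carrier A. m = (\<lambda>e\<in>E. \<Oplus>\<^bsub>A\<^esub>g\<in>cls ` H. a g \<otimes>\<^bsub>A\<^esub> g e) \<and>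
      (\<forall>g\<in>cls ` H. preceq prec (term_lec n E I prec (a g) g) (lec n E I prec m))"
    if b: "\<And>h w. h \<in> H \<Longrightarrow> w \<in> keys (b h) \<Longrightarrow> letters w" "x - (\<Sum>h\<in>H. lmul (b h) h) \<in> JE"
      and bound: "\<And>h. h \<in> H \<Longrightarrow> preceq prec (term_lec n E I prec (coset (b h)) (cls h)) (lec n E I prec m)"
    for b
  proof -
    define a where "a g = coset (b (inv_into H cls g))" for g
    have bF: "b h \<in> F" if "h \<in> H" for h using b(1)[OF that] by (simp add: carrier_free_algebra)
    have a: "a (cls h) = coset (b h)" if "h \<in> H" for h
      using that inj by (simp add: a_def)
    have "a \<in> cls ` H \<rightarrow> carrier A" using a bF A_simps(4) by auto
    moreover have "m = (\<lambda>e\<in>E. \<Oplus>\<^bsub>A\<^esub>g\<in>cls ` H. a g \<otimes>\<^bsub>A\<^esub> g e)"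
    proof -
      let ?y = "\<Sum>h\<in>H. lmul (b h) h"
      have yV: "?y \<in> Vecs"
        by (intro fv.subspace_sum Vecs_subspace Vecs_lmul bF lead_systemD(1)[OF H(2)])
      have "m = cls ?y" using x(2) cls_eq_iff[OF xV yV] b(2) by blast
      also have "\<dots> = (\<lambda>e\<in>E. \<Oplus>\<^bsub>A\<^esub>g\<in>cls ` H. a g \<otimes>\<^bsub>A\<^esub> g e)"
        unfolding cls_def[of ?y]
      proof (rule restrict_ext)
        fix e assume e: "e \<in> E"
        have hF: "h e \<in> F" if "h \<in> H" for h using lead_systemD(1)[OF H(2) that] e by (simp add: Vecs_def)
        have eq: "a (cls h) \<otimes>\<^bsub>A\<^esub> cls h e = coset (b h * h e)" if "h \<in> H" for h
          using a[OF that] A_simps(1)[OF bF[OF that] hF[OF that]] e by (simp add: cls_def)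
        have "(\<Oplus>\<^bsub>A\<^esub>g\<in>cls ` H. a g \<otimes>\<^bsub>A\<^esub> g e) = (\<Oplus>\<^bsub>A\<^esub>h\<in>H. a (cls h) \<otimes>\<^bsub>A\<^esub> cls h e)"
          by (rule A.finsum_reindex[OF _ inj]) (use eq bF hF A_simps(4) in auto)
        also have "\<dots> = (\<Oplus>\<^bsub>A\<^esub>h\<in>H. coset (b h * h e))"
          by (rule A.finsum_cong') (use eq bF hF A_simps(4) in auto)
        also have "\<dots> = coset (\<Sum>h\<in>H. b h * h e)"
          by (rule finsum_coset[OF H(1)]) (use bF hF in auto)
        finally show "coset (?y e) = (\<Oplus>\<^bsub>A\<^esub>g\<in>cls ` H. a g \<otimes>\<^bsub>A\<^esub> g e)"
          by (simp add: sum_fun_apply lmul_apply)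
      qed
      finally show ?thesis .
    qed
    moreover have "\<forall>g\<in>cls ` H. preceq prec (term_lec n E I prec (a g) g) (lec n E I prec m)"
      using bound a by auto
    ultimately show ?thesis by blast
  qed
  consider "x \<in> JE" | \<mu> where "\<mu> \<in> K" "\<mu> \<notin> Ld" "has_lead x \<mu>" using lead_cases[OF xV] by blast
  then show "\<exists>a\<in>cls ` H \<rightarrow> carrier A. m = (\<lambda>e\<in>E. \<Oplus>\<^bsub>A\<^esub>g\<in>cls ` H. a g \<otimes>\<^bsub>A\<^esub> g e) \<and>
      (\<forall>g\<in>cls ` H. preceq prec (term_lec n E I prec (a g) g) (lec n E I prec m))"
  proof cases
    case 1
    show ?thesis
    proof (rule main[of "\<lambda>_. 0"])
      fix h assume h: "h \<in> H"
      have z: "0 \<in> stdv (K - Ld)" by (rule fv.subspace_0[OF stdv_subspace])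
      have eE: "snd (ld h) \<in> E" using lead_systemD(2)[OF H(2) h] by (auto simp: mem_Times_iff)
      have "tau n (induced prec (snd (ld h))) (I (snd (ld h))) (coset 0) = 0"
        using tau_coset[OF z eE, of 0] by (simp add: vec_apply J_closed)
      then show "preceq prec (term_lec n E I prec (coset 0) (cls h)) (lec n E I prec m)"
        by (cases "ld h") (simp add: term_lec_def lecH[OF h] le_comp_def le_def lead_def supp_def)
    qed (use 1 in \<open>auto simp: lmul_zero\<close>)
  next
    case (2 \<mu>)
    have lm: "lec n E I prec m = Some \<mu>" using lec_has_lead[OF 2] x(2) by simp
    have "x \<in> span_le H ld (beneath \<mu>)" using rep[OF x(1) 2(1) has_lead_beneath[OF 2(3,1)]] .
    then obtain b where b: "\<forall>h\<in>H. \<forall>w\<in>keys (b h). letters w \<and> shift w (ld h) \<in> beneath \<mu>"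
      "x - (\<Sum>h\<in>H. lmul (b h) h) \<in> JE" using span_le_coeffs[OF H(1)] by blast
    show ?thesis
    proof (rule main[OF _ b(2)])
      fix h assume h: "h \<in> H"
      then show "preceq prec (term_lec n E I prec (coset (b h)) (cls h)) (lec n E I prec m)"
        unfolding lm using b(1) lead_systemD[OF H(2) h] H(4)[OF h] 2(1) by (intro term_lec_bound) auto
    qed (use b(1) in blast)
  qed
qed

theorem reduced_groebner_basis_cls:
  assumes H: "finite H" "lead_system H ld" "inj_on ld H" "\<And>h. h \<in> H \<Longrightarrow> ld h \<notin> Ld" "H \<subseteq> N"
    and N: "submod N" and rep: "\<And>x \<mu>. x \<in> N \<Longrightarrow> \<mu> \<in> K \<Longrightarrow> x \<in> V (beneath \<mu>) \<Longrightarrow> x \<in> span_le H ld (beneath \<mu>)"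
    and red: "\<And>h. h \<in> H \<Longrightarrow> h \<in> stdv (K - Ld)"
      "\<And>h. h \<in> H \<Longrightarrow> lookup (h (snd (ld h))) (std_word n (fst (ld h))) = 1"
      "\<And>h h' \<alpha> e. h \<in> H \<Longrightarrow> h' \<in> H \<Longrightarrow> h \<noteq> h' \<Longrightarrow> \<alpha> \<in> supp n (h e) \<Longrightarrow> \<not> mdvd n (ld h') (\<alpha>, e)"
  shows "reduced_groebner_basis n A E I prec (cls ` N) (cls ` H)"
  unfolding reduced_groebner_basis_def
proof (intro conjI)
  show "groebner_basis n A E I prec (cls ` N) (cls ` H)" by (rule groebner_basis_cls[OF H N rep])
  have lecH: "lec n E I prec (cls h) = Some (ld h)" if "h \<in> H" for h
    by (rule lec_has_lead[OF lead_systemD(2)[OF H(2) that] H(4)[OF that] lead_systemD(3)[OF H(2) that]])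
  have "0 \<in> JE" by (rule fv.subspace_0[OF JE_subspace])
  then have "lec n E I prec (vzero A E) = None" using lec_JE cls_ops(4) by simp
  then show "vzero A E \<notin> cls ` H" using lecH by force
  have vt: "vtau n E I prec (cls h) = (\<lambda>e\<in>E. h e)" "vsupp n E (vtau n E I prec (cls h)) = {(\<alpha>, e). \<alpha> \<in> supp n (h e)}"
    if "h \<in> H" for h
    using vtau_cls[OF red(1)[OF that], of h] vsupp_cls[OF red(1)[OF that], of h] fv.subspace_0[OF JE_subspace] by auto
  show "\<forall>g\<in>cls ` H. lc n E I prec g = 1"
  proof
    fix g assume "g \<in> cls ` H"
    then obtain h where h: "h \<in> H" "g = cls h" by blast
    have "snd (ld h) \<in> E" using lead_systemD(2)[OF H(2) h(1)] by (auto simp: mem_Times_iff)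
    then show "lc n E I prec g = 1" using red(2)[OF h(1)] h
      by (cases "ld h") (simp add: lc_def lecH vt)
  qed
  show "\<forall>g\<in>cls ` H. \<forall>(\<alpha>, e)\<in>vsupp n E (vtau n E I prec g). \<forall>g'\<in>cls ` H - {g}. \<forall>\<gamma>\<in>expos n.
        Some (\<alpha>, e) \<noteq> add_lec (Some \<gamma>) (lec n E I prec g')"
  proof (intro ballI, clarify)
    fix h \<alpha> e h' \<gamma>
    assume h: "h \<in> H" "(\<alpha>, e) \<in> vsupp n E (vtau n E I prec (cls h))" "h' \<in> H" "cls h' \<noteq> cls h" "\<gamma> \<in> expos n"
      "Some (\<alpha>, e) = add_lec (Some \<gamma>) (lec n E I prec (cls h'))"
    have "mdvd n (ld h') (\<alpha>, e)"
      using h(5,6) lecH[OF h(3)] by (cases "ld h'") (auto simp: mdvd_def)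
    moreover have "\<alpha> \<in> supp n (h e)" using h(2) vt(2)[OF h(1)] by simp
    ultimately show False using red(3)[OF h(1,3)] h(4) by blast
  qed
qed

section \<open>The ideal of relations as a span\<close>

text \<open>The elements whose images lie in the span on the right form an ideal that contains the relations.\<close>

lemma JE_span:
  "JE = fv.span {emb e (word w * f * word w') | e w f w'. e \<in> E \<and> letters w \<and> letters w' \<and>
     f \<in> I e \<union> comm_rels n (c e) (d e)}" (is "_ = fv.span ?B")
proof
  have rel: "I e \<union> comm_rels n (c e) (d e) \<subseteq> F" "J = Idl\<^bsub>free_algebra n\<^esub> (I e \<union> comm_rels n (c e) (d e))"
    if "e \<in> E" for e
  proof -
    have cs: "commutation_system n (c e) (d e) (induced prec e)" "I e \<subseteq> std_polys n"
      using datum[OF that] by (auto simp: pbw_datum_def)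
    then show "I e \<union> comm_rels n (c e) (d e) \<subseteq> F"
      unfolding commutation_system_def comm_rels_def
      using std_polys_carrier by (auto intro!: comm_rel_carrier)
    show "J = Idl\<^bsub>free_algebra n\<^esub> (I e \<union> comm_rels n (c e) (d e))"
      using J_eq[OF that] by (simp add: defining_ideal_def)
  qed
  have relJ: "f \<in> J" if "e \<in> E" "f \<in> I e \<union> comm_rels n (c e) (d e)" for e f
    using ring.genideal_self[OF ring_free_algebra rel(1)[OF that(1)]] rel(2)[OF that(1)] that(2) by blast
  show "fv.span ?B \<subseteq> JE"
  proof (rule fv.span_minimal[OF _ JE_subspace], rule subsetI)
    fix y assume "y \<in> ?B"
    then obtain e w g w' where y: "y = emb e (word w * g * word w')" "e \<in> E" "letters w" "letters w'"
      "g \<in> I e \<union> comm_rels n (c e) (d e)" by blast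
    have "word w * g * word w' \<in> J" using relJ[OF y(2,5)] y(3,4) by (intro J_closed) simp_all
    then show "y \<in> JE" unfolding y(1) by (rule emb_JE[OF y(2)])
  qed
  show "JE \<subseteq> fv.span ?B"
  proof
    fix t assume t: "t \<in> JE"
    have "emb e f \<in> fv.span ?B" if e: "e \<in> E" and f: "f \<in> J" for e f
    proof -
      let ?I = "{f \<in> F. emb e f \<in> fv.span ?B}"
      have wl: "emb e (word v * f * word v') \<in> fv.span ?B"
        if "emb e f \<in> fv.span ?B" "letters v" "letters v'" for f v v'
      proof -
        have "lmul (word v) (rmul (emb e f) (word v')) \<in> fv.span ?B"
        proof (rule fv_span_map[OF that(1), of "\<lambda>t. lmul (word v) (rmul t (word v'))"])
          fix y assume "y \<in> ?B"
          then obtain e' w g w' where y: "y = emb e' (word w * g * word w')" "e' \<in> E" "letters w" "letters w'"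
            "g \<in> I e' \<union> comm_rels n (c e') (d e')" by blast
          have "lmul (word v) (rmul y (word v')) = emb e' (word (v @ w) * g * word (w' @ v'))"
            by (simp add: y(1) rmul_emb lmul_emb mult.assoc flip: falg_mult_simps(1))
          then show "lmul (word v) (rmul y (word v')) \<in> fv.span ?B"
            using y that(2,3)
            by (intro fv.span_base CollectI exI[of _ e'] exI[of _ "v @ w"] exI[of _ g] exI[of _ "w' @ v'"]) auto
        qed (simp_all only: lmul_linear rmul_linear)
        then show ?thesis by (simp add: rmul_emb lmul_emb mult.assoc)
      qed
      have ml: "emb e (g * f) \<in> fv.span ?B" if "emb e f \<in> fv.span ?B" "g \<in> F" for f g
      proof -
        have "emb e (g * f) = lmul g (emb e f)" by (simp add: lmul_emb)
        also have "\<dots> \<in> fv.span ?B" unfolding lmul_expand[of g]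
        proof (intro fv.span_sum fv.span_scale)
          fix w assume "w \<in> keys g"
          then show "lmul (word w) (emb e f) \<in> fv.span ?B"
            using wl[OF that(1), of w "[]"] that(2) by (auto simp: lmul_emb falg_mult_simps carrier_free_algebra)
        qed
        finally show ?thesis .
      qed
      have mr: "emb e (f * g) \<in> fv.span ?B" if "emb e f \<in> fv.span ?B" "g \<in> F" for f g
      proof -
        have "emb e (f * g) = rmul (emb e f) g" by (simp add: rmul_emb)
        also have "\<dots> \<in> fv.span ?B" unfolding rmul_expand[of _ g]
        proof (intro fv.span_sum fv.span_scale)
          fix w assume "w \<in> keys g"
          then show "rmul (emb e f) (word w) \<in> fv.span ?B"
            using wl[OF that(1), of "[]" w] that(2) by (auto simp: rmul_emb falg_mult_simps carrier_free_algebra)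
        qed
        finally show ?thesis .
      qed
      have "ideal ?I (free_algebra n)"
      proof (rule idealI[OF ring_free_algebra])
        show "subgroup ?I (add_monoid (free_algebra n))"
        proof (rule group.subgroupI)
          show "Group.group (add_monoid (free_algebra n))"
            using abelian_group.a_group[OF ring.is_abelian_group[OF ring_free_algebra]] .
          show "?I \<noteq> {}" using fv.span_zero by (auto simp: emb_linear intro!: exI[of _ 0])
          fix a assume a: "a \<in> ?I"
          have "emb e (- a) = - emb e a" using emb_linear(3)[of e 0 a] by (simp add: emb_linear(4))
          then have "- a \<in> ?I" using a by (simp add: fv.span_neg)
          then show "inv\<^bsub>add_monoid (free_algebra n)\<^esub> a \<in> ?I"
            using a_inv_free_algebra[of a n] a unfolding a_inv_def by simp
        qed (auto simp: emb_linear fv.span_add)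
      qed (use ml mr in auto)
      moreover have "I e \<union> comm_rels n (c e) (d e) \<subseteq> ?I"
      proof
        fix g assume g: "g \<in> I e \<union> comm_rels n (c e) (d e)"
        have "emb e g \<in> ?B" using e g
          by (intro CollectI exI[of _ e] exI[of _ "[]"] exI[of _ g]) (simp add: falg_mult_simps)
        then have "emb e g \<in> fv.span ?B" by (rule fv.span_base)
        then show "g \<in> ?I" using rel(1)[OF e] g by blast
      qed
      ultimately have "Idl\<^bsub>free_algebra n\<^esub> (I e \<union> comm_rels n (c e) (d e)) \<subseteq> ?I"
        by (rule ring.genideal_minimal[OF ring_free_algebra])
      then have "J \<subseteq> ?I" by (simp only: rel(2)[OF e])
      then show ?thesis using f by blast
    qed
    then have "(\<Sum>e\<in>E. emb e (t e)) \<in> fv.span ?B"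
      using t by (intro fv.span_sum) (auto simp: JE_def)
    then show "t \<in> fv.span ?B" using vec_expand[of t] t by (simp add: JE_def)
  qed
qed

end

section \<open>The algorithm\<close>

text \<open>A key is a position in the list of indices together with a word; a row is a sparse vector over keys. The input
  consists of \<open>n\<close>, for each index the relations \<open>(i, j, c\<^sub>i\<^sub>j, d\<^sub>i\<^sub>j)\<close> and the ideal generators, and the
  elements of \<open>G\<close> as lists of components.\<close>

type_synonym 'k row = "('k \<times> nat \<times> nat list) list"
type_synonym 'k poly = "('k \<times> nat list) list"
type_synonym 'k relation = "nat \<times> nat \<times> 'k \<times> 'k poly"
type_synonym 'k input = "nat \<times> ('k relation list \<times> 'k poly list) list \<times> 'k poly list list"

abbreviation "enc_word \<equiv> enc_list Num"
abbreviation "enc_key \<equiv> enc_pair Num enc_word"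
abbreviation "enc_row \<equiv> enc_list (enc_pair Scal enc_key)"
abbreviation "enc_poly \<equiv> enc_list (enc_pair Scal enc_word)"
abbreviation "enc_relation \<equiv> enc_pair Num (enc_pair Num (enc_pair Scal enc_poly))"
abbreviation "enc_data \<equiv> enc_list (enc_pair (enc_list enc_relation) (enc_list enc_poly))"
abbreviation "enc_input \<equiv> enc_pair Num (enc_pair enc_data (enc_list (enc_list enc_poly)))"


definition occ :: "nat \<Rightarrow> nat list \<Rightarrow> nat" where
  "occ i w = fold (\<lambda>x a. if x = i then Suc a else a) w 0"

definition mcounts :: "nat \<Rightarrow> nat \<times> nat list \<Rightarrow> nat list \<times> nat" where
  "mcounts n k = (map (\<lambda>i. occ i (snd k)) [0..<n], fst k)"

text \<open>Phrased through codes, since the comparison is answered for coded monomials.\<close>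

definition mono_less :: "('k val \<Rightarrow> bool) \<Rightarrow> nat \<Rightarrow> nat \<times> nat list \<Rightarrow> nat \<times> nat list \<Rightarrow> bool" where
  "mono_less Q n k k' \<longleftrightarrow> Q (enc_pair (enc_pair enc_word Num) (enc_pair enc_word Num) (mcounts n k, mcounts n k'))"

text \<open>A word over \<open>n\<close> letters is standard if it equals its own sorted rearrangement.\<close>

definition is_std :: "nat \<Rightarrow> nat \<times> nat list \<Rightarrow> bool" where
  "is_std n k \<longleftrightarrow> concat (map (\<lambda>i. filter (\<lambda>x. x = i) (snd k)) [0..<n]) = snd k"

text \<open>All standard keys are smaller than all others, which are not distinguished. The elimination proceeds
  from large to small keys, so that rows with standard pivots contain standard monomials only.\<close>

definition key_less :: "('k val \<Rightarrow> bool) \<Rightarrow> nat \<Rightarrow> nat \<times> nat list \<Rightarrow> nat \<times> nat list \<Rightarrow> bool" where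
  "key_less Q n k k' \<longleftrightarrow> is_std n k \<and> (\<not> is_std n k' \<or> mono_less Q n k k')"

definition key_insert :: "('k val \<Rightarrow> bool) \<Rightarrow> nat \<Rightarrow> nat \<times> nat list \<Rightarrow> (nat \<times> nat list) list \<Rightarrow> (nat \<times> nat list) list" where
  "key_insert Q n k l = filter (\<lambda>y. key_less Q n k y) l @ k # filter (\<lambda>y. \<not> key_less Q n k y) l"

definition key_sort :: "('k val \<Rightarrow> bool) \<Rightarrow> nat \<Rightarrow> (nat \<times> nat list) list \<Rightarrow> (nat \<times> nat list) list" where
  "key_sort Q n ks = fold (\<lambda>k l. key_insert Q n k l) ks []"

text \<open>For each letter, as many copies are removed from the occurrences in \<open>u\<close> as there are in \<open>w\<close>.\<close>

definition word_minus :: "nat \<Rightarrow> nat list \<Rightarrow> nat list \<Rightarrow> nat list" where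
  "word_minus n u w = concat (map (\<lambda>i. fold (\<lambda>_ v. tl v) (filter (\<lambda>x. x = i) w) (filter (\<lambda>x. x = i) u)) [0..<n])"

definition kdvd :: "nat \<Rightarrow> nat \<times> nat list \<Rightarrow> nat \<times> nat list \<Rightarrow> bool" where
  "kdvd n l k \<longleftrightarrow> fst l = fst k \<and> word_minus n (snd l) (snd k) = []"

text \<open>All words of length at most \<open>N\<close>, possibly repeated.\<close>

definition words :: "nat \<Rightarrow> nat \<Rightarrow> nat list list" where
  "words n N = rec_nat [[]] (\<lambda>_ W. W @ concat (map (\<lambda>w. map (\<lambda>i. i # w) [0..<n]) W)) N"

definition poly_row :: "nat \<Rightarrow> 'k poly \<Rightarrow> 'k row" where
  "poly_row p f = map (\<lambda>t. (fst t, p, snd t)) f"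

definition rel_poly :: "('k::field) relation \<Rightarrow> 'k poly" where
  "rel_poly r = (1, [fst (snd r), fst r]) # (- fst (snd (snd r)), [fst r, fst (snd r)]) #
     smul (- 1) (snd (snd (snd r)))"

definition ideal_rows :: "(('k::field) relation list \<times> 'k poly list) list \<Rightarrow> 'k row list" where
  "ideal_rows ds = concat (map (\<lambda>t. map (\<lambda>f. poly_row (fst t) f) (snd (snd t))) (List.enumerate 0 ds))"

definition relation_rows :: "(('k::field) relation list \<times> 'k poly list) list \<Rightarrow> 'k row list" where
  "relation_rows ds = concat (map (\<lambda>t. map (\<lambda>r. poly_row (fst t) (rel_poly r)) (fst (snd t))) (List.enumerate 0 ds))"

definition vec_row :: "'k poly list \<Rightarrow> 'k row" where
  "vec_row g = concat (map (\<lambda>t. poly_row (fst t) (snd t)) (List.enumerate 0 g))"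

definition mul_row :: "nat list \<Rightarrow> 'k row \<Rightarrow> nat list \<Rightarrow> 'k row" where
  "mul_row w v w' = map (\<lambda>t. (fst t, fst (snd t), w @ snd (snd t) @ w')) v"

definition products :: "nat list list \<Rightarrow> nat list list \<Rightarrow> 'k row \<Rightarrow> 'k row list" where
  "products W W' v = concat (map (\<lambda>w. map (\<lambda>w'. mul_row w v w') W') W)"

definition J_rows :: "nat list list \<Rightarrow> (('k::field) relation list \<times> 'k poly list) list \<Rightarrow> 'k row list" where
  "J_rows W ds = concat (map (\<lambda>v. products W W v) (relation_rows ds @ ideal_rows ds))"

definition gen_rows :: "bool \<Rightarrow> nat list list \<Rightarrow> 'k poly list list \<Rightarrow> 'k row list" where
  "gen_rows two W gs = concat (map (\<lambda>g. products W (if two then W else [[]]) (vec_row g)) gs)"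

definition lead_rows :: "(('k::field) val \<Rightarrow> bool) \<Rightarrow> nat \<Rightarrow> 'k row list \<Rightarrow> ((nat \<times> nat list) \<times> 'k row) list" where
  "lead_rows Q n rows = rref (key_sort Q n (vkeys rows)) rows"

text \<open>The echelon form of a single row is the row itself, made monic at its leading monomial.\<close>

definition ideal_leads :: "(('k::field) val \<Rightarrow> bool) \<Rightarrow> nat \<Rightarrow> ('k relation list \<times> 'k poly list) list \<Rightarrow>
    ((nat \<times> nat list) \<times> 'k row) list" where
  "ideal_leads Q n ds = concat (map (\<lambda>f. lead_rows Q n [f]) (ideal_rows ds))"

definition std_rows :: "(('k::field) val \<Rightarrow> bool) \<Rightarrow> bool \<Rightarrow> nat list list \<Rightarrow> 'k input \<Rightarrow> ((nat \<times> nat list) \<times> 'k row) list" where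
  "std_rows Q two W x = filter (\<lambda>t. is_std (fst x) (fst t))
     (lead_rows Q (fst x) (J_rows W (fst (snd x)) @ gen_rows two W (snd (snd x))))"

text \<open>\<open>L\<close> are the leading terms of the ideal; keys divisible by them are reducible in the quotient.\<close>

definition minimal_rows :: "nat \<Rightarrow> ((nat \<times> nat list) \<times> 'k row) list \<Rightarrow> ((nat \<times> nat list) \<times> 'k row) list \<Rightarrow>
    ((nat \<times> nat list) \<times> 'k row) list" where
  "minimal_rows n L P = filter (\<lambda>t. list_all (\<lambda>l. \<not> kdvd n (fst l) (fst t)) L \<and>
     list_all (\<lambda>l. fst l = fst t \<or> \<not> kdvd n (fst l) (fst t)) P) P"

definition candidates :: "(('k::field) val \<Rightarrow> bool) \<Rightarrow> bool \<Rightarrow> nat list list \<Rightarrow> 'k input \<Rightarrow> ((nat \<times> nat list) \<times> 'k row) list" where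
  "candidates Q two W x = minimal_rows (fst x) (ideal_leads Q (fst x) (fst (snd x))) (std_rows Q two W x)"

text \<open>For monic rows of standard monomials this makes the basis reduced; it also makes the rows equal to the
  representatives \<open>\<tau>\<close> of their classes.\<close>

definition tails_reduced :: "nat \<Rightarrow> ((nat \<times> nat list) \<times> ('k::field) row) list \<Rightarrow> ((nat \<times> nat list) \<times> 'k row) list \<Rightarrow> bool" where
  "tails_reduced n L H \<longleftrightarrow> list_all (\<lambda>t. list_all (\<lambda>k. coef (snd t) k = 0 \<or>
     list_all (\<lambda>l. \<not> kdvd n (fst l) k) L \<and> list_all (\<lambda>l. fst l = fst t \<or> \<not> kdvd n (fst l) k) H)
       (map snd (snd t))) H"

text \<open>The multiples of candidates that are admitted in the representation of an S-vector formed at the monomial of \<open>k\<close>.\<close>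

definition lower_rows :: "('k val \<Rightarrow> bool) \<Rightarrow> nat \<Rightarrow> nat list list \<Rightarrow> ((nat \<times> nat list) \<times> 'k row) list \<Rightarrow>
    nat \<times> nat list \<Rightarrow> 'k row list" where
  "lower_rows Q n W H k = concat (map (\<lambda>l. map (\<lambda>w. mul_row w (snd l) [])
     (filter (\<lambda>w. mono_less Q n (fst (fst l), w @ snd (fst l)) k) W)) H)"

definition cofactor :: "nat \<Rightarrow> nat \<times> nat list \<Rightarrow> nat \<times> nat list \<Rightarrow> nat list" where
  "cofactor n k k' = word_minus n (snd k') (snd k)"

text \<open>The membership test covers both parts of \<open>critical_pairs_reduce\<close>: if \<open>t'\<close> is a leading term of the ideal, its row
  represents zero and does not enlarge the span.\<close>

definition pair_reduces :: "(('k::field) val \<Rightarrow> bool) \<Rightarrow> nat \<Rightarrow> nat list list \<Rightarrow> 'k row list \<Rightarrow> ((nat \<times> nat list) \<times> 'k row) list \<Rightarrow>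
    (nat \<times> nat list) \<times> 'k row \<Rightarrow> (nat \<times> nat list) \<times> 'k row \<Rightarrow> bool" where
  "pair_reduces Q n W jr H t t' \<longleftrightarrow> \<not> fst (fst t) = fst (fst t') \<or>
     in_span (mul_row (cofactor n (fst t') (fst t)) (snd t') [] #
         lower_rows Q n W H (fst (fst t), cofactor n (fst t) (fst t') @ snd (fst t)) @ jr)
       (mul_row (cofactor n (fst t) (fst t')) (snd t) [])"

definition pairs_reduce :: "(('k::field) val \<Rightarrow> bool) \<Rightarrow> nat \<Rightarrow> nat list list \<Rightarrow> 'k row list \<Rightarrow>
    ((nat \<times> nat list) \<times> 'k row) list \<Rightarrow> ((nat \<times> nat list) \<times> 'k row) list \<Rightarrow> bool" where
  "pairs_reduce Q n W jr L H \<longleftrightarrow> list_all (\<lambda>t. list_all (\<lambda>t'. pair_reduces Q n W jr H t t') (H @ L)) H"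

definition generates :: "nat list list \<Rightarrow> ('k::field) row list \<Rightarrow> ((nat \<times> nat list) \<times> 'k row) list \<Rightarrow> 'k row list \<Rightarrow> bool" where
  "generates W jr H vs \<longleftrightarrow> list_all (\<lambda>v. in_span (concat (map (\<lambda>l. products W [[]] (snd l)) H) @ jr) v) vs"

text \<open>For a left submodule to be two-sided it suffices that products of generators with single
  variables on the right stay inside.\<close>

definition right_rows :: "bool \<Rightarrow> nat \<Rightarrow> ((nat \<times> nat list) \<times> 'k row) list \<Rightarrow> 'k row list" where
  "right_rows two n H = (if two then concat (map (\<lambda>l. map (\<lambda>i. mul_row [] (snd l) [i]) [0..<n]) H) else [])"

definition accept :: "(('k::field) val \<Rightarrow> bool) \<Rightarrow> bool \<Rightarrow> nat list list \<Rightarrow> 'k input \<Rightarrow> ((nat \<times> nat list) \<times> 'k row) list \<Rightarrow> bool" where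
  "accept Q two W x H \<longleftrightarrow> tails_reduced (fst x) (ideal_leads Q (fst x) (fst (snd x))) H \<and>
     pairs_reduce Q (fst x) W (J_rows W (fst (snd x))) (ideal_leads Q (fst x) (fst (snd x))) H \<and>
     generates W (J_rows W (fst (snd x))) H (map (\<lambda>g. vec_row g) (snd (snd x)) @ right_rows two (fst x) H)"

definition row_words :: "nat \<Rightarrow> ('k::field) row \<Rightarrow> nat list list" where
  "row_words p r = fold (\<lambda>t ws. if fst (snd t) = p \<and> \<not> coef r (snd t) = 0 \<and>
     list_all (\<lambda>w. \<not> w = snd (snd t)) ws then snd (snd t) # ws else ws) r []"

definition row_poly :: "nat \<Rightarrow> ('k::field) row \<Rightarrow> 'k poly" where
  "row_poly p r = map (\<lambda>w. (coef r (p, w), w)) (row_words p r)"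

definition answer :: "('k::field) input \<Rightarrow> ((nat \<times> nat list) \<times> 'k row) list \<Rightarrow> 'k poly list list" where
  "answer x H = map (\<lambda>t. map (\<lambda>i. row_poly (fst i) (snd t)) (List.enumerate 0 (fst (snd x)))) H"

section \<open>The algorithm is computable\<close>

text \<open>Each function of the algorithm is first shown to be computable on the tuple of its arguments, by applying the
  rules collected so far to its definition; the following lemmas turn this into a rule for
  arbitrary computable arguments, which is added to the collection.\<close>

lemma computable_lift2:
  assumes "computable (enc_pair A B) C (\<lambda>Q z. F Q (fst z) (snd z))"
    "computable a A f" "computable a B g"
  shows "computable a C (\<lambda>Q x. F Q (f Q x) (g Q x))"
  using computable_comp[OF computable_Pair[OF assms(2,3)] assms(1)] by simp

lemma computable_lift3:
  assumes "computable (enc_pair A (enc_pair B C)) D (\<lambda>Q z. F Q (fst z) (fst (snd z)) (snd (snd z)))"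
    "computable a A f" "computable a B g" "computable a C h"
  shows "computable a D (\<lambda>Q x. F Q (f Q x) (g Q x) (h Q x))"
  using computable_comp[OF computable_Pair[OF assms(2) computable_Pair[OF assms(3,4)]] assms(1)] by simp

lemma computable_lift4:
  assumes "computable (enc_pair A (enc_pair B (enc_pair C D))) G
      (\<lambda>Q z. F Q (fst z) (fst (snd z)) (fst (snd (snd z))) (snd (snd (snd z))))"
    "computable a A f" "computable a B g" "computable a C h" "computable a D i"
  shows "computable a G (\<lambda>Q x. F Q (f Q x) (g Q x) (h Q x) (i Q x))"
  using computable_comp[OF computable_Pair[OF assms(2) computable_Pair[OF assms(3) computable_Pair[OF assms(4,5)]]] assms(1)] by simp

lemma computable_lift5:
  assumes "computable (enc_pair A (enc_pair B (enc_pair C (enc_pair D E)))) G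
      (\<lambda>Q z. F Q (fst z) (fst (snd z)) (fst (snd (snd z))) (fst (snd (snd (snd z)))) (snd (snd (snd (snd z)))))"
    "computable a A f" "computable a B g" "computable a C h" "computable a D i" "computable a E j"
  shows "computable a G (\<lambda>Q x. F Q (f Q x) (g Q x) (h Q x) (i Q x) (j Q x))"
  using computable_comp[OF computable_Pair[OF assms(2) computable_Pair[OF assms(3) computable_Pair[OF assms(4) computable_Pair[OF assms(5,6)]]]] assms(1)] by simp

lemma computable_lift6:
  assumes "computable (enc_pair A (enc_pair B (enc_pair C (enc_pair D (enc_pair E H))))) G
      (\<lambda>Q z. F Q (fst z) (fst (snd z)) (fst (snd (snd z))) (fst (snd (snd (snd z)))) (fst (snd (snd (snd (snd z))))) (snd (snd (snd (snd (snd z))))))"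
    "computable a A f" "computable a B g" "computable a C h" "computable a D i" "computable a E j" "computable a H k"
  shows "computable a G (\<lambda>Q x. F Q (f Q x) (g Q x) (h Q x) (i Q x) (j Q x) (k Q x))"
  using computable_comp[OF computable_Pair[OF assms(2) computable_Pair[OF assms(3) computable_Pair[OF assms(4) computable_Pair[OF assms(5) computable_Pair[OF assms(6,7)]]]]] assms(1)] by simp

lemma computable_coef_aux:
  assumes inj: "inj a" shows "computable (enc_pair (enc_list (enc_pair Scal a)) a) Scal (\<lambda>Q z. coef (fst z) (snd z))"
  unfolding coef_def by (rule computable_intros inj)+
lemma computable_coef:
  assumes "computable b (enc_list (enc_pair Scal a)) f0" "computable b a f1" "inj a"
  shows "computable b Scal (\<lambda>Q x. coef (f0 Q x) (f1 Q x))"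
  by (rule computable_lift2[where F = "(\<lambda>Q. coef)", OF computable_coef_aux[OF assms(3)] assms(1,2)])
lemmas comp_coef = computable_coef computable_intros

lemma computable_smul_aux:
  shows "computable (enc_pair Scal (enc_list (enc_pair Scal a))) (enc_list (enc_pair Scal a)) (\<lambda>Q z. smul (fst z) (snd z))"
  unfolding smul_def by (rule comp_coef)+
lemmas computable_smul = computable_lift2[where F = "(\<lambda>Q. smul)", OF computable_smul_aux]
lemmas comp_smul = computable_smul comp_coef

lemma computable_elim_aux:
  assumes inj: "inj a" shows "computable (enc_pair a (enc_pair (enc_list (enc_pair Scal a)) (enc_list (enc_pair Scal a)))) (enc_list (enc_pair Scal a)) (\<lambda>Q z. elim (fst z) (fst (snd z)) (snd (snd z)))"
  unfolding elim_def by (rule comp_smul inj)+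
lemma computable_elim:
  assumes "computable b a f0" "computable b (enc_list (enc_pair Scal a)) f1" "computable b (enc_list (enc_pair Scal a)) f2" "inj a"
  shows "computable b (enc_list (enc_pair Scal a)) (\<lambda>Q x. elim (f0 Q x) (f1 Q x) (f2 Q x))"
  by (rule computable_lift3[where F = "(\<lambda>Q. elim)", OF computable_elim_aux[OF assms(4)] assms(1,2,3)])
lemmas comp_elim = computable_elim comp_smul

lemma computable_vkeys_aux:
  shows "computable (enc_list (enc_list (enc_pair Scal a))) (enc_list a) (\<lambda>Q z. vkeys z)"
  unfolding vkeys_def by (rule comp_elim)+
lemmas computable_vkeys = computable_comp[OF _ computable_vkeys_aux]
lemmas comp_vkeys = computable_vkeys comp_elim

lemma computable_rref_step_aux:
  assumes inj: "inj a" shows "computable (enc_pair a (enc_pair (enc_list (enc_pair a (enc_list (enc_pair Scal a)))) (enc_list (enc_list (enc_pair Scal a))))) (enc_pair (enc_list (enc_pair a (enc_list (enc_pair Scal a)))) (enc_list (enc_list (enc_pair Scal a)))) (\<lambda>Q z. rref_step (fst z) (snd z))"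
  unfolding rref_step_def by (rule comp_vkeys inj)+
lemma computable_rref_step:
  assumes "computable b a f0" "computable b (enc_pair (enc_list (enc_pair a (enc_list (enc_pair Scal a)))) (enc_list (enc_list (enc_pair Scal a)))) f1" "inj a"
  shows "computable b (enc_pair (enc_list (enc_pair a (enc_list (enc_pair Scal a)))) (enc_list (enc_list (enc_pair Scal a)))) (\<lambda>Q x. rref_step (f0 Q x) (f1 Q x))"
  by (rule computable_lift2[where F = "(\<lambda>Q. rref_step)", OF computable_rref_step_aux[OF assms(3)] assms(1,2)])
lemmas comp_rref_step = computable_rref_step comp_vkeys

lemma computable_rref_aux:
  assumes inj: "inj a" shows "computable (enc_pair (enc_list a) (enc_list (enc_list (enc_pair Scal a)))) (enc_list (enc_pair a (enc_list (enc_pair Scal a)))) (\<lambda>Q z. rref (fst z) (snd z))"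
  unfolding rref_def by (rule comp_rref_step inj)+
lemma computable_rref:
  assumes "computable b (enc_list a) f0" "computable b (enc_list (enc_list (enc_pair Scal a))) f1" "inj a"
  shows "computable b (enc_list (enc_pair a (enc_list (enc_pair Scal a)))) (\<lambda>Q x. rref (f0 Q x) (f1 Q x))"
  by (rule computable_lift2[where F = "(\<lambda>Q. rref)", OF computable_rref_aux[OF assms(3)] assms(1,2)])
lemmas comp_rref = computable_rref comp_rref_step

lemma computable_in_span_aux:
  assumes inj: "inj a" shows "computable (enc_pair (enc_list (enc_list (enc_pair Scal a))) (enc_list (enc_pair Scal a))) bit (\<lambda>Q z. in_span (fst z) (snd z))"
  unfolding in_span_def by (rule comp_rref inj)+
lemma computable_in_span:
  assumes "computable b (enc_list (enc_list (enc_pair Scal a))) f0" "computable b (enc_list (enc_pair Scal a)) f1" "inj a"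
  shows "computable b bit (\<lambda>Q x. in_span (f0 Q x) (f1 Q x))"
  by (rule computable_lift2[where F = "(\<lambda>Q. in_span)", OF computable_in_span_aux[OF assms(3)] assms(1,2)])
lemmas comp_in_span = computable_in_span comp_rref

lemma computable_occ_aux:
  shows "computable (enc_pair Num enc_word) Num (\<lambda>Q z. occ (fst z) (snd z))"
  unfolding occ_def by (rule comp_in_span)+
lemmas computable_occ = computable_lift2[where F = "(\<lambda>Q. occ)", OF computable_occ_aux]
lemmas comp_occ = computable_occ comp_in_span

lemma computable_mcounts_aux:
  shows "computable (enc_pair Num enc_key) (enc_pair enc_word Num) (\<lambda>Q z. mcounts (fst z) (snd z))"
  unfolding mcounts_def by (rule comp_occ)+
lemmas computable_mcounts = computable_lift2[where F = "(\<lambda>Q. mcounts)", OF computable_mcounts_aux]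
lemmas comp_mcounts = computable_mcounts comp_occ

lemma computable_mono_less_aux:
  shows "computable (enc_pair Num (enc_pair enc_key enc_key)) bit (\<lambda>Q z. mono_less Q (fst z) (fst (snd z)) (snd (snd z)))"
proof -
  have "computable (enc_pair Num (enc_pair enc_key enc_key)) (enc_pair (enc_pair enc_word Num) (enc_pair enc_word Num))
      (\<lambda>Q z. (mcounts (fst z) (fst (snd z)), mcounts (fst z) (snd (snd z))))"
    by (rule comp_mcounts)+
  from computable_Less[OF this] show ?thesis unfolding mono_less_def .
qed
lemmas computable_mono_less = computable_lift3[where F = "(\<lambda>Q. mono_less Q)", OF computable_mono_less_aux]
lemmas comp_mono_less = computable_mono_less comp_mcounts

lemma computable_is_std_aux:
  shows "computable (enc_pair Num enc_key) bit (\<lambda>Q z. is_std (fst z) (snd z))"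
  unfolding is_std_def by (rule comp_mono_less)+
lemmas computable_is_std = computable_lift2[where F = "(\<lambda>Q. is_std)", OF computable_is_std_aux]
lemmas comp_is_std = computable_is_std comp_mono_less

lemma computable_key_less_aux:
  shows "computable (enc_pair Num (enc_pair enc_key enc_key)) bit (\<lambda>Q z. key_less Q (fst z) (fst (snd z)) (snd (snd z)))"
  unfolding key_less_def by (rule comp_is_std)+
lemmas computable_key_less = computable_lift3[where F = "(\<lambda>Q. key_less Q)", OF computable_key_less_aux]
lemmas comp_key_less = computable_key_less comp_is_std

lemma computable_key_insert_aux:
  shows "computable (enc_pair Num (enc_pair enc_key (enc_list enc_key))) (enc_list enc_key) (\<lambda>Q z. key_insert Q (fst z) (fst (snd z)) (snd (snd z)))"
  unfolding key_insert_def by (rule comp_key_less)+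
lemmas computable_key_insert = computable_lift3[where F = "(\<lambda>Q. key_insert Q)", OF computable_key_insert_aux]
lemmas comp_key_insert = computable_key_insert comp_key_less

lemma computable_key_sort_aux:
  shows "computable (enc_pair Num (enc_list enc_key)) (enc_list enc_key) (\<lambda>Q z. key_sort Q (fst z) (snd z))"
  unfolding key_sort_def by (rule comp_key_insert)+
lemmas computable_key_sort = computable_lift2[where F = "(\<lambda>Q. key_sort Q)", OF computable_key_sort_aux]
lemmas comp_key_sort = computable_key_sort comp_key_insert

lemma computable_word_minus_aux:
  shows "computable (enc_pair Num (enc_pair enc_word enc_word)) enc_word (\<lambda>Q z. word_minus (fst z) (fst (snd z)) (snd (snd z)))"
  unfolding word_minus_def by (rule comp_key_sort)+
lemmas computable_word_minus = computable_lift3[where F = "(\<lambda>Q. word_minus)", OF computable_word_minus_aux]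
lemmas comp_word_minus = computable_word_minus comp_key_sort

lemma computable_kdvd_aux:
  shows "computable (enc_pair Num (enc_pair enc_key enc_key)) bit (\<lambda>Q z. kdvd (fst z) (fst (snd z)) (snd (snd z)))"
  unfolding kdvd_def by (rule comp_word_minus)+
lemmas computable_kdvd = computable_lift3[where F = "(\<lambda>Q. kdvd)", OF computable_kdvd_aux]
lemmas comp_kdvd = computable_kdvd comp_word_minus

lemma computable_words_aux:
  shows "computable (enc_pair Num Num) (enc_list enc_word) (\<lambda>Q z. words (fst z) (snd z))"
  unfolding words_def by (rule comp_kdvd)+
lemmas computable_words = computable_lift2[where F = "(\<lambda>Q. words)", OF computable_words_aux]
lemmas comp_words = computable_words comp_kdvd

lemma computable_poly_row_aux:
  shows "computable (enc_pair Num enc_poly) enc_row (\<lambda>Q z. poly_row (fst z) (snd z))"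
  unfolding poly_row_def by (rule comp_words)+
lemmas computable_poly_row = computable_lift2[where F = "(\<lambda>Q. poly_row)", OF computable_poly_row_aux]
lemmas comp_poly_row = computable_poly_row comp_words

lemma computable_rel_poly_aux:
  shows "computable enc_relation enc_poly (\<lambda>Q z. rel_poly z)"
  unfolding rel_poly_def by (rule comp_poly_row)+
lemmas computable_rel_poly = computable_comp[OF _ computable_rel_poly_aux]
lemmas comp_rel_poly = computable_rel_poly comp_poly_row

lemma computable_ideal_rows_aux:
  shows "computable enc_data (enc_list enc_row) (\<lambda>Q z. ideal_rows z)"
  unfolding ideal_rows_def by (rule comp_rel_poly)+
lemmas computable_ideal_rows = computable_comp[OF _ computable_ideal_rows_aux]
lemmas comp_ideal_rows = computable_ideal_rows comp_rel_poly

lemma computable_relation_rows_aux: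
  shows "computable enc_data (enc_list enc_row) (\<lambda>Q z. relation_rows z)"
  unfolding relation_rows_def by (rule comp_ideal_rows)+
lemmas computable_relation_rows = computable_comp[OF _ computable_relation_rows_aux]
lemmas comp_relation_rows = computable_relation_rows comp_ideal_rows

lemma computable_vec_row_aux:
  shows "computable (enc_list enc_poly) enc_row (\<lambda>Q z. vec_row z)"
  unfolding vec_row_def by (rule comp_relation_rows)+
lemmas computable_vec_row = computable_comp[OF _ computable_vec_row_aux]
lemmas comp_vec_row = computable_vec_row comp_relation_rows

lemma computable_mul_row_aux:
  shows "computable (enc_pair enc_word (enc_pair enc_row enc_word)) enc_row (\<lambda>Q z. mul_row (fst z) (fst (snd z)) (snd (snd z)))"
  unfolding mul_row_def by (rule comp_vec_row)+
lemmas computable_mul_row = computable_lift3[where F = "(\<lambda>Q. mul_row)", OF computable_mul_row_aux]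
lemmas comp_mul_row = computable_mul_row comp_vec_row

lemma computable_products_aux:
  shows "computable (enc_pair (enc_list enc_word) (enc_pair (enc_list enc_word) enc_row)) (enc_list enc_row) (\<lambda>Q z. products (fst z) (fst (snd z)) (snd (snd z)))"
  unfolding products_def by (rule comp_mul_row)+
lemmas computable_products = computable_lift3[where F = "(\<lambda>Q. products)", OF computable_products_aux]
lemmas comp_products = computable_products comp_mul_row

lemma computable_J_rows_aux:
  shows "computable (enc_pair (enc_list enc_word) enc_data) (enc_list enc_row) (\<lambda>Q z. J_rows (fst z) (snd z))"
  unfolding J_rows_def by (rule comp_products)+
lemmas computable_J_rows = computable_lift2[where F = "(\<lambda>Q. J_rows)", OF computable_J_rows_aux]
lemmas comp_J_rows = computable_J_rows comp_products

lemma computable_gen_rows_aux: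
  shows "computable (enc_pair bit (enc_pair (enc_list enc_word) (enc_list (enc_list enc_poly)))) (enc_list enc_row) (\<lambda>Q z. gen_rows (fst z) (fst (snd z)) (snd (snd z)))"
  unfolding gen_rows_def by (rule comp_J_rows)+
lemmas computable_gen_rows = computable_lift3[where F = "(\<lambda>Q. gen_rows)", OF computable_gen_rows_aux]
lemmas comp_gen_rows = computable_gen_rows comp_J_rows

lemma computable_lead_rows_aux:
  shows "computable (enc_pair Num (enc_list enc_row)) (enc_list (enc_pair enc_key enc_row)) (\<lambda>Q z. lead_rows Q (fst z) (snd z))"
  unfolding lead_rows_def by (rule comp_gen_rows)+
lemmas computable_lead_rows = computable_lift2[where F = "(\<lambda>Q. lead_rows Q)", OF computable_lead_rows_aux]
lemmas comp_lead_rows = computable_lead_rows comp_gen_rows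

lemma computable_ideal_leads_aux:
  shows "computable (enc_pair Num enc_data) (enc_list (enc_pair enc_key enc_row)) (\<lambda>Q z. ideal_leads Q (fst z) (snd z))"
  unfolding ideal_leads_def by (rule comp_lead_rows)+
lemmas computable_ideal_leads = computable_lift2[where F = "(\<lambda>Q. ideal_leads Q)", OF computable_ideal_leads_aux]
lemmas comp_ideal_leads = computable_ideal_leads comp_lead_rows

lemma computable_std_rows_aux:
  shows "computable (enc_pair bit (enc_pair (enc_list enc_word) enc_input)) (enc_list (enc_pair enc_key enc_row)) (\<lambda>Q z. std_rows Q (fst z) (fst (snd z)) (snd (snd z)))"
  unfolding std_rows_def by (rule comp_ideal_leads)+
lemmas computable_std_rows = computable_lift3[where F = "(\<lambda>Q. std_rows Q)", OF computable_std_rows_aux]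
lemmas comp_std_rows = computable_std_rows comp_ideal_leads

lemma computable_minimal_rows_aux:
  shows "computable (enc_pair Num (enc_pair (enc_list (enc_pair enc_key enc_row)) (enc_list (enc_pair enc_key enc_row)))) (enc_list (enc_pair enc_key enc_row)) (\<lambda>Q z. minimal_rows (fst z) (fst (snd z)) (snd (snd z)))"
  unfolding minimal_rows_def by (rule comp_std_rows)+
lemmas computable_minimal_rows = computable_lift3[where F = "(\<lambda>Q. minimal_rows)", OF computable_minimal_rows_aux]
lemmas comp_minimal_rows = computable_minimal_rows comp_std_rows

lemma computable_candidates_aux:
  shows "computable (enc_pair bit (enc_pair (enc_list enc_word) enc_input)) (enc_list (enc_pair enc_key enc_row)) (\<lambda>Q z. candidates Q (fst z) (fst (snd z)) (snd (snd z)))"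
  unfolding candidates_def by (rule comp_minimal_rows)+
lemmas computable_candidates = computable_lift3[where F = "(\<lambda>Q. candidates Q)", OF computable_candidates_aux]
lemmas comp_candidates = computable_candidates comp_minimal_rows

lemma computable_tails_reduced_aux:
  shows "computable (enc_pair Num (enc_pair (enc_list (enc_pair enc_key enc_row)) (enc_list (enc_pair enc_key enc_row)))) bit (\<lambda>Q z. tails_reduced (fst z) (fst (snd z)) (snd (snd z)))"
  unfolding tails_reduced_def by (rule comp_candidates)+
lemmas computable_tails_reduced = computable_lift3[where F = "(\<lambda>Q. tails_reduced)", OF computable_tails_reduced_aux]
lemmas comp_tails_reduced = computable_tails_reduced comp_candidates

lemma computable_lower_rows_aux:
  shows "computable (enc_pair Num (enc_pair (enc_list enc_word) (enc_pair (enc_list (enc_pair enc_key enc_row)) enc_key))) (enc_list enc_row) (\<lambda>Q z. lower_rows Q (fst z) (fst (snd z)) (fst (snd (snd z))) (snd (snd (snd z))))"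
  unfolding lower_rows_def by (rule comp_tails_reduced)+
lemmas computable_lower_rows = computable_lift4[where F = "(\<lambda>Q. lower_rows Q)", OF computable_lower_rows_aux]
lemmas comp_lower_rows = computable_lower_rows comp_tails_reduced

lemma computable_cofactor_aux:
  shows "computable (enc_pair Num (enc_pair enc_key enc_key)) enc_word (\<lambda>Q z. cofactor (fst z) (fst (snd z)) (snd (snd z)))"
  unfolding cofactor_def by (rule comp_lower_rows)+
lemmas computable_cofactor = computable_lift3[where F = "(\<lambda>Q. cofactor)", OF computable_cofactor_aux]
lemmas comp_cofactor = computable_cofactor comp_lower_rows

lemma computable_pair_reduces_aux:
  shows "computable (enc_pair Num (enc_pair (enc_list enc_word) (enc_pair (enc_list enc_row) (enc_pair (enc_list (enc_pair enc_key enc_row)) (enc_pair (enc_pair enc_key enc_row) (enc_pair enc_key enc_row)))))) bit (\<lambda>Q z. pair_reduces Q (fst z) (fst (snd z)) (fst (snd (snd z))) (fst (snd (snd (snd z)))) (fst (snd (snd (snd (snd z))))) (snd (snd (snd (snd (snd z))))))"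
  unfolding pair_reduces_def by (rule comp_cofactor)+
lemmas computable_pair_reduces = computable_lift6[where F = "(\<lambda>Q. pair_reduces Q)", OF computable_pair_reduces_aux]
lemmas comp_pair_reduces = computable_pair_reduces comp_cofactor

lemma computable_pairs_reduce_aux:
  shows "computable (enc_pair Num (enc_pair (enc_list enc_word) (enc_pair (enc_list enc_row) (enc_pair (enc_list (enc_pair enc_key enc_row)) (enc_list (enc_pair enc_key enc_row)))))) bit (\<lambda>Q z. pairs_reduce Q (fst z) (fst (snd z)) (fst (snd (snd z))) (fst (snd (snd (snd z)))) (snd (snd (snd (snd z)))))"
  unfolding pairs_reduce_def by (rule comp_pair_reduces)+
lemmas computable_pairs_reduce = computable_lift5[where F = "(\<lambda>Q. pairs_reduce Q)", OF computable_pairs_reduce_aux]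
lemmas comp_pairs_reduce = computable_pairs_reduce comp_pair_reduces

lemma computable_generates_aux:
  shows "computable (enc_pair (enc_list enc_word) (enc_pair (enc_list enc_row) (enc_pair (enc_list (enc_pair enc_key enc_row)) (enc_list enc_row)))) bit (\<lambda>Q z. generates (fst z) (fst (snd z)) (fst (snd (snd z))) (snd (snd (snd z))))"
  unfolding generates_def by (rule comp_pairs_reduce)+
lemmas computable_generates = computable_lift4[where F = "(\<lambda>Q. generates)", OF computable_generates_aux]
lemmas comp_generates = computable_generates comp_pairs_reduce

lemma computable_right_rows_aux:
  shows "computable (enc_pair bit (enc_pair Num (enc_list (enc_pair enc_key enc_row)))) (enc_list enc_row) (\<lambda>Q z. right_rows (fst z) (fst (snd z)) (snd (snd z)))"
  unfolding right_rows_def by (rule comp_generates)+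
lemmas computable_right_rows = computable_lift3[where F = "(\<lambda>Q. right_rows)", OF computable_right_rows_aux]
lemmas comp_right_rows = computable_right_rows comp_generates

lemma computable_accept_aux:
  shows "computable (enc_pair bit (enc_pair (enc_list enc_word) (enc_pair enc_input (enc_list (enc_pair enc_key enc_row))))) bit (\<lambda>Q z. accept Q (fst z) (fst (snd z)) (fst (snd (snd z))) (snd (snd (snd z))))"
  unfolding accept_def by (rule comp_right_rows)+
lemmas computable_accept = computable_lift4[where F = "(\<lambda>Q. accept Q)", OF computable_accept_aux]
lemmas comp_accept = computable_accept comp_right_rows

lemma computable_row_words_aux:
  shows "computable (enc_pair Num enc_row) (enc_list enc_word) (\<lambda>Q z. row_words (fst z) (snd z))"
  unfolding row_words_def by (rule comp_accept)+
lemmas computable_row_words = computable_lift2[where F = "(\<lambda>Q. row_words)", OF computable_row_words_aux]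
lemmas comp_row_words = computable_row_words comp_accept

lemma computable_row_poly_aux:
  shows "computable (enc_pair Num enc_row) enc_poly (\<lambda>Q z. row_poly (fst z) (snd z))"
  unfolding row_poly_def by (rule comp_row_words)+
lemmas computable_row_poly = computable_lift2[where F = "(\<lambda>Q. row_poly)", OF computable_row_poly_aux]
lemmas comp_row_poly = computable_row_poly comp_row_words

lemma computable_answer_aux:
  shows "computable (enc_pair enc_input (enc_list (enc_pair enc_key enc_row))) (enc_list (enc_list enc_poly)) (\<lambda>Q z. answer (fst z) (snd z))"
  unfolding answer_def by (rule comp_row_poly)+
lemmas computable_answer = computable_lift2[where F = "(\<lambda>Q. answer)", OF computable_answer_aux]
lemmas comp_answer = computable_answer comp_row_poly

section \<open>Rows as vectors over the free algebra\<close>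

definition pol :: "('k::field) poly \<Rightarrow> 'k falg" where
  "pol f = sum_list (map (\<lambda>t. Poly_Mapping.single (snd t) (fst t)) f)"

lemma pol_simps [simp]: "pol [] = 0" "pol (t # f) = Poly_Mapping.single (snd t) (fst t) + pol f"
  "pol (f @ g) = pol f + pol g"
  by (simp_all add: pol_def)

lemma pol_smul: "pol (smul a f) = scalar a * pol f"
  by (induction f) (simp_all add: smul_def algebra_simps scalar_def mult_single plus_append)

text \<open>The lists \<open>ds\<close> and \<open>gs\<close> are the decoded input. Entries may be repeated, and coefficients of repeated words add up;
  only the polynomials denoted by the lists matter.\<close>

locale pbw_input = pbw_data n E c d I prec J
  for n and E :: "'e set" and c :: "'e \<Rightarrow> nat \<Rightarrow> nat \<Rightarrow> 'k::field" and d I prec J +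
  fixes es :: "'e list" and ds :: "('k relation list \<times> 'k poly list) list" and gs :: "'k poly list list"
  assumes es: "distinct es" "set es = E" and ds_length: "length ds = length es"
    and relations: "\<And>p. p < length es \<Longrightarrow>
      (\<lambda>r. (fst r, fst (snd r), fst (snd (snd r)), pol (snd (snd (snd r))))) ` set (fst (ds ! p))
        = (\<lambda>(i, j). (i, j, c (es ! p) i j, d (es ! p) i j)) ` {(i, j). i < j \<and> j < n}"
    and ideal: "\<And>p. p < length es \<Longrightarrow> pol ` set (snd (ds ! p)) = I (es ! p)"
    and relation_letters: "\<And>p r t. p < length es \<Longrightarrow> r \<in> set (fst (ds ! p)) \<Longrightarrow>
      t \<in> set (snd (snd (snd r))) \<Longrightarrow> set (snd t) \<subseteq> {..<n}"
    and ideal_letters: "\<And>p f t. p < length es \<Longrightarrow> f \<in> set (snd (ds ! p)) \<Longrightarrow> t \<in> set f \<Longrightarrow> set (snd t) \<subseteq> {..<n}"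
    and gs: "\<And>g. g \<in> set gs \<Longrightarrow> length g = length es"
      "\<And>g f t. g \<in> set gs \<Longrightarrow> f \<in> set g \<Longrightarrow> t \<in> set f \<Longrightarrow> set (snd t) \<subseteq> {..<n}"
begin

abbreviation "m \<equiv> length es"
abbreviation Q :: "'k val \<Rightarrow> bool" where "Q \<equiv> compare n es prec"

text \<open>Keys with positions outside of the list of indices are ignored, so that \<open>vec\<close> is total.\<close>

definition vec :: "'k row \<Rightarrow> 'e \<Rightarrow> 'k falg" where
  "vec v = sum_list (map (\<lambda>t. if fst (snd t) < m
     then emb (es ! fst (snd t)) (Poly_Mapping.single (snd (snd t)) (fst t)) else 0) v)"

definition X :: "nat \<times> nat list \<Rightarrow> ('e \<Rightarrow> 'k falg) \<Rightarrow> 'k" where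
  "X k t = lookup (t (es ! fst k)) (snd k)"

text \<open>\<open>X\<close> are the coordinate functionals of vectors; \<open>mk k\<close> is the monomial of the key \<open>k\<close>, regardless of the order of
  letters.\<close>

definition "valid_key k \<longleftrightarrow> fst k < m \<and> letters (snd k)"
definition valid_row :: "'k row \<Rightarrow> bool" where
  "valid_row v \<longleftrightarrow> (\<forall>k\<in>snd ` set v. valid_key k)"
definition "mk k = (exw (snd k), es ! fst k)"

lemma vec_simps: "vec [] = 0"
  "vec (t # v) = (if fst (snd t) < m then emb (es ! fst (snd t)) (Poly_Mapping.single (snd (snd t)) (fst t)) else 0) + vec v"
  "vec (v @ w) = vec v + vec w"
  by (simp_all only: vec_def list.map map_append sum_list.Cons sum_list.Nil sum_list.append)

lemma emb_scalar_single: "emb e (Poly_Mapping.single w (a * b)) = vscale a (emb e (Poly_Mapping.single w b))"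
proof -
  have "Poly_Mapping.single w (a * b) = scalar a * Poly_Mapping.single w b"
    by (simp add: scalar_def mult_single plus_append)
  then show ?thesis by (simp add: emb_linear)
qed

lemma vec_smul: "vec (smul a v) = vscale a (vec v)"
proof (induction v)
  case Nil
  then show ?case by (simp add: smul_def vec_simps)
next
  case (Cons t v)
  then show ?case by (simp add: smul_def vec_simps fv.scale_right_distrib emb_scalar_single)
qed

lemma X_vec: "fst k < m \<Longrightarrow> X k (vec v) = coef v k"
proof (induction v)
  case Nil
  then show ?case by (simp add: vec_simps X_def vec_apply)
next
  case (Cons t v)
  have "fst (snd t) < m \<Longrightarrow> es ! fst (snd t) = es ! fst k \<longleftrightarrow> fst (snd t) = fst k"
    using es(1) Cons.prems by (simp add: nth_eq_iff_index_eq)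
  then show ?case using Cons by (auto simp: vec_simps X_def vec_apply coef_Cons lookup_add lookup_single
      when_def prod_eq_iff)
qed

lemma vec_zero_outside: "e \<notin> E \<Longrightarrow> vec v e = 0"
  using es(2) by (induction v) (auto simp: vec_simps vec_apply)

lemma index_es: "e \<in> E \<Longrightarrow> \<exists>p<m. es ! p = e"
  using es(2) by (metis in_set_conv_nth)

lemma es_E: "p < m \<Longrightarrow> es ! p \<in> E" using es(2) by auto

lemma vec_eqI:
  assumes "\<And>k. fst k < m \<Longrightarrow> X k s = X k t" "\<And>e. e \<notin> E \<Longrightarrow> s e = t e" shows "s = t"
proof
  fix e show "s e = t e"
  proof (cases "e \<in> E")
    case True
    then obtain p where p: "p < m" "es ! p = e" using index_es by blast
    show ?thesis using assms(1)[of "(p, _)"] p by (intro poly_mapping_eqI) (auto simp: X_def)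
  qed (rule assms(2))
qed

sublocale sparse_rep "vscale :: 'k \<Rightarrow> ('e \<Rightarrow> 'k falg) \<Rightarrow> 'e \<Rightarrow> 'k falg" vec X "{k. fst k < m}"
proof unfold_locales
  fix v :: "'k row" assume "\<And>k. k \<in> {k. fst k < m} \<Longrightarrow> coef v k = 0"
  then show "vec v = 0"
    by (intro vec_eqI) (auto simp: X_vec vec_zero_outside X_def[of _ 0] vec_apply)
qed (auto simp: vec_simps vec_smul X_def vec_apply lookup_add X_vec[unfolded X_def])

lemma mk_K: "valid_key k \<Longrightarrow> mk k \<in> K"
  by (simp add: valid_key_def mk_def es_E)

lemma valid_row_simps [simp]: "valid_row []" "valid_row (t # v) \<longleftrightarrow> valid_key (snd t) \<and> valid_row v"
  "valid_row (v @ w) \<longleftrightarrow> valid_row v \<and> valid_row w"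
  by (auto simp: valid_row_def)

lemma vec_Vecs: "valid_row v \<Longrightarrow> vec v \<in> Vecs"
proof (induction v)
  case Nil
  then show ?case by (simp add: vec_simps fv.subspace_0[OF Vecs_subspace])
next
  case (Cons t v)
  then have "emb (es ! fst (snd t)) (Poly_Mapping.single (snd (snd t)) (fst t)) \<in> Vecs"
    by (intro emb_Vecs es_E) (auto simp: valid_key_def carrier_free_algebra)
  then show ?case using Cons by (auto simp: vec_simps valid_key_def intro: fv.subspace_add[OF Vecs_subspace])
qed

lemma vec_poly_row: "p < m \<Longrightarrow> vec (poly_row p f) = emb (es ! p) (pol f)"
  by (induction f) (simp_all add: poly_row_def vec_simps emb_linear)

lemma vec_mul_row: "vec (mul_row w v w') = lmul (word w) (rmul (vec v) (word w'))"
proof (induction v)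
  case Nil
  have "lmul (word w) (rmul 0 (word w')) = (0 :: 'e \<Rightarrow> 'k falg)" by (simp add: fun_eq_iff vec_apply)
  then show ?case by (simp only: mul_row_def list.map vec_simps)
next
  case (Cons t v)
  have z: "lmul (word w) (rmul 0 (word w')) = (0 :: 'e \<Rightarrow> 'k falg)" by (simp add: fun_eq_iff vec_apply)
  have "lmul (word w) (rmul (emb e (Poly_Mapping.single u a)) (word w')) = emb e (Poly_Mapping.single (w @ u @ w') a)"
    for e :: 'e and u and a :: 'k
    by (simp add: rmul_emb lmul_emb word_def mult_single plus_append)
  then show ?case using Cons by (simp add: mul_row_def vec_simps lmul_linear rmul_linear z)
qed

lemma valid_mul_row: "valid_row v \<Longrightarrow> letters w \<Longrightarrow> letters w' \<Longrightarrow> valid_row (mul_row w v w')"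
  by (auto simp: valid_row_def mul_row_def valid_key_def)

lemma set_words: "set (words n N) = {w. length w \<le> N \<and> letters w}"
proof (induction N)
  case 0 then show ?case by (auto simp: words_def)
next
  case (Suc N)
  have "words n (Suc N) = words n N @ concat (map (\<lambda>w. map (\<lambda>i. i # w) [0..<n]) (words n N))"
    by (simp add: words_def)
  then have "set (words n (Suc N)) = set (words n N) \<union> {i # w | i w. i < n \<and> w \<in> set (words n N)}"
    by auto
  also have "\<dots> = {w. length w \<le> Suc N \<and> letters w}"
  proof (rule Set.set_eqI)
    fix w
    show "w \<in> set (words n N) \<union> {i # w | i w. i < n \<and> w \<in> set (words n N)} \<longleftrightarrow> w \<in> {w. length w \<le> Suc N \<and> letters w}"
      unfolding Suc by (cases w) auto
  qed
  finally show ?case .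
qed

lemma set_products: "set (products W W' v) = {mul_row w v w' | w w'. w \<in> set W \<and> w' \<in> set W'}"
  by (auto simp: products_def)

lemma set_enumerate: "set (List.enumerate 0 ys) = (\<lambda>p. (p, ys ! p)) ` {..<length ys}"
  by (auto simp: in_set_enumerate_eq)

lemma relation_row:
  assumes "p < m" "r \<in> set (fst (ds ! p))"
  shows "\<exists>i j. i < j \<and> j < n \<and> pol (rel_poly r) = comm_rel (c (es ! p)) (d (es ! p)) i j"
    "valid_row (poly_row p (rel_poly r))"
proof -
  have "(fst r, fst (snd r), fst (snd (snd r)), pol (snd (snd (snd r))))
      \<in> (\<lambda>(i, j). (i, j, c (es ! p) i j, d (es ! p) i j)) ` {(i, j). i < j \<and> j < n}"
    using relations[OF assms(1)] assms(2) by blast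
  then obtain i j where ij: "i < j" "j < n" "fst r = i" "fst (snd r) = j" "fst (snd (snd r)) = c (es ! p) i j"
      "pol (snd (snd (snd r))) = d (es ! p) i j" by auto
  have s: "scalar (- 1) * f = - f" for f :: "'k falg" by (simp add: scalar_uminus falg_mult_simps)
  have "pol (rel_poly r) = comm_rel (c (es ! p)) (d (es ! p)) i j"
    by (simp add: rel_poly_def ij pol_smul comm_rel_def gen_def scalar_def mult_single plus_append s[unfolded scalar_def]
        single_uminus single_nil_one)
  then show "\<exists>i j. i < j \<and> j < n \<and> pol (rel_poly r) = comm_rel (c (es ! p)) (d (es ! p)) i j"
    using ij by blast
  show "valid_row (poly_row p (rel_poly r))"
    using ij assms(1) relation_letters[OF assms]
    by (auto simp: rel_poly_def poly_row_def valid_row_def valid_key_def smul_def)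
qed

lemma vec_relation_rows:
  "vec ` set (relation_rows ds) = {emb e f | e f. e \<in> E \<and> f \<in> comm_rels n (c e) (d e)}"
  "v \<in> set (relation_rows ds) \<Longrightarrow> valid_row v"
proof -
  have rows: "v \<in> set (relation_rows ds) \<longleftrightarrow> (\<exists>p<m. \<exists>r\<in>set (fst (ds ! p)). v = poly_row p (rel_poly r))" for v
    unfolding relation_rows_def using ds_length by (auto simp: set_enumerate)
  show "valid_row v" if "v \<in> set (relation_rows ds)"
    using that unfolding rows by (elim exE conjE bexE) (simp only: relation_row(2))
  show "vec ` set (relation_rows ds) = {emb e f | e f. e \<in> E \<and> f \<in> comm_rels n (c e) (d e)}"
  proof (intro Set.set_eqI iffI)
    fix t assume "t \<in> vec ` set (relation_rows ds)"
    then obtain v where "t = vec v" "v \<in> set (relation_rows ds)" by (rule imageE)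
    then obtain p r where pr: "p < m" "r \<in> set (fst (ds ! p))" "t = vec (poly_row p (rel_poly r))"
      unfolding rows by (elim exE conjE bexE) simp
    then show "t \<in> {emb e f | e f. e \<in> E \<and> f \<in> comm_rels n (c e) (d e)}"
      using relation_row(1)[OF pr(1,2)] es_E[OF pr(1)] unfolding comm_rels_def by (force simp: vec_poly_row)
  next
    fix t assume "t \<in> {emb e f | e f. e \<in> E \<and> f \<in> comm_rels n (c e) (d e)}"
    then obtain e i j where t: "t = emb e (comm_rel (c e) (d e) i j)" "e \<in> E" "i < j" "j < n"
      unfolding comm_rels_def by blast
    obtain p where p: "p < m" "es ! p = e" using index_es t(2) by blast
    have "(i, j, c e i j, d e i j) \<in> (\<lambda>(i, j). (i, j, c (es ! p) i j, d (es ! p) i j)) ` {(i, j). i < j \<and> j < n}"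
      using t p by force
    then obtain r where r: "r \<in> set (fst (ds ! p))" "fst r = i" "fst (snd r) = j"
        "fst (snd (snd r)) = c e i j" "pol (snd (snd (snd r))) = d e i j"
      unfolding relations[OF p(1), symmetric] by force
    have s: "scalar (- 1) * f = - f" for f :: "'k falg" by (simp add: scalar_uminus falg_mult_simps)
    have "pol (rel_poly r) = comm_rel (c e) (d e) i j"
      by (simp add: rel_poly_def r pol_smul comm_rel_def gen_def scalar_def mult_single plus_append s[unfolded scalar_def]
        single_uminus single_nil_one)
    then have "t = vec (poly_row p (rel_poly r))" using p t(1) by (simp add: vec_poly_row)
    then show "t \<in> vec ` set (relation_rows ds)" using rows p(1) r(1) by blast
  qed
qed

lemma ideal_rows_iff: "v \<in> set (ideal_rows ds) \<longleftrightarrow> (\<exists>p<m. \<exists>f\<in>set (snd (ds ! p)). v = poly_row p f)"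
  unfolding ideal_rows_def using ds_length by (auto simp: set_enumerate)

lemma vec_ideal_rows:
  "vec ` set (ideal_rows ds) = {emb e f | e f. e \<in> E \<and> f \<in> I e}"
  "v \<in> set (ideal_rows ds) \<Longrightarrow> valid_row v"
proof -
  have "valid_row (poly_row p f)" if "p < m" "f \<in> set (snd (ds ! p))" for p f
    using that(1) ideal_letters[OF that] unfolding valid_row_def poly_row_def valid_key_def by auto
  then show "v \<in> set (ideal_rows ds) \<Longrightarrow> valid_row v" unfolding ideal_rows_iff by blast
  show "vec ` set (ideal_rows ds) = {emb e f | e f. e \<in> E \<and> f \<in> I e}"
  proof (intro Set.set_eqI iffI)
    fix t assume "t \<in> vec ` set (ideal_rows ds)"
    then obtain v where "t = vec v" "v \<in> set (ideal_rows ds)" by (rule imageE)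
    then obtain p f where pr: "p < m" "f \<in> set (snd (ds ! p))" "t = vec (poly_row p f)"
      unfolding ideal_rows_iff by (elim exE conjE bexE) simp
    then show "t \<in> {emb e f | e f. e \<in> E \<and> f \<in> I e}"
      using ideal[OF pr(1)] es_E[OF pr(1)] by (force simp: vec_poly_row)
  next
    fix t assume "t \<in> {emb e f | e f. e \<in> E \<and> f \<in> I e}"
    then obtain e f where t: "t = emb e f" "e \<in> E" "f \<in> I e" by blast
    obtain p where p: "p < m" "es ! p = e" using index_es t(2) by blast
    obtain f' where f': "f' \<in> set (snd (ds ! p))" "f = pol f'" using ideal[OF p(1)] p(2) t(3) by blast
    have "t = vec (poly_row p f')" using t(1) p f' by (simp add: vec_poly_row)
    then show "t \<in> vec ` set (ideal_rows ds)" using ideal_rows_iff p(1) f'(1) by blast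
  qed
qed

lemma vec_J_rows:
  assumes "\<forall>w\<in>set W. letters w"
  shows "vec ` set (J_rows W ds) = {emb e (word w * f * word w') | e w f w'. e \<in> E \<and> w \<in> set W \<and> w' \<in> set W \<and>
     f \<in> I e \<union> comm_rels n (c e) (d e)}" (is "?L = ?R")
    and "v \<in> set (J_rows W ds) \<Longrightarrow> valid_row v"
proof -
  have rows: "v \<in> set (J_rows W ds) \<longleftrightarrow> (\<exists>u\<in>set (relation_rows ds) \<union> set (ideal_rows ds).
      \<exists>w\<in>set W. \<exists>w'\<in>set W. v = mul_row w u w')" for v
    unfolding J_rows_def by (auto simp: set_products)
  show "valid_row v" if "v \<in> set (J_rows W ds)"
  proof -
    from that obtain u w w' where u: "u \<in> set (relation_rows ds) \<union> set (ideal_rows ds)" "w \<in> set W" "w' \<in> set W"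
      "v = mul_row w u w'" unfolding rows by blast
    have "valid_row u" using u(1) vec_relation_rows(2) vec_ideal_rows(2) by auto
    then show ?thesis unfolding u(4) using valid_mul_row[of u w w'] assms u(2,3) by blast
  qed
  have base: "vec ` (set (relation_rows ds) \<union> set (ideal_rows ds))
      = {emb e f | e f. e \<in> E \<and> f \<in> I e \<union> comm_rels n (c e) (d e)}"
    unfolding image_Un vec_relation_rows(1) vec_ideal_rows(1) by blast
  have "?L = {lmul (word w) (rmul b (word w')) | w b w'. w \<in> set W \<and> w' \<in> set W \<and>
      b \<in> vec ` (set (relation_rows ds) \<union> set (ideal_rows ds))}" (is "_ = ?M")
  proof (intro Set.set_eqI iffI)
    fix t assume "t \<in> ?L"
    then obtain v where "t = vec v" "v \<in> set (J_rows W ds)" by (rule imageE)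
    then obtain u w w' where "u \<in> set (relation_rows ds) \<union> set (ideal_rows ds)" "w \<in> set W" "w' \<in> set W"
      "t = vec (mul_row w u w')" unfolding rows by (elim bexE) simp
    then show "t \<in> ?M" unfolding vec_mul_row by blast
  next
    fix t assume "t \<in> ?M"
    then obtain u w w' where u: "u \<in> set (relation_rows ds) \<union> set (ideal_rows ds)" "w \<in> set W" "w' \<in> set W"
      "t = vec (mul_row w u w')" unfolding vec_mul_row by blast
    then have "mul_row w u w' \<in> set (J_rows W ds)" unfolding rows by blast
    then show "t \<in> ?L" using u(4) by blast
  qed
  also have "\<dots> = ?R"
  proof (intro Set.set_eqI iffI)
    fix t assume "t \<in> ?M"
    then obtain w e f w' where "w \<in> set W" "w' \<in> set W" "e \<in> E" "f \<in> I e \<union> comm_rels n (c e) (d e)"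
      "t = lmul (word w) (rmul (emb e f) (word w'))" unfolding base by blast
    then show "t \<in> ?R" by (auto simp: rmul_emb lmul_emb mult.assoc)
  next
    fix t assume "t \<in> ?R"
    then obtain w e f w' where *: "w \<in> set W" "w' \<in> set W" "e \<in> E" "f \<in> I e \<union> comm_rels n (c e) (d e)"
      "t = emb e (word w * f * word w')" by blast
    then have "t = lmul (word w) (rmul (emb e f) (word w'))" by (simp add: rmul_emb lmul_emb mult.assoc)
    then show "t \<in> ?M" unfolding base using * by blast
  qed
  finally show "?L = ?R" .
qed

definition "Gv = (\<lambda>g. vec (vec_row g)) ` set gs"

lemma vec_row_valid: "g \<in> set gs \<Longrightarrow> valid_row (vec_row g)"
proof -
  assume g: "g \<in> set gs"
  have "valid_key (p, snd t)" if "p < length g" "t \<in> set (g ! p)" for p t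
    using gs(1)[OF g] gs(2)[OF g nth_mem[OF that(1)] that(2)] that(1) by (simp add: valid_key_def)
  then show ?thesis unfolding valid_row_def vec_row_def poly_row_def by (auto simp: set_enumerate)
qed

lemma vec_row_apply:
  assumes "length g = m" "p < m" shows "vec (vec_row g) (es ! p) = pol (g ! p)"
proof -
  have gen: "vec (concat (map (\<lambda>t. poly_row (fst t) (snd t)) (List.enumerate q h))) (es ! p)
      = (if q \<le> p \<and> p < q + length h then pol (h ! (p - q)) else 0)" if "q + length h \<le> m" for q h
    using that
  proof (induction h arbitrary: q)
    case Nil
    then show ?case by (auto simp: vec_simps vec_apply)
  next
    case (Cons f h)
    then have "es ! p = es ! q \<longleftrightarrow> p = q" using es(1) assms(2) by (simp add: nth_eq_iff_index_eq)
    then show ?case using Cons by (auto simp: vec_simps vec_poly_row vec_apply nth_Cons' not_less_eq_eq le_Suc_eq)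
  qed
  then show ?thesis using gen[of 0 g] assms by (simp add: vec_row_def)
qed

lemma Gv_Vecs: "Gv \<subseteq> Vecs" unfolding Gv_def using vec_Vecs[OF vec_row_valid] by blast

lemma vec_gen_rows:
  assumes "\<forall>w\<in>set W. letters w"
  shows "vec ` set (gen_rows two W gs) = {lmul (word w) (rmul g (word w')) | w g w'. w \<in> set W \<and> g \<in> Gv \<and>
      w' \<in> (if two then set W else {[]})}"
    and "v \<in> set (gen_rows two W gs) \<Longrightarrow> valid_row v"
proof -
  have rows: "v \<in> set (gen_rows two W gs) \<longleftrightarrow> (\<exists>g\<in>set gs.
      \<exists>w\<in>set W. \<exists>w'\<in>(if two then set W else {[]}). v = mul_row w (vec_row g) w')" for v
    unfolding gen_rows_def by (auto simp: set_products)
  show "valid_row v" if "v \<in> set (gen_rows two W gs)"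
  proof -
    from that obtain g w w' where "g \<in> set gs" "w \<in> set W" "w' \<in> (if two then set W else {[]})"
      "v = mul_row w (vec_row g) w'" unfolding rows by blast
    moreover from this have "letters w'" using assms by (auto split: if_splits)
    ultimately show ?thesis using valid_mul_row[OF vec_row_valid] assms by simp
  qed
  show "vec ` set (gen_rows two W gs) = {lmul (word w) (rmul g (word w')) | w g w'. w \<in> set W \<and> g \<in> Gv \<and>
      w' \<in> (if two then set W else {[]})}" (is "?L = ?R")
  proof (intro Set.set_eqI iffI)
    fix t assume "t \<in> ?L"
    then obtain v where "t = vec v" "v \<in> set (gen_rows two W gs)" by (rule imageE)
    then obtain g w w' where "g \<in> set gs" "w \<in> set W" "w' \<in> (if two then set W else {[]})"
      "t = vec (mul_row w (vec_row g) w')" unfolding rows by (elim bexE) simp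
    then show "t \<in> ?R" unfolding vec_mul_row Gv_def by blast
  next
    fix t assume "t \<in> ?R"
    then obtain g w w' where u: "g \<in> set gs" "w \<in> set W" "w' \<in> (if two then set W else {[]})"
      "t = vec (mul_row w (vec_row g) w')" unfolding vec_mul_row Gv_def by blast
    then have "mul_row w (vec_row g) w' \<in> set (gen_rows two W gs)" unfolding rows by blast
    then show "t \<in> ?L" using u(4) by blast
  qed
qed

section \<open>Keys and monomials\<close>

lemma occ_eq: "occ i w = count_list w i"
proof -
  have "fold (\<lambda>x a. if x = i then Suc a else a) w s = s + count_list w i" for s
    by (induction w arbitrary: s) auto
  then show ?thesis by (simp add: occ_def)
qed

lemma mcounts_enc: "enc_pair enc_word Num (mcounts n k) = mono_val n (exw (snd k)) (fst k)"
  by (simp add: mcounts_def mono_val_def enc_list_def occ_eq lookup_exw comp_def)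

lemma list_val_inj: "list_val (map Num u) = list_val (map Num v) \<Longrightarrow> u = v"
  using injD[OF inj_enc_list[OF inj_Num], of u v] by (simp add: enc_list_def)

lemma mono_val_inj:
  assumes "(mono_val n \<alpha> p :: 'k val) = mono_val n \<beta> q" "\<alpha> \<in> expos n" "\<beta> \<in> expos n"
  shows "\<alpha> = \<beta> \<and> p = q"
proof -
  have n: "map (\<lambda>i. Num (f i)) xs = map Num (map f xs)" for f and xs :: "nat list" by simp
  have "list_val (map Num (map (lookup \<alpha>) [0..<n])) = (list_val (map Num (map (lookup \<beta>) [0..<n])) :: 'k val)" "p = q"
    using assms(1) unfolding mono_val_def n[of "lookup \<alpha>"] n[of "lookup \<beta>"] by simp_all
  then have l: "map (lookup \<alpha>) [0..<n] = map (lookup \<beta>) [0..<n]" using list_val_inj by blast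
  have "lookup \<alpha> i = lookup \<beta> i" for i
  proof (cases "i < n")
    case True then show ?thesis using l by simp
  next
    case False
    then have "i \<notin> keys \<alpha>" "i \<notin> keys \<beta>" using assms(2,3) by (auto simp: expos_def)
    then show ?thesis by (simp add: in_keys_iff)
  qed
  then show ?thesis using \<open>p = q\<close> by (simp add: poly_mapping_eqI)
qed

lemma mono_less_iff:
  assumes "valid_key k" "valid_key k'"
  shows "mono_less Q n k k' \<longleftrightarrow> prec (mk k) (mk k')"
proof -
  have v: "exw (snd k) \<in> expos n" "exw (snd k') \<in> expos n" "fst k < m" "fst k' < m"
    using assms by (auto simp: valid_key_def)
  have "mono_less Q n k k' \<longleftrightarrow> Q (Pair (mono_val n (exw (snd k)) (fst k)) (mono_val n (exw (snd k')) (fst k')))"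
    by (simp add: mono_less_def mcounts_enc)
  also have "\<dots> \<longleftrightarrow> prec (mk k) (mk k')"
    unfolding compare_def mk_def
  proof
    assume "\<exists>\<alpha>\<in>expos n. \<exists>\<beta>\<in>expos n. \<exists>p<m. \<exists>q<m. (Pair :: 'k val \<Rightarrow> _) (mono_val n (exw (snd k)) (fst k)) (mono_val n (exw (snd k')) (fst k'))
      = Pair (mono_val n \<alpha> p) (mono_val n \<beta> q) \<and> prec (\<alpha>, es ! p) (\<beta>, es ! q)"
    then obtain \<alpha> \<beta> p q where *: "\<alpha> \<in> expos n" "\<beta> \<in> expos n" "mono_val n (exw (snd k)) (fst k) = (mono_val n \<alpha> p :: 'k val)"
      "mono_val n (exw (snd k')) (fst k') = (mono_val n \<beta> q :: 'k val)" "prec (\<alpha>, es ! p) (\<beta>, es ! q)" unfolding val.inject by blast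
    then show "prec (exw (snd k), es ! fst k) (exw (snd k'), es ! fst k')"
      using mono_val_inj[OF *(3) v(1) *(1)] mono_val_inj[OF *(4) v(2) *(2)] by simp
  qed (use v in blast)
  finally show ?thesis .
qed

lemma filter_eq_replicate_count: "filter (\<lambda>x. x = i) w = replicate (count_list w i) i"
  by (induction w) auto

lemma is_std_iff: "letters (snd k) \<Longrightarrow> is_std n k \<longleftrightarrow> snd k = std_word n (exw (snd k))"
  unfolding is_std_def std_word_def by (auto simp: filter_eq_replicate_count lookup_exw)

lemma word_minus: "letters u \<Longrightarrow> exw (word_minus n u w) = exw u - exw w \<and> letters (word_minus n u w)"
proof -
  assume u: "letters u"
  have fd: "fold (\<lambda>_ v. tl v) xs ys = drop (length xs) ys" for xs ys :: "nat list"
    by (induction xs arbitrary: ys) (auto simp: drop_Suc)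
  have e: "word_minus n u w = concat (map (\<lambda>i. replicate (count_list u i - count_list w i) i) [0..<n])"
    by (simp only: word_minus_def fd filter_eq_replicate_count length_replicate drop_replicate)
  have "count_list (concat (map (\<lambda>i. replicate (f i) i) [0..<N])) j = (if j < N then f j else 0)" for f N j
    by (induction N) (auto simp: count_list_replicate')
  moreover have "n \<le> j \<Longrightarrow> count_list u j = 0" for j using u by (auto simp: count_list_0_iff)
  ultimately have "lookup (exw (word_minus n u w)) j = lookup (exw u - exw w) j" for j
    by (simp add: e lookup_exw lookup_minus not_less)
  then show "exw (word_minus n u w) = exw u - exw w \<and> letters (word_minus n u w)"
    using e by (auto intro: poly_mapping_eqI)
qed

lemma kdvd_iff:
  assumes "valid_key l" "valid_key k"
  shows "kdvd n l k \<longleftrightarrow> mdvd n (mk l) (mk k)"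
proof -
  have "es ! fst l = es ! fst k \<longleftrightarrow> fst l = fst k"
    using assms es(1) by (simp add: valid_key_def nth_eq_iff_index_eq)
  moreover have "word_minus n (snd l) (snd k) = [] \<longleftrightarrow> exw (word_minus n (snd l) (snd k)) = 0"
    using lookup_exw[of "word_minus n (snd l) (snd k)"]
    by (auto simp: poly_mapping_eq_iff fun_eq_iff count_list_0_iff)
  moreover have "exw (snd l) - exw (snd k) = 0 \<longleftrightarrow> (\<forall>i. lookup (exw (snd l)) i \<le> lookup (exw (snd k)) i)"
    by (simp add: poly_mapping_eq_iff fun_eq_iff lookup_minus)
  moreover have "fst (mk k) \<in> expos n" using assms(2) by (simp add: mk_def valid_key_def)
  ultimately show ?thesis
    using word_minus[of "snd l" "snd k"] assms(1) by (auto simp: kdvd_def mdvd_iff mk_def valid_key_def)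
qed

lemma mk_std_inj:
  assumes "valid_key k" "valid_key k'" "is_std n k" "is_std n k'" "mk k = mk k'" shows "k = k'"
proof -
  have "fst k = fst k'" using assms(1,2,5) es(1) by (simp add: valid_key_def mk_def nth_eq_iff_index_eq)
  moreover have "snd k = snd k'" using assms is_std_iff by (metis mk_def prod.inject valid_key_def)
  ultimately show ?thesis by (simp add: prod_eq_iff)
qed

text \<open>Among the keys of a monomial exactly one is standard.\<close>

definition "std_key \<mu> = (THE k. valid_key k \<and> is_std n k \<and> mk k = \<mu>)"

lemma std_key:
  assumes "\<mu> \<in> K" shows "valid_key (std_key \<mu>)" "is_std n (std_key \<mu>)" "mk (std_key \<mu>) = \<mu>"
proof -
  obtain p where p: "p < m" "es ! p = snd \<mu>" using index_es assms by (metis mem_Times_iff)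
  let ?k = "(p, std_word n (fst \<mu>))"
  have k: "valid_key ?k \<and> is_std n ?k \<and> mk ?k = \<mu>"
    using p assms set_std_word[of n "fst \<mu>"]
    by (auto simp: valid_key_def is_std_iff mk_def mem_Times_iff)
  have "valid_key (std_key \<mu>) \<and> is_std n (std_key \<mu>) \<and> mk (std_key \<mu>) = \<mu>"
    unfolding std_key_def by (rule theI[of _ ?k]) (use k mk_std_inj in auto)
  then show "valid_key (std_key \<mu>)" "is_std n (std_key \<mu>)" "mk (std_key \<mu>) = \<mu>" by auto
qed

lemma key_less_trans:
  assumes "valid_key a" "valid_key b" "valid_key k" "key_less Q n a b" "key_less Q n b k"
  shows "key_less Q n a k"
  using assms prec_trans[of "mk a" "mk b" "mk k"] mk_K by (auto simp: key_less_def mono_less_iff)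

lemma key_less_asym:
  assumes "valid_key a" "valid_key b" "key_less Q n a b" shows "\<not> key_less Q n b a"
  using assms prec_trans[of "mk a" "mk b" "mk a"] prec_irrefl mk_K by (auto simp: key_less_def mono_less_iff)

text \<open>Since \<open>key_less\<close> is a strict partial order on valid keys, insertion keeps the list in decreasing order.\<close>

lemma key_sort:
  assumes "\<forall>k\<in>set ks. valid_key k"
  shows "set (key_sort Q n ks) = set ks \<and> sorted_wrt (\<lambda>a b. \<not> key_less Q n a b) (key_sort Q n ks)"
proof -
  have "set (fold (\<lambda>k l. key_insert Q n k l) ks l) = set ks \<union> set l \<and>
      sorted_wrt (\<lambda>a b. \<not> key_less Q n a b) (fold (\<lambda>k l. key_insert Q n k l) ks l)"
    if "\<forall>k\<in>set ks \<union> set l. valid_key k" "sorted_wrt (\<lambda>a b. \<not> key_less Q n a b) l" for l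
    using that
  proof (induction ks arbitrary: l)
    case (Cons k ks)
    have set_ins: "set (key_insert Q n k l) = insert k (set l)" by (auto simp: key_insert_def)
    have v: "valid_key k" "\<And>y. y \<in> set l \<Longrightarrow> valid_key y" using Cons.prems(1) by auto
    have "sorted_wrt (\<lambda>a b. \<not> key_less Q n a b) (key_insert Q n k l)"
      unfolding key_insert_def sorted_wrt_append
    proof (intro conjI ballI)
      show "sorted_wrt (\<lambda>a b. \<not> key_less Q n a b) (filter (key_less Q n k) l)"
        using Cons.prems(2) by (rule sorted_wrt_filter)
      show "sorted_wrt (\<lambda>a b. \<not> key_less Q n a b) (k # filter (\<lambda>y. \<not> key_less Q n k y) l)"
        using sorted_wrt_filter[OF Cons.prems(2), of "\<lambda>y. \<not> key_less Q n k y"] by simp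
      fix a b assume "a \<in> set (filter (key_less Q n k) l)" "b \<in> set (k # filter (\<lambda>y. \<not> key_less Q n k y) l)"
      then have a: "a \<in> set l" "key_less Q n k a" and b: "b = k \<or> b \<in> set l \<and> \<not> key_less Q n k b" by auto
      show "\<not> key_less Q n a b"
        using b key_less_asym[OF v(1) v(2)[OF a(1)] a(2)] key_less_trans[OF v(1) v(2)[OF a(1)] v(2) a(2)] by blast
    qed
    then show ?case using Cons.IH[of "key_insert Q n k l"] Cons.prems(1) set_ins by simp
  qed simp
  from this[of "[]"] show ?thesis using assms by (simp add: key_sort_def)
qed

end

context pbw_input
begin

section \<open>Leading terms of the echelon form\<close>

lemma vkeys_valid: "\<forall>r\<in>set rows. valid_row r \<Longrightarrow> \<forall>k\<in>set (vkeys rows). valid_key k"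
  by (auto simp: set_vkeys valid_row_def)

lemma in_span_valid:
  assumes "valid_row v" "\<forall>r\<in>set rows. valid_row r"
  shows "in_span rows v \<longleftrightarrow> vec v \<in> fv.span (vec ` set rows)"
proof (rule in_span_iff)
  have "\<forall>k\<in>set (vkeys (v # rows)). valid_key k" by (rule vkeys_valid) (use assms in simp)
  then show "set (vkeys (v # rows)) \<subseteq> {k. fst k < m}" by (auto simp: valid_key_def)
qed

lemma lookup_vec: "p < m \<Longrightarrow> lookup (vec r (es ! p)) w = coef r (p, w)"
  using X_vec[of "(p, w)" r] by (simp add: X_def)

lemma monv_mk: "valid_key k \<Longrightarrow> is_std n k \<Longrightarrow> monv (mk k) = emb (es ! fst k) (word (snd k))"
  using is_std_iff[of k] by (simp add: monv_def mk_def valid_key_def)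

context
  fixes rows assumes rows: "\<forall>r\<in>set rows. valid_row r"
begin

private lemma ks: "set (vkeys rows) \<subseteq> set (key_sort Q n (vkeys rows))"
  and sorted: "sorted_wrt (\<lambda>a b. \<not> key_less Q n a b) (key_sort Q n (vkeys rows))"
  and V: "set (vkeys rows) \<subseteq> {k. fst k < m}"
  using key_sort[OF vkeys_valid[OF rows]] vkeys_valid[OF rows] by (auto simp: valid_key_def)

lemma lead_rows_span: "fv.span (vec ` snd ` set (lead_rows Q n rows)) = fv.span (vec ` set rows)"
  unfolding lead_rows_def by (rule rref_span[OF ks sorted V])

lemma lead_rows_distinct: "distinct (map fst (lead_rows Q n rows))"
  unfolding lead_rows_def by (rule rref_distinct[OF ks sorted V])

lemma lead_rows_valid:
  assumes "(k, r) \<in> set (lead_rows Q n rows)"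
  shows "valid_key k" "valid_row r" "coef r k = 1"
proof -
  note p = rref_keys[OF ks sorted V, of k r, folded lead_rows_def, OF assms]
  then show "valid_row r" "valid_key k" "coef r k = 1"
    using vkeys_valid[OF rows] unfolding valid_row_def by blast+
qed

lemma lead_rows_reduced:
  "(k, r) \<in> set (lead_rows Q n rows) \<Longrightarrow> (k', r') \<in> set (lead_rows Q n rows) \<Longrightarrow> k \<noteq> k' \<Longrightarrow> coef r k' = 0"
  unfolding lead_rows_def by (rule rref_reduced[OF ks sorted V])

lemma lead_rows_unique:
  assumes "t \<in> fv.span (vec ` set rows)" "\<And>k r. (k, r) \<in> set (lead_rows Q n rows) \<Longrightarrow> X k t = 0"
  shows "t = 0"
  by (rule rref_unique[OF ks sorted V assms(1)]) (use assms(2) in \<open>simp add: lead_rows_def\<close>)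

text \<open>The pivot comes first in its row and standard keys come last in decreasing order; so if the pivot is
  standard, the row is supported on standard keys and the pivot is the largest monomial.\<close>

lemma lead_rows_order:
  assumes kr: "(k, r) \<in> set (lead_rows Q n rows)" "is_std n k" and k': "coef r k' \<noteq> 0" "k' \<noteq> k"
  shows "valid_key k'" "is_std n k'" "prec (mk k') (mk k)"
proof -
  have v: "valid_key k" "valid_row r" using lead_rows_valid[OF kr(1)] by auto
  show v': "valid_key k'" using coef_nonzero_key[OF k'(1)] v(2) unfolding valid_row_def by blast
  have "\<not> key_less Q n k k'"
    using rref_order[OF ks sorted V, of k r k', folded lead_rows_def] kr(1) k' by blast
  then have std: "is_std n k'" "\<not> prec (mk k) (mk k')"
    using kr(2) mono_less_iff[OF v(1) v'] by (auto simp: key_less_def)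
  have "mk k \<noteq> mk k'" using mk_std_inj[OF v(1) v' kr(2) std(1)] k'(2) by blast
  then show "is_std n k'" "prec (mk k') (mk k)" using std prec_total[OF mk_K[OF v(1)] mk_K[OF v']] by auto
qed

lemma lead_rows_has_lead:
  assumes kr: "(k, r) \<in> set (lead_rows Q n rows)" "is_std n k"
  shows "has_lead (vec r) (mk k)"
proof -
  note v = lead_rows_valid[OF kr(1)]
  have "vec r - monv (mk k) \<in> stdv (below (mk k))" unfolding stdv_def
  proof (intro CollectI allI impI)
    fix e w assume nz: "lookup ((vec r - monv (mk k)) e) w \<noteq> 0"
    have "e \<in> E"
    proof (rule ccontr)
      assume "e \<notin> E"
      then have "vec r e = 0" "monv (mk k) e = 0"
        using vec_zero_outside es_E v(1) by (auto simp: monv_mk[OF v(1) kr(2)] vec_apply valid_key_def)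
      then show False using nz by (simp add: vec_apply)
    qed
    then obtain p where p: "p < m" "es ! p = e" using index_es by blast
    have pe: "p = fst k" if "e = es ! fst k" using that p es(1) v(1) by (simp add: nth_eq_iff_index_eq valid_key_def)
    have "lookup ((vec r - monv (mk k)) e) w = coef r (p, w) - (if (p, w) = k then 1 else 0)"
      using lookup_vec[OF p(1), of r w] p pe
      by (auto simp: vec_apply monv_mk[OF v(1) kr(2)] lookup_minus word_def lookup_single when_def prod_eq_iff)
    then have "coef r (p, w) \<noteq> 0" "(p, w) \<noteq> k" using nz v(3) by (auto split: if_splits)
    note o = lead_rows_order[OF kr this]
    have "w = std_word n (exw w)" using o(1,2) is_std_iff[of "(p, w)"] by (simp add: valid_key_def)
    moreover have "(exw w, e) \<in> below (mk k)" using o mk_K[OF o(1)] p by (auto simp: below_def mk_def)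
    ultimately show "\<exists>\<alpha>. (\<alpha>, e) \<in> below (mk k) \<and> w = std_word n \<alpha>" by blast
  qed
  then have "vec r - monv (mk k) \<in> V (below (mk k))"
    using stdv_span[OF below_subset] unfolding V_def using fv.span_mono[of "monv ` below (mk k)"] by blast
  then show ?thesis unfolding has_lead_def by (intro exI[of _ 1]) simp
qed

end

lemma supp_vec:
  assumes "\<alpha> \<in> supp n (vec r e)" "valid_row r"
  obtains k where "valid_key k" "is_std n k" "mk k = (\<alpha>, e)" "coef r k \<noteq> 0" "k \<in> snd ` set r"
proof -
  have nz: "lookup (vec r e) (std_word n \<alpha>) \<noteq> 0" "\<alpha> \<in> expos n" using assms by (auto simp: supp_def in_keys_iff)
  then have "e \<in> E" using vec_zero_outside by fastforce
  then obtain p where p: "p < m" "es ! p = e" using index_es by blast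
  let ?k = "(p, std_word n \<alpha>)"
  have c: "coef r ?k \<noteq> 0" using lookup_vec[OF p(1)] p(2) nz(1) by simp
  have "valid_key ?k" using p set_std_word by (simp add: valid_key_def)
  moreover have "mk ?k = (\<alpha>, e)" using p nz(2) by (simp add: mk_def)
  moreover have "is_std n ?k" using is_std_iff[of ?k] set_std_word nz(2) by simp
  ultimately show ?thesis using that c coef_nonzero_key[OF c] by blast
qed

abbreviation "il \<equiv> ideal_leads Q n ds"

lemma ideal_J: "e \<in> E \<Longrightarrow> f \<in> I e \<Longrightarrow> emb e f \<in> JE"
  unfolding JE_span
  by (rule fv.span_base, intro CollectI exI[of _ e] exI[of _ "[]"] exI[of _ f]) (simp add: falg_mult_simps)

text \<open>The row space of a single row is at most one-dimensional, so the pivot row is a multiple of the ideal element; the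
  pivot is standard because all monomials of elements of \<open>I e\<close> are.\<close>

lemma ideal_lead_row:
  assumes "v \<in> set (ideal_rows ds)" "(k, r) \<in> set (lead_rows Q n [v])"
  obtains e f a where "e \<in> E" "f \<in> I e" "vec v = emb e f" "a \<noteq> 0" "vec r = vscale a (vec v)" "is_std n k" "es ! fst k = e"
proof -
  have rows: "\<forall>r\<in>set [v]. valid_row r" using vec_ideal_rows(2)[OF assms(1)] by simp
  note val = lead_rows_valid[OF rows assms(2)]
  have "vec v \<in> {emb e f | e f. e \<in> E \<and> f \<in> I e}" using vec_ideal_rows(1) assms(1) by blast
  then obtain e f where ef: "e \<in> E" "f \<in> I e" "vec v = emb e f" by blast
  have "vec r \<in> fv.span {vec v}"
    using lead_rows_span[OF rows] assms(2) fv.span_base[of "vec r" "vec ` snd ` set (lead_rows Q n [v])"] by force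
  then obtain a where a: "vec r = vscale a (vec v)" by (auto simp: fv.span_singleton)
  have k: "fst k < m" using val(1) by (simp add: valid_key_def)
  have "X k (vec r) = 1" using X_vec[OF k] val(3) by simp
  then have x: "a * X k (vec v) = 1" using a by (simp add: X_scale)
  then have nz: "lookup (emb e f (es ! fst k)) (snd k) \<noteq> 0" using ef(3) by (auto simp: X_def)
  then have e: "es ! fst k = e" and fk: "snd k \<in> keys f" by (auto simp: vec_apply in_keys_iff split: if_splits)
  have "f \<in> std_polys n" using datum[OF ef(1)] ef(2) by (auto simp: pbw_datum_def)
  then have "snd k = std_word n (exw (snd k))" using fk by (auto simp: std_polys_def)
  then have "is_std n k" using is_std_iff val(1) by (simp add: valid_key_def)
  moreover have "a \<noteq> 0" using x by auto
  ultimately show ?thesis using that[OF ef] a e by blast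
qed

lemma ideal_leads:
  assumes "t \<in> set il"
  shows "valid_key (fst t)" "is_std n (fst t)" "valid_row (snd t)" "vec (snd t) \<in> JE" "mk (fst t) \<in> Ld"
proof -
  obtain v where v: "v \<in> set (ideal_rows ds)" "t \<in> set (lead_rows Q n [v])" using assms by (auto simp: ideal_leads_def)
  obtain k r where t: "t = (k, r)" by (cases t)
  have kr: "(k, r) \<in> set (lead_rows Q n [v])" using v t by simp
  have rows: "\<forall>r\<in>set [v]. valid_row r" using vec_ideal_rows(2)[OF v(1)] by simp
  obtain e f a where *: "e \<in> E" "f \<in> I e" "vec v = emb e f" "vec r = vscale a (vec v)" "is_std n k"
    using ideal_lead_row[OF v(1) kr] by blast
  show val: "valid_key (fst t)" "valid_row (snd t)" "is_std n (fst t)"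
    using lead_rows_valid[OF rows kr] *(5) t by auto
  have J: "vec r \<in> JE" using *(3,4) ideal_J[OF *(1,2)] fv.subspace_scale[OF JE_subspace] by simp
  then show "vec (snd t) \<in> JE" using t by simp
  show "mk (fst t) \<in> Ld"
    using has_lead_Ld[OF lead_rows_has_lead[OF rows kr *(5)] JE_V[OF J]] mk_K val(1) t by simp
qed

text \<open>The pivot of the row of an ideal element is the largest monomial in it.\<close>

lemma ideal_leads_complete:
  assumes e: "e \<in> E" and l: "l \<in> lexps n (induced prec e) (I e)"
  shows "\<exists>t\<in>set il. mk (fst t) = (l, e)"
proof -
  obtain f where f: "f \<in> I e" "l \<in> supp n f" "\<And>\<delta>. \<delta> \<in> supp n f \<Longrightarrow> \<delta> = l \<or> prec (\<delta>, e) (l, e)"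
    using lexps_supp[OF e l] by blast
  have lE: "l \<in> expos n" using f(2) by (simp add: supp_def)
  have "emb e f \<in> vec ` set (ideal_rows ds)" unfolding vec_ideal_rows(1) using e f(1) by blast
  then obtain v where v: "v \<in> set (ideal_rows ds)" "vec v = emb e f" by force
  have rows: "\<forall>r\<in>set [v]. valid_row r" using vec_ideal_rows(2)[OF v(1)] by simp
  have "vec v e \<noteq> 0" using f(2) v(2) by (auto simp: vec_apply supp_def)
  then have "vec v \<noteq> 0" by (auto simp: vec_apply)
  have "lead_rows Q n [v] \<noteq> []"
  proof
    assume "lead_rows Q n [v] = []"
    then have "fv.span {vec v} = {0}" using lead_rows_span[OF rows] by simp
    then show False using fv.span_base[of "vec v" "{vec v}"] \<open>vec v \<noteq> 0\<close> by blast
  qed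
  then obtain k r where kr: "(k, r) \<in> set (lead_rows Q n [v])" by (metis list.set_intros(1) neq_Nil_conv surj_pair)
  obtain e' f' a where *: "vec v = emb e' f'" "a \<noteq> 0" "vec r = vscale a (vec v)" "is_std n k" "es ! fst k = e'"
    using ideal_lead_row[OF v(1) kr] by blast
  have "e' = e" using fun_cong[OF *(1), of e] \<open>vec v e \<noteq> 0\<close> by (auto simp: vec_apply split: if_splits)
  note val = lead_rows_valid[OF rows kr]
  have lk: "lookup (vec r e) w = a * lookup f w" for w using *(3) v(2) by (simp add: vec_apply)
  have fk: "fst k < m" using val(1) by (simp add: valid_key_def)
  have sk: "snd k = std_word n (exw (snd k))" "exw (snd k) \<in> expos n"
    using *(4) val(1) is_std_iff by (auto simp: valid_key_def)
  have "a * lookup f (snd k) = 1" using lookup_vec[OF fk, of r "snd k"] val(3) lk \<open>e' = e\<close> *(5) by simp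
  then have "exw (snd k) \<in> supp n f" using sk by (auto simp: supp_def in_keys_iff)
  then have 1: "mk k = (l, e) \<or> prec (mk k) (l, e)" using f(3) *(5) \<open>e' = e\<close> by (auto simp: mk_def)
  have "(l, e) = mk k"
  proof (rule ccontr)
    assume ne: "(l, e) \<noteq> mk k"
    let ?k = "(fst k, std_word n l)"
    have "lookup f (std_word n l) \<noteq> 0" using f(2) by (simp add: supp_def in_keys_iff)
    moreover have "coef r ?k = a * lookup f (std_word n l)"
      using lookup_vec[OF fk, of r "std_word n l"] lk *(5) \<open>e' = e\<close> by simp
    ultimately have "coef r ?k \<noteq> 0" using *(2) by (metis mult_eq_0_iff)
    moreover have mk: "mk ?k = (l, e)" using lE *(5) \<open>e' = e\<close> by (simp add: mk_def)
    then have "?k \<noteq> k" using ne by auto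
    ultimately have "prec (l, e) (mk k)" using lead_rows_order(3)[OF rows kr *(4)] mk by metis
    then show False using 1 ne prec_trans[of "(l, e)" "mk k" "(l, e)"] prec_irrefl[of "(l, e)"] mk_K[OF val(1)] lE e by auto
  qed
  then show ?thesis using kr v(1) unfolding ideal_leads_def by force
qed

lemma Ld_ideal_lead:
  assumes "\<mu> \<in> Ld" shows "\<exists>t\<in>set il. mdvd n (mk (fst t)) \<mu>"
proof -
  have K: "\<mu> \<in> K" using assms by (auto simp: Ld_def)
  obtain \<alpha> \<gamma> where a: "fst \<mu> = \<alpha> + \<gamma>" "\<alpha> \<in> lexps n (induced prec (snd \<mu>)) (I (snd \<mu>))" "\<gamma> \<in> expos n"
    using assms by (auto simp: Ld_def Lexps_def)
  then obtain t where "t \<in> set il" "mk (fst t) = (\<alpha>, snd \<mu>)"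
    using ideal_leads_complete[OF _ a(2)] K by (auto simp: mem_Times_iff)
  then show ?thesis using a by (intro bexI[of _ t]) (auto simp: mdvd_def)
qed

section \<open>Soundness\<close>

definition "valid_pairs H \<longleftrightarrow> (\<forall>(k, r)\<in>set H. valid_key k \<and> valid_row r)"

lemma shift_mk: "mk (fst k, w @ snd k) = shift w (mk k)"
  by (simp add: mk_def shift_def ac_simps)

lemma vec_mul_left: "vec (mul_row w v []) = lmul (word w) (vec v)"
  by (simp add: vec_mul_row falg_mult_simps rmul_one)

lemma vec_lower_rows:
  assumes H: "valid_pairs H" and W: "\<forall>w\<in>set W. letters w" and k: "valid_key k"
  shows "vec ` set (lower_rows Q n W H k) = {lmul (word w) (vec s) | w l s. (l, s) \<in> set H \<and> w \<in> set W \<and> prec (shift w (mk l)) (mk k)}"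
    (is "_ = ?R")
    and "v \<in> set (lower_rows Q n W H k) \<Longrightarrow> valid_row v"
proof -
  have rows: "v \<in> set (lower_rows Q n W H k) \<longleftrightarrow>
      (\<exists>l s w. (l, s) \<in> set H \<and> w \<in> set W \<and> prec (shift w (mk l)) (mk k) \<and> v = mul_row w s [])" for v
  proof -
    have "mono_less Q n (fst l, w @ snd l) k \<longleftrightarrow> prec (shift w (mk l)) (mk k)"
      if "(l, s) \<in> set H" "w \<in> set W" for l s w
    proof -
      have "valid_key (fst l, w @ snd l)" using that H W by (auto simp: valid_pairs_def valid_key_def)
      from mono_less_iff[OF this k] show ?thesis by (simp add: shift_mk)
    qed
    note ml = this
    have "v \<in> set (lower_rows Q n W H k) \<longleftrightarrow>
        (\<exists>t\<in>set H. \<exists>w\<in>set W. mono_less Q n (fst (fst t), w @ snd (fst t)) k \<and> v = mul_row w (snd t) [])"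
      unfolding lower_rows_def by auto
    also have "\<dots> \<longleftrightarrow> (\<exists>t\<in>set H. \<exists>w\<in>set W. prec (shift w (mk (fst t))) (mk k) \<and> v = mul_row w (snd t) [])"
    proof (intro bex_cong refl)
      fix t w assume "t \<in> set H" "w \<in> set W"
      then show "mono_less Q n (fst (fst t), w @ snd (fst t)) k \<and> v = mul_row w (snd t) [] \<longleftrightarrow>
          prec (shift w (mk (fst t))) (mk k) \<and> v = mul_row w (snd t) []"
        using ml[of "fst t" "snd t" w] by simp
    qed
    also have "\<dots> \<longleftrightarrow> (\<exists>l s w. (l, s) \<in> set H \<and> w \<in> set W \<and> prec (shift w (mk l)) (mk k) \<and> v = mul_row w s [])"
      by force
    finally show ?thesis .
  qed
  show "v \<in> set (lower_rows Q n W H k) \<Longrightarrow> valid_row v"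
    unfolding rows using H W valid_mul_row by (fastforce simp: valid_pairs_def)
  show "vec ` set (lower_rows Q n W H k) = ?R"
  proof (intro Set.set_eqI iffI)
    fix t assume "t \<in> vec ` set (lower_rows Q n W H k)"
    then obtain v where "t = vec v" "v \<in> set (lower_rows Q n W H k)" by (rule imageE)
    then obtain l s w where "(l, s) \<in> set H" "w \<in> set W" "prec (shift w (mk l)) (mk k)" "t = vec (mul_row w s [])"
      unfolding rows by blast
    then show "t \<in> ?R" by (intro CollectI exI[of _ w] exI[of _ l] exI[of _ s]) (simp add: vec_mul_left)
  next
    fix t assume "t \<in> ?R"
    then obtain w l s where *: "t = lmul (word w) (vec s)" "(l, s) \<in> set H" "w \<in> set W" "prec (shift w (mk l)) (mk k)" by blast
    then have "mul_row w s [] \<in> set (lower_rows Q n W H k)" unfolding rows by blast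
    moreover have "t = vec (mul_row w s [])" using * by (simp add: vec_mul_left)
    ultimately show "t \<in> vec ` set (lower_rows Q n W H k)" by (rule image_eqI[rotated])
  qed
qed

lemma cofactor:
  assumes "valid_key k" "valid_key k'"
  shows "letters (cofactor n k k')" "exw (cofactor n k k') = exw (snd k') - exw (snd k)"
  using word_minus[of "snd k'" "snd k"] assms by (auto simp: cofactor_def valid_key_def)

lemma pair_reduces_iff:
  assumes H: "valid_pairs H" and W: "\<forall>w\<in>set W. letters w" and jr: "\<forall>v\<in>set jr. valid_row v"
    and t: "valid_key k" "valid_row r" "valid_key k'" "valid_row r'"
  shows "pair_reduces Q n W jr H (k, r) (k', r') \<longleftrightarrow> (fst k = fst k' \<longrightarrow>
    lmul (word (cofactor n k k')) (vec r) \<in> fv.span (insert (lmul (word (cofactor n k' k)) (vec r'))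
      ({lmul (word w) (vec s) | w l s. (l, s) \<in> set H \<and> w \<in> set W \<and>
         prec (shift w (mk l)) (shift (cofactor n k k') (mk k))} \<union> vec ` set jr)))"
proof -
  let ?a = "cofactor n k k'" and ?a' = "cofactor n k' k"
  have a: "letters ?a" "letters ?a'" using cofactor t by auto
  have k: "valid_key (fst k, ?a @ snd k)" using t(1) a by (simp add: valid_key_def)
  let ?rows = "mul_row ?a' r' [] # lower_rows Q n W H (fst k, ?a @ snd k) @ jr"
  have "\<forall>v\<in>set ?rows. valid_row v"
    using valid_mul_row[OF t(4) a(2)] vec_lower_rows(2)[OF H W k] jr by auto
  moreover have "valid_row (mul_row ?a r [])" using valid_mul_row[OF t(2) a(1)] by simp
  ultimately have "in_span ?rows (mul_row ?a r []) \<longleftrightarrow> vec (mul_row ?a r []) \<in> fv.span (vec ` set ?rows)"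
    by (intro in_span_valid)
  moreover have "vec ` set ?rows = insert (lmul (word ?a') (vec r')) ({lmul (word w) (vec s) | w l s. (l, s) \<in> set H \<and> w \<in> set W \<and>
         prec (shift w (mk l)) (shift ?a (mk k))} \<union> vec ` set jr)"
    using vec_lower_rows(1)[OF H W k] by (simp add: vec_mul_left shift_mk image_Un)
  ultimately show ?thesis by (simp add: pair_reduces_def vec_mul_left)
qed

lemma generates_iff:
  assumes H: "valid_pairs H" and W: "\<forall>w\<in>set W. letters w" and jr: "\<forall>v\<in>set jr. valid_row v"
    and vs: "\<forall>v\<in>set vs. valid_row v"
  shows "generates W jr H vs \<longleftrightarrow> (\<forall>v\<in>set vs. vec v \<in> fv.span ({lmul (word w) (vec s) | w l s. (l, s) \<in> set H \<and> w \<in> set W}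
     \<union> vec ` set jr))"
proof -
  let ?rows = "concat (map (\<lambda>l. products W [[]] (snd l)) H) @ jr"
  have r: "set ?rows = {mul_row w s [] | w l s. (l, s) \<in> set H \<and> w \<in> set W} \<union> set jr"
  proof -
    have "{mul_row w s [] | w l s. (l, s) \<in> set H \<and> w \<in> set W} = (\<Union>l\<in>set H. {mul_row w (snd l) [] | w. w \<in> set W})"
      by force
    then show ?thesis by (auto simp: set_products)
  qed
  have "\<forall>v\<in>set ?rows. valid_row v"
    unfolding r using H W jr valid_mul_row by (fastforce simp: valid_pairs_def)
  then have "in_span ?rows v \<longleftrightarrow> vec v \<in> fv.span (vec ` set ?rows)" if "v \<in> set vs" for v
    using in_span_valid that vs by blast
  moreover have "vec ` set ?rows = {lmul (word w) (vec s) | w l s. (l, s) \<in> set H \<and> w \<in> set W} \<union> vec ` set jr"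
    unfolding r by (auto simp: image_Un vec_mul_left image_iff) (metis vec_mul_left)+
  ultimately show ?thesis unfolding generates_def list_all_iff by (simp only: cong: ball_cong)
qed

lemma submod_span_le: "lead_system H ld \<Longrightarrow> submod (span_le H ld K)"
  unfolding span_le_def
proof (rule submodI)
  assume ls: "lead_system H ld"
  show "{lmul (word w) h | w h. h \<in> H \<and> letters w \<and> shift w (ld h) \<in> K} \<subseteq> Vecs"
    using lead_systemD(1)[OF ls] by (auto intro!: Vecs_lmul)
  fix b v assume "b \<in> {lmul (word w) h | w h. h \<in> H \<and> letters w \<and> shift w (ld h) \<in> K}" and v: "letters v"
  then obtain w h where b: "b = lmul (word w) h" "h \<in> H" "letters w" by blast
  have "lmul (word v) b = lmul (word (v @ w)) h" by (simp add: b lmul_lmul falg_mult_simps)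
  then show "lmul (word v) b \<in> fv.span (JE \<union> {lmul (word w) h | w h. h \<in> H \<and> letters w \<and> shift w (ld h) \<in> K})"
    using b v lead_systemD(2)[OF ls b(2)]
    by (intro fv.span_base UnI2 CollectI exI[of _ "v @ w"] exI[of _ h]) auto
qed

lemma gen_vecs_minimal:
  assumes S: "submod S" "G \<subseteq> S" "two \<Longrightarrow> rclosed S" shows "gen_vecs two G \<subseteq> S"
  unfolding gen_vecs_def
proof (rule fv.span_minimal[OF _ submodD(1)[OF S(1)]], rule Un_least)
  show "JE \<subseteq> S" using submodD(2)[OF S(1)] by blast
  show "{lmul (word w) (rmul g (word w')) | w g w'. g \<in> G \<and> letters w \<and> letters w' \<and> (two \<or> w' = [])} \<subseteq> S"
  proof clarify
    fix w g w' assume *: "g \<in> G" "letters w" "letters w'" "two \<or> w' = []"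
    have "rmul g (word w') \<in> S"
      using * S(2,3) unfolding rclosed_def by (cases two) (auto simp: falg_mult_simps rmul_one)
    then show "lmul (word w) (rmul g (word w')) \<in> S" using submodD(4)[OF S(1)] *(2) by blast
  qed
qed

text \<open>Right multiplication by a variable commutes with left multiplication, so it is enough to treat the generators;
  words are products of variables.\<close>

lemma rclosed_span_le:
  assumes ls: "lead_system H ld" and r: "\<And>h i. h \<in> H \<Longrightarrow> i < n \<Longrightarrow> rmul h (word [i]) \<in> span_le H ld K"
  shows "rclosed (span_le H ld K)"
proof -
  let ?S = "span_le H ld K"
  have one: "rmul t (word [i]) \<in> ?S" if "t \<in> ?S" "i < n" for t i
    unfolding span_le_def
  proof (rule fv_span_map[OF that(1)[unfolded span_le_def]])
    fix y assume "y \<in> JE \<union> {lmul (word w) h |w h. h \<in> H \<and> letters w \<and> shift w (ld h) \<in> K}"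
    then show "rmul y (word [i]) \<in> fv.span (JE \<union> {lmul (word w) h |w h. h \<in> H \<and> letters w \<and> shift w (ld h) \<in> K})"
      unfolding span_le_def[symmetric]
    proof
      assume "y \<in> JE"
      then show "rmul y (word [i]) \<in> ?S" using JE_rmul[of y "word [i]"] that(2) by (intro span_le_closed(5)) simp
    next
      assume "y \<in> {lmul (word w) h |w h. h \<in> H \<and> letters w \<and> shift w (ld h) \<in> K}"
      then obtain w h where y: "y = lmul (word w) h" "h \<in> H" "letters w" by blast
      then show "rmul y (word [i]) \<in> ?S"
        using submodD(4)[OF submod_span_le[OF ls] r[OF y(2) that(2)] y(3)] by (simp add: rmul_lmul)
    qed
  qed (simp_all only: rmul_linear)
  have "rmul t (word w) \<in> ?S" if "t \<in> ?S" "letters w" for t w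
    using that
  proof (induction w arbitrary: t)
    case Nil then show ?case by (simp add: falg_mult_simps rmul_one)
  next
    case (Cons i w)
    have "rmul t (word (i # w)) = rmul (rmul t (word [i])) (word w)"
      by (simp add: rmul_rmul falg_mult_simps)
    then show ?case using Cons one by simp
  qed
  then show ?thesis unfolding rclosed_def by blast
qed

abbreviation "inp \<equiv> (n, ds, gs)"
abbreviation "all_rows two W \<equiv> J_rows W ds @ gen_rows two W gs"

lemma words_letters: "\<forall>w\<in>set (words n N). letters w" by (simp add: set_words)

lemma all_rows_valid: "\<forall>w\<in>set W. letters w \<Longrightarrow> \<forall>r\<in>set (all_rows two W). valid_row r"
  using vec_J_rows(2) vec_gen_rows(2) by auto

lemma J_rows_JE: "\<forall>w\<in>set W. letters w \<Longrightarrow> vec ` set (J_rows W ds) \<subseteq> JE"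
  unfolding JE_span by (subst vec_J_rows(1), assumption, rule subset_trans[OF _ fv.span_superset]) blast

lemma all_rows_gen: "\<forall>w\<in>set W. letters w \<Longrightarrow> fv.span (vec ` set (all_rows two W)) \<subseteq> gen_vecs two Gv"
proof (rule fv.span_minimal)
  assume W: "\<forall>w\<in>set W. letters w"
  note S = submod_gen[OF Gv_Vecs, of two]
  have "vec ` set (gen_rows two W gs) \<subseteq> gen_vecs two Gv"
    unfolding vec_gen_rows(1)[OF W] gen_vecs_def
    by (rule subset_trans[OF _ fv.span_superset]) (use W in \<open>auto split: if_splits; blast\<close>)
  moreover have "vec ` set (J_rows W ds) \<subseteq> gen_vecs two Gv" using J_rows_JE[OF W] submodD(2)[OF S] by blast
  ultimately show "vec ` set (all_rows two W) \<subseteq> gen_vecs two Gv" by (simp add: image_Un)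
  show "fv.subspace (gen_vecs two Gv)" by (rule submodD(1)[OF S])
qed

lemma candidates_iff:
  "t \<in> set (candidates Q two W inp) \<longleftrightarrow> t \<in> set (lead_rows Q n (all_rows two W)) \<and> is_std n (fst t) \<and>
     (\<forall>l\<in>set il. \<not> kdvd n (fst l) (fst t)) \<and>
     (\<forall>l\<in>set (lead_rows Q n (all_rows two W)). is_std n (fst l) \<longrightarrow> fst l = fst t \<or> \<not> kdvd n (fst l) (fst t))"
  unfolding candidates_def minimal_rows_def std_rows_def list_all_iff set_filter fst_conv snd_conv by blast

text \<open>The leading monomial of a candidate is its pivot, and different candidates have different pivots. The three
  parts of the test provide, in this order, reducedness, the hypothesis of Buchberger's criterion, and
  that the span of multiples of the candidates is the whole submodule.\<close>

theorem accept_sound: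
  assumes W: "\<forall>w\<in>set W. letters w" and H: "H = candidates Q two W inp" and acc: "accept Q two W inp H"
  shows "reduced_groebner_basis n A E I prec (cls ` gen_vecs two Gv) (cls ` vec ` snd ` set H)"
proof -
  let ?rows = "all_rows two W" and ?jr = "J_rows W ds"
  note rows = all_rows_valid[OF W, of two]
  have Hin: "(k, r) \<in> set (lead_rows Q n ?rows)" "is_std n k" "\<And>l. l \<in> set il \<Longrightarrow> \<not> kdvd n (fst l) k"
    if "(k, r) \<in> set H" for k r
    using that unfolding H candidates_iff by auto
  have Hval: "valid_key k" "valid_row r" "coef r k = 1" if "(k, r) \<in> set H" for k r
    using lead_rows_valid[OF rows Hin(1)[OF that]] by auto
  then have vp: "valid_pairs H" by (auto simp: valid_pairs_def)
  have jr: "\<forall>v\<in>set ?jr. valid_row v" using vec_J_rows(2)[OF W] by blast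
  let ?S = "vec ` snd ` set H"
  \<comment> \<open>in the echelon form, a row vanishes at the pivots of the other rows\<close>
  have ukey: "k = k'" if "(k, r) \<in> set H" "(k', r') \<in> set H" "vec r = vec r'" for k r k' r'
  proof (rule ccontr)
    assume "k \<noteq> k'"
    then have "coef r k' = 0" using lead_rows_reduced[OF rows Hin(1)[OF that(1)] Hin(1)[OF that(2)]] by blast
    moreover have "coef r k' = coef r' k'"
      using X_vec[of k' r] X_vec[of k' r'] that(3) Hval(1)[OF that(2)] by (simp add: valid_key_def)
    ultimately show False using Hval(3)[OF that(2)] by simp
  qed
  define ld where "ld h = mk (THE k. \<exists>r. (k, r) \<in> set H \<and> vec r = h)" for h
  have ld: "ld (vec r) = mk k" if "(k, r) \<in> set H" for k r
  proof -
    have "(THE k'. \<exists>r'. (k', r') \<in> set H \<and> vec r' = vec r) = k"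
      by (rule the_equality) (use that ukey in blast)+
    then show ?thesis by (simp add: ld_def)
  qed
  have ls: "lead_system ?S ld" unfolding lead_system_def
    using ld vec_Vecs[OF Hval(2)] mk_K[OF Hval(1)] lead_rows_has_lead[OF rows Hin(1,2)] by auto
  have inj: "inj_on ld ?S"
  proof (rule inj_onI)
    fix g h assume gh: "g \<in> ?S" "h \<in> ?S" "ld g = ld h"
    obtain k r k' r' where kr: "(k, r) \<in> set H" "g = vec r" "(k', r') \<in> set H" "h = vec r'" using gh by auto
    then have "k = k'" using mk_std_inj[OF Hval(1)[OF kr(1)] Hval(1)[OF kr(3)]] Hin(2) gh(3) ld by metis
    then have "r = r'" using lead_rows_distinct[OF rows] Hin(1)[OF kr(1)] Hin(1)[OF kr(3)]
      by (metis eq_key_imp_eq_value)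
    then show "g = h" using kr by simp
  qed
  have nLd: "mk k \<notin> Ld" if "(k, r) \<in> set H" for k r
  proof
    assume "mk k \<in> Ld"
    then obtain t where t: "t \<in> set il" "mdvd n (mk (fst t)) (mk k)" using Ld_ideal_lead by blast
    then have "kdvd n (fst t) k" using kdvd_iff[OF ideal_leads(1)[OF t(1)] Hval(1)[OF that]] by simp
    then show False using Hin(3)[OF that t(1)] by blast
  qed
  have acc': "tails_reduced n il H" "pairs_reduce Q n W ?jr il H"
    "generates W ?jr H (map (\<lambda>g. vec_row g) gs @ right_rows two n H)"
    using acc by (simp_all add: accept_def)
  \<comment> \<open>the spans formed by the algorithm, with cofactors from \<open>W\<close> only, are contained in the abstract ones\<close>
  have span_le_sub: "fv.span (insert u ({lmul (word w) (vec s) | w l s. (l, s) \<in> set H \<and> w \<in> set W \<and> P w l} \<union> vec ` set ?jr))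
     \<subseteq> fv.span (insert u (span_le ?S ld P'))"
    if "\<And>w l s. (l, s) \<in> set H \<Longrightarrow> w \<in> set W \<Longrightarrow> P w l \<Longrightarrow> shift w (mk l) \<in> P'" for u P P'
  proof (rule fv.span_mono, intro insert_mono Un_least subsetI)
    fix x assume "x \<in> {lmul (word w) (vec s) | w l s. (l, s) \<in> set H \<and> w \<in> set W \<and> P w l}"
    then obtain w l s where *: "x = lmul (word w) (vec s)" "(l, s) \<in> set H" "w \<in> set W" "P w l" by blast
    have "vec s \<in> ?S" using *(2) by force
    then show "x \<in> span_le ?S ld P'" unfolding *(1)
      by (rule span_le_closed(6)) (use * W that ld in auto)
  next
    fix x assume "x \<in> vec ` set ?jr"
    then show "x \<in> span_le ?S ld P'" using J_rows_JE[OF W] span_le_closed(5) by blast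
  qed
  have pairs: "lmul (word (cofactor n k k')) (vec r) \<in> fv.span (insert (lmul (word (cofactor n k' k)) (vec r'))
      (span_le ?S ld (below (shift (cofactor n k k') (mk k)))))"
    if kr: "(k, r) \<in> set H" and kr': "(k', r') \<in> set H \<union> set il" and e: "es ! fst k = es ! fst k'" for k r k' r'
  proof -
    have v': "valid_key k'" "valid_row r'" using kr' Hval(1)[of k' r'] Hval(2)[of k' r'] ideal_leads(1,3)[of "(k', r')"] by auto
    have pr: "pair_reduces Q n W ?jr H (k, r) (k', r')"
      using acc'(2) kr kr' unfolding pairs_reduce_def list_all_iff by auto
    have "fst k = fst k'" using e es(1) Hval(1)[OF kr] v'(1) by (simp add: valid_key_def nth_eq_iff_index_eq)
    then have "lmul (word (cofactor n k k')) (vec r) \<in> fv.span (insert (lmul (word (cofactor n k' k)) (vec r'))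
      ({lmul (word w) (vec s) | w l s. (l, s) \<in> set H \<and> w \<in> set W \<and>
         prec (shift w (mk l)) (shift (cofactor n k k') (mk k))} \<union> vec ` set ?jr))"
      using pr pair_reduces_iff[OF vp W jr Hval(1,2)[OF kr] v'] by blast
    moreover have "shift w (mk l) \<in> below (shift (cofactor n k k') (mk k))"
      if "(l, s) \<in> set H" "w \<in> set W" "prec (shift w (mk l)) (shift (cofactor n k k') (mk k))" for w l s
      using that(3) W that(2) mk_K[OF Hval(1)[OF that(1)]] by (simp add: below_def)
    ultimately show ?thesis
      using span_le_sub[of "\<lambda>w l. prec (shift w (mk l)) (shift (cofactor n k k') (mk k))"] by blast
  qed
  have cp: "critical_pairs_reduce ?S ld" unfolding critical_pairs_reduce_def
  proof (intro conjI ballI impI)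
    fix h h' assume h: "h \<in> ?S" "h' \<in> ?S" "snd (ld h) = snd (ld h')"
    obtain k r k' r' where kr: "(k, r) \<in> set H" "h = vec r" "(k', r') \<in> set H" "h' = vec r'" using h by auto
    have lds: "ld h = mk k" "ld h' = mk k'" using kr ld by auto
    have "es ! fst k = es ! fst k'" using h(3) lds by (simp add: mk_def)
    from pairs[OF kr(1) _ this, of r'] kr(3)
    show "\<exists>a a'. letters a \<and> letters a' \<and> exw a = fst (ld h') - fst (ld h) \<and> exw a' = fst (ld h) - fst (ld h') \<and>
        lmul (word a) h \<in> fv.span (insert (lmul (word a') h') (span_le ?S ld (below (shift a (ld h)))))"
      using cofactor[OF Hval(1)[OF kr(1)] Hval(1)[OF kr(3)]] cofactor[OF Hval(1)[OF kr(3)] Hval(1)[OF kr(1)]] kr lds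
      by (intro exI[of _ "cofactor n k k'"] exI[of _ "cofactor n k' k"]) (simp add: mk_def)
  next
    fix h l assume h: "h \<in> ?S" "l \<in> lexps n (induced prec (snd (ld h))) (I (snd (ld h)))"
    obtain k r where kr: "(k, r) \<in> set H" "h = vec r" using h by auto
    have ldh: "ld h = mk k" using kr ld by simp
    have "snd (ld h) \<in> E" using mk_K[OF Hval(1)[OF kr(1)]] ldh by (simp add: mem_Times_iff)
    then obtain t where t: "t \<in> set il" "mk (fst t) = (l, snd (ld h))" using ideal_leads_complete h(2) by blast
    obtain k' r' where t': "t = (k', r')" by (cases t)
    have v': "valid_key k'" using ideal_leads(1)[OF t(1)] t' by simp
    have e: "es ! fst k = es ! fst k'" using t(2) t' ldh by (simp add: mk_def)
    have "lmul (word (cofactor n k' k)) (vec r') \<in> JE"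
      using JE_lmul ideal_leads(4)[OF t(1)] t' cofactor(1)[OF v' Hval(1)[OF kr(1)]] by simp
    then have "insert (lmul (word (cofactor n k' k)) (vec r')) (span_le ?S ld (below (shift (cofactor n k k') (mk k))))
       = span_le ?S ld (below (shift (cofactor n k k') (mk k)))"
      using span_le_closed(5) by blast
    then have "lmul (word (cofactor n k k')) (vec r) \<in> span_le ?S ld (below (shift (cofactor n k k') (mk k)))"
      using pairs[OF kr(1) _ e, of r'] t(1) t' by (simp add: span_le_def fv.span_span)
    then show "\<exists>a. letters a \<and> exw a = l - fst (ld h) \<and> lmul (word a) h \<in> span_le ?S ld (below (shift a (ld h)))"
      using cofactor[OF Hval(1)[OF kr(1)] v'] kr ldh t(2) t'
      by (intro exI[of _ "cofactor n k k'"]) (simp add: mk_def)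
  qed
  have right_valid: "\<forall>v\<in>set (map (\<lambda>g. vec_row g) gs @ right_rows two n H). valid_row v"
    using vec_row_valid Hval(2) by (auto simp: right_rows_def intro!: valid_mul_row)
  have gen: "vec v \<in> span_le ?S ld K" if "v \<in> set (map (\<lambda>g. vec_row g) gs @ right_rows two n H)" for v
  proof -
    have "vec v \<in> fv.span ({lmul (word w) (vec s) | w l s. (l, s) \<in> set H \<and> w \<in> set W} \<union> vec ` set ?jr)"
      using acc'(3) generates_iff[OF vp W jr right_valid] that by blast
    also have "\<dots> \<subseteq> fv.span (span_le ?S ld K)"
    proof (rule fv.span_mono, rule Un_least)
      show "vec ` set ?jr \<subseteq> span_le ?S ld K" using J_rows_JE[OF W] span_le_closed(5) by blast
      show "{lmul (word w) (vec s) | w l s. (l, s) \<in> set H \<and> w \<in> set W} \<subseteq> span_le ?S ld K"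
      proof clarify
        fix w k p s assume *: "((k, p), s) \<in> set H" "w \<in> set W"
        have "vec s \<in> ?S" using *(1) by force
        then show "lmul (word w) (vec s) \<in> span_le ?S ld K"
          by (rule span_le_closed(6)) (use *(2) W ld[OF *(1)] mk_K[OF Hval(1)[OF *(1)]] in auto)
      qed
    qed
    finally show ?thesis by (simp add: span_le_def fv.span_span)
  qed
  have N: "submod (gen_vecs two Gv)" by (rule submod_gen[OF Gv_Vecs])
  have SN: "?S \<subseteq> gen_vecs two Gv"
  proof
    fix h assume "h \<in> ?S"
    then obtain k r where "(k, r) \<in> set H" "h = vec r" by auto
    then have "r \<in> snd ` set (lead_rows Q n ?rows)" using image_eqI[of r snd "(k, r)"] Hin(1) by simp
    then have "h \<in> vec ` snd ` set (lead_rows Q n ?rows)" using \<open>h = vec r\<close> by (rule image_eqI[rotated])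
    then have "h \<in> fv.span (vec ` snd ` set (lead_rows Q n ?rows))" by (rule fv.span_base)
    then show "h \<in> gen_vecs two Gv" using lead_rows_span[OF rows] all_rows_gen[OF W] by blast
  qed
  have gen_sub: "gen_vecs two Gv \<subseteq> span_le ?S ld K"
  proof (rule gen_vecs_minimal[OF submod_span_le[OF ls]])
    show "Gv \<subseteq> span_le ?S ld K" unfolding Gv_def using gen by auto
    assume two: two
    show "rclosed (span_le ?S ld K)"
    proof (rule rclosed_span_le[OF ls])
      fix h i assume "h \<in> ?S" and i: "i < n"
      then obtain k r where kr: "(k, r) \<in> set H" "h = vec r" by auto
      have "mul_row [] r [i] \<in> set (right_rows two n H)" using kr(1) i two by (force simp: right_rows_def)
      then have "vec (mul_row [] r [i]) \<in> span_le ?S ld K" using gen by simp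
      then show "rmul h (word [i]) \<in> span_le ?S ld K" using kr(2) by (simp add: vec_mul_row falg_mult_simps lmul_one)
    qed
  qed
  show ?thesis
  proof (rule reduced_groebner_basis_cls[OF _ ls inj _ SN N])
    show "finite ?S" by simp
    show "ld h \<notin> Ld" if "h \<in> ?S" for h using that nLd ld by auto
    show "x \<in> span_le ?S ld (beneath \<mu>)" if "x \<in> gen_vecs two Gv" "\<mu> \<in> K" "x \<in> V (beneath \<mu>)" for x \<mu>
      using buchberger[OF ls cp _ that(3,2)] gen_sub that(1) by blast
    have tail: "(\<forall>l\<in>set il. \<not> kdvd n (fst l) k') \<and> (\<forall>l\<in>set H. fst l = k \<or> \<not> kdvd n (fst l) k')"
      if "(k, r) \<in> set H" "coef r k' \<noteq> 0" for k r k'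
      using acc'(1) that coef_nonzero_key[OF that(2)] unfolding tails_reduced_def list_all_iff by fastforce
    show "h \<in> stdv (K - Ld)" if hS: "h \<in> ?S" for h
    proof -
      obtain k r where kr: "(k, r) \<in> set H" "h = vec r" using hS by auto
      show ?thesis unfolding stdv_def
      proof (intro CollectI allI impI)
        fix e w assume nz: "lookup (h e) w \<noteq> 0"
        then have "e \<in> E" using vec_zero_outside kr(2) by fastforce
        then obtain p where p: "p < m" "es ! p = e" using index_es by blast
        have c: "coef r (p, w) \<noteq> 0" using lookup_vec[OF p(1)] p(2) nz kr(2) by simp
        have std: "valid_key (p, w) \<and> is_std n (p, w)"
          using lead_rows_order[OF rows Hin(1,2)[OF kr(1)] c] Hval(1)[OF kr(1)] Hin(2)[OF kr(1)] by (cases "(p, w) = k") auto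
        have "mk (p, w) \<notin> Ld"
        proof
          assume "mk (p, w) \<in> Ld"
          then obtain t where t: "t \<in> set il" "mdvd n (mk (fst t)) (mk (p, w))" using Ld_ideal_lead by blast
          then have "kdvd n (fst t) (p, w)" using kdvd_iff[OF ideal_leads(1)[OF t(1)]] std by blast
          then show False using tail[OF kr(1) c] t(1) by blast
        qed
        then have "(exw w, e) \<in> K - Ld" using mk_K[of "(p, w)"] std p by (simp add: mk_def)
        moreover have "w = std_word n (exw w)" using std is_std_iff[of "(p, w)"] by (simp add: valid_key_def)
        ultimately show "\<exists>\<alpha>. (\<alpha>, e) \<in> K - Ld \<and> w = std_word n \<alpha>" by blast
      qed
    qed
    show "lookup (h (snd (ld h))) (std_word n (fst (ld h))) = 1" if hS: "h \<in> ?S" for h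
    proof -
      obtain k r where kr: "(k, r) \<in> set H" "h = vec r" using hS by auto
      have "std_word n (exw (snd k)) = snd k" using is_std_iff Hin(2)[OF kr(1)] Hval(1)[OF kr(1)] by (simp add: valid_key_def)
      then show ?thesis using kr ld[OF kr(1)] lookup_vec[of "fst k" r "snd k"] Hval[OF kr(1)]
        by (simp add: mk_def valid_key_def)
    qed
    show "\<not> mdvd n (ld h') (\<alpha>, e)" if h: "h \<in> ?S" "h' \<in> ?S" "h \<noteq> h'" "\<alpha> \<in> supp n (h e)" for h h' \<alpha> e
    proof
      assume dv: "mdvd n (ld h') (\<alpha>, e)"
      obtain k r k' r' where kr: "(k, r) \<in> set H" "h = vec r" "(k', r') \<in> set H" "h' = vec r'" using h by auto
      obtain q where q: "valid_key q" "mk q = (\<alpha>, e)" "coef r q \<noteq> 0" using supp_vec[of \<alpha> r e] h(4) kr(2) Hval(2)[OF kr(1)] by blast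
      have "kdvd n k' q" using dv ld[OF kr(3)] kr(4) q(2) kdvd_iff[OF Hval(1)[OF kr(3)] q(1)] by simp
      then have "k' = k" using tail[OF kr(1) q(3)] kr(3) by force
      then have "r' = r" using lead_rows_distinct[OF rows] Hin(1)[OF kr(1)] Hin(1)[OF kr(3)]
        by (metis eq_key_imp_eq_value)
      then show False using h(3) kr by simp
    qed
  qed
qed

end

section \<open>Completeness\<close>

lemma eventually_span:
  assumes "x \<in> fv.span B" "\<And>b. b \<in> B \<Longrightarrow> \<exists>N0. \<forall>N\<ge>N0. b \<in> fv.span (C (N :: nat))"
  shows "\<exists>N0. \<forall>N\<ge>N0. x \<in> fv.span (C N)"
  using assms(1)
proof (induction rule: fv.span_induct_alt)
  case base
  show ?case using fv.span_zero by blast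
next
  case (step a x y)
  obtain N1 where N1: "\<forall>N\<ge>N1. x \<in> fv.span (C N)" using assms(2)[OF step(1)] by blast
  obtain N2 where N2: "\<forall>N\<ge>N2. y \<in> fv.span (C N)" using step(2) by blast
  have "\<forall>N\<ge>max N1 N2. vscale a x + y \<in> fv.span (C N)"
    using N1 N2 by (simp add: fv.span_add fv.span_scale)
  then show ?case by blast
qed

lemma finite_uniform:
  assumes "finite S" "\<And>s. s \<in> S \<Longrightarrow> \<exists>N0. \<forall>N\<ge>N0. P s (N :: nat)"
  shows "\<exists>N0. \<forall>N\<ge>N0. \<forall>s\<in>S. P s N"
  using assms
proof (induction S rule: finite_induct)
  case (insert x S)
  obtain N1 where N1: "\<forall>N\<ge>N1. P x N" using insert.prems by blast
  obtain N2 where N2: "\<forall>N\<ge>N2. \<forall>s\<in>S. P s N" using insert.IH insert.prems by blast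
  have "\<forall>N\<ge>max N1 N2. \<forall>s\<in>insert x S. P s N" using N1 N2 by simp
  then show ?case by blast
qed simp

context pbw_input
begin

lemma eventually_JE:
  assumes "t \<in> JE" shows "\<exists>N0. \<forall>N\<ge>N0. t \<in> fv.span (vec ` set (J_rows (words n N) ds))"
proof (rule eventually_span[OF assms[unfolded JE_span]])
  fix b assume "b \<in> {emb e (word w * f * word w') | e w f w'. e \<in> E \<and> letters w \<and> letters w' \<and>
     f \<in> I e \<union> comm_rels n (c e) (d e)}"
  then obtain e w f w' where b: "b = emb e (word w * f * word w')" "e \<in> E" "letters w" "letters w'"
    "f \<in> I e \<union> comm_rels n (c e) (d e)" by blast
  have "b \<in> fv.span (vec ` set (J_rows (words n N) ds))" if "N \<ge> max (length w) (length w')" for N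
  proof (rule fv.span_base)
    have "w \<in> set (words n N)" "w' \<in> set (words n N)" using that b by (auto simp: set_words)
    then show "b \<in> vec ` set (J_rows (words n N) ds)"
      unfolding vec_J_rows(1)[OF words_letters] using b by blast
  qed
  then show "\<exists>N0. \<forall>N\<ge>N0. b \<in> fv.span (vec ` set (J_rows (words n N) ds))" by blast
qed

lemma eventually_gen:
  assumes "t \<in> gen_vecs two Gv"
  shows "\<exists>N0. \<forall>N\<ge>N0. t \<in> fv.span (vec ` set (all_rows two (words n N)))"
proof (rule eventually_span[OF assms[unfolded gen_vecs_def]])
  fix b assume "b \<in> JE \<union> {lmul (word w) (rmul g (word w')) | w g w'. g \<in> Gv \<and> letters w \<and> letters w' \<and> (two \<or> w' = [])}"
  then show "\<exists>N0. \<forall>N\<ge>N0. b \<in> fv.span (vec ` set (all_rows two (words n N)))"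
  proof
    assume "b \<in> JE"
    then obtain N0 where N0: "\<forall>N\<ge>N0. b \<in> fv.span (vec ` set (J_rows (words n N) ds))" using eventually_JE by blast
    have "fv.span (vec ` set (J_rows (words n N) ds)) \<subseteq> fv.span (vec ` set (all_rows two (words n N)))" for N
      by (rule fv.span_mono) auto
    then show ?thesis using N0 by blast
  next
    assume "b \<in> {lmul (word w) (rmul g (word w')) | w g w'. g \<in> Gv \<and> letters w \<and> letters w' \<and> (two \<or> w' = [])}"
    then obtain w g w' where b: "b = lmul (word w) (rmul g (word w'))" "g \<in> Gv" "letters w" "letters w'" "two \<or> w' = []"
      by blast
    have "b \<in> fv.span (vec ` set (all_rows two (words n N)))" if "N \<ge> max (length w) (length w')" for N
    proof (rule fv.span_base)
      have "w \<in> set (words n N)" "w' \<in> (if two then set (words n N) else {[]})" using that b by (auto simp: set_words)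
      then have "b \<in> vec ` set (gen_rows two (words n N) gs)"
        unfolding vec_gen_rows(1)[OF words_letters] using b(1,2) by blast
      then show "b \<in> vec ` set (all_rows two (words n N))" by auto
    qed
    then show ?thesis by blast
  qed
qed

text \<open>The part of \<open>span_le\<close> that is available with words of length at most \<open>N\<close>.\<close>

definition reps where
  "reps H ld P N = {lmul (word w) h | w h. h \<in> H \<and> w \<in> set (words n N) \<and> shift w (ld h) \<in> P}
     \<union> vec ` set (J_rows (words n N) ds)"

lemma eventually_span_le:
  assumes "t \<in> span_le H ld P" shows "\<exists>N0. \<forall>N\<ge>N0. t \<in> fv.span (reps H ld P N)"
proof (rule eventually_span[OF assms[unfolded span_le_def]])
  fix b assume "b \<in> JE \<union> {lmul (word w) h | w h. h \<in> H \<and> letters w \<and> shift w (ld h) \<in> P}"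
  then show "\<exists>N0. \<forall>N\<ge>N0. b \<in> fv.span (reps H ld P N)"
  proof
    assume "b \<in> JE"
    then obtain N0 where N0: "\<forall>N\<ge>N0. b \<in> fv.span (vec ` set (J_rows (words n N) ds))" using eventually_JE by blast
    have "fv.span (vec ` set (J_rows (words n N) ds)) \<subseteq> fv.span (reps H ld P N)" for N
      by (rule fv.span_mono) (auto simp: reps_def)
    then show ?thesis using N0 by blast
  next
    assume "b \<in> {lmul (word w) h | w h. h \<in> H \<and> letters w \<and> shift w (ld h) \<in> P}"
    then obtain w h where b: "b = lmul (word w) h" "h \<in> H" "letters w" "shift w (ld h) \<in> P" by blast
    have "b \<in> fv.span (reps H ld P N)" if "N \<ge> length w" for N
      by (rule fv.span_base) (use that b in \<open>auto simp: reps_def set_words\<close>)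
    then show ?thesis by blast
  qed
qed

text \<open>The coordinates of \<open>red_elem N \<mu>\<close> at pivots other than \<open>\<mu>\<close> vanish as soon as all standard pivots are in
  \<open>leads N\<close>; this makes it comparable with a row of the echelon form.\<close>

lemma X_red_elem:
  assumes N: "submod N" and \<mu>: "\<mu> \<in> leads N"
  shows "valid_key k \<Longrightarrow> X k (red_elem N \<mu>) \<noteq> 0 \<Longrightarrow> k = std_key \<mu> \<or> is_std n k \<and> mk k \<notin> leads N"
    and "X (std_key \<mu>) (red_elem N \<mu>) = 1"
proof -
  have K: "\<mu> \<in> K" using \<mu> by (auto simp: leads_def)
  note k\<mu> = std_key[OF K]
  define s where "s = monv \<mu> - red_elem N \<mu>"
  have s: "s \<in> stdv (below \<mu> - leads N)" unfolding s_def by (rule red_elem(2)[OF N K \<mu>])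
  have r: "red_elem N \<mu> = monv \<mu> - s" by (simp add: s_def)
  have Xs: "is_std n k \<and> mk k \<notin> leads N" if k: "valid_key k" "X k s \<noteq> 0" for k
  proof -
    obtain \<alpha> where a: "(\<alpha>, es ! fst k) \<in> below \<mu> - leads N" "snd k = std_word n \<alpha>"
      using s k(2) unfolding stdv_def X_def by blast
    then have "\<alpha> \<in> expos n" by (auto simp: below_def)
    then have "exw (snd k) = \<alpha>" using a(2) by simp
    then show ?thesis using a is_std_iff[of k] k(1) by (simp add: mk_def valid_key_def)
  qed
  have mon: "monv \<mu> = emb (es ! fst (std_key \<mu>)) (word (snd (std_key \<mu>)))"
    using monv_mk[OF k\<mu>(1,2)] k\<mu>(3) by simp
  have Xm: "X k (monv \<mu>) = (if k = std_key \<mu> then 1 else 0)" if "valid_key k" for k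
  proof -
    have "es ! fst k = es ! fst (std_key \<mu>) \<longleftrightarrow> fst k = fst (std_key \<mu>)"
      using that k\<mu>(1) es(1) by (simp add: valid_key_def nth_eq_iff_index_eq)
    then show ?thesis unfolding X_def mon by (auto simp: vec_apply word_def lookup_single when_def prod_eq_iff)
  qed
  have X: "X k (red_elem N \<mu>) = X k (monv \<mu>) - X k s" for k
    unfolding r by (simp add: X_def vec_apply lookup_minus)
  show "valid_key k \<Longrightarrow> X k (red_elem N \<mu>) \<noteq> 0 \<Longrightarrow> k = std_key \<mu> \<or> is_std n k \<and> mk k \<notin> leads N"
    using X[of k] Xm[of k] Xs[of k] by (auto split: if_splits)
  have "X (std_key \<mu>) s = 0" using Xs[OF k\<mu>(1)] k\<mu>(3) \<mu> by auto
  then show "X (std_key \<mu>) (red_elem N \<mu>) = 1" using X Xm[OF k\<mu>(1)] by simp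
qed

lemma span_le_below:
  assumes N: "submod N" and H: "H \<subseteq> N" "\<And>h. h \<in> H \<Longrightarrow> has_lead h (ld h) \<and> ld h \<in> K"
    and dvd: "\<And>\<mu>. \<mu> \<in> leads N - Ld \<Longrightarrow> \<exists>h\<in>H. mdvd n (ld h) \<mu>"
    and x: "x \<in> N"
  shows "x \<in> span_le H ld K" "\<nu> \<in> K \<Longrightarrow> x \<in> V (below \<nu>) \<Longrightarrow> x \<in> span_le H ld (below \<nu>)"
proof -
  have rep: "x \<in> span_le H ld (beneath \<rho>)" if "\<rho> \<in> K" "has_lead x \<rho>" for \<rho>
    by (rule division[OF N H dvd that(1) x has_lead_beneath[OF that(2,1)]])
  have c: "x \<in> JE \<or> (\<exists>\<rho>\<in>K. \<rho> \<notin> Ld \<and> has_lead x \<rho>)" using lead_cases[OF submodD(3)[OF N x]] by blast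
  show "x \<in> span_le H ld K"
    using c rep span_le_closed(5) span_le_mono[OF beneath_subset] by blast
  show "x \<in> span_le H ld (below \<nu>)" if "\<nu> \<in> K" "x \<in> V (below \<nu>)"
    using c
  proof
    assume "\<exists>\<rho>\<in>K. \<rho> \<notin> Ld \<and> has_lead x \<rho>"
    then obtain \<rho> where \<rho>: "\<rho> \<in> K" "\<rho> \<notin> Ld" "has_lead x \<rho>" by blast
    have "beneath \<rho> \<subseteq> below \<nu>" using has_lead_prec[OF \<rho>(3,1,2) that(2,1)] beneath_below \<rho>(1) that(1) by blast
    then show ?thesis using rep[OF \<rho>(1,3)] span_le_mono by blast
  qed (rule span_le_closed(5))
qed

text \<open>As soon as the row space contains the elements \<open>red_elem \<mu>\<close> for all minimal \<open>\<mu>\<close>, these are rows of the echelon form: a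
  vector of the row space is determined by its coordinates at the pivots, and the standard pivots are leading monomials
  of the submodule. The minimal pivots then are the minimal leading monomials. Each certificate exists by division and involves
  finitely many products, so all are found for large \<open>N\<close>.\<close>

theorem accept_complete: "\<exists>N. accept Q two (words n N) inp (candidates Q two (words n N) inp)"
proof -
  let ?M = "gen_vecs two Gv"
  let ?W = "\<lambda>N. words n N"
  let ?H = "\<lambda>N. candidates Q two (?W N) inp"
  have M: "submod ?M" by (rule submod_gen[OF Gv_Vecs])
  \<comment> \<open>the leading monomials of the reduced Groebner basis\<close>
  define B where "B = min_leads ?M - Ld"
  let ?r = "red_elem ?M"
  have finB: "finite B" unfolding B_def using finite_min_leads by blast
  have lK: "\<mu> \<in> K" if "\<mu> \<in> leads ?M" for \<mu> using that by (auto simp: leads_def)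
  have minl: "\<mu> \<in> leads ?M" if "\<mu> \<in> min_leads ?M" for \<mu> using that by (auto simp: min_leads_def)
  have Bl: "\<mu> \<in> leads ?M" "\<mu> \<in> K" if "\<mu> \<in> B" for \<mu> using that minl lK unfolding B_def by blast+
  note rM = red_elem(1)[OF M lK]
  define ld where "ld h = (THE \<mu>. \<mu> \<in> B \<and> ?r \<mu> = h)" for h
  have inj: "\<mu> = \<nu>" if "\<mu> \<in> B" "\<nu> \<in> B" "?r \<mu> = ?r \<nu>" for \<mu> \<nu>
  proof -
    have "X (std_key \<mu>) (?r \<nu>) \<noteq> 0" using X_red_elem(2)[OF M Bl(1)[OF that(1)]] that(3) by simp
    then have "std_key \<mu> = std_key \<nu>"
      using X_red_elem(1)[OF M Bl(1)[OF that(2)] std_key(1)[OF Bl(2)[OF that(1)]]]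
        std_key(3)[OF Bl(2)[OF that(1)]] Bl(1)[OF that(1)] by auto
    then show ?thesis using std_key(3) Bl(2) that(1,2) by metis
  qed
  have ld: "ld (?r \<mu>) = \<mu>" if "\<mu> \<in> B" for \<mu>
    unfolding ld_def by (rule the_equality) (use that inj in blast)+
  let ?R = "?r ` B"
  have RM: "?R \<subseteq> ?M" using rM Bl by blast
  have Rl: "has_lead h (ld h) \<and> ld h \<in> K" if "h \<in> ?R" for h
    using that red_elem_has_lead[OF M] Bl ld by auto
  have Rdvd: "\<exists>h\<in>?R. mdvd n (ld h) \<mu>" if \<mu>: "\<mu> \<in> leads ?M - Ld" for \<mu>
  proof -
    obtain \<nu> where \<nu>: "\<nu> \<in> min_leads ?M" "mdvd n \<nu> \<mu>" using min_leads_dvd[of \<mu> ?M] \<mu> by blast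
    then have "\<nu> \<in> B" using Ld_mdvd[of \<nu> \<mu>] \<mu> unfolding B_def by blast
    then show ?thesis using \<nu>(2) ld by (intro bexI[of _ "?r \<nu>"]) auto
  qed
  have rep: "x \<in> span_le ?R ld K" "\<nu> \<in> K \<Longrightarrow> x \<in> V (below \<nu>) \<Longrightarrow> x \<in> span_le ?R ld (below \<nu>)"
    if "x \<in> ?M" for x \<nu>
    using span_le_below[OF M RM, of ld] Rl Rdvd that by auto

  \<comment> \<open>from some bound on, the candidates are the elements of the reduced basis\<close>
  have "\<exists>N0. \<forall>N\<ge>N0. \<forall>\<mu>\<in>min_leads ?M. ?r \<mu> \<in> fv.span (vec ` set (all_rows two (?W N)))"
    by (rule finite_uniform[OF finite_min_leads]) (use eventually_gen rM minl in blast)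
  then obtain N0 where N0: "\<And>N \<mu>. N \<ge> N0 \<Longrightarrow> \<mu> \<in> min_leads ?M \<Longrightarrow> ?r \<mu> \<in> fv.span (vec ` set (all_rows two (?W N)))"
    by blast
  have rows: "\<forall>r\<in>set (all_rows two (?W N)). valid_row r" for N by (rule all_rows_valid[OF words_letters])
  have piv_lead: "mk k \<in> leads ?M" if "(k, r) \<in> set (lead_rows Q n (all_rows two (?W N)))" "is_std n k" for k r N
  proof -
    have "vec r \<in> vec ` snd ` set (lead_rows Q n (all_rows two (?W N)))" using that(1) by force
    then have "vec r \<in> fv.span (vec ` snd ` set (lead_rows Q n (all_rows two (?W N))))" by (rule fv.span_base)
    then have "vec r \<in> ?M" using lead_rows_span[OF rows] all_rows_gen[OF words_letters] by blast
    then show ?thesis using lead_rows_has_lead[OF rows that] mk_K[OF lead_rows_valid(1)[OF rows that(1)]]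
      by (auto simp: leads_def)
  qed
  have piv: "\<exists>r. (std_key \<mu>, r) \<in> set (lead_rows Q n (all_rows two (?W N))) \<and> vec r = ?r \<mu>"
    if N: "N \<ge> N0" and \<mu>: "\<mu> \<in> min_leads ?M" for N \<mu>
  proof -
    let ?P = "set (lead_rows Q n (all_rows two (?W N)))"
    note \<mu>l = minl[OF \<mu>] and k\<mu> = std_key[OF lK[OF minl[OF \<mu>]]]
    have other: "X k (?r \<mu>) = 0" if "(k, r) \<in> ?P" "k \<noteq> std_key \<mu>" for k r
      using X_red_elem(1)[OF M \<mu>l lead_rows_valid(1)[OF rows that(1)]] that piv_lead by blast
    have "\<exists>r. (std_key \<mu>, r) \<in> ?P"
    proof (rule ccontr)
      assume "\<nexists>r. (std_key \<mu>, r) \<in> ?P"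
      then have "?r \<mu> = 0" by (intro lead_rows_unique[OF rows N0[OF N \<mu>]] other) auto
      then show False using X_red_elem(2)[OF M \<mu>l] by simp
    qed
    then obtain r where r: "(std_key \<mu>, r) \<in> ?P" by blast
    have rs: "vec r \<in> fv.span (vec ` set (all_rows two (?W N)))"
    proof -
      have "vec r \<in> vec ` snd ` ?P" using r by force
      then have "vec r \<in> fv.span (vec ` snd ` ?P)" by (rule fv.span_base)
      then show ?thesis unfolding lead_rows_span[OF rows] .
    qed
    have "?r \<mu> - vec r = 0"
    proof (rule lead_rows_unique[OF rows fv.span_diff[OF N0[OF N \<mu>] rs]])
      fix k r' assume kr: "(k, r') \<in> ?P"
      have k: "fst k < m" using lead_rows_valid(1)[OF rows kr] by (simp add: valid_key_def)
      have d: "X k (?r \<mu> - vec r) = X k (?r \<mu>) - coef r k"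
        using X_vec[OF k, of r] by (simp add: X_def vec_apply lookup_minus)
      show "X k (?r \<mu> - vec r) = 0"
      proof (cases "k = std_key \<mu>")
        case True
        then show ?thesis using d X_red_elem(2)[OF M \<mu>l] lead_rows_valid(3)[OF rows r] by simp
      next
        case False
        then show ?thesis using d other[OF kr False] lead_rows_reduced[OF rows r kr] by simp
      qed
    qed
    then have "vec r = ?r \<mu>" by (simp only: right_minus_eq)
    then show ?thesis using r by blast
  qed
  have cand1: "\<exists>\<mu>\<in>B. k = std_key \<mu> \<and> vec r = ?r \<mu>" if N: "N \<ge> N0" and kr: "(k, r) \<in> set (?H N)" for N k r
  proof -
    have c: "(k, r) \<in> set (lead_rows Q n (all_rows two (?W N)))" "is_std n k" "\<forall>l\<in>set il. \<not> kdvd n (fst l) k"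
      "\<forall>l\<in>set (lead_rows Q n (all_rows two (?W N))). is_std n (fst l) \<longrightarrow> fst l = k \<or> \<not> kdvd n (fst l) k"
      using kr unfolding candidates_iff by auto
    have v: "valid_key k" using lead_rows_valid(1)[OF rows c(1)] .
    obtain \<nu> where \<nu>: "\<nu> \<in> min_leads ?M" "mdvd n \<nu> (mk k)" using min_leads_dvd[OF piv_lead[OF c(1,2)]] by blast
    note k\<nu> = std_key[OF lK[OF minl[OF \<nu>(1)]]]
    obtain r' where r': "(std_key \<nu>, r') \<in> set (lead_rows Q n (all_rows two (?W N)))" "vec r' = ?r \<nu>"
      using piv[OF N \<nu>(1)] by blast
    have "kdvd n (std_key \<nu>) k" using kdvd_iff[OF k\<nu>(1) v] \<nu>(2) k\<nu>(3) by simp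
    then have k: "k = std_key \<nu>" using c(4) r'(1) k\<nu>(2) by force
    then have "r = r'" using lead_rows_distinct[OF rows] c(1) r'(1) by (metis eq_key_imp_eq_value)
    moreover have "\<nu> \<notin> Ld"
    proof
      assume "\<nu> \<in> Ld"
      then obtain t where t: "t \<in> set il" "mdvd n (mk (fst t)) \<nu>" using Ld_ideal_lead by blast
      then have "kdvd n (fst t) k" using kdvd_iff[OF ideal_leads(1)[OF t(1)] v] k k\<nu>(3) by simp
      then show False using c(3) t(1) by blast
    qed
    ultimately show ?thesis using k r'(2) \<nu>(1) unfolding B_def by blast
  qed
  have cand2: "\<exists>r. (std_key \<mu>, r) \<in> set (?H N) \<and> vec r = ?r \<mu>" if N: "N \<ge> N0" and \<mu>: "\<mu> \<in> B" for N \<mu>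
  proof -
    have \<mu>m: "\<mu> \<in> min_leads ?M" using \<mu> by (simp add: B_def)
    note k\<mu> = std_key[OF Bl(2)[OF \<mu>]]
    obtain r where r: "(std_key \<mu>, r) \<in> set (lead_rows Q n (all_rows two (?W N)))" "vec r = ?r \<mu>"
      using piv[OF N \<mu>m] by blast
    have "\<not> kdvd n (fst l) (std_key \<mu>)" if l: "l \<in> set il" for l
    proof
      assume "kdvd n (fst l) (std_key \<mu>)"
      then have "mdvd n (mk (fst l)) \<mu>" using kdvd_iff[OF ideal_leads(1)[OF l] k\<mu>(1)] k\<mu>(3) by simp
      then have "\<mu> \<in> Ld" using Ld_mdvd[OF ideal_leads(5)[OF l]] by (cases \<mu>) blast
      then show False using \<mu> by (simp add: B_def)
    qed
    moreover have "fst l = std_key \<mu> \<or> \<not> kdvd n (fst l) (std_key \<mu>)"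
      if l: "l \<in> set (lead_rows Q n (all_rows two (?W N)))" "is_std n (fst l)" for l
    proof -
      have l': "(fst l, snd l) \<in> set (lead_rows Q n (all_rows two (?W N)))" using l(1) by simp
      note v = lead_rows_valid(1)[OF rows l']
      have "kdvd n (fst l) (std_key \<mu>) \<Longrightarrow> mk (fst l) = \<mu>"
        using kdvd_iff[OF v k\<mu>(1)] piv_lead[OF l' l(2)] \<mu>m k\<mu>(3) by (simp add: min_leads_def)
      then show ?thesis using mk_std_inj[OF v k\<mu>(1) l(2) k\<mu>(2)] k\<mu>(3) by auto
    qed
    ultimately have "(std_key \<mu>, r) \<in> set (?H N)" unfolding candidates_iff using r(1) k\<mu>(2) by simp
    then show ?thesis using r(2) by blast
  qed

  \<comment> \<open>from some bound on, all certificates are found\<close>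
  \<comment> \<open>the terms that can be the second member of a critical pair\<close>
  define T where "T = (\<lambda>\<mu>. (std_key \<mu>, ?r \<mu>)) ` B \<union> (\<lambda>t. (fst t, vec (snd t))) ` set il"
  let ?P2 = "\<lambda>(\<mu>, k', h') N. fst (std_key \<mu>) = fst k' \<longrightarrow>
     lmul (word (cofactor n (std_key \<mu>) k')) (?r \<mu>) \<in> fv.span (insert (lmul (word (cofactor n k' (std_key \<mu>))) h')
        (reps ?R ld (below (shift (cofactor n (std_key \<mu>) k') \<mu>)) N))"
  have "\<exists>N1. \<forall>N\<ge>N1. \<forall>s\<in>B \<times> T. ?P2 s N"
  proof (rule finite_uniform)
    show "finite (B \<times> T)" using finB by (simp add: T_def)
    fix s assume "s \<in> B \<times> T"
    then obtain \<mu> k' h' where s: "s = (\<mu>, k', h')" "\<mu> \<in> B" "(k', h') \<in> T" by auto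
    note k\<mu> = std_key[OF Bl(2)[OF s(2)]]
    let ?k = "std_key \<mu>"
    let ?\<nu> = "shift (cofactor n ?k k') \<mu>"
    let ?u = "lmul (word (cofactor n ?k k')) (?r \<mu>)"
    let ?u' = "lmul (word (cofactor n k' ?k)) h'"
    have v': "valid_key k'" using s(3) std_key(1) Bl(2) ideal_leads(1) by (auto simp: T_def)
    note a = cofactor[OF k\<mu>(1) v'] and a' = cofactor[OF v' k\<mu>(1)]
    have \<nu>: "?\<nu> \<in> K" using a(1) Bl(2)[OF s(2)] by simp
    have uM: "?u \<in> ?M" using submodD(4)[OF M rM a(1)] Bl[OF s(2)] by blast
    have ul: "has_lead ?u ?\<nu>"
      using has_lead_lmul[OF red_elem_has_lead[OF M Bl(1)[OF s(2)]] Bl(2)[OF s(2)] a(1)] .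
    show "\<exists>N1. \<forall>N\<ge>N1. ?P2 s N"
    proof (cases "fst ?k = fst k'")
      case False then show ?thesis using s(1) by simp
    next
      case True
      have \<nu>': "?\<nu> = shift (cofactor n k' ?k) (mk k')"
      proof -
        have "exw (snd ?k) + (exw (snd k') - exw (snd ?k)) = exw (snd k') + (exw (snd ?k) - exw (snd k'))"
          by (rule poly_mapping_eqI) (simp add: lookup_add lookup_minus)
        then show ?thesis using a(2) a'(2) True arg_cong[OF k\<mu>(3), of fst] arg_cong[OF k\<mu>(3), of snd]
          by (simp add: shift_def mk_def)
      qed
      have "\<exists>b. ?u - vscale b ?u' \<in> span_le ?R ld (below ?\<nu>)"
      proof -
        consider \<mu>' where "\<mu>' \<in> B" "k' = std_key \<mu>'" "h' = ?r \<mu>'" | t where "t \<in> set il" "k' = fst t"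
          using s(3) by (auto simp: T_def)
        then show ?thesis
        proof cases
          case (1 \<mu>')
          have mk': "mk k' = \<mu>'" using std_key(3)[OF Bl(2)[OF 1(1)]] 1(2) by simp
          have l': "has_lead ?u' ?\<nu>" unfolding \<nu>' mk' 1(3)
            using has_lead_lmul[OF red_elem_has_lead[OF M Bl(1)[OF 1(1)]] Bl(2)[OF 1(1)] a'(1)] .
          obtain b where b: "?u - vscale b ?u' \<in> V (below ?\<nu>)"
            by (rule has_lead_cancel[OF l' has_lead_beneath[OF ul \<nu>] \<nu>])
          have "?u' \<in> ?M" unfolding 1(3) using submodD(4)[OF M rM a'(1)] Bl[OF 1(1)] by blast
          then have "?u - vscale b ?u' \<in> ?M"
            using fv.subspace_diff[OF submodD(1)[OF M] uM] fv.subspace_scale[OF submodD(1)[OF M]] by blast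
          then show ?thesis using rep(2)[OF _ \<nu> b] by blast
        next
          case (2 t)
          have "?\<nu> \<in> Ld" unfolding \<nu>' using Ld_mdvd[OF ideal_leads(5)[OF 2(1)] mdvd_shift[OF a'(1)]] 2(2) by simp
          then have "V (beneath ?\<nu>) \<subseteq> V (below ?\<nu>)"
            using beneath_eq[OF \<nu>] Ld_iff[OF \<nu>] monv_V by (intro V_subset) auto
          then have "?u - vscale 0 ?u' \<in> V (below ?\<nu>)" using has_lead_beneath[OF ul \<nu>] by auto
          then show ?thesis using rep(2)[OF _ \<nu>, of "?u - vscale 0 ?u'"] uM by (intro exI[of _ 0]) simp
        qed
      qed
      then obtain b where b: "?u - vscale b ?u' \<in> span_le ?R ld (below ?\<nu>)" by blast
      then obtain N1 where N1: "\<forall>N\<ge>N1. ?u - vscale b ?u' \<in> fv.span (reps ?R ld (below ?\<nu>) N)"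
        using eventually_span_le by blast
      have "?P2 s N" if "N \<ge> N1" for N
        using N1 that s(1) by (auto simp: fv.span_breakdown_eq)
      then show ?thesis by blast
    qed
  qed
  then obtain N1 where N1: "\<And>N s. N \<ge> N1 \<Longrightarrow> s \<in> B \<times> T \<Longrightarrow> ?P2 s N" by blast
  \<comment> \<open>the vectors that have to be represented by the candidates\<close>
  define S3 where "S3 = Gv \<union> (if two then (\<lambda>(\<mu>, i). rmul (?r \<mu>) (word [i])) ` (B \<times> {..<n}) else {})"
  have "\<exists>N2. \<forall>N\<ge>N2. \<forall>v\<in>S3. v \<in> fv.span (reps ?R ld K N)"
  proof (rule finite_uniform)
    show "finite S3" using finB by (simp add: S3_def Gv_def)
    fix v assume "v \<in> S3"
    then have "v \<in> ?M"
    proof -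
      have "rmul (?r \<mu>) (word [i]) \<in> ?M" if "two" "\<mu> \<in> B" "i < n" for \<mu> i
        using rclosed_gen[of Gv] rM Bl[OF that(2)] that(1,3) unfolding rclosed_def by auto
      then show ?thesis using \<open>v \<in> S3\<close> gen_vecs_base by (auto simp: S3_def split: if_splits)
    qed
    then show "\<exists>N2. \<forall>N\<ge>N2. v \<in> fv.span (reps ?R ld K N)" using rep(1) eventually_span_le by blast
  qed
  then obtain N2 where N2: "\<And>N v. N \<ge> N2 \<Longrightarrow> v \<in> S3 \<Longrightarrow> v \<in> fv.span (reps ?R ld K N)" by blast

  define N where "N = max N0 (max N1 N2)"
  then have N: "N \<ge> N0" "N \<ge> N1" "N \<ge> N2" by auto
  let ?jr = "J_rows (?W N) ds"
  have Hval: "valid_key k" "valid_row r" "coef r k = 1" if "(k, r) \<in> set (?H N)" for k r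
    using lead_rows_valid[OF rows, of k r N] that unfolding candidates_iff by auto
  then have vp: "valid_pairs (?H N)" by (auto simp: valid_pairs_def)
  have jr: "\<forall>v\<in>set ?jr. valid_row v" using vec_J_rows(2)[OF words_letters] by blast
  have reps_sub: "reps ?R ld P N \<subseteq> {lmul (word w) (vec s) | w l s. (l, s) \<in> set (?H N) \<and> w \<in> set (?W N) \<and> shift w (mk l) \<in> P} \<union> vec ` set ?jr" for P
    unfolding reps_def
  proof (rule Un_mono[OF _ order_refl], clarify)
    fix w \<nu>1 \<nu>2 assume *: "(\<nu>1, \<nu>2) \<in> B" "w \<in> set (?W N)" "shift w (ld (?r (\<nu>1, \<nu>2))) \<in> P"
    obtain r where r: "(std_key (\<nu>1, \<nu>2), r) \<in> set (?H N)" "vec r = ?r (\<nu>1, \<nu>2)" using cand2[OF N(1) *(1)] by blast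
    then show "\<exists>w' l s. lmul (word w) (?r (\<nu>1, \<nu>2)) = lmul (word w') (vec s) \<and> (l, s) \<in> set (?H N) \<and> w' \<in> set (?W N) \<and> shift w' (mk l) \<in> P"
      using * ld[OF *(1)] std_key(3)[OF Bl(2)[OF *(1)]]
      by (intro exI[of _ w] exI[of _ "std_key (\<nu>1, \<nu>2)"] exI[of _ r]) simp
  qed
  have "tails_reduced n il (?H N)" unfolding tails_reduced_def list_all_iff
  proof (intro ballI)
    fix t k' assume t: "t \<in> set (?H N)" "k' \<in> set (map snd (snd t))"
    obtain k r where kr: "t = (k, r)" by (cases t)
    then have krH: "(k, r) \<in> set (?H N)" using t by simp
    obtain \<mu> where \<mu>: "\<mu> \<in> B" "k = std_key \<mu>" "vec r = ?r \<mu>" using cand1[OF N(1) krH] by blast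
    have v': "valid_key k'" using t(2) Hval(2)[OF krH] kr by (auto simp: valid_row_def)
    show "coef (snd t) k' = 0 \<or> (\<forall>l\<in>set il. \<not> kdvd n (fst l) k') \<and> (\<forall>l\<in>set (?H N). fst l = fst t \<or> \<not> kdvd n (fst l) k')"
    proof (cases "coef r k' = 0")
      case True then show ?thesis using kr by simp
    next
      case False
      then have "X k' (?r \<mu>) \<noteq> 0" using X_vec[of k' r] v' \<mu>(3) by (simp add: valid_key_def)
      then consider "k' = k" | "mk k' \<notin> leads ?M" using X_red_elem(1)[OF M Bl(1)[OF \<mu>(1)] v'] \<mu>(2) by blast
      then show ?thesis
      proof cases
        case 1
        have c: "\<forall>l\<in>set il. \<not> kdvd n (fst l) k"
          "\<forall>l\<in>set (lead_rows Q n (all_rows two (?W N))). is_std n (fst l) \<longrightarrow> fst l = k \<or> \<not> kdvd n (fst l) k"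
          using krH unfolding candidates_iff by auto
        have "fst l = k \<or> \<not> kdvd n (fst l) k" if "l \<in> set (?H N)" for l
          using c(2) candidates_iff[of l] that by simp
        then show ?thesis using c(1) 1 kr by simp
      next
        case 2
        have "\<not> kdvd n (fst l) k'" if l: "l \<in> set il" for l
          using kdvd_iff[OF ideal_leads(1)[OF l] v'] Ld_mdvd[OF ideal_leads(5)[OF l]] Ld_leads[OF M] 2 by blast
        moreover have "\<not> kdvd n (fst l) k'" if l: "l \<in> set (?H N)" for l
        proof -
          have l': "(fst l, snd l) \<in> set (?H N)" using l by simp
          obtain \<nu> where \<nu>: "\<nu> \<in> B" "fst l = std_key \<nu>" using cand1[OF N(1) l'] by blast
          then have "mk (fst l) \<in> leads ?M" using std_key(3) Bl by simp
          then show ?thesis using kdvd_iff[OF Hval(1)[OF l'] v'] leads_mdvd[OF M] 2 by blast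
        qed
        ultimately show ?thesis by blast
      qed
    qed
  qed
  moreover have "pairs_reduce Q n (?W N) ?jr il (?H N)" unfolding pairs_reduce_def list_all_iff
  proof (intro ballI)
    fix t t' assume t: "t \<in> set (?H N)" "t' \<in> set (?H N @ il)"
    obtain k r k' r' where kr: "t = (k, r)" "t' = (k', r')" by (cases t; cases t')
    have krH: "(k, r) \<in> set (?H N)" using t kr by simp
    obtain \<mu> where \<mu>: "\<mu> \<in> B" "k = std_key \<mu>" "vec r = ?r \<mu>" using cand1[OF N(1) krH] by blast
    have mk: "mk k = \<mu>" using \<mu> std_key(3) Bl(2) by simp
    have t'c: "(k', r') \<in> set (?H N) \<or> (k', r') \<in> set il" using t(2) kr(2) by simp
    then have v': "valid_key k'" "valid_row r'" using Hval(1)[of k' r'] Hval(2)[of k' r'] ideal_leads(1,3)[of "(k', r')"] by auto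
    have T: "(k', vec r') \<in> T"
      using t'c
    proof
      assume "(k', r') \<in> set (?H N)"
      then obtain \<mu>' where \<mu>': "\<mu>' \<in> B" "k' = std_key \<mu>'" "vec r' = ?r \<mu>'" using cand1[OF N(1)] by blast
      then show ?thesis unfolding T_def \<mu>'(2,3) by blast
    next
      assume "(k', r') \<in> set il"
      then have "(fst (k', r'), vec (snd (k', r'))) \<in> (\<lambda>t. (fst t, vec (snd t))) ` set il" by (rule imageI)
      then show ?thesis by (simp add: T_def)
    qed
    have "lmul (word (cofactor n k k')) (vec r) \<in> fv.span (insert (lmul (word (cofactor n k' k)) (vec r'))
      ({lmul (word w) (vec s) | w l s. (l, s) \<in> set (?H N) \<and> w \<in> set (?W N) \<and>
         prec (shift w (mk l)) (shift (cofactor n k k') (mk k))} \<union> vec ` set ?jr))" if "fst k = fst k'"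
    proof -
      have "?P2 (\<mu>, k', vec r') N" by (rule N1[OF N(2)]) (use \<mu>(1) T in simp)
      then have "lmul (word (cofactor n k k')) (vec r) \<in> fv.span (insert (lmul (word (cofactor n k' k)) (vec r'))
        (reps ?R ld (below (shift (cofactor n k k') \<mu>)) N))" using that \<mu> by simp
      also have "\<dots> \<subseteq> fv.span (insert (lmul (word (cofactor n k' k)) (vec r'))
      ({lmul (word w) (vec s) | w l s. (l, s) \<in> set (?H N) \<and> w \<in> set (?W N) \<and>
         prec (shift w (mk l)) (shift (cofactor n k k') (mk k))} \<union> vec ` set ?jr))"
        unfolding mk
        by (rule fv.span_mono, rule insert_mono, rule subset_trans[OF reps_sub], rule Un_mono)
          (auto simp: below_def)
      finally show ?thesis .
    qed
    then show "pair_reduces Q n (?W N) ?jr (?H N) t t'"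
      unfolding kr using pair_reduces_iff[OF vp words_letters jr Hval(1,2)[OF krH] v'] by blast
  qed
  moreover have "generates (?W N) ?jr (?H N) (map (\<lambda>g. vec_row g) gs @ right_rows two n (?H N))"
  proof -
    have vs: "\<forall>v\<in>set (map (\<lambda>g. vec_row g) gs @ right_rows two n (?H N)). valid_row v"
      using vec_row_valid Hval(2) by (auto simp: right_rows_def intro!: valid_mul_row)
    have "vec v \<in> S3" if "v \<in> set (map (\<lambda>g. vec_row g) gs @ right_rows two n (?H N))" for v
    proof -
      from that consider g where "g \<in> set gs" "v = vec_row g" | k r i where two "(k, r) \<in> set (?H N)" "i < n" "v = mul_row [] r [i]"
        by (auto simp: right_rows_def split: if_splits)
      then show ?thesis
      proof cases
        case (1 g) then show ?thesis by (auto simp: S3_def Gv_def)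
      next
        case (2 k r i)
        obtain \<mu> where \<mu>: "\<mu> \<in> B" "vec r = ?r \<mu>" using cand1[OF N(1) 2(2)] by blast
        have "vec v = rmul (?r \<mu>) (word [i])" using 2(4) \<mu>(2) by (simp add: vec_mul_row falg_mult_simps lmul_one)
        then show ?thesis using 2(1,3) \<mu>(1) by (force simp: S3_def)
      qed
    qed
    moreover have "fv.span (reps ?R ld K N) \<subseteq> fv.span ({lmul (word w) (vec s) | w l s. (l, s) \<in> set (?H N) \<and> w \<in> set (?W N)} \<union> vec ` set ?jr)"
      by (rule fv.span_mono, rule subset_trans[OF reps_sub]) blast
    ultimately show ?thesis
      unfolding generates_iff[OF vp words_letters jr vs] using N2[OF N(3)] by blast
  qed
  ultimately have "accept Q two (?W N) inp (?H N)" by (simp add: accept_def)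
  then show ?thesis by blast
qed

end

section \<open>Decoding of inputs and coding of outputs\<close>

lemma pol_of_words: "distinct ws \<Longrightarrow> set ws = keys f \<Longrightarrow> pol (map (\<lambda>w. (lookup f w, w)) ws) = f"
proof -
  assume ws: "distinct ws" "set ws = keys f"
  have "pol (map (\<lambda>w. (lookup f w, w)) ws) = (\<Sum>w\<in>keys f. Poly_Mapping.single w (lookup f w))"
    using sum_list_distinct_conv_sum_set[OF ws(1), of "\<lambda>w. Poly_Mapping.single w (lookup f w)"] ws(2)
    by (simp add: pol_def o_def)
  also have "\<dots> = f" by (rule poly_mapping_eqI) (simp add: lookup_sum lookup_single when_def in_keys_iff)
  finally show ?thesis .
qed

lemma enc_poly_of_words: "enc_poly (map (\<lambda>w. (lookup f w, w)) ws) =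
    list_val (map (\<lambda>w. Pair (Scal (lookup f w)) (list_val (map Num w))) ws)"
  by (simp add: enc_list_def o_def)

lemma poly_code_decode:
  assumes "poly_code f v"
  shows "\<exists>p. v = enc_poly p \<and> pol p = f \<and> (\<forall>t\<in>set p. snd t \<in> keys f)"
proof -
  obtain ws where ws: "distinct ws" "set ws = keys f"
    "v = list_val (map (\<lambda>w. Pair (Scal (lookup f w)) (list_val (map Num w))) ws)"
    using assms unfolding poly_code_def by blast
  show ?thesis
    by (rule exI[of _ "map (\<lambda>w. (lookup f w, w)) ws"])
      (use pol_of_words[OF ws(1,2)] ws in \<open>auto simp: enc_list_def o_def\<close>)
qed

lemma list_all2_decode:
  assumes "list_all2 R ys vs" "\<And>y v. y \<in> set ys \<Longrightarrow> R y v \<Longrightarrow> \<exists>x. v = a x \<and> T y x"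
  shows "\<exists>xs. list_val vs = enc_list a xs \<and> list_all2 T ys xs"
proof -
  have "\<exists>xs. vs = map a xs \<and> list_all2 T ys xs" using assms
  proof (induction rule: list_all2_induct)
    case (Cons y ys v vs)
    obtain x where "v = a x" "T y x" using Cons.prems[of y v] Cons.hyps(1) by auto
    moreover obtain xs where "vs = map a xs" "list_all2 T ys xs" using Cons.IH Cons.prems by auto
    ultimately show ?case by (intro exI[of _ "x # xs"]) simp
  qed simp
  then show ?thesis unfolding enc_list_def by blast
qed

lemma set_code_decode:
  assumes "set_code R Y v" "\<And>y v. y \<in> Y \<Longrightarrow> R y v \<Longrightarrow> \<exists>x. v = a x \<and> T y x"
  shows "\<exists>ys xs. set ys = Y \<and> v = enc_list a xs \<and> list_all2 T ys xs"
proof -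
  obtain ys vs where y: "set ys = Y" "list_all2 R ys vs" "v = list_val vs"
    using assms(1) unfolding set_code_def by blast
  show ?thesis using list_all2_decode[OF y(2), of a T] assms(2) y(1,3) by blast
qed

lemma list_all2_image: "list_all2 T ys xs \<Longrightarrow> (\<And>y x. T y x \<Longrightarrow> F x = G y) \<Longrightarrow> F ` set xs = G ` set ys"
  by (induction rule: list_all2_induct) auto

lemma list_all2_ball: "list_all2 T ys xs \<Longrightarrow> x \<in> set xs \<Longrightarrow> \<exists>y\<in>set ys. T y x"
  by (induction rule: list_all2_induct) auto

abbreviation "lettered n p \<equiv> \<forall>t\<in>set p. set (snd t) \<subseteq> {..<n}"

lemma poly_code_lettered:
  assumes "poly_code f v" "f \<in> carrier (free_algebra n)"
  shows "\<exists>p. v = enc_poly p \<and> pol p = f \<and> lettered n p"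
  using poly_code_decode[OF assms(1)] assms(2) unfolding carrier_free_algebra by blast

lemma datum_decode:
  assumes dat: "pbw_datum n c d I prec" and code: "datum_code n c d I v"
  shows "\<exists>D. v = enc_pair (enc_list enc_relation) (enc_list enc_poly) D \<and>
    (\<lambda>r. (fst r, fst (snd r), fst (snd (snd r)), pol (snd (snd (snd r))))) ` set (fst D)
        = (\<lambda>(i, j). (i, j, c i j, d i j)) ` {(i, j). i < j \<and> j < n} \<and>
    pol ` set (snd D) = I \<and> (\<forall>r\<in>set (fst D). lettered n (snd (snd (snd r)))) \<and>
    (\<forall>f\<in>set (snd D). lettered n f)"
proof -
  obtain u w where uw: "comm_code n c d u" "set_code poly_code I w" "v = Pair u w"
    using code unfolding datum_code_def by blast
  let ?T = "\<lambda>(i, j) r. fst r = i \<and> fst (snd r) = j \<and> fst (snd (snd r)) = c i j \<and>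
    pol (snd (snd (snd r))) = d i j \<and> lettered n (snd (snd (snd r)))"
  have "\<exists>ys rs. set ys = {(i, j). i < j \<and> j < n} \<and> u = enc_list enc_relation rs \<and> list_all2 ?T ys rs"
  proof (rule set_code_decode[OF uw(1)[unfolded comm_code_def]])
    fix y v
    assume y: "y \<in> {(i, j). i < j \<and> j < n}" and "(\<lambda>(i, j) v. \<exists>u. poly_code (d i j) u \<and>
        v = Pair (Num i) (Pair (Num j) (Pair (Scal (c i j)) u))) y v"
    then obtain i j u where u: "y = (i, j)" "i < j" "j < n" "poly_code (d i j) u"
      "v = Pair (Num i) (Pair (Num j) (Pair (Scal (c i j)) u))" by auto
    have "d i j \<in> carrier (free_algebra n)"
      using dat u(2,3) std_polys_carrier unfolding pbw_datum_def commutation_system_def by blast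
    then obtain p where "u = enc_poly p" "pol p = d i j" "lettered n p" using poly_code_lettered[OF u(4)] by blast
    then show "\<exists>r. v = enc_relation r \<and> ?T y r" using u(1,5) by (intro exI[of _ "(i, j, c i j, p)"]) simp
  qed
  then obtain ys rs where rs: "set ys = {(i, j). i < j \<and> j < n}" "u = enc_list enc_relation rs" "list_all2 ?T ys rs"
    by blast
  have "\<exists>zs fs. set zs = I \<and> w = enc_list enc_poly fs \<and> list_all2 (\<lambda>f p. pol p = f \<and> lettered n p) zs fs"
  proof (rule set_code_decode[OF uw(2)])
    fix f v assume "f \<in> I" "poly_code f v"
    moreover have "I \<subseteq> carrier (free_algebra n)" using dat std_polys_carrier unfolding pbw_datum_def by blast
    ultimately show "\<exists>p. v = enc_poly p \<and> pol p = f \<and> lettered n p" using poly_code_lettered by blast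
  qed
  then obtain zs fs where fs: "set zs = I" "w = enc_list enc_poly fs" "list_all2 (\<lambda>f p. pol p = f \<and> lettered n p) zs fs"
    by blast
  have "(\<lambda>r. (fst r, fst (snd r), fst (snd (snd r)), pol (snd (snd (snd r))))) ` set rs
      = (\<lambda>(i, j). (i, j, c i j, d i j)) ` set ys" by (rule list_all2_image[OF rs(3)]) (auto split: prod.splits)
  moreover have "pol ` set fs = (\<lambda>f. f) ` set zs" by (rule list_all2_image[OF fs(3)]) simp
  moreover have "lettered n (snd (snd (snd r)))" if "r \<in> set rs" for r
    using list_all2_ball[OF rs(3) that] by (auto split: prod.splits)
  moreover have "lettered n f" if "f \<in> set fs" for f using list_all2_ball[OF fs(3) that] by auto
  ultimately show ?thesis using rs(1,2) fs(1,2) uw(3) by (intro exI[of _ "(rs, fs)"]) simp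
qed

lemma defining_ideal_ideal:
  assumes "pbw_datum n c d I prec" shows "ideal (defining_ideal n c d I) (free_algebra n)"
proof -
  have "I \<union> comm_rels n c d \<subseteq> carrier (free_algebra n)"
  proof
    fix f assume "f \<in> I \<union> comm_rels n c d"
    then show "f \<in> carrier (free_algebra n)"
    proof
      assume "f \<in> I"
      then show ?thesis using assms std_polys_carrier unfolding pbw_datum_def by blast
    next
      assume "f \<in> comm_rels n c d"
      then obtain i j where ij: "i < j" "j < n" "f = comm_rel c d i j" unfolding comm_rels_def by blast
      then have "d i j \<in> std_polys n" using assms unfolding pbw_datum_def commutation_system_def by blast
      then show ?thesis using comm_rel_carrier[of d i j n c] ij by auto
    qed
  qed
  then show ?thesis unfolding defining_ideal_def by (rule ring.genideal_ideal[OF ring_free_algebra])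
qed

context pbw_input
begin

lemma row_words: "distinct (row_words p r) \<and> set (row_words p r) = {w. coef r (p, w) \<noteq> 0}"
proof -
  let ?step = "\<lambda>t ws. if fst (snd t) = p \<and> \<not> coef r (snd t) = 0 \<and>
     list_all (\<lambda>w. \<not> w = snd (snd t)) ws then snd (snd t) # ws else ws"
  have "distinct ws \<Longrightarrow> distinct (fold ?step l ws) \<and>
      set (fold ?step l ws) = set ws \<union> {w. (p, w) \<in> snd ` set l \<and> coef r (p, w) \<noteq> 0}" for l ws
  proof (induction l arbitrary: ws)
    case (Cons t l)
    have "distinct (?step t ws)" using Cons.prems by (auto simp: list_all_iff)
    moreover have "set (?step t ws) = set ws \<union> {w. (p, w) = snd t \<and> coef r (p, w) \<noteq> 0}"
      by (cases "snd t") (auto simp: list_all_iff)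
    ultimately show ?case using Cons.IH[of "?step t ws"] by auto
  qed simp
  from this[of "[]" r] have "distinct (row_words p r)"
    "set (row_words p r) = {w. (p, w) \<in> snd ` set r \<and> coef r (p, w) \<noteq> 0}"
    by (simp_all add: row_words_def)
  moreover have "(p, w) \<in> snd ` set r" if "coef r (p, w) \<noteq> 0" for w using coef_nonzero_key[OF that] by simp
  ultimately show ?thesis by auto
qed

lemma poly_code_row_poly:
  assumes "p < m" shows "poly_code (vec r (es ! p)) (enc_poly (row_poly p r))"
proof -
  have "row_poly p r = map (\<lambda>w. (lookup (vec r (es ! p)) w, w)) (row_words p r)"
    using lookup_vec[OF assms, of r] by (simp add: row_poly_def)
  then have "enc_poly (row_poly p r) = list_val (map (\<lambda>w. Pair (Scal (lookup (vec r (es ! p)) w)) (list_val (map Num w)))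
      (row_words p r))" by (simp only: enc_poly_of_words)
  moreover have "keys (vec r (es ! p)) = {w. coef r (p, w) \<noteq> 0}" using lookup_vec[OF assms, of r] by (auto simp: in_keys_iff)
  ultimately show ?thesis unfolding poly_code_def using row_words[of p r] by blast
qed

lemma answer_code: "set_code (vec_code es) (cls ` vec ` snd ` set H) (enc_list (enc_list enc_poly) (answer inp H))"
proof -
  have one: "vec_code es (cls (vec r)) (enc_list enc_poly (map (\<lambda>i. row_poly (fst i) r) (List.enumerate 0 ds)))" for r
  proof -
    have "list_all2 (\<lambda>e u. \<exists>t\<in>cls (vec r) e. poly_code t u) es
      (map enc_poly (map (\<lambda>i. row_poly (fst i) r) (List.enumerate 0 ds)))"
    proof (rule list_all2_all_nthI)
      fix p assume p: "p < m"
      have "vec r (es ! p) \<in> cls (vec r) (es ! p)" using es_E[OF p] by (simp add: cls_def in_coset J_closed)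
      then show "\<exists>t\<in>cls (vec r) (es ! p). poly_code t
          (map enc_poly (map (\<lambda>i. row_poly (fst i) r) (List.enumerate 0 ds)) ! p)"
        using poly_code_row_poly[OF p, of r] p ds_length by (auto simp: nth_enumerate_eq)
    qed (simp add: ds_length)
    then show ?thesis unfolding vec_code_def enc_list_def by blast
  qed
  show ?thesis unfolding set_code_def
    by (rule exI[of _ "map (\<lambda>t. cls (vec (snd t))) H"],
        rule exI[of _ "map (\<lambda>t. enc_list enc_poly (map (\<lambda>i. row_poly (fst i) (snd t)) (List.enumerate 0 ds))) H"])
      (use one in \<open>auto simp: answer_def enc_list_def o_def list_all2_map1 list_all2_map2 list.rel_refl image_image\<close>)
qed

end

text \<open>The ideal \<open>J\<close> is recovered from \<open>A\<close> as its zero element; hence all data have the same one. Representatives occurring in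
  the code lie in the free algebra in \<open>n\<close> letters because they are members of cosets.\<close>

lemma input_decode:
  assumes A: "pbw_reduction_algebra n A" and mod: "pbw_module n A E c d I prec"
    and G: "G \<subseteq> free_module A E" and es: "distinct es" "set es = E" and v: "input_code n es c d I G v"
  shows "\<exists>J ds gs. v = enc_input (n, ds, gs) \<and> A = free_algebra n Quot J \<and>
    pbw_input n E c d I prec J es ds gs \<and> G = pbw_data.cls n E J ` pbw_input.Gv es gs"
proof -
  obtain c' d' I' prec' where w: "pbw_datum n c' d' I' prec'" "A = pbw_quotient n c' d' I'"
    using A unfolding pbw_reduction_algebra_def by blast
  define J where "J = defining_ideal n c' d' I'"
  have AJ: "A = free_algebra n Quot J" using w(2) by (simp add: pbw_quotient_def J_def)
  have mod': "finite E" "module_monomial_ordering n E prec"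
    "\<And>e. e \<in> E \<Longrightarrow> pbw_datum n (c e) (d e) (I e) (induced prec e)"
    "\<And>e. e \<in> E \<Longrightarrow> A = pbw_quotient n (c e) (d e) (I e)"
    using mod unfolding pbw_module_def by auto
  have Je: "defining_ideal n (c e) (d e) (I e) = J" if "e \<in> E" for e
    using arg_cong[OF mod'(4)[OF that], of ring.zero] AJ by (simp add: pbw_quotient_def FactRing_def)
  interpret pbw_data n E c d I prec J
    by (rule pbw_data.intro) (use mod' Je defining_ideal_ideal[OF w(1)] in \<open>simp_all add: J_def\<close>)
  obtain vs w where vw: "list_all2 (\<lambda>e. datum_code n (c e) (d e) (I e)) es vs" "set_code (vec_code es) G w"
    "v = Pair (Num n) (Pair (list_val vs) w)" using v unfolding input_code_def by blast
  let ?D = "\<lambda>e D. (\<lambda>r. (fst r, fst (snd r), fst (snd (snd r)), pol (snd (snd (snd r))))) ` set (fst D)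
        = (\<lambda>(i, j). (i, j, c e i j, d e i j)) ` {(i, j). i < j \<and> j < n} \<and>
    pol ` set (snd D) = I e \<and> (\<forall>r\<in>set (fst D). lettered n (snd (snd (snd r)))) \<and>
    (\<forall>f\<in>set (snd D). lettered n f)"
  have "\<exists>ds. list_val vs = enc_data ds \<and> list_all2 ?D es ds"
    by (rule list_all2_decode[OF vw(1)], rule datum_decode) (use es(2) mod'(3) in auto)
  then obtain ds where ds: "list_val vs = enc_data ds" "list_all2 ?D es ds" by blast
  let ?T = "\<lambda>g ps. list_all2 (\<lambda>e p. pol p \<in> g e \<and> lettered n p) es ps"
  have "\<exists>ys gs. set ys = G \<and> w = enc_list (enc_list enc_poly) gs \<and> list_all2 (\<lambda>g ps. g \<in> G \<and> ?T g ps) ys gs"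
  proof (rule set_code_decode[OF vw(2)])
    fix g v assume g: "g \<in> G" and "vec_code es g v"
    then obtain us where us: "list_all2 (\<lambda>e u. \<exists>t\<in>g e. poly_code t u) es us" "v = list_val us"
      unfolding vec_code_def by blast
    have "\<exists>ps. list_val us = enc_list enc_poly ps \<and> ?T g ps"
    proof (rule list_all2_decode[OF us(1)])
      fix e u assume e: "e \<in> set es" and "\<exists>t\<in>g e. poly_code t u"
      then obtain t where t: "t \<in> g e" "poly_code t u" by blast
      have "g e \<in> carrier (free_algebra n Quot J)" using G g e es(2) AJ by (auto simp: free_module_def)
      then obtain f where f: "f \<in> F" "g e = coset f" using carrier_A by blast
      have "t - f \<in> F" using t(1) f(2) J_carrier by (auto simp: in_coset)
      then have "t - f + f \<in> F" using f(1) by (rule carrier_add)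
      then have "t \<in> F" by simp
      then show "\<exists>p. u = enc_poly p \<and> pol p \<in> g e \<and> lettered n p" using poly_code_lettered[OF t(2)] t(1) by blast
    qed
    then show "\<exists>ps. v = enc_list enc_poly ps \<and> g \<in> G \<and> ?T g ps" using us(2) g by blast
  qed
  then obtain ys gs where code: "set ys = G" "w = enc_list (enc_list enc_poly) gs"
    "list_all2 (\<lambda>g ps. g \<in> G \<and> ?T g ps) ys gs" by blast
  have gs': "\<exists>g\<in>G. ?T g ps" if "ps \<in> set gs" for ps using list_all2_ball[OF code(3) that] by blast
  have in_ps: "\<exists>p<length es. x = xs ! p" if "x \<in> set xs" "list_all2 P es xs" for x and xs :: "'z list" and P
    using that by (metis in_set_conv_nth list_all2_lengthD)
  have D: "?D (es ! p) (ds ! p)" if "p < length es" for p using list_all2_nthD[OF ds(2) that] .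
  interpret pbw_input n E c d I prec J es ds gs
  proof unfold_locales
    show "distinct es" "set es = E" "length ds = length es" using es ds(2) by (auto simp: list_all2_lengthD)
    show "length g = length es" if "g \<in> set gs" for g using gs'[OF that] by (auto simp: list_all2_lengthD)
    show "set (snd t) \<subseteq> {..<n}" if g: "g \<in> set gs" "f \<in> set g" "t \<in> set f" for g f t
      using gs'[OF g(1)] list_all2_ball[OF _ g(2)] g(3) by fastforce
    show "(\<lambda>r. (fst r, fst (snd r), fst (snd (snd r)), pol (snd (snd (snd r))))) ` set (fst (ds ! p))
        = (\<lambda>(i, j). (i, j, c (es ! p) i j, d (es ! p) i j)) ` {(i, j). i < j \<and> j < n}"
      and "pol ` set (snd (ds ! p)) = I (es ! p)" if "p < length es" for p
      using D[OF that] by blast+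
    show "set (snd t) \<subseteq> {..<n}"
      if "p < length es" "r \<in> set (fst (ds ! p))" "t \<in> set (snd (snd (snd r)))" for p r t
      using D[OF that(1)] that(2,3) by (elim conjE) simp
    show "set (snd t) \<subseteq> {..<n}" if "p < length es" "f \<in> set (snd (ds ! p))" "t \<in> set f" for p f t
      using D[OF that(1)] that(2,3) by (elim conjE) simp
  qed
  have "(\<lambda>ps. cls (vec (vec_row ps))) ` set gs = (\<lambda>g. g) ` set ys"
  proof (rule list_all2_image[OF code(3)])
    fix g ps assume g: "g \<in> G \<and> ?T g ps"
    then have "g \<in> free_module (free_algebra n Quot J) E" using G AJ by blast
    then obtain t where t: "t \<in> Vecs" "g = cls t" by (rule free_module_cls)
    show "cls (vec (vec_row ps)) = g" unfolding t(2) cls_def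
    proof (rule restrict_ext)
      fix e assume e: "e \<in> E"
      then obtain p where p: "p < m" "es ! p = e" using index_es by blast
      have l: "length ps = m" using g by (auto simp: list_all2_lengthD)
      have "pol (ps ! p) \<in> g e" using list_all2_nthD[of _ es ps p] g p by blast
      then show "coset (vec (vec_row ps) e) = coset (t e)"
        using vec_row_apply[OF l p(1)] p(2) e t(2) by (simp add: cls_def in_coset coset_eq_iff)
    qed
  qed
  then have "G = cls ` Gv" using code(1) by (simp add: Gv_def image_image)
  then show ?thesis using vw(3) ds(1) code(2) AJ pbw_input_axioms by (intro exI[of _ J] exI[of _ ds] exI[of _ gs]) simp
qed

section \<open>Groebner bases are computable\<close>

lemma computable_test:
  "computable (enc_pair Num enc_input) bit (\<lambda>Q z. accept Q two (words (fst (snd z)) (fst z)) (snd z)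
     (candidates Q two (words (fst (snd z)) (fst z)) (snd z)))"
  by (cases two) (simp_all only:, (rule comp_answer computable_True computable_False)+)

lemma computable_result:
  "computable (enc_pair Num enc_input) (enc_list (enc_list enc_poly)) (\<lambda>Q z. answer (snd z)
     (candidates Q two (words (fst (snd z)) (fst z)) (snd z)))"
  by (cases two) (simp_all only:, (rule comp_answer computable_True computable_False)+)

definition submodule :: "bool \<Rightarrow> ('a, 'm) ring_scheme \<Rightarrow> 'e set \<Rightarrow> ('e \<Rightarrow> 'a) set \<Rightarrow> bool" where
  "submodule two = (if two then two_sided_submodule else left_submodule)"

theorem reduced_groebner_bases_computable:
  "\<exists>p. solves p (\<lambda>n (A :: ('k::field) falg set ring) (E :: 'e set) I prec G H.
     reduced_groebner_basis n A E I prec (submodule two A E hull G) H)"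
proof -
  let ?H = "\<lambda>(Q :: 'k val \<Rightarrow> bool) N (x :: 'k input). candidates Q two (words (fst x) N) x"
  have "\<exists>p. \<forall>(Q :: 'k val \<Rightarrow> bool) x. (\<exists>N. accept Q two (words (fst x) N) x (?H Q N x)) \<longrightarrow>
      (\<exists>N. accept Q two (words (fst x) N) x (?H Q N x) \<and>
        run Q p (enc_input x) (enc_list (enc_list enc_poly) (answer x (?H Q N x))))"
    using computable_search[OF computable_test[of two] computable_result[of two]] unfolding fst_conv snd_conv .
  then obtain p where p: "\<forall>(Q :: 'k val \<Rightarrow> bool) x. (\<exists>N. accept Q two (words (fst x) N) x (?H Q N x)) \<longrightarrow>
      (\<exists>N. accept Q two (words (fst x) N) x (?H Q N x) \<and>
        run Q p (enc_input x) (enc_list (enc_list enc_poly) (answer x (?H Q N x))))" by blast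
  show ?thesis
  proof (rule exI[of _ p], unfold solves_def, intro allI impI)
    fix n and A :: "'k falg set ring" and E :: "'e set" and c d I prec G es v
    assume A: "pbw_reduction_algebra n A" and mod: "pbw_module n A E c d I prec" and G: "finite G" "G \<subseteq> free_module A E"
      and es: "distinct es" "set es = E" and v: "input_code n es c d I G v"
    obtain J ds gs where x: "v = enc_input (n, ds, gs)" "A = free_algebra n Quot J"
      "pbw_input n E c d I prec J es ds gs" "G = pbw_data.cls n E J ` pbw_input.Gv es gs"
      using input_decode[OF A mod G(2) es v] by blast
    interpret pbw_input n E c d I prec J es ds gs by (rule x(3))
    have hull: "submodule two A E hull G = cls ` gen_vecs two Gv"
      using left_hull[OF Gv_Vecs] two_sided_hull[OF Gv_Vecs] x(2,4) by (cases two) (simp_all add: submodule_def)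
    obtain N where N: "accept Q two (words n N) inp (candidates Q two (words n N) inp)"
      "run Q p v (enc_list (enc_list enc_poly) (answer inp (candidates Q two (words n N) inp)))"
      using p[THEN spec, of Q, THEN spec, of inp] accept_complete[of two] unfolding x(1) fst_conv by blast
    have "\<forall>w\<in>set (words n N). letters w" using words_letters by blast
    from accept_sound[OF this refl N(1)]
    have "reduced_groebner_basis n A E I prec (submodule two A E hull G)
        (cls ` vec ` snd ` set (candidates Q two (words n N) inp))" using hull x(2) by simp
    then show "\<exists>w H. run Q p v w \<and> set_code (vec_code es) H w \<and>
        reduced_groebner_basis n A E I prec (submodule two A E hull G) H"
      using N(2) answer_code by blast
  qed
qed

lemma solves_mono:
  fixes P P' :: "nat \<Rightarrow> ('k::field) falg set ring \<Rightarrow> 'e set \<Rightarrow> _"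
  assumes "solves p P" "\<And>n A E I prec G H. P n A E I prec G H \<Longrightarrow> P' n A E I prec G H"
  shows "solves p P'"
  unfolding solves_def
proof (intro allI impI)
  fix n and A :: "'k falg set ring" and E :: "'e set" and c d I prec G es v
  assume "pbw_reduction_algebra n A" "pbw_module n A E c d I prec" "finite G" "G \<subseteq> free_module A E"
    "distinct es" "set es = E" "input_code n es c d I G v"
  then obtain w H where "run (compare n es prec) p v w" "set_code (vec_code es) H w" "P n A E I prec G H"
    using assms(1)[unfolded solves_def, rule_format, of n A E c d I prec G es v] by blast
  then show "\<exists>w H. run (compare n es prec) p v w \<and> set_code (vec_code es) H w \<and> P' n A E I prec G H"
    using assms(2) by blast
qed

theorem proposition1p33:
  shows
    "(\<exists>p. solves p
        (\<lambda>n (A :: ('k::field) falg set ring) (E :: 'e set) I prec G H.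
           groebner_basis n A E I prec (left_submodule A E hull G) H)) \<and>
     (\<exists>p. solves p
        (\<lambda>n (A :: ('k::field) falg set ring) (E :: 'e set) I prec G H.
           reduced_groebner_basis n A E I prec (left_submodule A E hull G) H)) \<and>
     (\<exists>p. solves p
        (\<lambda>n (A :: ('k::field) falg set ring) (E :: 'e set) I prec G H.
           groebner_basis n A E I prec (two_sided_submodule A E hull G) H)) \<and>
     (\<exists>p. solves p
        (\<lambda>n (A :: ('k::field) falg set ring) (E :: 'e set) I prec G H.
           reduced_groebner_basis n A E I prec (two_sided_submodule A E hull G) H))"
proof -
  have reduced: "\<exists>p. solves p (\<lambda>n (A :: 'k falg set ring) (E :: 'e set) I prec G H.
      reduced_groebner_basis n A E I prec (submodule two A E hull G) H)" for two
    by (rule reduced_groebner_bases_computable)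
  have "\<exists>p. solves p (\<lambda>n (A :: 'k falg set ring) (E :: 'e set) I prec G H.
      groebner_basis n A E I prec (submodule two A E hull G) H)" for two
  proof -
    obtain p where p: "solves p (\<lambda>n (A :: 'k falg set ring) (E :: 'e set) I prec G H.
      reduced_groebner_basis n A E I prec (submodule two A E hull G) H)" using reduced[of two] by blast
    show ?thesis by (rule exI[of _ p], rule solves_mono[OF p]) (simp add: reduced_groebner_basis_def)
  qed
  from reduced[of False] this[of False] reduced[of True] this[of True]
  show ?thesis unfolding submodule_def if_True if_False by (intro conjI)
qed

end
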